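(* Let $\Omega\subset\mathbb{R}^n$ ($n\le 3$) be a bounded Lipschitz domain and let $d_1,d_2,d_3,a_1,a_3,b_1,b_2,c_2,c_3,F,G_1,G_2$ be arbitrary positive constants. Consider the Oregonator system $$\frac{\partial u}{\partial t}=d_1\Delta u+a_1u+b_1v-Fu^2-G_1uv,\qquad \frac{\partial v}{\partial t}=d_2\Delta v-b_2v+c_2w-G_2uv,\qquad \frac{\partial w}{\partial t}=d_3\Delta w+a_3u-c_3w$$ for $t>0$, $x\in\Omega$, with the homogeneous Dirichlet boundary condition $u=v=w=0$ on $\partial\Omega$. Then there exists a global attractor $\mathscr{A}$ in $H_+$ for the Oregonator semiflow $\{S(t)\}_{t\ge0}$ on $H_+$.
   Context: Spaces: $H=[L^2(\Omega)]^3$ with norm $\|\cdot\|$, $E=[H_0^1(\Omega)]^3$ with norm $\|\varphi\|_E=\|\nabla\varphi\|$, $E^*=[H^{-1}(\Omega)]^3$, with $(\cdot,\cdot)$ the $(E^*,E)$ dual product. $H_+=\{\varphi\in H:\varphi_i\ge0 \text{ a.e. in }\Omega,\ i=1,2,3\}$. Operators: $A=\mathrm{diag}(d_1\Delta,d_2\Delta,d_3\Delta)$ with Dirichlet conditions, regarded also as a bounded operator $E\to E^*$, and $f:E\to H$, $f(u,v,w)=(a_1u+b_1v-Fu^2-G_1uv,\,-b_2v+c_2w-G_2uv,\,a_3u-c_3w)$. The system is written as $\frac{dg}{dt}=Ag+f(g)$, $g(0)=g_0$, with $g=(u,v,w)$. Weak solution on $[0,\tau]$: a function $g\in L^2(0,\tau;E)\cap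 C_w([0,\tau];H)$ ($C_w$: weakly continuous) with $g(0)=g_0$ such that for every $\phi\in E$, $\frac{d}{dt}(g,\phi)=(Ag,\phi)+(f(g),\phi)$ for a.e. $t\in[0,\tau]$ (time derivative in the distributional sense). A global weak solution is a function on $[0,\infty)$ that is a weak solution on every $[0,\tau]$. Oregonator semiflow: for every $g_0\in H_+$ there is a unique global weak solution $g(t;g_0)$, and it stays in $H_+$; $S(t)g_0=g(t;g_0)$, $t\ge0$. Global attractor in $H_+$ for $\{S(t)\}_{t\ge0}$: a nonempty compact (in the $H$-norm) subset $\mathscr{A}\subset H_+$ with $S(t)\mathscr{A}=\mathscr{A}$ for all $t\ge0$, and such that for every bounded $B\subset H_+$, $\sup_{x\in B}\inf_{y\in\mathscr{A}}\|S(t)x-y\|\to0$ as $t\to\infty$. *)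

theory Defs
  imports "HOL-Analysis.Analysis"
begin

section \<open>The Hilbert space of square-integrable functions\<close>

definition sq_integrable :: "('a::euclidean_space \<Rightarrow> real) \<Rightarrow> bool" where
  "sq_integrable f \<longleftrightarrow> f \<in> borel_measurable lebesgue \<and> integrable lebesgue (\<lambda>x. (f x)\<^sup>2)"

definition l2_rel :: "('a::euclidean_space \<Rightarrow> real) \<Rightarrow> ('a \<Rightarrow> real) \<Rightarrow> bool" where
  "l2_rel f g \<longleftrightarrow> sq_integrable f \<and> sq_integrable g \<and> (AE x in lebesgue. f x = g x)"

lemma sq_integrable_zero: "sq_integrable (\<lambda>x. 0)"
  by (simp add: sq_integrable_def)

lemma sq_integrable_mult:
  assumes "sq_integrable f" "sq_integrable g"
  shows "integrable lebesgue (\<lambda>x. f x * g x)"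
proof (rule Bochner_Integration.integrable_bound)
  show "integrable lebesgue (\<lambda>x. (f x)\<^sup>2 + (g x)\<^sup>2)"
    using assms by (simp add: sq_integrable_def)
  show "(\<lambda>x. f x * g x) \<in> borel_measurable lebesgue"
    using assms by (auto simp: sq_integrable_def intro: borel_measurable_times)
  have "\<bar>a * b\<bar> \<le> a\<^sup>2 + b\<^sup>2" for a b :: real
  proof -
    have "2 * (\<bar>a\<bar> * \<bar>b\<bar>) \<le> \<bar>a\<bar>\<^sup>2 + \<bar>b\<bar>\<^sup>2"
      using sum_squares_bound[of "\<bar>a\<bar>" "\<bar>b\<bar>"] by simp
    then show ?thesis
      by (simp add: abs_mult) (smt (verit) mult_nonneg_nonneg abs_ge_zero)
  qed
  then show "AE x in lebesgue. norm (f x * g x) \<le> norm ((f x)\<^sup>2 + (g x)\<^sup>2)"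
    by (intro AE_I2) (simp add: abs_of_nonneg)
qed

lemma sq_integrable_add:
  assumes "sq_integrable f" "sq_integrable g"
  shows "sq_integrable (\<lambda>x. f x + g x)"
proof -
  have "integrable lebesgue (\<lambda>x. (f x)\<^sup>2 + (g x)\<^sup>2 + 2 * (f x * g x))"
    using assms sq_integrable_mult[OF assms] by (simp add: sq_integrable_def)
  then show ?thesis
    using assms by (auto simp: sq_integrable_def power2_sum mult.assoc intro: borel_measurable_add)
qed

lemma sq_integrable_scale: "sq_integrable f \<Longrightarrow> sq_integrable (\<lambda>x. c * f x)"
  by (auto simp: sq_integrable_def power_mult_distrib intro: borel_measurable_times)

lemma sq_integrable_minus: "sq_integrable f \<Longrightarrow> sq_integrable (\<lambda>x. - f x)"
  using sq_integrable_scale[of f "-1"] by simp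

lemma sq_integrable_diff:
  "sq_integrable f \<Longrightarrow> sq_integrable g \<Longrightarrow> sq_integrable (\<lambda>x. f x - g x)"
  using sq_integrable_add[of f "\<lambda>x. - g x"] sq_integrable_minus[of g] by simp

text \<open>
  Elements of the type are almost-everywhere classes of square-integrable functions on the whole
  space.  The space over a measurable set \<open>\<Omega>\<close> is identified below, by extension by zero, with
  the closed subspace of classes vanishing almost everywhere outside \<open>\<Omega>\<close>.
  \<open>abs_l2 f\<close> is meaningful only if \<open>f\<close> is square-integrable.
\<close>

quotient_type (overloaded) 'a l2 = "'a::euclidean_space \<Rightarrow> real" / partial: l2_rel
proof (rule part_equivpI)
  show "\<exists>f::'a \<Rightarrow> real. l2_rel f f"
    using sq_integrable_zero by (auto simp: l2_rel_def)
  show "symp (l2_rel :: ('a \<Rightarrow> real) \<Rightarrow> _)"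
    by (auto simp: symp_def l2_rel_def elim: AE_mp)
  show "transp (l2_rel :: ('a \<Rightarrow> real) \<Rightarrow> _)"
    by (auto simp: transp_def l2_rel_def)
qed

instantiation l2 :: (euclidean_space) real_inner
begin

lift_definition zero_l2 :: "'a l2" is "\<lambda>x. 0"
  by (simp add: l2_rel_def sq_integrable_zero)

lift_definition plus_l2 :: "'a l2 \<Rightarrow> 'a l2 \<Rightarrow> 'a l2" is "\<lambda>f g x. f x + g x"
  by (auto simp: l2_rel_def sq_integrable_add)

lift_definition minus_l2 :: "'a l2 \<Rightarrow> 'a l2 \<Rightarrow> 'a l2" is "\<lambda>f g x. f x - g x"
  by (auto simp: l2_rel_def sq_integrable_diff)

lift_definition uminus_l2 :: "'a l2 \<Rightarrow> 'a l2" is "\<lambda>f x. - f x"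
  by (auto simp: l2_rel_def sq_integrable_minus)

lift_definition scaleR_l2 :: "real \<Rightarrow> 'a l2 \<Rightarrow> 'a l2" is "\<lambda>c f x. c * f x"
  by (auto simp: l2_rel_def sq_integrable_scale)

lift_definition inner_l2 :: "'a l2 \<Rightarrow> 'a l2 \<Rightarrow> real" is "\<lambda>f g. LINT x|lebesgue. f x * g x"
  by (rule integral_cong_AE) (auto simp: l2_rel_def sq_integrable_def)

definition norm_l2 :: "'a l2 \<Rightarrow> real" where
  "norm_l2 u = sqrt (inner u u)"

definition sgn_l2 :: "'a l2 \<Rightarrow> 'a l2" where
  "sgn_l2 u = scaleR (inverse (norm u)) u"

definition dist_l2 :: "'a l2 \<Rightarrow> 'a l2 \<Rightarrow> real" where
  "dist_l2 u v = norm (u - v)"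

definition uniformity_l2 :: "('a l2 \<times> 'a l2) filter" where
  "uniformity_l2 = (INF e\<in>{0<..}. principal {(u, v). dist u v < e})"

definition open_l2 :: "'a l2 set \<Rightarrow> bool" where
  "open_l2 U \<longleftrightarrow> (\<forall>u\<in>U. eventually (\<lambda>(u', v). u' = u \<longrightarrow> v \<in> U) uniformity)"

instance
proof
  fix a b :: real and u v w :: "'a l2"
  show "u + v + w = u + (v + w)"
    by transfer (auto simp: l2_rel_def sq_integrable_add add.assoc)
  show "u + v = v + u"
    by transfer (auto simp: l2_rel_def sq_integrable_add add.commute)
  show "0 + u = u"
    by transfer (auto simp: l2_rel_def)
  show "- u + u = 0"
    by transfer (auto simp: l2_rel_def sq_integrable_zero)
  show "u - v = u + - v"
    by transfer (auto simp: l2_rel_def sq_integrable_diff)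
  show "a *\<^sub>R (u + v) = a *\<^sub>R u + a *\<^sub>R v"
    by transfer (use sq_integrable_add sq_integrable_scale in
        \<open>auto simp: l2_rel_def distrib_left\<close>)
  show "(a + b) *\<^sub>R u = a *\<^sub>R u + b *\<^sub>R u"
    by transfer (use sq_integrable_add sq_integrable_scale in
        \<open>auto simp: l2_rel_def distrib_right\<close>)
  show "a *\<^sub>R b *\<^sub>R u = (a * b) *\<^sub>R u"
    by transfer (use sq_integrable_scale in \<open>auto simp: l2_rel_def mult.assoc\<close>)
  show "1 *\<^sub>R u = u"
    by transfer (auto simp: l2_rel_def)
  show "sgn u = scaleR (inverse (norm u)) u"
    by (simp add: sgn_l2_def)
  show "dist u v = norm (u - v)"
    by (simp add: dist_l2_def)
  show "uniformity = (INF e\<in>{0<..}. principal {(x, y :: 'a l2). dist x y < e})"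
    by (simp add: uniformity_l2_def)
  show "open U \<longleftrightarrow> (\<forall>x\<in>U. \<forall>\<^sub>F (x', y) in uniformity. x' = x \<longrightarrow> y \<in> U)" for U :: "'a l2 set"
    by (simp add: open_l2_def)
  show "inner u v = inner v u"
    by transfer (simp add: mult.commute)
  show "inner (u + v) w = inner u w + inner v w"
    by transfer (simp add: l2_rel_def distrib_right sq_integrable_mult)
  show "inner (a *\<^sub>R u) v = a * inner u v"
    by transfer (simp add: mult.assoc)
  show "0 \<le> inner u u"
    by transfer simp
  show "inner u u = 0 \<longleftrightarrow> u = 0"
  proof transfer
    fix f :: "'a \<Rightarrow> real" assume "l2_rel f f"
    then have f: "sq_integrable f"
      by (simp add: l2_rel_def)
    then have "(LINT x|lebesgue. f x * f x) = 0 \<longleftrightarrow> (AE x in lebesgue. f x * f x = 0)"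
      by (intro integral_nonneg_eq_0_iff_AE sq_integrable_mult) auto
    then show "(LINT x|lebesgue. f x * f x) = 0 \<longleftrightarrow> l2_rel f (\<lambda>x. 0)"
      using f by (simp add: l2_rel_def sq_integrable_zero)
  qed
  show "norm u = sqrt (inner u u)"
    by (simp add: norm_l2_def)
qed

end

definition L2_space :: "'a::euclidean_space set \<Rightarrow> 'a l2 set" where
  "L2_space \<Omega> = {u. AE x in lebesgue. x \<notin> \<Omega> \<longrightarrow> rep_l2 u x = 0}"


section \<open>Lipschitz domains\<close>

text \<open>
  Near each boundary point, \<open>\<Omega>\<close> is the part strictly above the graph of a Lipschitz function, in
  coordinates whose vertical axis is the unit vector \<open>e\<close>; the function is defined on the
  hyperplane orthogonal to \<open>e\<close>.
\<close>

definition lipschitz_boundary :: "'a::euclidean_space set \<Rightarrow> bool" where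
  "lipschitz_boundary \<Omega> \<longleftrightarrow>
    (\<forall>p\<in>frontier \<Omega>. \<exists>r e L \<gamma>. r > 0 \<and> norm e = 1 \<and> L-lipschitz_on {y. y \<bullet> e = 0} \<gamma> \<and>
       \<Omega> \<inter> ball p r = {x. x \<bullet> e > \<gamma> (x - (x \<bullet> e) *\<^sub>R e)} \<inter> ball p r)"

definition bounded_lipschitz_domain :: "'a::euclidean_space set \<Rightarrow> bool" where
  "bounded_lipschitz_domain \<Omega> \<longleftrightarrow>
    open \<Omega> \<and> connected \<Omega> \<and> \<Omega> \<noteq> {} \<and> bounded \<Omega> \<and> lipschitz_boundary \<Omega>"


section \<open>Test functions and Sobolev spaces\<close>

primrec C_k :: "nat \<Rightarrow> ('a::euclidean_space \<Rightarrow> real) \<Rightarrow> bool" where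
  "C_k 0 f \<longleftrightarrow> continuous_on UNIV f"
| "C_k (Suc k) f \<longleftrightarrow> (\<forall>x. f differentiable (at x)) \<and>
     (\<forall>v. C_k k (\<lambda>x. frechet_derivative f (at x) v))"

definition test_functions :: "'a::euclidean_space set \<Rightarrow> ('a \<Rightarrow> real) set" where
  "test_functions U =
    {\<psi>. (\<forall>k. C_k k \<psi>) \<and> compact (closure {x. \<psi> x \<noteq> 0}) \<and> closure {x. \<psi> x \<noteq> 0} \<subseteq> U}"

definition partial_deriv :: "'n \<Rightarrow> (real^'n::finite \<Rightarrow> real) \<Rightarrow> real^'n \<Rightarrow> real" where
  "partial_deriv i \<psi> x = frechet_derivative \<psi> (at x) (axis i 1)"

definition weak_partial ::
    "(real^'n::finite) set \<Rightarrow> 'n \<Rightarrow> (real^'n) l2 \<Rightarrow> (real^'n) l2 \<Rightarrow> bool" where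
  "weak_partial \<Omega> i u p \<longleftrightarrow> p \<in> L2_space \<Omega> \<and>
    (\<forall>\<psi>\<in>test_functions \<Omega>.
       (LINT x|lebesgue_on \<Omega>. rep_l2 u x * partial_deriv i \<psi> x) =
       - (LINT x|lebesgue_on \<Omega>. rep_l2 p x * \<psi> x))"

definition H1 :: "(real^'n::finite) set \<Rightarrow> (real^'n) l2 set" where
  "H1 \<Omega> = {u \<in> L2_space \<Omega>. \<forall>i. \<exists>p. weak_partial \<Omega> i u p}"

definition grad :: "(real^'n::finite) set \<Rightarrow> (real^'n) l2 \<Rightarrow> (real^'n) l2 ^ 'n" where
  "grad \<Omega> u = (\<chi> i. THE p. weak_partial \<Omega> i u p)"

definition H1_norm :: "(real^'n::finite) set \<Rightarrow> (real^'n) l2 \<Rightarrow> real" where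
  "H1_norm \<Omega> u = sqrt ((norm u)\<^sup>2 + (norm (grad \<Omega> u))\<^sup>2)"

definition H10 :: "(real^'n::finite) set \<Rightarrow> (real^'n) l2 set" where
  "H10 \<Omega> = {u \<in> H1 \<Omega>. \<forall>\<epsilon>>0. \<exists>\<psi>\<in>test_functions \<Omega>. H1_norm \<Omega> (u - abs_l2 \<psi>) < \<epsilon>}"


section \<open>Phase spaces\<close>

type_synonym 'n state = "(real^'n) l2 ^ 3"

definition H_space :: "(real^'n::finite) set \<Rightarrow> 'n state set" where
  "H_space \<Omega> = {g. \<forall>i. g $ i \<in> L2_space \<Omega>}"

definition H_plus :: "(real^'n::finite) set \<Rightarrow> 'n state set" where
  "H_plus \<Omega> = {g \<in> H_space \<Omega>. \<forall>i. AE x in lebesgue_on \<Omega>. 0 \<le> rep_l2 (g $ i) x}"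

definition E_space :: "(real^'n::finite) set \<Rightarrow> 'n state set" where
  "E_space \<Omega> = {\<phi>. \<forall>i. \<phi> $ i \<in> H10 \<Omega>}"

definition E_norm :: "(real^'n::finite) set \<Rightarrow> 'n state \<Rightarrow> real" where
  "E_norm \<Omega> \<phi> = norm (\<chi> i. grad \<Omega> (\<phi> $ i))"


section \<open>Weak solutions\<close>

text \<open>Strong (Bochner) measurability is with respect to the norm of \<open>E\<close>.\<close>

definition in_L2_E :: "(real^'n::finite) set \<Rightarrow> real \<Rightarrow> (real \<Rightarrow> 'n state) \<Rightarrow> bool" where
  "in_L2_E \<Omega> \<tau> g \<longleftrightarrow>
    (AE t in lebesgue_on {0..\<tau>}. g t \<in> E_space \<Omega>) \<and>
    (\<exists>s. (\<forall>k. simple_function (lebesgue_on {0..\<tau>}) (s k) \<and> (\<forall>t\<in>{0..\<tau>}. s k t \<in> E_space \<Omega>)) \<and>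
         (AE t in lebesgue_on {0..\<tau>}. (\<lambda>k. E_norm \<Omega> (s k t - g t)) \<longlonglongrightarrow> 0)) \<and>
    (\<integral>\<^sup>+ t. ennreal ((E_norm \<Omega> (g t))\<^sup>2) \<partial>lebesgue_on {0..\<tau>}) < \<infinity>"

definition in_Cw_H :: "(real^'n::finite) set \<Rightarrow> real \<Rightarrow> (real \<Rightarrow> 'n state) \<Rightarrow> bool" where
  "in_Cw_H \<Omega> \<tau> g \<longleftrightarrow> (\<forall>t\<in>{0..\<tau>}. g t \<in> H_space \<Omega>) \<and>
    (\<forall>h\<in>H_space \<Omega>. continuous_on {0..\<tau>} (\<lambda>t. g t \<bullet> h))"

text \<open>The locally integrable function \<open>z\<close> is the distributional derivative of \<open>y\<close> on \<open>(0,\<tau>)\<close>.\<close>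

definition distr_deriv :: "real \<Rightarrow> (real \<Rightarrow> real) \<Rightarrow> (real \<Rightarrow> real) \<Rightarrow> bool" where
  "distr_deriv \<tau> y z \<longleftrightarrow>
    (\<forall>a b. 0 < a \<and> b < \<tau> \<longrightarrow> integrable (lebesgue_on {a..b}) z) \<and>
    (\<forall>\<eta>\<in>test_functions {0<..<\<tau>}.
       - (LINT t|lebesgue_on {0<..<\<tau>}. y t * deriv \<eta> t) =
       (LINT t|lebesgue_on {0<..<\<tau>}. z t * \<eta> t))"

text \<open>
  Elements of \<open>E\<^sup>*\<close> are represented by the functionals they induce on \<open>E\<close>; an element \<open>h\<close> of \<open>H\<close>
  acts as \<open>\<lambda>\<phi>. h \<bullet> \<phi>\<close>.
\<close>

definition weak_solution ::
    "(real^'n::finite) set \<Rightarrow> ('n state \<Rightarrow> 'n state \<Rightarrow> real) \<Rightarrow> ('n state \<Rightarrow> 'n state) \<Rightarrow>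
     real \<Rightarrow> 'n state \<Rightarrow> (real \<Rightarrow> 'n state) \<Rightarrow> bool" where
  "weak_solution \<Omega> A f \<tau> g0 g \<longleftrightarrow>
    in_L2_E \<Omega> \<tau> g \<and> in_Cw_H \<Omega> \<tau> g \<and> g 0 = g0 \<and>
    (\<forall>\<phi>\<in>E_space \<Omega>. distr_deriv \<tau> (\<lambda>t. g t \<bullet> \<phi>) (\<lambda>t. A (g t) \<phi> + f (g t) \<bullet> \<phi>))"

definition global_weak_solution ::
    "(real^'n::finite) set \<Rightarrow> ('n state \<Rightarrow> 'n state \<Rightarrow> real) \<Rightarrow> ('n state \<Rightarrow> 'n state) \<Rightarrow>
     'n state \<Rightarrow> (real \<Rightarrow> 'n state) \<Rightarrow> bool" where
  "global_weak_solution \<Omega> A f g0 g \<longleftrightarrow> (\<forall>\<tau>>0. weak_solution \<Omega> A f \<tau> g0 g)"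

text \<open>
  \<open>S\<close> is the solution semiflow on \<open>H\<^sub>+\<close>: for each initial state in \<open>H\<^sub>+\<close>, its trajectory is the
  unique global weak solution and stays in \<open>H\<^sub>+\<close>.
\<close>

definition solution_semiflow ::
    "(real^'n::finite) set \<Rightarrow> ('n state \<Rightarrow> 'n state \<Rightarrow> real) \<Rightarrow> ('n state \<Rightarrow> 'n state) \<Rightarrow>
     (real \<Rightarrow> 'n state \<Rightarrow> 'n state) \<Rightarrow> bool" where
  "solution_semiflow \<Omega> A f S \<longleftrightarrow>
    (\<forall>g0\<in>H_plus \<Omega>.
       global_weak_solution \<Omega> A f g0 (\<lambda>t. S t g0) \<and>
       (\<forall>h. global_weak_solution \<Omega> A f g0 h \<longrightarrow> (\<forall>t\<ge>0. h t = S t g0)) \<and>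
       (\<forall>t\<ge>0. S t g0 \<in> H_plus \<Omega>))"


section \<open>The Oregonator system\<close>

text \<open>The Dirichlet Laplacian as an operator from \<open>H\<^sub>0\<^sup>1\<close> to its dual.\<close>

definition dirichlet_laplacian ::
    "(real^'n::finite) set \<Rightarrow> (real^'n) l2 \<Rightarrow> (real^'n) l2 \<Rightarrow> real" where
  "dirichlet_laplacian \<Omega> u \<psi> = - (grad \<Omega> u \<bullet> grad \<Omega> \<psi>)"

definition oregonator_A ::
    "(real^'n::finite) set \<Rightarrow> real \<Rightarrow> real \<Rightarrow> real \<Rightarrow> 'n state \<Rightarrow> 'n state \<Rightarrow> real" where
  "oregonator_A \<Omega> d1 d2 d3 g \<phi> =
     d1 * dirichlet_laplacian \<Omega> (g $ 1) (\<phi> $ 1) +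
     d2 * dirichlet_laplacian \<Omega> (g $ 2) (\<phi> $ 2) +
     d3 * dirichlet_laplacian \<Omega> (g $ 3) (\<phi> $ 3)"

text \<open>
  For states in \<open>E\<close> and space dimension at most three (indeed at most four), all three components
  are square-integrable by the Sobolev embedding into \<open>L\<^sup>4\<close>, so that \<open>abs_l2\<close> is meaningful.
\<close>

definition oregonator_f ::
    "real \<Rightarrow> real \<Rightarrow> real \<Rightarrow> real \<Rightarrow> real \<Rightarrow> real \<Rightarrow> real \<Rightarrow> real \<Rightarrow> real \<Rightarrow>
     'n::finite state \<Rightarrow> 'n state" where
  "oregonator_f a1 b1 F G1 b2 c2 G2 a3 c3 g =
     (let u = rep_l2 (g $ 1); v = rep_l2 (g $ 2); w = rep_l2 (g $ 3) in
      vector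
       [abs_l2 (\<lambda>x. a1 * u x + b1 * v x - F * (u x)\<^sup>2 - G1 * u x * v x),
        abs_l2 (\<lambda>x. - b2 * v x + c2 * w x - G2 * u x * v x),
        abs_l2 (\<lambda>x. a3 * u x - c3 * w x)])"


section \<open>Global attractors\<close>

definition global_attractor ::
    "'h::metric_space set \<Rightarrow> (real \<Rightarrow> 'h \<Rightarrow> 'h) \<Rightarrow> 'h set \<Rightarrow> bool" where
  "global_attractor X S \<A> \<longleftrightarrow>
    \<A> \<noteq> {} \<and> compact \<A> \<and> \<A> \<subseteq> X \<and> (\<forall>t\<ge>0. S t ` \<A> = \<A>) \<and>
    (\<forall>B\<subseteq>X. bounded B \<longrightarrow> ((\<lambda>t. SUP x\<in>B. ennreal (infdist (S t x) \<A>)) \<longlongrightarrow> 0) at_top)"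

end

theory Submission
  imports Defs
begin

text \<open>
  In the energy identity for \<open>u\<close>, \<open>v\<close> and a multiple of \<open>w\<close>, the quadratic reaction terms contribute
  with a favourable sign on \<open>H\<^sub>+\<close>: up to a constant, \<open>F u\<^sup>3\<close> absorbs \<open>a\<^sub>1 u\<^sup>2\<close>, and \<open>G\<^sub>1 u\<^sup>2 v\<close> absorbs
  \<open>b\<^sub>1 u v\<close> at the cost of a multiple of \<open>v\<close>; a large weight on \<open>w\<close> takes care of the linear couplings.  This yields a bounded
  absorbing set in \<open>H\<^sub>+\<close> and a bound on the time average of the squared gradient norm.  Hence every
  trajectory from the absorbing set passes, within one unit of time, through a fixed bounded set of
  \<open>E\<close>, which is relatively compact in \<open>H\<close>.  Flowing this set for times in \<open>[0,1]\<close>, which is jointly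
  continuous by the energy inequality for differences of solutions, produces a compact absorbing set,
  and the attractor is its \<open>\<omega>\<close>-limit set.

  The energy identity itself is justified mode by mode: testing a weak solution with Dirichlet
  eigenfunctions gives scalar absolutely continuous functions, and summing over the modes needs only
  that \<open>f(g)\<close> is integrable in time with values in \<open>H\<close>, which follows from the interpolation of \<open>L\<^sup>4\<close>
  between \<open>L\<^sup>2\<close> and \<open>H\<^sub>0\<^sup>1\<close>.
\<close>

section \<open>Square-integrable functions\<close>

text \<open>A weak solution is only weakly continuous in H, and the quadratic terms are bounded in H
  by squared gradient norms, hence only integrably in time. Strong continuity, measurability of
  gradient norms and the energy identity are therefore all extracted from the scalar mode equations.
  The spatial estimates rest on averages over dyadic cubes of side 2^-k. Such an average misses a
  test function by order 2^-k times its gradient in L^2, and on a bounded domain it is determined by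
  finitely many values; this gives compactness. Consecutive averages differ by a function constant
  on cubes, for which L^4 is controlled by L^2 at the price of the inverse volume; in dimension at
  most 3 the resulting factor 2^(kn) 16^-k is at most 2^-k. Summing from a late level gives an L^4
  bound with an arbitrarily small weight on the gradient. Smallness of that weight matters for
  dependence on the data: differences of quadratic terms carry the size R of the solutions as a
  factor, and diffusion must still absorb their gradient part.\<close>

lemma abs_rep_l2 [simp]: "abs_l2 (rep_l2 u) = u"
  by (rule Quotient3_abs_rep[OF Quotient3_l2])

lemma l2_rel_rep: "l2_rel (rep_l2 u) (rep_l2 u)"
  by (rule Quotient3_rep_reflp[OF Quotient3_l2])

lemma sq_integrable_rep [simp]: "sq_integrable (rep_l2 u)"
  using l2_rel_rep[of u] by (simp add: l2_rel_def)

lemma l2_rel_refl: "sq_integrable f \<Longrightarrow> l2_rel f f"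
  by (simp add: l2_rel_def)

lemma sq_integrable_measurable: "sq_integrable f \<Longrightarrow> f \<in> borel_measurable lebesgue"
  by (simp add: sq_integrable_def)

lemma rep_l2_measurable [measurable, simp]: "rep_l2 u \<in> borel_measurable lebesgue"
  by (rule sq_integrable_measurable) simp

lemma rep_abs_l2: "sq_integrable f \<Longrightarrow> AE x in lebesgue. rep_l2 (abs_l2 f) x = f x"
  using Quotient3_rep_abs[OF Quotient3_l2 l2_rel_refl, of f] by (simp add: l2_rel_def)

lemma abs_l2_eqI:
  "sq_integrable f \<Longrightarrow> sq_integrable g \<Longrightarrow> AE x in lebesgue. f x = g x \<Longrightarrow> abs_l2 f = abs_l2 g"
  using Quotient3_rel_abs[OF Quotient3_l2, of f g] by (simp add: l2_rel_def)

lemma abs_l2_plus: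
  "sq_integrable f \<Longrightarrow> sq_integrable g \<Longrightarrow> abs_l2 f + abs_l2 g = abs_l2 (\<lambda>x. f x + g x)"
  by (rule plus_l2.abs_eq) (simp_all add: l2_rel_refl)

lemma abs_l2_minus:
  "sq_integrable f \<Longrightarrow> sq_integrable g \<Longrightarrow> abs_l2 f - abs_l2 g = abs_l2 (\<lambda>x. f x - g x)"
  by (rule minus_l2.abs_eq) (simp_all add: l2_rel_refl)

lemma abs_l2_scaleR:
  "sq_integrable f \<Longrightarrow> c *\<^sub>R abs_l2 f = abs_l2 (\<lambda>x. c * f x)"
  by (rule scaleR_l2.abs_eq) (simp_all add: l2_rel_refl)

lemma inner_abs_l2:
  "sq_integrable f \<Longrightarrow> sq_integrable g \<Longrightarrow> abs_l2 f \<bullet> abs_l2 g = (LINT x|lebesgue. f x * g x)"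
  by (rule inner_l2.abs_eq) (simp_all add: l2_rel_refl)

lemma rep_plus: "AE x in lebesgue. rep_l2 (u + v) x = rep_l2 u x + rep_l2 v x"
  using abs_l2_plus[of "rep_l2 u" "rep_l2 v"]
    rep_abs_l2[OF sq_integrable_add[of "rep_l2 u" "rep_l2 v"]] by simp

lemma rep_minus: "AE x in lebesgue. rep_l2 (u - v) x = rep_l2 u x - rep_l2 v x"
  using abs_l2_minus[of "rep_l2 u" "rep_l2 v"]
    rep_abs_l2[OF sq_integrable_diff[of "rep_l2 u" "rep_l2 v"]] by simp

lemma rep_zero: "AE x in lebesgue. rep_l2 0 x = 0"
  using rep_abs_l2[OF sq_integrable_zero] by (simp add: zero_l2_def)

lemma inner_rep_l2: "u \<bullet> v = (LINT x|lebesgue. rep_l2 u x * rep_l2 v x)"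
  using inner_abs_l2[of "rep_l2 u" "rep_l2 v"] by simp

lemma inner_abs_right: "sq_integrable f \<Longrightarrow> u \<bullet> abs_l2 f = (LINT x|lebesgue. rep_l2 u x * f x)"
  using inner_abs_l2[of "rep_l2 u" f] by simp

lemma norm_abs_l2: "sq_integrable f \<Longrightarrow> (norm (abs_l2 f))\<^sup>2 = (LINT x|lebesgue. (f x)\<^sup>2)"
  unfolding power2_norm_eq_inner by (simp add: inner_abs_l2 power2_eq_square)

lemma norm_rep_l2: "(norm u)\<^sup>2 = (LINT x|lebesgue. (rep_l2 u x)\<^sup>2)"
  using norm_abs_l2[of "rep_l2 u"] by simp

lemma l2_eqI: "AE x in lebesgue. rep_l2 u x = rep_l2 v x \<Longrightarrow> u = v"
  using abs_l2_eqI[of "rep_l2 u" "rep_l2 v"] by simp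

lemma sq_integrable_cong_AE:
  assumes "sq_integrable f" "g \<in> borel_measurable lebesgue" "AE x in lebesgue. f x = g x"
  shows "sq_integrable g"
proof -
  have [measurable]: "f \<in> borel_measurable lebesgue" "g \<in> borel_measurable lebesgue"
    using assms by (auto simp: sq_integrable_def)
  have "integrable lebesgue (\<lambda>x. (f x)\<^sup>2) \<longleftrightarrow> integrable lebesgue (\<lambda>x. (g x)\<^sup>2)"
    by (rule integrable_cong_AE) (use assms(3) in auto)
  then show ?thesis using assms by (simp add: sq_integrable_def)
qed

lemma integrable_rep_mult: "integrable lebesgue (\<lambda>x. rep_l2 u x * rep_l2 v x)"
  by (rule sq_integrable_mult) simp_all

lemma integrable_rep_sq: "integrable lebesgue (\<lambda>x. (rep_l2 u x)\<^sup>2)"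
  using integrable_rep_mult[of u u] by (simp add: power2_eq_square)

lemma sq_integrable_bound:
  assumes "sq_integrable f" "g \<in> borel_measurable lebesgue" "AE x in lebesgue. \<bar>g x\<bar> \<le> \<bar>f x\<bar>"
  shows "sq_integrable g"
  unfolding sq_integrable_def
proof
  show "g \<in> borel_measurable lebesgue" by fact
  then have [measurable]: "g \<in> borel_measurable lebesgue" .
  show "integrable lebesgue (\<lambda>x. (g x)\<^sup>2)"
  proof (rule Bochner_Integration.integrable_bound)
    show "integrable lebesgue (\<lambda>x. (f x)\<^sup>2)" using assms(1) by (simp add: sq_integrable_def)
    show "AE x in lebesgue. norm ((g x)\<^sup>2) \<le> norm ((f x)\<^sup>2)"
      using assms(3) by eventually_elim (simp add: abs_le_square_iff)
  qed measurable
qed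

lemma nn_integral_sq_rep: "(\<integral>\<^sup>+x. ennreal ((rep_l2 u x)\<^sup>2) \<partial>lebesgue) = ennreal ((norm u)\<^sup>2)"
  unfolding norm_rep_l2 by (rule nn_integral_eq_integral) (auto simp: integrable_rep_sq)

lemma sq_integrable_nn_integral:
  assumes "f \<in> borel_measurable lebesgue" "(\<integral>\<^sup>+x. ennreal ((f x)\<^sup>2) \<partial>lebesgue) < \<infinity>"
  shows "sq_integrable f"
  using assms unfolding sq_integrable_def by (auto intro!: integrableI_bounded)

text \<open>The squared differences tend to zero in L^1, hence almost everywhere along a
  subsequence. Through this lemma nonnegativity and L^4 bounds survive L^2 limits.\<close>

lemma l2_subseq_AE_tendsto:
  fixes u :: "nat \<Rightarrow> 'a::euclidean_space l2"
  assumes "u \<longlonglongrightarrow> l"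
  shows "\<exists>r. strict_mono r \<and> (AE x in lebesgue. (\<lambda>n. rep_l2 (u (r n)) x) \<longlonglongrightarrow> rep_l2 l x)"
proof -
  define d where "d n x = (rep_l2 (u n - l) x)\<^sup>2" for n x
  have "\<exists>r. strict_mono r \<and> (AE x in lebesgue. (\<lambda>n. d (r n) x) \<longlonglongrightarrow> 0)"
  proof (rule tendsto_L1_AE_subseq)
    show "integrable lebesgue (d n)" for n
      unfolding d_def by (rule integrable_rep_sq)
    have "(\<lambda>n. (norm (u n - l))\<^sup>2) \<longlonglongrightarrow> 0"
      using assms by (auto simp: LIM_zero_iff intro!: tendsto_eq_intros tendsto_norm_zero)
    then show "(\<lambda>n. LINT x|lebesgue. norm (d n x)) \<longlonglongrightarrow> 0"
      by (simp add: d_def norm_rep_l2)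
  qed
  then obtain r where r: "strict_mono r" "AE x in lebesgue. (\<lambda>n. d (r n) x) \<longlonglongrightarrow> 0" by blast
  have "AE x in lebesgue. \<forall>n. rep_l2 (u n - l) x = rep_l2 (u n) x - rep_l2 l x"
    by (subst AE_all_countable) (simp add: rep_minus)
  with r(2) have "AE x in lebesgue. (\<lambda>n. rep_l2 (u (r n)) x) \<longlonglongrightarrow> rep_l2 l x"
  proof eventually_elim
    case (elim x)
    then have "(\<lambda>n. sqrt ((rep_l2 (u (r n)) x - rep_l2 l x)\<^sup>2)) \<longlonglongrightarrow> sqrt 0"
      by (intro tendsto_real_sqrt) (simp add: d_def)
    then show ?case
      by (simp add: LIM_zero_iff tendsto_rabs_zero_iff)
  qed
  with r(1) show ?thesis by blast
qed

section \<open>Completeness of L^2\<close>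

lemma geometric_square_bound:
  fixes z :: real
  assumes "4^n * z\<^sup>2 \<le> C"
  shows "\<bar>z\<bar> \<le> sqrt C * (1/2)^n"
proof -
  have "(2^n * \<bar>z\<bar>)\<^sup>2 = 4^n * z\<^sup>2"
    unfolding power_mult_distrib power2_abs power2_eq_square[of "2^n"]
    unfolding power_mult_distrib[symmetric] by simp
  with assms have "2^n * \<bar>z\<bar> \<le> sqrt C" by (intro real_le_rsqrt) simp
  then show ?thesis by (simp add: power_divide pos_le_divide_eq mult.commute)
qed

text \<open>Squared increments of size 8^-n stay summable after multiplication by 4^n. So almost
  everywhere the n-th increment is at most a constant times 2^-n, and the telescoping series
  converges absolutely.\<close>

lemma l2_rapid_subseq_AE:
  fixes u :: "nat \<Rightarrow> 'a::euclidean_space l2"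
  assumes r: "\<And>n. (norm (u (Suc n) - u n))\<^sup>2 \<le> (1/8)^n"
  shows "AE x in lebesgue. convergent (\<lambda>n. rep_l2 (u n) x)"
proof -
  define d where "d n x = (rep_l2 (u (Suc n) - u n) x)\<^sup>2" for n x
  have [measurable]: "d n \<in> borel_measurable lebesgue" for n
    unfolding d_def by measurable
  have "(\<integral>\<^sup>+x. (\<Sum>n. ennreal (4^n * d n x)) \<partial>lebesgue) = (\<Sum>n. \<integral>\<^sup>+x. ennreal (4^n * d n x) \<partial>lebesgue)"
    by (rule nn_integral_suminf) measurable
  also have "\<dots> = (\<Sum>n. ennreal (4^n * (norm (u (Suc n) - u n))\<^sup>2))"
    by (simp add: d_def ennreal_mult nn_integral_cmult nn_integral_sq_rep)
  also have "\<dots> \<le> (\<Sum>n. ennreal ((1/2)^n))"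
  proof (intro suminf_le)
    fix n
    have "4^n * (norm (u (Suc n) - u n))\<^sup>2 \<le> 4^n * (1/8)^n"
      using r[of n] by (intro mult_left_mono) auto
    also have "\<dots> = (1/2)^n" by (simp flip: power_mult_distrib)
    finally show "ennreal (4^n * (norm (u (Suc n) - u n))\<^sup>2) \<le> ennreal ((1/2)^n)"
      by (rule ennreal_leI)
  qed simp_all
  also have "\<dots> = ennreal (\<Sum>n. (1/2)^n)"
    by (rule suminf_ennreal2) (auto intro: summable_geometric)
  also have "\<dots> < \<infinity>" by simp
  finally have "AE x in lebesgue. (\<Sum>n. ennreal (4^n * d n x)) \<noteq> \<infinity>"
    by (intro nn_integral_noteq_infinite) auto
  moreover have "AE x in lebesgue. \<forall>n. rep_l2 (u (Suc n) - u n) x = rep_l2 (u (Suc n)) x - rep_l2 (u n) x"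
    by (subst AE_all_countable) (simp add: rep_minus)
  ultimately show ?thesis
  proof eventually_elim
    case (elim x)
    define C where "C = enn2real (\<Sum>n. ennreal (4^n * d n x))"
    have C: "4^n * d n x \<le> C" for n
    proof -
      have "ennreal (4^n * d n x) \<le> (\<Sum>n. ennreal (4^n * d n x))"
        using sum_le_suminf[of "\<lambda>n. ennreal (4^n * d n x)" "{n}"] by simp
      also have "\<dots> = ennreal C"
        using elim(1) by (simp add: C_def less_top)
      finally show ?thesis
        by (simp add: C_def d_def ennreal_le_iff)
    qed
    have "\<bar>rep_l2 (u (Suc n)) x - rep_l2 (u n) x\<bar> \<le> sqrt C * (1/2)^n" for n
      using C[of n] elim(2) by (intro geometric_square_bound) (metis d_def)
    moreover have "summable (\<lambda>n. sqrt C * (1/2)^n)"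
      by (intro summable_mult summable_geometric) simp
    ultimately have "summable (\<lambda>n. rep_l2 (u (Suc n)) x - rep_l2 (u n) x)"
      using summable_comparison_test'[of "\<lambda>n. sqrt C * (1/2)^n" 0 "\<lambda>n. rep_l2 (u (Suc n)) x - rep_l2 (u n) x"] by simp
    then have "(\<lambda>n. \<Sum>i<n. rep_l2 (u (Suc i)) x - rep_l2 (u i) x) \<longlonglongrightarrow>
        (\<Sum>i. rep_l2 (u (Suc i)) x - rep_l2 (u i) x)" (is "_ \<longlonglongrightarrow> ?s")
      by (rule summable_LIMSEQ)
    then have "(\<lambda>n. rep_l2 (u n) x - rep_l2 (u 0) x) \<longlonglongrightarrow> ?s"
      by (simp add: sum_lessThan_telescope[of "\<lambda>n. rep_l2 (u n) x"])
    then have "(\<lambda>n. (rep_l2 (u n) x - rep_l2 (u 0) x) + rep_l2 (u 0) x) \<longlonglongrightarrow> ?s + rep_l2 (u 0) x"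
      by (intro tendsto_intros)
    then show ?case by (auto simp: convergent_def)
  qed
qed

text \<open>Riesz-Fischer: a rapidly Cauchy subsequence converges almost everywhere, and Fatou's
  lemma turns the Cauchy estimate into an L^2 bound on the distance to the pointwise limit.\<close>

instance l2 :: (euclidean_space) complete_space
proof
  fix X :: "nat \<Rightarrow> 'a l2"
  assume C: "Cauchy X"
  have "\<exists>r. strict_mono r \<and> (\<forall>n. \<forall>m\<ge>r n. \<forall>k\<ge>r n. norm (X m - X k) < (1/8)^n)"
  proof -
    have ex: "\<exists>M. \<forall>m\<ge>M. \<forall>k\<ge>M. norm (X m - X k) < (1/8)^n" for n
      using C by (simp add: Cauchy_iff)
    have "\<exists>f. \<forall>n. (\<forall>m\<ge>f n. \<forall>k\<ge>f n. norm (X m - X k) < (1/8)^n) \<and> f n < f (Suc n)"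
    proof (intro dependent_nat_choice)
      show "\<exists>x. \<forall>m\<ge>x. \<forall>k\<ge>x. norm (X m - X k) < (1/8)^0" by (rule ex)
      fix x n
      obtain M where "\<forall>m\<ge>M. \<forall>k\<ge>M. norm (X m - X k) < (1/8)^(Suc n)" using ex by blast
      then show "\<exists>y. (\<forall>m\<ge>y. \<forall>k\<ge>y. norm (X m - X k) < (1/8)^(Suc n)) \<and> x < y"
        by (intro exI[of _ "max M (Suc x)"]) auto
    qed
    then obtain f where "\<forall>n. (\<forall>m\<ge>f n. \<forall>k\<ge>f n. norm (X m - X k) < (1/8)^n) \<and> f n < f (Suc n)" by blast
    then show ?thesis by (intro exI[of _ f]) (auto simp: strict_mono_Suc_iff)
  qed
  then obtain r where r: "strict_mono r" "\<And>n m k. m \<ge> r n \<Longrightarrow> k \<ge> r n \<Longrightarrow> norm (X m - X k) < (1/8)^n"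
    by blast
  have "AE x in lebesgue. convergent (\<lambda>n. rep_l2 (X (r n)) x)"
  proof (rule l2_rapid_subseq_AE)
    fix n
    have "norm (X (r (Suc n)) - X (r n)) < (1/8)^n"
      using r(1) by (intro r(2)) (auto simp: strict_mono_Suc_iff less_imp_le)
    moreover have "(1/8::real)^n \<le> 1" by (simp add: power_le_one)
    ultimately show "(norm (X (r (Suc n)) - X (r n)))\<^sup>2 \<le> (1/8)^n"
      unfolding power2_eq_square
      by (smt (verit) mult_left_le norm_ge_zero mult_right_mono)
  qed
  then have lim: "AE x in lebesgue. (\<lambda>n. rep_l2 (X (r n)) x) \<longlonglongrightarrow> lim (\<lambda>n. rep_l2 (X (r n)) x)"
    by eventually_elim (simp add: convergent_LIMSEQ_iff)
  define f where "f x = lim (\<lambda>n. rep_l2 (X (r n)) x)" for x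
  have f[measurable]: "f \<in> borel_measurable lebesgue"
    unfolding f_def by measurable
  \<comment> \<open>Fatou is applied in the subsequence index with \<open>k\<close> fixed, so the
    estimate already concerns the whole sequence.\<close>
  have bound: "(\<integral>\<^sup>+x. ennreal ((f x - rep_l2 (X k) x)\<^sup>2) \<partial>lebesgue) \<le> ennreal (((1/8)^n)\<^sup>2)"
    if k: "k \<ge> r n" for n k
  proof -
    have "(\<integral>\<^sup>+x. ennreal ((f x - rep_l2 (X k) x)\<^sup>2) \<partial>lebesgue)
       = (\<integral>\<^sup>+x. liminf (\<lambda>m. ennreal ((rep_l2 (X (r m)) x - rep_l2 (X k) x)\<^sup>2)) \<partial>lebesgue)"
    proof (rule nn_integral_cong_AE, use lim in eventually_elim)
      case (elim x)
      then have "(\<lambda>m. ennreal ((rep_l2 (X (r m)) x - rep_l2 (X k) x)\<^sup>2)) \<longlonglongrightarrow> ennreal ((f x - rep_l2 (X k) x)\<^sup>2)"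
        unfolding f_def by (intro tendsto_intros) auto
      then show ?case by (metis lim_imp_Liminf trivial_limit_sequentially)
    qed
    also have "\<dots> \<le> liminf (\<lambda>m. \<integral>\<^sup>+x. ennreal ((rep_l2 (X (r m)) x - rep_l2 (X k) x)\<^sup>2) \<partial>lebesgue)"
      by (rule nn_integral_liminf) measurable
    also have "\<dots> = liminf (\<lambda>m. ennreal ((norm (X (r m) - X k))\<^sup>2))"
    proof -
      have "(\<integral>\<^sup>+x. ennreal ((rep_l2 (X (r m)) x - rep_l2 (X k) x)\<^sup>2) \<partial>lebesgue) = ennreal ((norm (X (r m) - X k))\<^sup>2)" for m
        unfolding nn_integral_sq_rep[symmetric]
        by (rule nn_integral_cong_AE, use rep_minus[of "X (r m)" "X k"] in eventually_elim) simp
      then show ?thesis by simp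
    qed
    also have "\<dots> \<le> ennreal (((1/8)^n)\<^sup>2)"
    proof (rule order_trans[OF Liminf_le_Limsup Limsup_bounded])
      show "\<forall>\<^sub>F m in sequentially. ennreal ((norm (X (r m) - X k))\<^sup>2) \<le> ennreal (((1/8)^n)\<^sup>2)"
        using eventually_ge_at_top[of n]
      proof eventually_elim
        case (elim m)
        then have "norm (X (r m) - X k) < (1/8)^n"
          using r(1) k by (intro r(2)) (auto simp: strict_mono_less_eq)
        then show ?case by (intro ennreal_leI power_mono) auto
      qed
    qed simp
    finally show ?thesis .
  qed
  have fk: "sq_integrable (\<lambda>x. f x - rep_l2 (X (r 0)) x)"
    using bound[of 0 "r 0"] by (intro sq_integrable_nn_integral) (auto simp: le_less_trans)
  have sf: "sq_integrable f"
    using sq_integrable_add[OF fk sq_integrable_rep[of "X (r 0)"]] by simp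
  have "X \<longlonglongrightarrow> abs_l2 f"
  proof (rule LIMSEQ_I)
    fix e :: real assume "e > 0"
    then obtain n where n: "(1/8::real)^n < e"
      using real_arch_pow_inv[of e "1/8"] by auto
    have "norm (X k - abs_l2 f) < e" if "k \<ge> r n" for k
    proof -
      have "ennreal ((norm (abs_l2 f - X k))\<^sup>2) = (\<integral>\<^sup>+x. ennreal ((f x - rep_l2 (X k) x)\<^sup>2) \<partial>lebesgue)"
        unfolding nn_integral_sq_rep[symmetric]
        by (rule nn_integral_cong_AE, use rep_minus[of "abs_l2 f" "X k"] rep_abs_l2[OF sf] in eventually_elim) simp
      also have "\<dots> \<le> ennreal (((1/8)^n)\<^sup>2)" by (rule bound) fact
      finally have "norm (abs_l2 f - X k) \<le> (1/8)^n"
        by (simp add: ennreal_le_iff power2_le_iff_abs_le)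
      with n show ?thesis by (simp add: norm_minus_commute)
    qed
    then show "\<exists>no. \<forall>k\<ge>no. norm (X k - abs_l2 f) < e" by blast
  qed
  then show "convergent X" by (auto simp: convergent_def)
qed

subsection \<open>Multiplication by indicator functions\<close>

definition cut :: "'a::euclidean_space set \<Rightarrow> 'a l2 \<Rightarrow> 'a l2" where
  "cut A u = abs_l2 (\<lambda>x. indicator A x * rep_l2 u x)"

lemma sq_integrable_indicator_mult:
  "A \<in> sets lebesgue \<Longrightarrow> sq_integrable f \<Longrightarrow> sq_integrable (\<lambda>x. indicator A x * f x)"
  by (rule sq_integrable_bound[of f]) (auto simp: indicator_def sq_integrable_def)

lemma rep_cut: "A \<in> sets lebesgue \<Longrightarrow> AE x in lebesgue. rep_l2 (cut A u) x = indicator A x * rep_l2 u x"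
  unfolding cut_def by (rule rep_abs_l2) (simp add: sq_integrable_indicator_mult)

lemma inner_cut:
  assumes "A \<in> sets lebesgue"
  shows "cut A u \<bullet> v = (LINT x|lebesgue. indicator A x * (rep_l2 u x * rep_l2 v x))"
  unfolding inner_rep_l2
proof (rule integral_cong_AE)
  show "(\<lambda>x. indicat_real A x * (rep_l2 u x * rep_l2 v x)) \<in> borel_measurable lebesgue"
    using assms by measurable
qed (use rep_cut[OF assms, of u] in \<open>auto simp: mult.assoc\<close>)

lemma inner_cut_commute: "A \<in> sets lebesgue \<Longrightarrow> cut A u \<bullet> v = u \<bullet> cut A v"
  using inner_cut[of A u v] inner_cut[of A v u] by (simp add: inner_commute mult.commute)

lemma L2_space_iff_cut: "A \<in> sets lebesgue \<Longrightarrow> u \<in> L2_space A \<longleftrightarrow> cut A u = u"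
proof -
  assume A: "A \<in> sets lebesgue"
  show ?thesis
  proof
    assume "u \<in> L2_space A"
    then have *: "AE x in lebesgue. x \<notin> A \<longrightarrow> rep_l2 u x = 0" by (simp add: L2_space_def)
    show "cut A u = u"
      by (rule l2_eqI, use * rep_cut[OF A, of u] in eventually_elim) (auto simp: indicator_def)
  next
    assume "cut A u = u"
    then show "u \<in> L2_space A"
      using rep_cut[OF A, of u] unfolding L2_space_def by (auto simp: indicator_def)
  qed
qed

text \<open>Membership becomes a family of equations between continuous linear functionals of
  \<open>u\<close>, from which closedness and linearity are read off without touching
  representatives.\<close>

lemma L2_space_iff_inner:
  assumes A: "A \<in> sets lebesgue"
  shows "u \<in> L2_space A \<longleftrightarrow> (\<forall>v. u \<bullet> v = u \<bullet> cut A v)"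
  unfolding L2_space_iff_cut[OF A] inner_cut_commute[OF A, symmetric]
  by (metis vector_eq_rdot)

lemma L2_space_closed: "A \<in> sets lebesgue \<Longrightarrow> closed (L2_space A)"
proof -
  assume A: "A \<in> sets lebesgue"
  have "L2_space A = {u. \<forall>v. u \<bullet> v = u \<bullet> cut A v}"
    using L2_space_iff_inner[OF A] by blast
  then show ?thesis
    by (auto intro!: closed_Collect_all closed_Collect_eq continuous_intros)
qed

lemma L2_space_subspace: assumes A: "A \<in> sets lebesgue" shows "subspace (L2_space A)"
  unfolding subspace_def Ball_def L2_space_iff_inner[OF A] by (simp add: inner_add_left)

subsection \<open>Uniform boundedness\<close>

text \<open>The sign is taken to agree with that of \<open>a \<bullet> x\<close>, so the push adds
  to the pairing instead of cancelling it.\<close>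

lemma scaled_sign_push:
  fixes x a :: "'a::real_inner"
  assumes "r > 0"
  shows "\<exists>s. \<bar>s\<bar> = 1 \<and> \<bar>a \<bullet> (x + (s * r) *\<^sub>R sgn a)\<bar> \<ge> r * norm a"
proof -
  have *: "a \<bullet> sgn a = norm a"
    by (cases "a = 0") (auto simp: sgn_div_norm power2_norm_eq_inner[symmetric] power2_eq_square)
  have nn: "0 \<le> r * norm a" using assms by simp
  show ?thesis
  proof (cases "a \<bullet> x \<ge> 0")
    case True then show ?thesis using nn by (intro exI[of _ 1]) (auto simp: inner_add_right *)
  next
    case False then show ?thesis using nn by (intro exI[of _ "-1"]) (auto simp: inner_diff_right *)
  qed
qed

text \<open>Gliding hump: each step moves by \<open>3\<^sup>-\<^sup>n\<close>, so that later steps cannot undo it.\<close>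

lemma weakly_bounded_imp_bounded:
  fixes u :: "'i \<Rightarrow> 'a::{real_inner, complete_space}"
  assumes V: "subspace V" "closed V" "\<And>i. i \<in> I \<Longrightarrow> u i \<in> V"
    and bd: "\<And>h. h \<in> V \<Longrightarrow> \<exists>C. \<forall>i\<in>I. \<bar>u i \<bullet> h\<bar> \<le> C"
  shows "\<exists>C. \<forall>i\<in>I. norm (u i) \<le> C"
proof (rule ccontr)
  assume "\<nexists>C. \<forall>i\<in>I. norm (u i) \<le> C"
  \<comment> \<open>Norms of size 4^n beat steps of size 3^-n. Each push makes the pairing at least
    3^-n times the norm, and the remaining steps, of total length at most half of 3^-n, undo at most
    half of it; so (4/3)^n would stay bounded.\<close>
  then have "\<forall>n. \<exists>i\<in>I. norm (u i) \<ge> 4^n" by (meson linorder_le_cases)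
  then obtain t where t: "\<And>n::nat. t n \<in> I" "\<And>n. norm (u (t n)) \<ge> 4^n" by metis
  define step where "step n x = x + ((SOME s. \<bar>s\<bar> = 1 \<and>
     \<bar>u (t n) \<bullet> (x + (s * (1/3)^n) *\<^sub>R sgn (u (t n)))\<bar> \<ge> (1/3)^n * norm (u (t n))) * (1/3)^n) *\<^sub>R sgn (u (t n))" for n x
  have step: "\<exists>s. \<bar>s\<bar> = 1 \<and> step n x = x + (s * (1/3)^n) *\<^sub>R sgn (u (t n)) \<and>
      \<bar>u (t n) \<bullet> step n x\<bar> \<ge> (1/3)^n * norm (u (t n))" for n x
    using someI_ex[OF scaled_sign_push[of "(1/3)^n" "u (t n)" x]] unfolding step_def by auto
  define x where "x = rec_nat 0 (\<lambda>n. step n)"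
  have xs: "x (Suc n) = step n (x n)" for n by (simp add: x_def)
  have x0: "x 0 = 0" by (simp add: x_def)
  have xV: "x n \<in> V" for n
  proof (induction n)
    case 0 then show ?case by (simp add: x0 subspace_0[OF V(1)])
  next
    case (Suc n)
    have "sgn (u (t n)) \<in> V" unfolding sgn_div_norm using V t by (simp add: subspace_scale)
    then show ?case using step[of n "x n"] Suc V(1) by (auto simp: xs intro!: subspace_add subspace_scale)
  qed
  have dx: "norm (x (Suc n) - x n) \<le> (1/3)^n" for n
    using step[of n "x n"] by (auto simp: xs norm_sgn abs_mult)
  have dx2: "norm (x (n + k) - x n) \<le> (1/3)^n * (3/2) * (1 - (1/3)^k)" for n k
  proof (induction k)
    case (Suc k)
    have "norm (x (n + Suc k) - x n) \<le> norm (x (Suc (n + k)) - x (n+k)) + norm (x (n + k) - x n)"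
      using norm_triangle_ineq[of "x (Suc (n + k)) - x (n+k)" "x (n + k) - x n"] by simp
    also have "\<dots> \<le> (1/3)^(n+k) + (1/3)^n * (3/2) * (1 - (1/3)^k)"
      using dx[of "n+k"] Suc by linarith
    also have "\<dots> = (1/3)^n * (3/2) * (1 - (1/3)^Suc k)"
      by (simp add: power_add field_simps)
    finally show ?case .
  qed simp
  have dx3: "norm (x m - x n) \<le> (1/3)^n * (3/2)" if "m \<ge> n" for m n
  proof -
    have "norm (x (n + (m - n)) - x n) \<le> (1/3)^n * (3/2) * (1 - (1/3)^(m-n))" by (rule dx2)
    also have "\<dots> \<le> (1/3)^n * (3/2) * 1" by (intro mult_left_mono) auto
    finally show ?thesis using that by simp
  qed
  have "Cauchy x"
  proof (rule metric_CauchyI)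
    fix e :: real assume "e > 0"
    then obtain n where n: "(1/3::real)^n < e / 3"
      using real_arch_pow_inv[of "e/3" "1/3"] by auto
    have "dist (x m) (x k) < e" if "m \<ge> n" "k \<ge> n" for m k
    proof -
      have "dist (x m) (x k) \<le> norm (x m - x n) + norm (x k - x n)"
        using norm_triangle_ineq4[of "x m - x n" "x k - x n"] by (simp add: dist_norm)
      also have "\<dots> \<le> (1/3)^n * 3" using dx3[OF that(1)] dx3[OF that(2)] by simp
      also have "\<dots> < e" using n by simp
      finally show ?thesis .
    qed
    then show "\<exists>M. \<forall>m\<ge>M. \<forall>n\<ge>M. dist (x m) (x n) < e" by blast
  qed
  then obtain l where l: "x \<longlonglongrightarrow> l" using Cauchy_convergent convergent_def by blast
  have lV: "l \<in> V" using closed_sequentially[OF V(2)] xV l by blast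
  obtain C where C: "\<And>i. i \<in> I \<Longrightarrow> \<bar>u i \<bullet> l\<bar> \<le> C" using bd[OF lV] by blast
  have lx: "norm (l - x (Suc n)) \<le> (1/3)^n * (1/2)" for n
  proof (rule tendsto_upperbound)
    show "(\<lambda>m. norm (x m - x (Suc n))) \<longlonglongrightarrow> norm (l - x (Suc n))" by (intro tendsto_intros l)
    show "\<forall>\<^sub>F m in sequentially. norm (x m - x (Suc n)) \<le> (1/3)^n * (1/2)"
      using eventually_ge_at_top[of "Suc n"] by eventually_elim (use dx3 in fastforce)
  qed simp
  have "(4/3)^n \<le> 2 * C" for n
  proof -
    have "(1/3)^n * norm (u (t n)) \<le> \<bar>u (t n) \<bullet> x (Suc n)\<bar>"
      using step[of n "x n"] by (auto simp: xs)
    also have "\<dots> \<le> \<bar>u (t n) \<bullet> l\<bar> + \<bar>u (t n) \<bullet> (l - x (Suc n))\<bar>"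
      by (simp add: inner_diff_right)
    also have "\<dots> \<le> C + norm (u (t n)) * ((1/3)^n * (1/2))"
      using C[OF t(1)] Cauchy_Schwarz_ineq2[of "u (t n)" "l - x (Suc n)"] lx[of n]
      by (smt (verit) mult_left_mono norm_ge_zero)
    finally have "(1/3)^n * norm (u (t n)) \<le> 2 * C" by (simp add: field_simps)
    moreover have "(1/3)^n * 4^n \<le> (1/3)^n * norm (u (t n))"
      using t(2)[of n] by (intro mult_left_mono) auto
    ultimately show ?thesis by (simp flip: power_mult_distrib)
  qed
  moreover obtain n where "(4/3::real)^n > 2 * C" using real_arch_pow[of "4/3" "2*C"] by auto
  ultimately show False by (meson not_le)
qed

section \<open>Smooth functions\<close>

lemma C_k_has_derivative:
  "C_k (Suc k) f \<Longrightarrow> (f has_derivative frechet_derivative f (at x)) (at x)"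
  by (simp add: frechet_derivative_works)

lemma C_k_continuous: "C_k k f \<Longrightarrow> continuous_on UNIV f"
  by (cases k) (auto intro!: continuous_at_imp_continuous_on differentiable_imp_continuous_within)

lemma C_k_SucI:
  assumes "\<And>x. (f has_derivative f' x) (at x)" "\<And>v. C_k k (\<lambda>x. f' x v)"
  shows "C_k (Suc k) f"
  using assms frechet_derivative_at[OF assms(1)] by (auto simp: differentiable_def)

lemma C_k_Suc_D: "C_k (Suc k) f \<Longrightarrow> C_k k f"
  by (induction k arbitrary: f)
    (auto intro!: continuous_at_imp_continuous_on differentiable_imp_continuous_within)

lemma C_k_const: "C_k k (\<lambda>x. c)"
proof (induction k arbitrary: c)
  case (Suc k)
  show ?case by (rule C_k_SucI[where f'="\<lambda>_ _. 0"]) (auto intro: Suc)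
qed simp

lemma C_k_add: "C_k k f \<Longrightarrow> C_k k g \<Longrightarrow> C_k k (\<lambda>x. f x + g x)"
proof (induction k arbitrary: f g)
  case (Suc k)
  note d = C_k_has_derivative[OF Suc.prems(1)] C_k_has_derivative[OF Suc.prems(2)]
  show ?case
    by (rule C_k_SucI, rule has_derivative_add[OF d]) (use Suc in auto)
qed (auto intro: continuous_intros)

lemma C_k_mult: "C_k k f \<Longrightarrow> C_k k g \<Longrightarrow> C_k k (\<lambda>x. f x * g x)"
proof (induction k arbitrary: f g)
  case (Suc k)
  note d = C_k_has_derivative[OF Suc.prems(1)] C_k_has_derivative[OF Suc.prems(2)]
  show ?case
    by (rule C_k_SucI, rule has_derivative_mult[OF d], rule C_k_add; rule Suc.IH)
      (use Suc.prems C_k_Suc_D in auto)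
qed (auto intro: continuous_intros)

lemma C_k_linear: "bounded_linear f \<Longrightarrow> C_k k f"
proof (cases k)
  case 0
  then show "bounded_linear f \<Longrightarrow> C_k k f" by (simp add: linear_continuous_on)
next
  case (Suc j)
  show ?thesis if "bounded_linear f"
    unfolding Suc
    by (rule C_k_SucI[where f'="\<lambda>x. f"])
      (use that in \<open>auto intro: C_k_const bounded_linear_imp_has_derivative\<close>)
qed

lemma C_k_real_deriv:
  fixes f :: "real \<Rightarrow> real"
  assumes "\<And>x. (f has_real_derivative f' x) (at x)" "C_k k f'"
  shows "C_k (Suc k) f"
  by (rule C_k_SucI[where f'="\<lambda>x v. f' x * v"])
    (use assms in \<open>auto simp: has_field_derivative_def intro: C_k_mult C_k_const\<close>)

lemma frechet_derivative_real:
  fixes h :: "real \<Rightarrow> real"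
  assumes "h differentiable at x"
  shows "frechet_derivative h (at x) v = v * frechet_derivative h (at x) 1"
proof -
  have "linear (frechet_derivative h (at x))"
    using assms by (rule linear_frechet_derivative)
  from linear_scale[OF this, of v 1] show ?thesis by simp
qed

lemma deriv_eq_frechet:
  fixes h :: "real \<Rightarrow> real"
  assumes "h differentiable at x"
  shows "deriv h x = frechet_derivative h (at x) 1"
proof -
  have "frechet_derivative h (at x) = (\<lambda>v. frechet_derivative h (at x) 1 * v)"
    by (rule ext, subst frechet_derivative_real[OF assms], rule mult.commute)
  then have "(h has_derivative (\<lambda>v. frechet_derivative h (at x) 1 * v)) (at x)"
    using frechet_derivative_works[THEN iffD1, OF assms] by argo
  then show ?thesis by (intro DERIV_imp_deriv) (simp add: has_field_derivative_def)
qed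

lemma C_k_deriv: "C_k (Suc k) (h::real\<Rightarrow>real) \<Longrightarrow> C_k k (deriv h)"
proof -
  assume h: "C_k (Suc k) h"
  then have "deriv h = (\<lambda>x. frechet_derivative h (at x) 1)"
    by (auto intro!: deriv_eq_frechet)
  with h show ?thesis by simp
qed

lemma C_k_compose:
  fixes h :: "real \<Rightarrow> real" and f :: "'a::euclidean_space \<Rightarrow> real"
  assumes "C_k k h" "C_k k f"
  shows "C_k k (\<lambda>x. h (f x))"
  using assms
proof (induction k arbitrary: f h)
  case 0
  then show ?case by (auto intro: continuous_on_compose2[of UNIV h])
next
  case (Suc k)
  show ?case
  proof (rule C_k_SucI[where f'="\<lambda>x v. frechet_derivative f (at x) v * deriv h (f x)"])
    fix x
    have "((h \<circ> f) has_derivative frechet_derivative h (at (f x)) \<circ> frechet_derivative f (at x)) (at x)"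
      using Suc.prems by (intro diff_chain_at C_k_has_derivative)
    moreover have "frechet_derivative h (at (f x)) w = w * deriv h (f x)" for w
      using Suc.prems frechet_derivative_real[of h "f x" w] deriv_eq_frechet[of h "f x"] by simp
    ultimately show "((\<lambda>x. h (f x)) has_derivative (\<lambda>v. frechet_derivative f (at x) v * deriv h (f x))) (at x)"
      by (simp add: o_def)
  next
    fix v
    show "C_k k (\<lambda>x. frechet_derivative f (at x) v * deriv h (f x))"
    proof (rule C_k_mult)
      show "C_k k (\<lambda>x. frechet_derivative f (at x) v)" using Suc.prems by simp
      show "C_k k (\<lambda>x. deriv h (f x))"
        by (rule Suc.IH[OF C_k_deriv[OF Suc.prems(1)] C_k_Suc_D[OF Suc.prems(2)]])
    qed
  qed
qed

lemma C_k_prod: "finite I \<Longrightarrow> (\<And>i. i \<in> I \<Longrightarrow> C_k k (f i)) \<Longrightarrow> C_k k (\<lambda>x. \<Prod>i\<in>I. f i x)"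
  by (induction I rule: finite_induct) (auto intro: C_k_const C_k_mult)

lemma C_k_shift: "C_k k f \<Longrightarrow> C_k k (\<lambda>x. f (x + a))"
proof (induction k arbitrary: f)
  case 0
  then show ?case by (auto intro!: continuous_intros intro: continuous_on_compose2[of UNIV f])
next
  case (Suc k)
  show ?case
  proof (rule C_k_SucI[where f'="\<lambda>x. frechet_derivative f (at (x + a))"])
    fix x
    have "((\<lambda>x. f (x + a)) has_derivative (\<lambda>v. frechet_derivative f (at (x + a)) v)) (at x)"
      by (rule has_derivative_compose[of "\<lambda>x. x + a" "\<lambda>v. v" x UNIV f])
        (use Suc.prems in \<open>auto intro!: derivative_eq_intros simp: frechet_derivative_works\<close>)
    then show "((\<lambda>x. f (x + a)) has_derivative frechet_derivative f (at (x + a))) (at x)" .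
  qed (use Suc in auto)
qed

section \<open>A smooth function supported on the half-line\<close>

definition bump :: "real \<Rightarrow> real" where
  "bump t = (if t > 0 then exp (- (1 / t)) else 0)"

text \<open>Derivatives of \<^term>\<open>bump\<close> stay in the class of functions \<open>p (1/t) exp (-1/t)\<close> with \<open>p\<close> polynomial.\<close>

lemma poly_exp_decay: "((\<lambda>s. poly p s * exp (- s)) \<longlongrightarrow> 0) at_top" for p :: "real poly"
proof -
  have mono: "((\<lambda>s::real. s ^ n * exp (- s)) \<longlongrightarrow> 0) at_top" for n
    using tendsto_power_div_exp_0[of n] by (simp add: exp_minus divide_inverse)
  have "((\<lambda>s. \<Sum>i\<le>degree p. coeff p i * (s ^ i * exp (- s))) \<longlongrightarrow> (\<Sum>i\<le>degree p. coeff p i * 0)) at_top"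
    by (intro tendsto_intros mono)
  then show ?thesis
    by (simp add: poly_altdef sum_distrib_right mult.assoc)
qed

definition pexp :: "real poly \<Rightarrow> real \<Rightarrow> real" where
  "pexp p t = (if t > 0 then poly p (1/t) * exp (- (1/t)) else 0)"

lemma pexp_tendsto_0: "((\<lambda>t. pexp p t) \<longlongrightarrow> 0) (at_right 0)"
proof -
  have "((\<lambda>t. poly p (inverse t) * exp (- inverse t)) \<longlongrightarrow> 0) (at_right 0)"
    by (rule filterlim_compose[OF poly_exp_decay filterlim_inverse_at_top_right])
  then show ?thesis
    by (rule Lim_transform_eventually)
      (auto simp: pexp_def eventually_at_filter inverse_eq_divide)
qed

text \<open>The factor \<open>[:0,0,1:]\<close> is 1/t^2 from the chain rule. At 0 the difference
  quotient from the right is itself of the class, with the polynomial multiplied by its variable,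
  and so tends to 0.\<close>

lemma pexp_deriv: "(pexp p has_real_derivative pexp ([:0,0,1:] * (p - pderiv p)) t) (at t)"
proof (cases "t = 0")
  case False
  show ?thesis
  proof (cases "t > 0")
    case True
    have "((\<lambda>t. poly p (1/t) * exp (- (1/t))) has_real_derivative pexp ([:0,0,1:] * (p - pderiv p)) t) (at t)"
      using True unfolding pexp_def
      by (auto intro!: derivative_eq_intros DERIV_chain2[OF poly_DERIV] simp: field_simps power2_eq_square)
    moreover have "\<forall>\<^sub>F s in nhds t. pexp p s = poly p (1/s) * exp (- (1/s))"
      using eventually_nhds_in_open[of "{0<..}" t] True by (auto elim!: eventually_mono simp: pexp_def)
    ultimately show ?thesis by (subst DERIV_cong_ev[OF refl _ refl]) auto
  next
    case f: False
    have "\<forall>\<^sub>F s in nhds t. pexp p s = 0"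
      using eventually_nhds_in_open[of "{..<0}" t] f False by (auto elim!: eventually_mono simp: pexp_def)
    with f show ?thesis by (subst DERIV_cong_ev[OF refl _ refl]) (auto simp: pexp_def)
  qed
next
  case True
  have "((\<lambda>h. (pexp p (0 + h) - pexp p 0) / h) \<longlongrightarrow> 0) (at 0)"
  proof -
    have "((\<lambda>h. pexp ([:0,1:] * p) h) \<longlongrightarrow> 0) (at_right 0)" by (rule pexp_tendsto_0)
    then have "((\<lambda>h. (pexp p (0 + h) - pexp p 0) / h) \<longlongrightarrow> 0) (at_right 0)"
      by (rule Lim_transform_eventually) (auto simp: pexp_def eventually_at_filter)
    moreover have "((\<lambda>h. (pexp p (0 + h) - pexp p 0) / h) \<longlongrightarrow> 0) (at_left 0)"
      by (rule Lim_transform_eventually[OF tendsto_const]) (auto simp: pexp_def eventually_at_filter)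
    ultimately show ?thesis by (simp add: filterlim_split_at)
  qed
  then show ?thesis using True by (simp add: DERIV_def pexp_def)
qed

lemma C_k_pexp: "C_k k (pexp p)"
proof (induction k arbitrary: p)
  case 0
  show ?case using DERIV_isCont[OF pexp_deriv] by (auto simp: continuous_at_imp_continuous_on)
next
  case (Suc k)
  show ?case by (rule C_k_real_deriv[OF pexp_deriv Suc])
qed

lemma C_k_bump: "C_k k bump"
proof -
  have "bump = pexp [:1:]" by (auto simp: bump_def pexp_def)
  then show ?thesis by (metis C_k_pexp)
qed

lemma bump_nonneg: "0 \<le> bump t" and bump_le_1: "bump t \<le> 1" and bump_pos: "0 < t \<Longrightarrow> 0 < bump t"
  and bump_zero: "t \<le> 0 \<Longrightarrow> bump t = 0"
  by (auto simp: bump_def)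

text \<open>Dilated bumps approximate the indicator of the half-line; products of them therefore
  approximate indicators of boxes by test functions.\<close>

lemma bump_tendsto: "(\<lambda>m. bump (real m * t)) \<longlonglongrightarrow> indicator {0<..} t"
proof (cases "t > 0")
  case True
  have "(\<lambda>m. exp (- (1 / t * (1 / real m)))) \<longlonglongrightarrow> exp (- (1/t * 0))"
    by (intro tendsto_intros lim_1_over_n)
  then have "(\<lambda>m. exp (- (1 / t * (1 / real m)))) \<longlonglongrightarrow> 1" by simp
  then show ?thesis
    by (rule Lim_transform_eventually[THEN tendsto_eq_rhs])
      (use True in \<open>auto simp: bump_def mult.commute intro!: eventually_sequentiallyI[of 1]\<close>)
next
  case False
  then show ?thesis by (auto simp: bump_def mult_le_0_iff zero_less_mult_iff)
qed

section \<open>Test functions\<close>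

lemma test_functionsD:
  assumes "\<psi> \<in> test_functions U"
  shows "C_k k \<psi>" "compact (closure {x. \<psi> x \<noteq> 0})" "closure {x. \<psi> x \<noteq> 0} \<subseteq> U"
    "x \<notin> U \<Longrightarrow> \<psi> x = 0"
  using assms closure_subset[of "{x. \<psi> x \<noteq> 0}"] by (auto simp: test_functions_def)

lemma test_functions_continuous: "\<psi> \<in> test_functions U \<Longrightarrow> continuous_on UNIV \<psi>"
  using test_functionsD(1) C_k_continuous by blast

lemma test_functions_borel [measurable_dest]: "\<psi> \<in> test_functions U \<Longrightarrow> \<psi> \<in> borel_measurable borel"
  using test_functions_continuous by (intro borel_measurable_continuous_onI)

lemma compact_support_I:
  fixes f :: "'a::euclidean_space \<Rightarrow> real"
  assumes "compact K" "\<And>x. f x \<noteq> 0 \<Longrightarrow> x \<in> K"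
  shows "compact (closure {x. f x \<noteq> 0}) \<and> closure {x. f x \<noteq> 0} \<subseteq> K"
proof -
  have "closure {x. f x \<noteq> 0} \<subseteq> K" using assms by (intro closure_minimal compact_imp_closed) auto
  then show ?thesis using assms(1) compact_closure bounded_subset compact_imp_bounded
    by (metis (no_types, lifting) closure_closed closure_subset compact_imp_closed bounded_closure)
qed

lemma test_functionsI:
  assumes "\<And>k. C_k k f" "compact K" "K \<subseteq> U" "\<And>x. f x \<noteq> 0 \<Longrightarrow> x \<in> K"
  shows "f \<in> test_functions U"
  using compact_support_I[OF assms(2,4)] assms by (auto simp: test_functions_def)

lemma test_functions_add: "\<psi> \<in> test_functions U \<Longrightarrow> \<phi> \<in> test_functions U \<Longrightarrow> (\<lambda>x. \<psi> x + \<phi> x) \<in> test_functions U"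
proof (rule test_functionsI[of _ "closure {x. \<psi> x \<noteq> 0} \<union> closure {x. \<phi> x \<noteq> 0}"])
  assume \<psi>: "\<psi> \<in> test_functions U" and \<phi>: "\<phi> \<in> test_functions U"
  show "C_k k (\<lambda>x. \<psi> x + \<phi> x)" for k
    by (intro C_k_add test_functionsD(1)[OF \<psi>] test_functionsD(1)[OF \<phi>])
  show "compact (closure {x. \<psi> x \<noteq> 0} \<union> closure {x. \<phi> x \<noteq> 0})"
    by (intro compact_Un test_functionsD(2)[OF \<psi>] test_functionsD(2)[OF \<phi>])
  show "closure {x. \<psi> x \<noteq> 0} \<union> closure {x. \<phi> x \<noteq> 0} \<subseteq> U"
    by (intro Un_least test_functionsD(3)[OF \<psi>] test_functionsD(3)[OF \<phi>])
  show "\<psi> x + \<phi> x \<noteq> 0 \<Longrightarrow> x \<in> closure {x. \<psi> x \<noteq> 0} \<union> closure {x. \<phi> x \<noteq> 0}" for x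
    using closure_subset[of "{x. \<psi> x \<noteq> 0}"] closure_subset[of "{x. \<phi> x \<noteq> 0}"] by (cases "\<psi> x = 0") auto
qed

lemma test_functions_mult_smooth:
  assumes \<psi>: "\<psi> \<in> test_functions U" and f: "\<And>k. C_k k f"
  shows "(\<lambda>x. f x * \<psi> x) \<in> test_functions U"
proof (rule test_functionsI[of _ "closure {x. \<psi> x \<noteq> 0}"])
  show "C_k k (\<lambda>x. f x * \<psi> x)" for k
    by (intro C_k_mult f test_functionsD(1)[OF \<psi>])
  show "f x * \<psi> x \<noteq> 0 \<Longrightarrow> x \<in> closure {x. \<psi> x \<noteq> 0}" for x
    using closure_subset[of "{x. \<psi> x \<noteq> 0}"] by auto
qed (rule test_functionsD[OF \<psi>])+

lemma test_functions_scale: "\<psi> \<in> test_functions U \<Longrightarrow> (\<lambda>x. c * \<psi> x) \<in> test_functions U"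
  by (rule test_functions_mult_smooth) (auto intro: C_k_const)

lemma test_functions_zero: "(\<lambda>x. 0) \<in> test_functions U"
  by (rule test_functionsI[of _ "{}"]) (auto intro: C_k_const)

lemma frechet_derivative_outside_support:
  assumes "x \<notin> closure {x. f x \<noteq> 0}"
  shows "frechet_derivative f (at x) = (\<lambda>v. 0)"
proof -
  have "((\<lambda>_. 0) has_derivative (\<lambda>v. 0)) (at x)" by simp
  then have "(f has_derivative (\<lambda>v. 0)) (at x)"
    by (rule has_derivative_transform_within_open[of _ _ _ _ "- closure {x. f x \<noteq> 0}"])
      (use assms closure_subset[of "{x. f x \<noteq> 0}"] in auto)
  then show ?thesis by (rule frechet_derivative_at[symmetric])
qed

lemma test_functions_deriv:
  assumes \<psi>: "\<psi> \<in> test_functions U"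
  shows "(\<lambda>x. frechet_derivative \<psi> (at x) v) \<in> test_functions U"
proof (rule test_functionsI[of _ "closure {x. \<psi> x \<noteq> 0}"])
  show "C_k k (\<lambda>x. frechet_derivative \<psi> (at x) v)" for k
    using test_functionsD(1)[OF \<psi>, of "Suc k"] by auto
  show "frechet_derivative \<psi> (at x) v \<noteq> 0 \<Longrightarrow> x \<in> closure {x. \<psi> x \<noteq> 0}" for x
    using frechet_derivative_outside_support[of x \<psi>] by metis
qed (use test_functionsD[OF \<psi>] in auto)

lemma test_functions_has_derivative:
  "\<psi> \<in> test_functions U \<Longrightarrow> (\<psi> has_derivative frechet_derivative \<psi> (at x)) (at x)"
  using test_functionsD(1)[of \<psi> U "Suc 0"] by (intro C_k_has_derivative)

lemma partial_deriv_test: "\<psi> \<in> test_functions U \<Longrightarrow> partial_deriv i \<psi> \<in> test_functions U"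
  using test_functions_deriv[of \<psi> U "axis i 1"] by (simp add: partial_deriv_def[abs_def])

lemma test_functions_bounded:
  assumes "\<psi> \<in> test_functions U"
  shows "\<exists>B. \<forall>x. \<bar>\<psi> x\<bar> \<le> B"
proof -
  have "compact (\<psi> ` closure {x. \<psi> x \<noteq> 0})"
    using continuous_on_subset[OF test_functions_continuous[OF assms]] test_functionsD(2)[OF assms]
    by (intro compact_continuous_image) auto
  then obtain B where B: "\<forall>x\<in>closure {x. \<psi> x \<noteq> 0}. \<bar>\<psi> x\<bar> \<le> B"
    by (auto dest!: compact_imp_bounded simp: bounded_iff)
  have "\<bar>\<psi> x\<bar> \<le> max B 0" for x
    using B closure_subset[of "{x. \<psi> x \<noteq> 0}"] by (cases "\<psi> x = 0") force+
  then show ?thesis by blast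
qed

lemma continuous_compact_support_integrable:
  fixes f :: "'a::euclidean_space \<Rightarrow> real"
  assumes "continuous_on UNIV f" "compact (closure {x. f x \<noteq> 0})"
  shows "integrable lborel f"
proof -
  have "set_integrable lborel (closure {x. f x \<noteq> 0}) f"
    unfolding set_integrable_def
    by (intro borel_integrable_compact assms continuous_on_subset[OF assms(1)]) auto
  moreover have "indicator (closure {x. f x \<noteq> 0}) x *\<^sub>R f x = f x" for x
    using closure_subset[of "{x. f x \<noteq> 0}"] by (auto simp: indicator_def)
  ultimately show ?thesis by (simp only: set_integrable_def)
qed

lemma test_functions_integrable: "\<psi> \<in> test_functions U \<Longrightarrow> integrable lborel \<psi>"
  using test_functions_continuous test_functionsD(2) continuous_compact_support_integrable by blast

lemma test_functions_mult_continuous: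
  assumes "\<psi> \<in> test_functions U" "continuous_on UNIV g"
  shows "integrable lborel (\<lambda>x. \<psi> x * g x)"
proof (rule continuous_compact_support_integrable)
  show "continuous_on UNIV (\<lambda>x. \<psi> x * g x)"
    using assms test_functions_continuous by (intro continuous_intros)
  show "compact (closure {x. \<psi> x * g x \<noteq> 0})"
    using compact_support_I[of "closure {x. \<psi> x \<noteq> 0}" "\<lambda>x. \<psi> x * g x"] test_functionsD(2)[OF assms(1)]
      closure_subset[of "{x. \<psi> x \<noteq> 0}"] by auto
qed

lemma borel_measurable_lebesgueI: "f \<in> borel_measurable borel \<Longrightarrow> f \<in> borel_measurable lebesgue"
  by (rule measurable_completion) simp

lemma test_functions_sq_integrable: "\<psi> \<in> test_functions U \<Longrightarrow> sq_integrable \<psi>"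
proof -
  assume \<psi>: "\<psi> \<in> test_functions U"
  have [measurable]: "\<psi> \<in> borel_measurable borel" by (rule test_functions_borel[OF \<psi>])
  have "integrable lborel (\<lambda>x. \<psi> x * \<psi> x)"
    by (rule test_functions_mult_continuous[OF \<psi> test_functions_continuous[OF \<psi>]])
  then have "integrable lebesgue (\<lambda>x. \<psi> x * \<psi> x)"
    by (subst integrable_completion) measurable
  moreover have "\<psi> \<in> borel_measurable lebesgue" by (rule borel_measurable_lebesgueI) measurable
  ultimately show ?thesis by (simp only: sq_integrable_def power2_eq_square simp_thms)
qed

lemma test_in_L2_space: 
  assumes "\<psi> \<in> test_functions U" shows "abs_l2 \<psi> \<in> L2_space U"
  using rep_abs_l2[OF test_functions_sq_integrable[OF assms]] test_functionsD(4)[OF assms]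
  unfolding L2_space_def by (auto elim: AE_mp)

text \<open>The product of one-dimensional bumps below is positive exactly on \<open>box a b\<close>.\<close>

definition boxbump :: "nat \<Rightarrow> 'a::euclidean_space \<Rightarrow> 'a \<Rightarrow> 'a \<Rightarrow> real" where
  "boxbump m a b x = (\<Prod>i\<in>Basis. bump (real m * ((x - a) \<bullet> i)) * bump (real m * ((b - x) \<bullet> i)))"

lemma boxbump_bounds: "0 \<le> boxbump m a b x" "boxbump m a b x \<le> 1"
  unfolding boxbump_def
  by (auto intro!: prod_nonneg prod_le_1 mult_nonneg_nonneg bump_nonneg mult_le_one bump_le_1)

lemma boxbump_outside: "x \<notin> box a b \<Longrightarrow> boxbump m a b x = 0"
proof -
  assume "x \<notin> box a b"
  then obtain i where i: "i \<in> Basis" "(x - a) \<bullet> i \<le> 0 \<or> (b - x) \<bullet> i \<le> 0"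
    by (auto simp: mem_box inner_diff_left not_less)
  then have "bump (real m * ((x - a) \<bullet> i)) * bump (real m * ((b - x) \<bullet> i)) = 0"
    by (auto simp: bump_zero mult_nonneg_nonpos)
  then show ?thesis unfolding boxbump_def using i(1) by (intro prod_zero) auto
qed

lemma boxbump_tendsto: "(\<lambda>m. boxbump m a b x) \<longlonglongrightarrow> indicator (box a b) x"
proof -
  have "(\<lambda>m. boxbump m a b x) \<longlonglongrightarrow> (\<Prod>i\<in>Basis. indicator {0<..} ((x - a) \<bullet> i) * indicator {0<..} ((b - x) \<bullet> i))"
    unfolding boxbump_def by (intro tendsto_intros bump_tendsto)
  also have "(\<Prod>i\<in>Basis. indicator {0<..} ((x - a) \<bullet> i) * indicator {0<..} ((b - x) \<bullet> i)) = (indicator (box a b) x :: real)"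
  proof (cases "x \<in> box a b")
    case True
    then show ?thesis by (auto simp: mem_box inner_diff_left intro!: prod.neutral)
  next
    case False
    then have "\<exists>i\<in>Basis. indicator {0<..} ((x - a) \<bullet> i) * indicator {0<..} ((b - x) \<bullet> i) = (0::real)"
      by (auto simp: mem_box inner_diff_left indicator_def)
    with False show ?thesis by simp
  qed
  finally show ?thesis .
qed

lemma boxbump_test:
  assumes "cbox a b \<subseteq> U"
  shows "boxbump m a b \<in> test_functions U"
proof (rule test_functionsI[of _ "cbox a b"])
  show "C_k k (boxbump m a b)" for k
  proof -
    have lin: "C_k k (\<lambda>x. real m * (x \<bullet> i) + c)" for i :: 'a and c
      by (intro C_k_add C_k_const C_k_linear bounded_linear_const_mult bounded_linear_inner_left)
    have lin2: "C_k k (\<lambda>x. real m * ((x - a) \<bullet> i))" for i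
      using lin[of i "- real m * (a \<bullet> i)"] by (simp add: inner_diff_left algebra_simps)
    have lin3: "C_k k (\<lambda>x. real m * ((b - x) \<bullet> i))" for i
      using C_k_add[OF C_k_const[of k "real m * (b \<bullet> i)"] C_k_mult[OF C_k_const[of k "-1"] lin[of i 0]]]
      by (simp add: inner_diff_left algebra_simps)
    show ?thesis
      unfolding boxbump_def[abs_def]
      by (intro C_k_prod C_k_mult C_k_compose[OF C_k_bump] lin2 lin3) simp
  qed
  show "boxbump m a b x \<noteq> 0 \<Longrightarrow> x \<in> cbox a b" for x
    using boxbump_outside[of x a b m] box_subset_cbox by blast
qed (use assms in auto)

section \<open>The fundamental lemma of the calculus of variations\<close>

lemma Int_stable_boxes: "Int_stable (range (\<lambda>(a, b). box a b :: 'a::euclidean_space set))"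
  by (auto simp: Int_stable_def box_Int_box)

text \<open>Integrals over boxes are limits of integrals against test functions, hence zero. Boxes
  are stable under intersection and generate the Borel sets, so all Borel subsets of a box inside
  \<open>U\<close> give integral zero and the function vanishes there; countably many boxes cover
  \<open>U\<close>.\<close>

lemma fundamental_lemma:
  fixes f :: "'a::euclidean_space \<Rightarrow> real"
  assumes U: "open U" and f: "sq_integrable f"
    and z: "\<And>\<psi>. \<psi> \<in> test_functions U \<Longrightarrow> (LINT x|lebesgue. f x * \<psi> x) = 0"
  shows "AE x in lebesgue. x \<in> U \<longrightarrow> f x = 0"
proof -
  \<comment> \<open>Boxes generate only the Borel sets, so the argument runs on a Borel
    representative.\<close>
  obtain g where g: "g \<in> borel_measurable lborel" "AE x in lborel. f x = g x"
    using completion_ex_borel_measurable_real[of f lborel] f by (auto simp: sq_integrable_def)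
  note [measurable] = g(1)
  have gf: "AE x in lebesgue. f x = g x" using g(2) by (rule AE_completion)
  have sg: "sq_integrable g"
    by (rule sq_integrable_cong_AE[OF f _ gf]) (use g(1) in \<open>simp add: borel_measurable_lebesgueI\<close>)
  have sgl: "integrable lborel (\<lambda>x. (g x)\<^sup>2)"
    using sg by (simp add: sq_integrable_def integrable_completion)
  have zg: "(LINT x|lborel. g x * \<psi> x) = 0" if \<psi>: "\<psi> \<in> test_functions U" for \<psi>
  proof -
    note [measurable] = test_functions_borel[OF \<psi>]
    have "(LINT x|lborel. g x * \<psi> x) = (LINT x|lebesgue. g x * \<psi> x)"
      by (rule integral_completion[symmetric]) measurable
    also have "\<dots> = (LINT x|lebesgue. f x * \<psi> x)"
    proof (rule integral_cong_AE)
      have "\<psi> \<in> borel_measurable lebesgue" by (intro borel_measurable_lebesgueI) measurable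
      then show "(\<lambda>x. g x * \<psi> x) \<in> borel_measurable lebesgue" "(\<lambda>x. f x * \<psi> x) \<in> borel_measurable lebesgue"
        using f sg by (auto simp: sq_integrable_def intro!: borel_measurable_times)
    qed (use gf in auto)
    also have "\<dots> = 0" by (rule z[OF \<psi>])
    finally show ?thesis .
  qed
  have int: "integrable lborel (\<lambda>x. g x * indicator A x)" if A: "A \<in> sets borel" "bounded A" for A
  proof -
    obtain c d where cd: "A \<subseteq> cbox c d" using bounded_subset_cbox_symmetric[OF A(2)] by blast
    show ?thesis
    proof (rule Bochner_Integration.integrable_bound)
      show "integrable lborel (\<lambda>x. (g x)\<^sup>2 + indicator (cbox c d) x)"
        by (intro Bochner_Integration.integrable_add sgl integrable_real_indicator emeasure_lborel_cbox_finite) simp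
      have "\<bar>g x\<bar> \<le> (g x)\<^sup>2 + 1" for x
        using sum_squares_bound[of "\<bar>g x\<bar>" 1] by (simp add: abs_le_iff) (smt (verit) zero_le_power2)
      then show "AE x in lborel. norm (g x * indicator A x) \<le> norm ((g x)\<^sup>2 + indicat_real (cbox c d) x)"
        using cd by (intro AE_I2) (auto simp: indicator_def)
    qed (use A in measurable)
  qed
  have box0: "(LINT x|lborel. g x * indicator (box a b) x) = 0" if ab: "cbox a b \<subseteq> U" for a b
  proof -
    have "(\<lambda>m. LINT x|lborel. g x * boxbump m a b x) \<longlonglongrightarrow> (LINT x|lborel. g x * indicator (box a b) x)"
    proof (rule integral_dominated_convergence[where w="\<lambda>x. \<bar>g x * indicator (box a b) x\<bar>"])
      show "(\<lambda>x. g x * boxbump m a b x) \<in> borel_measurable lborel" for m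
        using test_functions_borel[OF boxbump_test[OF ab]] by measurable
      show "AE x in lborel. (\<lambda>m. g x * boxbump m a b x) \<longlonglongrightarrow> g x * indicator (box a b) x"
        by (intro AE_I2 tendsto_intros boxbump_tendsto)
      show "AE x in lborel. norm (g x * boxbump m a b x) \<le> \<bar>g x * indicator (box a b) x\<bar>" for m
        using boxbump_bounds[of m a b] boxbump_outside[of _ a b m]
        by (intro AE_I2) (auto simp: abs_mult indicator_def mult_left_le)
      show "integrable lborel (\<lambda>x. \<bar>g x * indicator (box a b) x\<bar>)"
        by (intro integrable_abs int) auto
    qed measurable
    moreover have "(LINT x|lborel. g x * boxbump m a b x) = 0" for m
      by (rule zg[OF boxbump_test[OF ab]])
    ultimately show ?thesis by (simp add: LIMSEQ_const_iff)
  qed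
  have zero_box: "AE x in lborel. x \<in> box a b \<longrightarrow> g x = 0" if ab: "cbox a b \<subseteq> U" for a b
  proof -
    have "AE x in lborel. g x * indicator (box a b) x = 0"
    proof (rule density_unique_real)
      show "integrable lborel (\<lambda>x. g x * indicator (box a b) x)" by (intro int) auto
      fix A :: "'a set" assume "A \<in> sets lborel"
      then have A: "A \<in> sigma_sets UNIV (range (\<lambda>(c,d). box c d))"
        by (simp add: borel_eq_box)
      \<comment> \<open>Cutting a generator down to the fixed box keeps the closed box inside
        \<open>U\<close>, so \<open>box0\<close> settles every generator.\<close>
      have inters: "\<exists>c' d'. box c d \<inter> box a b = box c' d' \<and> cbox c' d' \<subseteq> U" for c d
      proof -
        let ?c = "\<Sum>i\<in>Basis. max (c \<bullet> i) (a \<bullet> i) *\<^sub>R i" and ?d = "\<Sum>i\<in>Basis. min (d \<bullet> i) (b \<bullet> i) *\<^sub>R i"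
        have "box c d \<inter> box a b = box ?c ?d" by (rule box_Int_box)
        moreover have "cbox ?c ?d \<subseteq> cbox a b" by (auto simp: mem_box)
        ultimately show ?thesis using ab by blast
      qed
      let ?I = "\<lambda>A. LINT x:A|lborel. g x * indicator (box a b) x"
      have si: "set_integrable lborel A (\<lambda>x. g x * indicator (box a b) x)" if "A \<in> sets lborel" for A
        unfolding set_integrable_def using that by (intro integrable_mult_indicator int) auto
      have "?I A = 0"
        using Int_stable_boxes top_greatest[of "range (\<lambda>(c,d). box c d)", folded Pow_UNIV] A
      proof (induction rule: sigma_sets_induct_disjoint)
        case (basic A)
        then obtain c d where [simp]: "A = box c d" by auto
        obtain c' d' where cd: "box c d \<inter> box a b = box c' d'" "cbox c' d' \<subseteq> U" using inters by blast
        have "?I A = (LINT x|lborel. g x * indicator (box c' d') x)"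
          unfolding set_lebesgue_integral_def cd(1)[symmetric]
          by (intro Bochner_Integration.integral_cong) (auto simp: indicator_def)
        then show ?case using box0[OF cd(2)] by simp
      next
        case (compl A)
        then have "A \<in> sets lborel" by (simp add: borel_eq_box)
        have "?I UNIV = ?I (A \<union> (UNIV - A))" by simp
        also have "\<dots> = ?I A + ?I (UNIV - A)"
          by (rule set_integral_Un) (use \<open>A \<in> sets lborel\<close> in \<open>auto intro!: si\<close>)
        finally have "?I (UNIV - A) = ?I UNIV" using compl by simp
        also have "\<dots> = 0" using box0[OF ab] by (simp add: set_lebesgue_integral_def)
        finally show ?case .
      next
        case (union A)
        then have mA: "A i \<in> sets lborel" for i by (simp add: borel_eq_box range_subsetD)
        have "?I (\<Union>i. A i) = (\<Sum>i. ?I (A i))"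
          by (rule lebesgue_integral_countable_add[of A lborel])
            (use mA union(1) in \<open>auto intro!: si simp: disjoint_family_on_def\<close>)
        with union show ?case by simp
      qed (auto simp: set_lebesgue_integral_def)
      then show "?I A = (LINT x:A|lborel. 0)" by (simp add: set_lebesgue_integral_def)
    qed simp
    then show ?thesis by eventually_elim (auto simp: indicator_def split: if_splits)
  qed
  obtain D where D: "countable D" "D \<subseteq> Pow U" "\<And>X. X \<in> D \<Longrightarrow> \<exists>a b. X = cbox a b" "\<Union>D = U"
    using open_countable_Union_open_cbox[OF U] by metis
  have "AE x in lebesgue. x \<in> X \<longrightarrow> f x = 0" if XD: "X \<in> D" for X
  proof -
    obtain a b where X: "X = cbox a b" using D(3)[OF XD] by blast
    then have "cbox a b \<subseteq> U" using D(2) XD by blast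
    then have "AE x in lebesgue. x \<in> box a b \<longrightarrow> g x = 0" by (intro AE_completion zero_box)
    \<comment> \<open>The cover uses closed boxes while vanishing is known on open ones; the faces
      are null.\<close>
    moreover have "AE x in lebesgue. x \<notin> cbox a b - box a b"
      using negligible_frontier_interval[of a b] by (intro AE_not_in) (simp add: negligible_iff_null_sets)
    ultimately show ?thesis using gf by eventually_elim (auto simp: X)
  qed
  then have "AE x in lebesgue. \<forall>X\<in>D. x \<in> X \<longrightarrow> f x = 0"
    using D(1) by (subst AE_ball_countable) auto
  then show ?thesis by eventually_elim (use D(4) in blast)
qed

section \<open>Translations of test functions\<close>

lemma integral_lborel_translate:
  fixes h :: "'a::euclidean_space \<Rightarrow> real"
  assumes "h \<in> borel_measurable borel"
  shows "(LINT x|lborel. h (x + v)) = (LINT x|lborel. h x)"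
proof -
  have "(LINT x|lborel. h x) = (LINT x|distr lborel borel ((+) v). h x)"
    by (simp add: lborel_distr_plus)
  also have "\<dots> = (LINT x|lborel. h (v + x))"
    using assms by (intro integral_distr) auto
  finally show ?thesis by (simp add: add.commute)
qed

lemma integrable_lborel_translate:
  fixes h :: "'a::euclidean_space \<Rightarrow> real"
  assumes "integrable lborel h"
  shows "integrable lborel (\<lambda>x. h (x + v))"
proof -
  have "integrable (distr lborel borel ((+) v)) h"
    using assms by (simp add: lborel_distr_plus)
  then have "integrable lborel (\<lambda>x. h (v + x))"
    by (subst (asm) integrable_distr_eq) (use assms in auto)
  then show ?thesis by (simp add: add.commute)
qed

lemma nn_integral_lborel_translate:
  fixes h :: "'a::euclidean_space \<Rightarrow> ennreal"
  assumes [measurable]: "h \<in> borel_measurable borel"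
  shows "(\<integral>\<^sup>+x. h (x + v) \<partial>lborel) = (\<integral>\<^sup>+x. h x \<partial>lborel)"
proof -
  have "(\<integral>\<^sup>+x. h x \<partial>lborel) = (\<integral>\<^sup>+x. h x \<partial>distr lborel borel ((+) v))"
    by (simp add: lborel_distr_plus)
  also have "\<dots> = (\<integral>\<^sup>+x. h (v + x) \<partial>lborel)"
    by (intro nn_integral_distr) auto
  finally show ?thesis by (simp add: add.commute)
qed

lemma test_functions_translate_FTC:
  assumes \<psi>: "\<psi> \<in> test_functions U"
  shows "(LINT t|lborel. frechet_derivative \<psi> (at (x + t *\<^sub>R v)) v * indicator {0..1} t) = \<psi> (x + v) - \<psi> x"
proof -
  have "(LINT t|lborel. frechet_derivative \<psi> (at (x + t *\<^sub>R v)) v * indicator {0..1} t)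
      = \<psi> (x + 1 *\<^sub>R v) - \<psi> (x + 0 *\<^sub>R v)"
  proof (rule integral_FTC_Icc_real)
    fix t :: real
    have "((\<lambda>t. \<psi> (x + t *\<^sub>R v)) has_derivative (\<lambda>s. frechet_derivative \<psi> (at (x + t *\<^sub>R v)) (s *\<^sub>R v))) (at t)"
      by (rule has_derivative_compose[OF _ test_functions_has_derivative[OF \<psi>]])
        (auto intro!: derivative_eq_intros)
    moreover have "frechet_derivative \<psi> (at (x + t *\<^sub>R v)) (s *\<^sub>R v) = frechet_derivative \<psi> (at (x + t *\<^sub>R v)) v * s" for s
      using linear_scale[OF has_derivative_linear[OF test_functions_has_derivative[OF \<psi>]]] by simp
    ultimately show "((\<lambda>t. \<psi> (x + t *\<^sub>R v)) has_real_derivative frechet_derivative \<psi> (at (x + t *\<^sub>R v)) v) (at t)"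
      by (simp add: has_field_derivative_def)
    have c: "continuous_on UNIV (\<lambda>y. frechet_derivative \<psi> (at y) v)"
      by (rule test_functions_continuous[OF test_functions_deriv[OF \<psi>]])
    have "continuous_on UNIV (\<lambda>t. frechet_derivative \<psi> (at (x + t *\<^sub>R v)) v)"
      by (rule continuous_on_compose2[OF c]) (auto intro!: continuous_intros)
    then show "isCont (\<lambda>t. frechet_derivative \<psi> (at (x + t *\<^sub>R v)) v) t"
      by (simp add: continuous_on_eq_continuous_at)
  qed simp
  then show ?thesis by simp
qed

text \<open>By Fubini and translation invariance the integral of the derivative equals that of its
  mean over the segments from \<open>x\<close> to \<open>x + v\<close>. That mean is
  \<open>\<psi> (x + v) - \<psi> x\<close>, whose integral vanishes by translation invariance
  again.\<close>

lemma integral_test_deriv_zero: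
  fixes \<psi> :: "'a::euclidean_space \<Rightarrow> real"
  assumes \<psi>: "\<psi> \<in> test_functions U"
  shows "(LINT x|lborel. frechet_derivative \<psi> (at x) v) = 0"
proof -
  define h where "h x = frechet_derivative \<psi> (at x) v" for x
  have ht: "h \<in> test_functions U" using test_functions_deriv[OF \<psi>] by (simp add: h_def[abs_def])
  note [measurable] = test_functions_borel[OF ht] test_functions_borel[OF \<psi>]
  have hi: "integrable lborel h" by (rule test_functions_integrable[OF ht])
  have pm: "(\<lambda>(t, x). h (x + t *\<^sub>R v) * indicator {0..1} t) \<in> borel_measurable (lborel \<Otimes>\<^sub>M lborel)"
    by measurable
  have P: "integrable (lborel \<Otimes>\<^sub>M lborel) (\<lambda>(t, x). h (x + t *\<^sub>R v) * indicator {0..1::real} t)"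
  proof (rule lborel_pair.Fubini_integrable[OF pm])
    have "(LINT x|lborel. norm (case (t, x) of (t, x) \<Rightarrow> h (x + t *\<^sub>R v) * indicator {0..1} t)) =
        indicator {0..1} t *\<^sub>R (LINT x|lborel. \<bar>h x\<bar>)" for t :: real
      using integral_lborel_translate[of "\<lambda>x. \<bar>h x\<bar>" "t *\<^sub>R v"] by (auto simp: indicator_def)
    then show "integrable lborel (\<lambda>t. LINT x|lborel. norm (case (t, x) of (t, x) \<Rightarrow> h (x + t *\<^sub>R v) * indicator {0..1} t))"
      by (simp only:) (intro integrable_scaleR_left integrable_real_indicator, auto)
    show "AE t in lborel. integrable lborel (\<lambda>x. case (t, x) of (t, x) \<Rightarrow> h (x + t *\<^sub>R v) * indicator {0..1} t)"
      using integrable_lborel_translate[OF hi] by (auto simp: indicator_def)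
  qed
  have "(LINT t|lborel. LINT x|lborel. h (x + t *\<^sub>R v) * indicator {0..1} t) =
     (LINT x|lborel. LINT t|lborel. h (x + t *\<^sub>R v) * indicator {0..1} t)"
    using lborel_pair.Fubini_integral[OF P] by simp
  moreover have "(LINT t|lborel. LINT x|lborel. h (x + t *\<^sub>R v) * indicator {0..1} t) = (LINT x|lborel. h x)"
    by (simp add: integral_lborel_translate)
  moreover have "(LINT x|lborel. LINT t|lborel. h (x + t *\<^sub>R v) * indicator {0..1} t) = (LINT x|lborel. \<psi> (x + v) - \<psi> x)"
    unfolding h_def by (simp add: test_functions_translate_FTC[OF \<psi>])
  moreover have "(LINT x|lborel. \<psi> (x + v) - \<psi> x) = 0"
    using test_functions_integrable[OF \<psi>] integrable_lborel_translate
    by (subst Bochner_Integration.integral_diff) (auto simp: integral_lborel_translate)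
  ultimately show ?thesis by (simp add: h_def)
qed

text \<open>Expands the nonnegative integral of the squared deviation of \<open>g\<close> from its
  mean.\<close>

lemma unit_interval_jensen:
  fixes g :: "real \<Rightarrow> real"
  assumes "continuous_on UNIV g"
  shows "ennreal ((LINT t|lborel. g t * indicator {0..1} t)\<^sup>2) \<le> (\<integral>\<^sup>+t. ennreal ((g t)\<^sup>2 * indicator {0..1} t) \<partial>lborel)"
proof -
  have int: "integrable lborel (\<lambda>t. f t * indicator {0..1} t)" if "continuous_on UNIV f" for f :: "real \<Rightarrow> real"
    using borel_integrable_compact[of "{0..1}" f] continuous_on_subset[OF that] by (simp add: mult.commute)
  define m where "m = (LINT t|lborel. g t * indicator {0..1} t)"
  have i1: "integrable lborel (\<lambda>t. g t * indicator {0..1} t)" by (rule int[OF assms])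
  have i2: "integrable lborel (\<lambda>t. (g t)\<^sup>2 * indicator {0..1} t)"
    by (rule int) (intro continuous_intros assms)
  have i3: "integrable lborel (\<lambda>t. indicator {0..1::real} t :: real)" by (intro integrable_real_indicator) auto
  have "0 \<le> (LINT t|lborel. (g t - m)\<^sup>2 * indicator {0..1} t)" by (intro integral_nonneg_AE) auto
  also have "\<dots> = (LINT t|lborel. (g t)\<^sup>2 * indicator {0..1} t - 2 * m * (g t * indicator {0..1} t) + m\<^sup>2 * indicator {0..1} t)"
    by (intro Bochner_Integration.integral_cong) (auto simp: power2_diff algebra_simps)
  also have "\<dots> = (LINT t|lborel. (g t)\<^sup>2 * indicator {0..1} t) - 2 * m * m + m\<^sup>2"
    using i1 i2 i3 by (subst Bochner_Integration.integral_add, simp, simp,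
      subst Bochner_Integration.integral_diff) (auto simp: m_def[symmetric])
  finally have "m\<^sup>2 \<le> (LINT t|lborel. (g t)\<^sup>2 * indicator {0..1} t)" by (simp add: power2_eq_square)
  then have "ennreal (m\<^sup>2) \<le> ennreal (LINT t|lborel. (g t)\<^sup>2 * indicator {0..1} t)" by (rule ennreal_leI)
  also have "\<dots> = (\<integral>\<^sup>+t. ennreal ((g t)\<^sup>2 * indicator {0..1} t) \<partial>lborel)"
    using i2 by (intro nn_integral_eq_integral[symmetric]) auto
  finally show ?thesis by (simp add: m_def)
qed

text \<open>The increment is the mean of the directional derivative along a segment; Jensen, Tonelli
  and translation invariance remove the segment parameter.\<close>

lemma test_functions_translate_bound:
  fixes \<psi> :: "'a::euclidean_space \<Rightarrow> real"
  assumes \<psi>: "\<psi> \<in> test_functions U"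
  shows "(\<integral>\<^sup>+x. ennreal ((\<psi> (x + v) - \<psi> x)\<^sup>2) \<partial>lborel) \<le> (\<integral>\<^sup>+x. ennreal ((frechet_derivative \<psi> (at x) v)\<^sup>2) \<partial>lborel)"
proof -
  define h where "h x = frechet_derivative \<psi> (at x) v" for x
  have ht: "h \<in> test_functions U" using test_functions_deriv[OF \<psi>] by (simp add: h_def[abs_def])
  note [measurable] = test_functions_borel[OF ht] test_functions_borel[OF \<psi>]
  have hc: "continuous_on UNIV (\<lambda>t. h (x + t *\<^sub>R v))" for x
    by (rule continuous_on_compose2[OF test_functions_continuous[OF ht]]) (auto intro!: continuous_intros)
  have "(\<integral>\<^sup>+x. ennreal ((\<psi> (x + v) - \<psi> x)\<^sup>2) \<partial>lborel)
     \<le> (\<integral>\<^sup>+x. (\<integral>\<^sup>+t. ennreal ((h (x + t *\<^sub>R v))\<^sup>2 * indicator {0..1} t) \<partial>lborel) \<partial>lborel)"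
  proof (rule nn_integral_mono)
    fix x
    show "ennreal ((\<psi> (x + v) - \<psi> x)\<^sup>2) \<le> (\<integral>\<^sup>+t. ennreal ((h (x + t *\<^sub>R v))\<^sup>2 * indicator {0..1} t) \<partial>lborel)"
      using unit_interval_jensen[OF hc[of x]] test_functions_translate_FTC[OF \<psi>, of x v] by (simp add: h_def)
  qed
  also have "\<dots> = (\<integral>\<^sup>+t. (\<integral>\<^sup>+x. ennreal ((h (x + t *\<^sub>R v))\<^sup>2 * indicator {0..1} t) \<partial>lborel) \<partial>lborel)"
    by (rule lborel_pair.Fubini') measurable
  also have "\<dots> = (\<integral>\<^sup>+t. (\<integral>\<^sup>+x. ennreal ((h x)\<^sup>2) \<partial>lborel) * indicator {0..1::real} t \<partial>lborel)"
  proof (rule nn_integral_cong)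
    fix t :: real
    show "(\<integral>\<^sup>+x. ennreal ((h (x + t *\<^sub>R v))\<^sup>2 * indicator {0..1} t) \<partial>lborel) = (\<integral>\<^sup>+x. ennreal ((h x)\<^sup>2) \<partial>lborel) * indicator {0..1} t"
      using nn_integral_lborel_translate[of "\<lambda>x. ennreal ((h x)\<^sup>2)" "t *\<^sub>R v"] by (auto simp: indicator_def)
  qed
  also have "\<dots> = (\<integral>\<^sup>+x. ennreal ((h x)\<^sup>2) \<partial>lborel)"
    by (simp add: nn_integral_cmult_indicator)
  finally show ?thesis by (simp add: h_def)
qed

section \<open>Sobolev spaces\<close>

lemma frechet_derivative_test_sum:
  fixes \<psi> :: "real^'n \<Rightarrow> real"
  assumes \<psi>: "\<psi> \<in> test_functions U"
  shows "frechet_derivative \<psi> (at x) v = (\<Sum>i\<in>UNIV. v $ i * partial_deriv i \<psi> x)"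
proof -
  have l: "linear (frechet_derivative \<psi> (at x))"
    by (rule has_derivative_linear[OF test_functions_has_derivative[OF \<psi>]])
  have "frechet_derivative \<psi> (at x) v = frechet_derivative \<psi> (at x) (\<Sum>i\<in>UNIV. v $ i *s axis i 1)"
    by (simp add: basis_expansion)
  also have "\<dots> = (\<Sum>i\<in>UNIV. v $ i * partial_deriv i \<psi> x)"
    unfolding linear_sum[OF l] scalar_mult_eq_scaleR linear_scale[OF l] by (simp add: partial_deriv_def)
  finally show ?thesis .
qed

lemma frechet_derivative_test_sq:
  fixes \<psi> :: "real^'n \<Rightarrow> real"
  assumes \<psi>: "\<psi> \<in> test_functions U"
  shows "(frechet_derivative \<psi> (at x) v)\<^sup>2 \<le> (norm v)\<^sup>2 * (\<Sum>i\<in>UNIV. (partial_deriv i \<psi> x)\<^sup>2)"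
proof -
  define g where "g = (\<chi> i. partial_deriv i \<psi> x)"
  have "frechet_derivative \<psi> (at x) v = v \<bullet> g"
    by (simp add: frechet_derivative_test_sum[OF \<psi>] g_def inner_vec_def)
  then have "(frechet_derivative \<psi> (at x) v)\<^sup>2 \<le> (v \<bullet> v) * (g \<bullet> g)"
    by (simp add: Cauchy_Schwarz_ineq)
  also have "g \<bullet> g = (\<Sum>i\<in>UNIV. (partial_deriv i \<psi> x)\<^sup>2)"
    by (simp add: g_def inner_vec_def power2_eq_square)
  finally show ?thesis by (simp add: power2_norm_eq_inner)
qed

lemma partial_deriv_mult:
  assumes \<psi>: "\<psi> \<in> test_functions U" and \<phi>: "\<phi> \<in> test_functions V"
  shows "partial_deriv i (\<lambda>x. \<psi> x * \<phi> x) x = \<psi> x * partial_deriv i \<phi> x + partial_deriv i \<psi> x * \<phi> x"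
  using frechet_derivative_at[OF has_derivative_mult[OF test_functions_has_derivative[OF \<psi>] test_functions_has_derivative[OF \<phi>]], symmetric]
  by (simp add: partial_deriv_def)

lemma integral_lebesgue_lborel:
  fixes f :: "'a::euclidean_space \<Rightarrow> real"
  shows "f \<in> borel_measurable borel \<Longrightarrow> (LINT x|lebesgue. f x) = (LINT x|lborel. f x)"
  by (rule integral_completion) simp

text \<open>The derivative of the product of the two test functions has integral zero.\<close>

lemma test_integration_by_parts:
  assumes \<psi>: "\<psi> \<in> test_functions U" and \<phi>: "\<phi> \<in> test_functions V"
  shows "abs_l2 \<psi> \<bullet> abs_l2 (partial_deriv i \<phi>) = - (abs_l2 (partial_deriv i \<psi>) \<bullet> abs_l2 \<phi>)"
proof -
  note [measurable] = test_functions_borel[OF \<psi>] test_functions_borel[OF \<phi>]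
    test_functions_borel[OF partial_deriv_test[OF \<psi>]] test_functions_borel[OF partial_deriv_test[OF \<phi>]]
  have "(\<lambda>x. \<phi> x * \<psi> x) \<in> test_functions U"
    by (rule test_functions_mult_smooth[OF \<psi> test_functionsD(1)[OF \<phi>]])
  then have "(LINT x|lborel. partial_deriv i (\<lambda>x. \<phi> x * \<psi> x) x) = 0"
    unfolding partial_deriv_def by (rule integral_test_deriv_zero)
  then have "(LINT x|lborel. \<phi> x * partial_deriv i \<psi> x + partial_deriv i \<phi> x * \<psi> x) = 0"
    by (simp add: partial_deriv_mult[OF \<phi> \<psi>])
  also have "(LINT x|lborel. \<phi> x * partial_deriv i \<psi> x + partial_deriv i \<phi> x * \<psi> x) =
     (LINT x|lborel. \<phi> x * partial_deriv i \<psi> x) + (LINT x|lborel. partial_deriv i \<phi> x * \<psi> x)"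
    by (intro Bochner_Integration.integral_add test_functions_mult_continuous[OF \<phi>]
      test_functions_mult_continuous[OF partial_deriv_test[OF \<phi>]] test_functions_continuous[OF \<psi>]
      test_functions_continuous[OF partial_deriv_test[OF \<psi>]])
  finally show ?thesis
    using \<psi> \<phi>
    by (simp add: inner_abs_l2 test_functions_sq_integrable[OF \<psi>] test_functions_sq_integrable[OF \<phi>]
      test_functions_sq_integrable[OF partial_deriv_test[OF \<psi>]] test_functions_sq_integrable[OF partial_deriv_test[OF \<phi>]]
      integral_lebesgue_lborel mult.commute)
qed

section \<open>Weak gradients and limits of test functions\<close>

locale open_domain =
  fixes \<Omega> :: "(real^'n::finite) set"
  assumes open_\<Omega>: "open \<Omega>"
begin

lemma sets_\<Omega> [measurable, simp]: "\<Omega> \<in> sets lebesgue"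
  using open_\<Omega> by (auto intro: borel_open)

text \<open>Test functions and their derivatives vanish outside the domain, so the integrals are
  inner products in the whole-space L^2. Limits in \<open>u\<close> and \<open>p\<close> then reduce
  to continuity of the inner product.\<close>

lemma weak_partial_iff:
  "weak_partial \<Omega> i u p \<longleftrightarrow> p \<in> L2_space \<Omega> \<and>
    (\<forall>\<psi>\<in>test_functions \<Omega>. u \<bullet> abs_l2 (partial_deriv i \<psi>) = - (p \<bullet> abs_l2 \<psi>))"
proof -
  have *: "(LINT x|lebesgue_on \<Omega>. rep_l2 w x * \<phi> x) = w \<bullet> abs_l2 \<phi>" if \<phi>: "\<phi> \<in> test_functions \<Omega>" for w \<phi>
  proof -
    have "(LINT x|lebesgue_on \<Omega>. rep_l2 w x * \<phi> x) = (LINT x:\<Omega>|lebesgue. rep_l2 w x * \<phi> x)"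
      by (subst integral_restrict_space) (auto simp: set_lebesgue_integral_def)
    also have "\<dots> = (LINT x|lebesgue. rep_l2 w x * \<phi> x)"
      unfolding set_lebesgue_integral_def
      by (intro Bochner_Integration.integral_cong) (auto simp: indicator_def test_functionsD(4)[OF \<phi>])
    finally show ?thesis by (simp add: inner_abs_right test_functions_sq_integrable[OF \<phi>])
  qed
  show ?thesis unfolding weak_partial_def by (auto simp: * partial_deriv_test)
qed

text \<open>Density of test functions in dual form: it yields uniqueness of weak derivatives and,
  later, completeness of the eigenfunctions in all of L^2.\<close>

lemma orthogonal_test_zero:
  assumes p: "p \<in> L2_space \<Omega>" and z: "\<And>\<psi>. \<psi> \<in> test_functions \<Omega> \<Longrightarrow> p \<bullet> abs_l2 \<psi> = 0"
  shows "p = 0"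
proof (rule l2_eqI)
  have "AE x in lebesgue. x \<in> \<Omega> \<longrightarrow> rep_l2 p x = 0"
    by (rule fundamental_lemma[OF open_\<Omega> sq_integrable_rep])
      (use z inner_abs_right[OF test_functions_sq_integrable] in metis)
  moreover have "AE x in lebesgue. x \<notin> \<Omega> \<longrightarrow> rep_l2 p x = 0" using p by (simp add: L2_space_def)
  ultimately show "AE x in lebesgue. rep_l2 p x = rep_l2 0 x" using rep_zero by eventually_elim auto
qed

lemma L2_sub: "subspace (L2_space \<Omega>)" by (rule L2_space_subspace) simp
lemma L2_closed: "closed (L2_space \<Omega>)" by (rule L2_space_closed) simp

lemma weak_partial_unique:
  assumes "weak_partial \<Omega> i u p" "weak_partial \<Omega> i u q" shows "p = q"
proof -
  have "p - q = 0"
    by (rule orthogonal_test_zero) (use assms L2_sub in \<open>auto simp: weak_partial_iff subspace_diff inner_diff_left\<close>)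
  then show ?thesis by simp
qed

lemma grad_eq: "weak_partial \<Omega> i u p \<Longrightarrow> grad \<Omega> u $ i = p"
  unfolding grad_def using weak_partial_unique by (auto intro!: the_equality)

lemma grad_eqI: "(\<And>i. weak_partial \<Omega> i u (p $ i)) \<Longrightarrow> grad \<Omega> u = p"
  by (simp add: vec_eq_iff grad_eq)

lemma weak_partial_grad: "u \<in> H1 \<Omega> \<Longrightarrow> weak_partial \<Omega> i u (grad \<Omega> u $ i)"
  unfolding H1_def using grad_eq by fastforce

lemma H1_I: "u \<in> L2_space \<Omega> \<Longrightarrow> (\<And>i. weak_partial \<Omega> i u (p $ i)) \<Longrightarrow> u \<in> H1 \<Omega> \<and> grad \<Omega> u = p"
  using grad_eqI[of u p] by (auto simp: H1_def)

lemma H1_add: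
  assumes "u \<in> H1 \<Omega>" "v \<in> H1 \<Omega>"
  shows "u + v \<in> H1 \<Omega> \<and> grad \<Omega> (u + v) = grad \<Omega> u + grad \<Omega> v"
  using weak_partial_grad[OF assms(1)] weak_partial_grad[OF assms(2)] L2_sub assms
  by (intro H1_I) (auto simp: weak_partial_iff H1_def inner_add_left subspace_add)

lemma H1_scale:
  assumes "u \<in> H1 \<Omega>"
  shows "c *\<^sub>R u \<in> H1 \<Omega> \<and> grad \<Omega> (c *\<^sub>R u) = c *\<^sub>R grad \<Omega> u"
  using weak_partial_grad[OF assms(1)] L2_sub assms
  by (intro H1_I) (auto simp: weak_partial_iff H1_def subspace_scale)

lemma H1_diff:
  assumes "u \<in> H1 \<Omega>" "v \<in> H1 \<Omega>"
  shows "u - v \<in> H1 \<Omega> \<and> grad \<Omega> (u - v) = grad \<Omega> u - grad \<Omega> v"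
  using H1_add[OF assms(1) conjunct1[OF H1_scale[OF assms(2), of "-1"]]] H1_scale[OF assms(2), of "-1"] by simp

lemma H1_test:
  assumes \<psi>: "\<psi> \<in> test_functions \<Omega>"
  shows "abs_l2 \<psi> \<in> H1 \<Omega> \<and> grad \<Omega> (abs_l2 \<psi>) = (\<chi> i. abs_l2 (partial_deriv i \<psi>))"
  by (intro H1_I test_in_L2_space[OF \<psi>])
    (auto simp: weak_partial_iff test_in_L2_space partial_deriv_test[OF \<psi>] test_integration_by_parts[OF \<psi>])

text \<open>Both sides of the weak identity are inner products with fixed vectors and so pass to the
  limit. This closedness of the gradient identifies limits of minimising sequences and of
  eigenfunction series.\<close>

lemma H1_limit:
  assumes u: "\<And>j. u j \<in> H1 \<Omega>" and l: "u \<longlonglongrightarrow> l" and g: "(\<lambda>j. grad \<Omega> (u j)) \<longlonglongrightarrow> p"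
  shows "l \<in> H1 \<Omega> \<and> grad \<Omega> l = p"
proof (rule H1_I)
  show "l \<in> L2_space \<Omega>"
    using closed_sequentially[OF L2_closed _ l] u by (auto simp: H1_def)
  fix i
  have gi: "(\<lambda>j. grad \<Omega> (u j) $ i) \<longlonglongrightarrow> p $ i" by (intro tendsto_intros g)
  show "weak_partial \<Omega> i l (p $ i)"
    unfolding weak_partial_iff
  proof (intro conjI ballI)
    show "p $ i \<in> L2_space \<Omega>"
      using closed_sequentially[OF L2_closed _ gi] weak_partial_grad[OF u] by (auto simp: weak_partial_iff)
    fix \<psi> assume \<psi>: "\<psi> \<in> test_functions \<Omega>"
    have A: "(\<lambda>j. u j \<bullet> abs_l2 (partial_deriv i \<psi>)) \<longlonglongrightarrow> l \<bullet> abs_l2 (partial_deriv i \<psi>)"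
      by (intro tendsto_intros l)
    have B: "(\<lambda>j. - (grad \<Omega> (u j) $ i \<bullet> abs_l2 \<psi>)) \<longlonglongrightarrow> - (p $ i \<bullet> abs_l2 \<psi>)"
      by (intro tendsto_intros gi)
    have C: "u j \<bullet> abs_l2 (partial_deriv i \<psi>) = - (grad \<Omega> (u j) $ i \<bullet> abs_l2 \<psi>)" for j
      using weak_partial_grad[OF u] \<psi> by (auto simp: weak_partial_iff)
    show "l \<bullet> abs_l2 (partial_deriv i \<psi>) = - (p $ i \<bullet> abs_l2 \<psi>)"
      using LIMSEQ_unique[OF A[unfolded C] B] .
  qed
qed

lemma H10_approx:
  assumes u: "u \<in> H10 \<Omega>" and "e > 0"
  shows "\<exists>\<psi>\<in>test_functions \<Omega>. norm (u - abs_l2 \<psi>) < e \<and> norm (grad \<Omega> u - grad \<Omega> (abs_l2 \<psi>)) < e"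
proof -
  obtain \<psi> where \<psi>: "\<psi> \<in> test_functions \<Omega>" "H1_norm \<Omega> (u - abs_l2 \<psi>) < e"
    using assms unfolding H10_def by blast
  have g: "grad \<Omega> (u - abs_l2 \<psi>) = grad \<Omega> u - grad \<Omega> (abs_l2 \<psi>)"
    using H1_diff H1_test[OF \<psi>(1)] u by (auto simp: H10_def)
  have "norm (u - abs_l2 \<psi>) \<le> H1_norm \<Omega> (u - abs_l2 \<psi>)" "norm (grad \<Omega> u - grad \<Omega> (abs_l2 \<psi>)) \<le> H1_norm \<Omega> (u - abs_l2 \<psi>)"
    unfolding H1_norm_def g[symmetric] by (auto intro: real_le_rsqrt)
  then show ?thesis using \<psi> by force
qed

lemma H10_I:
  assumes u: "u \<in> H1 \<Omega>"
    and ap: "\<And>e. e > 0 \<Longrightarrow> \<exists>\<psi>\<in>test_functions \<Omega>. norm (u - abs_l2 \<psi>) < e \<and> norm (grad \<Omega> u - grad \<Omega> (abs_l2 \<psi>)) < e"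
  shows "u \<in> H10 \<Omega>"
  unfolding H10_def
proof (intro CollectI conjI allI impI u)
  fix e :: real assume "e > 0"
  then obtain \<psi> where \<psi>: "\<psi> \<in> test_functions \<Omega>" "norm (u - abs_l2 \<psi>) < e/2" "norm (grad \<Omega> u - grad \<Omega> (abs_l2 \<psi>)) < e/2"
    using ap[of "e/2"] by auto
  have g: "grad \<Omega> (u - abs_l2 \<psi>) = grad \<Omega> u - grad \<Omega> (abs_l2 \<psi>)"
    using H1_diff H1_test[OF \<psi>(1)] u by auto
  have "H1_norm \<Omega> (u - abs_l2 \<psi>) \<le> norm (u - abs_l2 \<psi>) + norm (grad \<Omega> (u - abs_l2 \<psi>))"
    unfolding H1_norm_def by (rule sqrt_sum_squares_le_sum) auto
  also have "\<dots> < e" using \<psi> by (simp add: g)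
  finally show "\<exists>\<psi>\<in>test_functions \<Omega>. H1_norm \<Omega> (u - abs_l2 \<psi>) < e" using \<psi>(1) by blast
qed

lemma H10_H1: "u \<in> H10 \<Omega> \<Longrightarrow> u \<in> H1 \<Omega>" and H10_L2: "u \<in> H10 \<Omega> \<Longrightarrow> u \<in> L2_space \<Omega>"
  by (auto simp: H10_def H1_def)

lemma H10_test: "\<psi> \<in> test_functions \<Omega> \<Longrightarrow> abs_l2 \<psi> \<in> H10 \<Omega>"
  by (rule H10_I) (auto simp: H1_test intro!: bexI[of _ \<psi>])

text \<open>The limit is approximated first by some \<open>u j\<close> and that element by a test
  function, in both norms at once.\<close>

lemma H10_limit:
  assumes u: "\<And>j. u j \<in> H10 \<Omega>" and l: "u \<longlonglongrightarrow> l" and g: "(\<lambda>j. grad \<Omega> (u j)) \<longlonglongrightarrow> p"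
  shows "l \<in> H10 \<Omega> \<and> grad \<Omega> l = p"
proof -
  have L: "l \<in> H1 \<Omega> \<and> grad \<Omega> l = p"
    by (rule H1_limit[OF _ l g]) (use u H10_H1 in auto)
  have "l \<in> H10 \<Omega>"
  proof (rule H10_I)
    fix e :: real assume e: "e > 0"
    have "\<forall>\<^sub>F j in sequentially. dist (u j) l < e/2 \<and> dist (grad \<Omega> (u j)) p < e/2"
      using tendstoD[OF l, of "e/2"] tendstoD[OF g, of "e/2"] e by (auto intro: eventually_conj)
    then obtain j where j: "dist (u j) l < e/2" "dist (grad \<Omega> (u j)) p < e/2"
      by (auto simp: eventually_sequentially)
    obtain \<psi> where \<psi>: "\<psi> \<in> test_functions \<Omega>" "norm (u j - abs_l2 \<psi>) < e/2"
        "norm (grad \<Omega> (u j) - grad \<Omega> (abs_l2 \<psi>)) < e/2"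
      using H10_approx[OF u[of j], of "e/2"] e by auto
    have "norm (l - abs_l2 \<psi>) < e"
      using norm_triangle_ineq[of "l - u j" "u j - abs_l2 \<psi>"] j(1) \<psi>(2) by (simp add: dist_norm norm_minus_commute)
    moreover have "norm (grad \<Omega> l - grad \<Omega> (abs_l2 \<psi>)) < e"
      using norm_triangle_ineq[of "grad \<Omega> l - grad \<Omega> (u j)" "grad \<Omega> (u j) - grad \<Omega> (abs_l2 \<psi>)"] j(2) \<psi>(3) L
      by (simp add: dist_norm norm_minus_commute)
    ultimately show "\<exists>\<psi>\<in>test_functions \<Omega>. norm (l - abs_l2 \<psi>) < e \<and> norm (grad \<Omega> l - grad \<Omega> (abs_l2 \<psi>)) < e"
      using \<psi>(1) by blast
  qed (use L in auto)
  with L show ?thesis by blast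
qed

lemma H10_seq:
  assumes u: "u \<in> H10 \<Omega>"
  shows "\<exists>\<psi>. (\<forall>j. \<psi> j \<in> test_functions \<Omega>) \<and> (\<lambda>j. abs_l2 (\<psi> j)) \<longlonglongrightarrow> u \<and> (\<lambda>j. grad \<Omega> (abs_l2 (\<psi> j))) \<longlonglongrightarrow> grad \<Omega> u"
proof -
  have "\<forall>j. \<exists>\<psi>\<in>test_functions \<Omega>. norm (u - abs_l2 \<psi>) < 1 / Suc j \<and> norm (grad \<Omega> u - grad \<Omega> (abs_l2 \<psi>)) < 1 / Suc j"
    using H10_approx[OF u] by simp
  then obtain \<psi> where \<psi>: "\<And>j. \<psi> j \<in> test_functions \<Omega>" "\<And>j::nat. norm (u - abs_l2 (\<psi> j)) < 1 / Suc j"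
    "\<And>j. norm (grad \<Omega> u - grad \<Omega> (abs_l2 (\<psi> j))) < 1 / Suc j" by metis
  have "(\<lambda>j. abs_l2 (\<psi> j)) \<longlonglongrightarrow> u"
    by (rule LIM_zero_cancel, rule Lim_null_comparison[OF _ LIMSEQ_inverse_real_of_nat])
      (use \<psi>(2) in \<open>auto simp: norm_minus_commute inverse_eq_divide less_imp_le intro!: always_eventually\<close>)
  moreover have "(\<lambda>j. grad \<Omega> (abs_l2 (\<psi> j))) \<longlonglongrightarrow> grad \<Omega> u"
    by (rule LIM_zero_cancel, rule Lim_null_comparison[OF _ LIMSEQ_inverse_real_of_nat])
      (use \<psi>(3) in \<open>auto simp: norm_minus_commute inverse_eq_divide less_imp_le intro!: always_eventually\<close>)
  ultimately show ?thesis using \<psi>(1) by blast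
qed

lemma H10_add:
  assumes u: "u \<in> H10 \<Omega>" and v: "v \<in> H10 \<Omega>"
  shows "u + v \<in> H10 \<Omega>"
proof -
  obtain \<psi> where \<psi>: "\<And>j. \<psi> j \<in> test_functions \<Omega>" "(\<lambda>j. abs_l2 (\<psi> j)) \<longlonglongrightarrow> u" "(\<lambda>j. grad \<Omega> (abs_l2 (\<psi> j))) \<longlonglongrightarrow> grad \<Omega> u"
    using H10_seq[OF u] by blast
  obtain \<phi> where \<phi>: "\<And>j. \<phi> j \<in> test_functions \<Omega>" "(\<lambda>j. abs_l2 (\<phi> j)) \<longlonglongrightarrow> v" "(\<lambda>j. grad \<Omega> (abs_l2 (\<phi> j))) \<longlonglongrightarrow> grad \<Omega> v"
    using H10_seq[OF v] by blast
  have s: "abs_l2 (\<lambda>x. \<psi> j x + \<phi> j x) = abs_l2 (\<psi> j) + abs_l2 (\<phi> j)" for j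
    by (simp add: abs_l2_plus test_functions_sq_integrable[OF \<psi>(1)] test_functions_sq_integrable[OF \<phi>(1)])
  have g: "grad \<Omega> (abs_l2 (\<psi> j) + abs_l2 (\<phi> j)) = grad \<Omega> (abs_l2 (\<psi> j)) + grad \<Omega> (abs_l2 (\<phi> j))" for j
    using H1_add H1_test \<psi>(1) \<phi>(1) by blast
  have "(\<lambda>j. abs_l2 (\<lambda>x. \<psi> j x + \<phi> j x)) \<longlonglongrightarrow> u + v" unfolding s by (intro tendsto_intros \<psi> \<phi>)
  moreover have "(\<lambda>j. grad \<Omega> (abs_l2 (\<lambda>x. \<psi> j x + \<phi> j x))) \<longlonglongrightarrow> grad \<Omega> u + grad \<Omega> v"
    unfolding s g by (intro tendsto_intros \<psi> \<phi>)
  moreover have "abs_l2 (\<lambda>x. \<psi> j x + \<phi> j x) \<in> H10 \<Omega>" for j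
    by (intro H10_test test_functions_add \<psi> \<phi>)
  ultimately show ?thesis using H10_limit[of "\<lambda>j. abs_l2 (\<lambda>x. \<psi> j x + \<phi> j x)"] by blast
qed

lemma H10_scale:
  assumes u: "u \<in> H10 \<Omega>"
  shows "c *\<^sub>R u \<in> H10 \<Omega>"
proof -
  obtain \<psi> where \<psi>: "\<And>j. \<psi> j \<in> test_functions \<Omega>" "(\<lambda>j. abs_l2 (\<psi> j)) \<longlonglongrightarrow> u" "(\<lambda>j. grad \<Omega> (abs_l2 (\<psi> j))) \<longlonglongrightarrow> grad \<Omega> u"
    using H10_seq[OF u] by blast
  have s: "abs_l2 (\<lambda>x. c * \<psi> j x) = c *\<^sub>R abs_l2 (\<psi> j)" for j
    by (simp add: abs_l2_scaleR test_functions_sq_integrable[OF \<psi>(1)])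
  have g: "grad \<Omega> (c *\<^sub>R abs_l2 (\<psi> j)) = c *\<^sub>R grad \<Omega> (abs_l2 (\<psi> j))" for j
    using H1_scale H1_test \<psi>(1) by blast
  have "(\<lambda>j. abs_l2 (\<lambda>x. c * \<psi> j x)) \<longlonglongrightarrow> c *\<^sub>R u" unfolding s by (intro tendsto_intros \<psi>)
  moreover have "(\<lambda>j. grad \<Omega> (abs_l2 (\<lambda>x. c * \<psi> j x))) \<longlonglongrightarrow> c *\<^sub>R grad \<Omega> u"
    unfolding s g by (intro tendsto_intros \<psi>)
  moreover have "abs_l2 (\<lambda>x. c * \<psi> j x) \<in> H10 \<Omega>" for j
    by (intro H10_test test_functions_scale \<psi>)
  ultimately show ?thesis using H10_limit[of "\<lambda>j. abs_l2 (\<lambda>x. c * \<psi> j x)"] by blast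
qed

lemma H10_zero: "0 \<in> H10 \<Omega>"
  using H10_test[OF test_functions_zero] by (simp add: zero_l2_def)

lemma H10_sub: "subspace (H10 \<Omega>)"
  unfolding subspace_def using H10_zero H10_add H10_scale by blast

lemma grad_add: "u \<in> H10 \<Omega> \<Longrightarrow> v \<in> H10 \<Omega> \<Longrightarrow> grad \<Omega> (u + v) = grad \<Omega> u + grad \<Omega> v"
  by (simp add: H1_add H10_H1)

lemma grad_scale: "u \<in> H10 \<Omega> \<Longrightarrow> grad \<Omega> (c *\<^sub>R u) = c *\<^sub>R grad \<Omega> u"
  by (simp add: H1_scale H10_H1)

lemma grad_diff: "u \<in> H10 \<Omega> \<Longrightarrow> v \<in> H10 \<Omega> \<Longrightarrow> grad \<Omega> (u - v) = grad \<Omega> u - grad \<Omega> v"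
  by (simp add: H1_diff H10_H1)

lemma grad_zero: "grad \<Omega> 0 = 0"
  using grad_scale[OF H10_zero, of 0] by simp

end

section \<open>Dyadic averages\<close>

text \<open>The half-open dyadic cube of side 2^-k containing \<open>x\<close>, encoded as an
  equivalence class. The floors are coerced to reals so that Borel measurability reduces to that of
  real functions.\<close>

definition cell :: "nat \<Rightarrow> real^'n \<Rightarrow> (real^'n) set" where
  "cell k x = {y. \<forall>i. real_of_int \<lfloor>2^k * x $ i\<rfloor> = real_of_int \<lfloor>2^k * y $ i\<rfloor>}"

text \<open>The constant factor is the reciprocal of the cell volume, so this is the conditional
  expectation on the dyadic cubes of level \<open>k\<close>.\<close>

definition dyavg :: "nat \<Rightarrow> (real^'n::finite \<Rightarrow> real) \<Rightarrow> real^'n \<Rightarrow> real" where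
  "dyavg k f x = (LINT y|lborel. 2^(k * CARD('n)) * (indicator (cell k x) y * f y))"

lemma cell_refl: "x \<in> cell k x" and cell_sym: "y \<in> cell k x \<longleftrightarrow> x \<in> cell k y"
  and cell_eq: "y \<in> cell k x \<Longrightarrow> cell k y = cell k x"
  by (auto simp: cell_def)

lemma measurable_cell_pair [measurable]:
  "(\<lambda>(x, y). indicator (cell k x) y :: real) \<in> borel_measurable (lborel \<Otimes>\<^sub>M (lborel :: (real^'n::finite) measure))"
proof -
  have "(\<lambda>(x, y). indicator (cell k x) y :: real) = (\<lambda>p::(real^'n) \<times> (real^'n).
     \<Prod>i\<in>UNIV. indicator {0} (real_of_int \<lfloor>2^k * (fst p \<bullet> axis i 1)\<rfloor> - real_of_int \<lfloor>2^k * (snd p \<bullet> axis i 1)\<rfloor>))"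
    by (auto simp: fun_eq_iff cell_def indicator_def inner_axis split: if_splits)
  also have "\<dots> \<in> borel_measurable (lborel \<Otimes>\<^sub>M lborel)"
    by measurable
  finally show ?thesis .
qed

lemma cell_borel [measurable]: "cell k (x::real^'n::finite) \<in> sets borel"
proof -
  have "cell k x = (\<Inter>i. {y. real_of_int \<lfloor>2^k * (x \<bullet> axis i 1)\<rfloor> = real_of_int \<lfloor>2^k * (y \<bullet> axis i 1)\<rfloor>})"
    by (auto simp: cell_def inner_axis)
  also have "\<dots> \<in> sets borel" by measurable
  finally show ?thesis .
qed

lemma emeasure_const_box:
  fixes a b :: "real^'n::finite"
  assumes "\<And>i. b $ i - a $ i = h" "0 \<le> h"
  shows "emeasure lborel (box a b) = ennreal (h ^ CARD('n))" "emeasure lborel (cbox a b) = ennreal (h ^ CARD('n))"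
proof -
  have B: "(b - a) \<bullet> i = h" if "i \<in> Basis" for i
    using that assms by (auto simp: Basis_vec_def inner_axis)
  then have le: "a \<bullet> i \<le> b \<bullet> i" if "i \<in> Basis" for i
    using assms(2) B[OF that] by (simp add: inner_diff_left)
  show "emeasure lborel (box a b) = ennreal (h ^ CARD('n))" "emeasure lborel (cbox a b) = ennreal (h ^ CARD('n))"
    using le B by (simp_all add: emeasure_lborel_box emeasure_lborel_cbox)
qed

text \<open>The half-open cube lies between the open and the closed box of the same volume.\<close>

lemma emeasure_cell: "emeasure lborel (cell k (x::real^'n::finite)) = ennreal ((1/2)^(k * CARD('n)))"
proof -
  define a where "a = (\<chi> i. real_of_int \<lfloor>2^k * x $ i\<rfloor> / 2^k)"
  define b where "b = (\<chi> i. real_of_int \<lfloor>2^k * x $ i\<rfloor> / 2^k + (1/2)^k)"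
  have h: "b $ i - a $ i = (1/2)^k" for i by (simp add: a_def b_def)
  have in_cell: "y \<in> cell k x \<longleftrightarrow> (\<forall>i. a $ i \<le> y $ i \<and> y $ i < b $ i)" for y
  proof -
    have "real_of_int \<lfloor>2^k * x $ i\<rfloor> = real_of_int \<lfloor>2^k * y $ i\<rfloor> \<longleftrightarrow> a $ i \<le> y $ i \<and> y $ i < b $ i" for i
    proof -
      have "real_of_int \<lfloor>2^k * x $ i\<rfloor> = real_of_int \<lfloor>2^k * y $ i\<rfloor> \<longleftrightarrow> \<lfloor>2^k * y $ i\<rfloor> = \<lfloor>2^k * x $ i\<rfloor>"
        by auto
      also have "\<dots> \<longleftrightarrow> real_of_int \<lfloor>2^k * x $ i\<rfloor> \<le> 2^k * y $ i \<and> 2^k * y $ i < real_of_int \<lfloor>2^k * x $ i\<rfloor> + 1"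
        by (rule floor_eq_iff)
      also have "\<dots> \<longleftrightarrow> a $ i \<le> y $ i \<and> y $ i < b $ i"
      proof -
        have "b $ i = (real_of_int \<lfloor>2^k * x $ i\<rfloor> + 1) / 2^k"
          by (simp add: b_def power_divide add_divide_distrib)
        then show ?thesis by (simp add: a_def pos_divide_le_eq pos_less_divide_eq mult.commute)
      qed
      finally show ?thesis .
    qed
    then show ?thesis by (simp add: cell_def)
  qed
  have s: "box a b \<subseteq> cell k x" "cell k x \<subseteq> cbox a b"
    by (auto simp: in_cell mem_box_cart less_imp_le)
  have p: "((1/2::real)^k)^CARD('n) = (1/2)^(k * CARD('n))" by (simp add: power_mult)
  have "emeasure lborel (box a b) \<le> emeasure lborel (cell k x)" "emeasure lborel (cell k x) \<le> emeasure lborel (cbox a b)"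
    by (intro emeasure_mono s; measurable)+
  then show ?thesis
    using emeasure_const_box[of b a, OF h] by (auto simp: p)
qed

lemma half_two_pow: "(1/2::real)^m * 2^m = 1" "2^m * (1/2::real)^m = 1"
  by (simp_all add: power_divide)

lemma measure_cell: "measure lborel (cell k (x::real^'n::finite)) = (1/2)^(k * CARD('n))"
  by (simp add: measure_def emeasure_cell)

lemma cell_integrable:
  fixes f :: "real^'n::finite \<Rightarrow> real"
  assumes [measurable]: "f \<in> borel_measurable borel" and b: "\<And>x. \<bar>f x\<bar> \<le> B"
  shows "integrable lborel (\<lambda>y. indicator (cell k x) y * f y)"
proof (rule Bochner_Integration.integrable_bound[where f="\<lambda>y. B * indicator (cell k x) y"])
  show "integrable lborel (\<lambda>y. B * indicator (cell k x) y)"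
    by (intro integrable_mult_right integrable_real_indicator) (auto simp: emeasure_cell)
qed (use b in \<open>auto simp: indicator_def intro!: AE_I2 order_trans[OF b abs_ge_self]\<close>)

lemma cell_integral_const: "(LINT y|lborel. indicator (cell k (x::real^'n::finite)) y * (c::real)) = (1/2)^(k * CARD('n)) * c"
  by (simp add: measure_cell)

lemma dyavg_eq: "dyavg k (f :: real^'n::finite \<Rightarrow> real) x = 2^(k * CARD('n)) * (LINT y|lborel. indicator (cell k x) y * f y)"
  by (simp add: dyavg_def)

lemma dyavg_diff_const:
  fixes f :: "real^'n::finite \<Rightarrow> real"
  assumes "f \<in> borel_measurable borel" "\<And>x. \<bar>f x\<bar> \<le> B"
  shows "dyavg k (\<lambda>y. c - f y) x = c - dyavg k f x"
proof -
  have "(LINT y|lborel. indicator (cell k x) y * (c - f y)) =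
     (LINT y|lborel. indicator (cell k x) y * c) - (LINT y|lborel. indicator (cell k x) y * f y)"
    unfolding right_diff_distrib
    by (intro Bochner_Integration.integral_diff cell_integrable[where B="\<bar>c\<bar>"] cell_integrable[where B=B] assms) auto
  then show ?thesis
    unfolding dyavg_eq cell_integral_const by (simp add: right_diff_distrib half_two_pow mult.assoc[symmetric])
qed

lemma dyavg_jensen:
  fixes f :: "real^'n::finite \<Rightarrow> real"
  assumes [measurable]: "f \<in> borel_measurable borel" and b: "\<And>x. \<bar>f x\<bar> \<le> B"
  shows "ennreal ((dyavg k f x)\<^sup>2) \<le> ennreal (2^(k * CARD('n))) * (\<integral>\<^sup>+y. ennreal (indicator (cell k x) y * (f y)\<^sup>2) \<partial>lborel)"
proof -
  define c where "c = dyavg k f x"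
  define I where "I = (LINT y|lborel. indicator (cell k x) y * f y)"
  define J where "J = (LINT y|lborel. indicator (cell k x) y * (f y)\<^sup>2)"
  let ?m = "2^(k * CARD('n)) :: real"
  have cI: "c = ?m * I" by (simp add: c_def I_def dyavg_eq)
  have i1: "integrable lborel (\<lambda>y. indicator (cell k x) y * f y)" by (rule cell_integrable[where B=B]) (use b in auto)
  have b2: "\<bar>(f y)\<^sup>2\<bar> \<le> B\<^sup>2" for y
    using power_mono[OF b abs_ge_zero, of y 2] by simp
  have i2: "integrable lborel (\<lambda>y. indicator (cell k x) y * (f y)\<^sup>2)" by (rule cell_integrable[OF _ b2]) measurable
  have i3: "integrable lborel (\<lambda>y. indicator (cell k x) y * c\<^sup>2)" by (rule cell_integrable[where B="c\<^sup>2"]) auto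
  have "0 \<le> (LINT y|lborel. indicator (cell k x) y * (f y - c)\<^sup>2)" by (intro integral_nonneg_AE) auto
  also have "\<dots> = (LINT y|lborel. indicator (cell k x) y * (f y)\<^sup>2 - 2 * c * (indicator (cell k x) y * f y) + indicator (cell k x) y * c\<^sup>2)"
    by (intro Bochner_Integration.integral_cong) (auto simp: power2_diff algebra_simps)
  also have "\<dots> = J - 2 * c * I + (1/2)^(k * CARD('n)) * c\<^sup>2"
    using i1 i2 i3 unfolding cell_integral_const[symmetric] J_def I_def
    by (simp add: Bochner_Integration.integral_diff measure_cell)
  finally have "0 \<le> ?m * (J - 2 * c * I + (1/2)^(k * CARD('n)) * c\<^sup>2)" by simp
  also have "\<dots> = ?m * J - 2 * c * (?m * I) + (?m * (1/2)^(k * CARD('n))) * c\<^sup>2" by algebra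
  also have "\<dots> = ?m * J - c\<^sup>2"
    unfolding cI[symmetric] half_two_pow by (simp add: power2_eq_square)
  finally have "ennreal (c\<^sup>2) \<le> ennreal (?m * J)" by (intro ennreal_leI) simp
  also have "\<dots> = ennreal ?m * ennreal J" by (rule ennreal_mult') simp
  also have "ennreal J = (\<integral>\<^sup>+y. ennreal (indicator (cell k x) y * (f y)\<^sup>2) \<partial>lborel)"
    unfolding J_def by (rule nn_integral_eq_integral[symmetric, OF i2]) auto
  finally show ?thesis by (simp add: c_def)
qed

lemma dyavg_measurable [measurable]:
  fixes f :: "real^'n::finite \<Rightarrow> real"
  assumes [measurable]: "f \<in> borel_measurable borel"
  shows "dyavg k f \<in> borel_measurable borel"
proof -
  have "(\<lambda>x. LINT y|lborel. 2^(k * CARD('n)) * ((\<lambda>(x, y). indicator (cell k x) y) (x, y) * f y)) \<in> borel_measurable lborel"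
    by measurable
  then show ?thesis by (simp add: dyavg_def[abs_def])
qed

text \<open>Jensen on each cell, then Tonelli. Lying in a common cell is symmetric, so integrating
  over \<open>x\<close> first produces the cell volume, which cancels the normalising
  factor.\<close>

lemma dyavg_contraction:
  fixes f :: "real^'n::finite \<Rightarrow> real"
  assumes [measurable]: "f \<in> borel_measurable borel" and b: "\<And>x. \<bar>f x\<bar> \<le> B"
  shows "(\<integral>\<^sup>+x. ennreal ((dyavg k f x)\<^sup>2) \<partial>lborel) \<le> (\<integral>\<^sup>+x. ennreal ((f x)\<^sup>2) \<partial>lborel)"
proof -
  let ?m = "ennreal (2^(k * CARD('n)))"
  have [measurable]: "(\<lambda>(x, y). ennreal (indicator (cell k x) y * (f y)\<^sup>2)) \<in> borel_measurable (lborel \<Otimes>\<^sub>M lborel)"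
  proof -
    have "(\<lambda>p. ennreal ((\<lambda>(x, y). indicator (cell k x) y) p * (f (snd p))\<^sup>2)) \<in> borel_measurable (lborel \<Otimes>\<^sub>M lborel)"
      by measurable
    then show ?thesis by (simp add: case_prod_beta')
  qed
  have "(\<integral>\<^sup>+x. ennreal ((dyavg k f x)\<^sup>2) \<partial>lborel) \<le>
      (\<integral>\<^sup>+x. ?m * (\<integral>\<^sup>+y. ennreal (indicator (cell k x) y * (f y)\<^sup>2) \<partial>lborel) \<partial>lborel)"
    by (intro nn_integral_mono dyavg_jensen[OF assms])
  also have "\<dots> = ?m * (\<integral>\<^sup>+x. (\<integral>\<^sup>+y. ennreal (indicator (cell k x) y * (f y)\<^sup>2) \<partial>lborel) \<partial>lborel)"
    by (rule nn_integral_cmult) measurable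
  also have "\<dots> = ?m * (\<integral>\<^sup>+y. (\<integral>\<^sup>+x. ennreal (indicator (cell k x) y * (f y)\<^sup>2) \<partial>lborel) \<partial>lborel)"
    by (subst lborel_pair.Fubini') auto
  also have "\<dots> = ?m * (\<integral>\<^sup>+y. ennreal ((f y)\<^sup>2) * ennreal ((1/2)^(k * CARD('n))) \<partial>lborel)"
  proof -
    have "(\<integral>\<^sup>+x. ennreal (indicator (cell k x) y * (f y)\<^sup>2) \<partial>lborel) = ennreal ((f y)\<^sup>2) * ennreal ((1/2)^(k * CARD('n)))" for y
    proof -
      have "(\<integral>\<^sup>+x. ennreal (indicator (cell k x) y * (f y)\<^sup>2) \<partial>lborel) = (\<integral>\<^sup>+x. ennreal ((f y)\<^sup>2) * indicator (cell k y) x \<partial>lborel)"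
        by (intro nn_integral_cong) (use cell_sym[of _ k y] in \<open>auto simp: indicator_def\<close>)
      also have "\<dots> = ennreal ((f y)\<^sup>2) * emeasure lborel (cell k y)" by (rule nn_integral_cmult_indicator) simp
      finally show ?thesis by (simp add: emeasure_cell)
    qed
    then show ?thesis by simp
  qed
  also have "\<dots> = (?m * ennreal ((1/2)^(k * CARD('n)))) * (\<integral>\<^sup>+y. ennreal ((f y)\<^sup>2) \<partial>lborel)"
    by (simp add: nn_integral_multc ac_simps)
  also have "?m * ennreal ((1/2)^(k * CARD('n))) = 1"
    by (simp add: ennreal_mult'[symmetric] half_two_pow)
  finally show ?thesis by simp
qed

lemma cell_component: "y \<in> cell k x \<Longrightarrow> \<bar>y $ i - x $ i\<bar> \<le> (1/2)^k"
proof -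
  assume "y \<in> cell k x"
  then have "\<lfloor>2^k * x $ i\<rfloor> = \<lfloor>2^k * y $ i\<rfloor>" by (auto simp: cell_def)
  then have "\<bar>2^k * y $ i - 2^k * x $ i\<bar> \<le> 1" by linarith
  then have "2^k * \<bar>y $ i - x $ i\<bar> \<le> 1" by (simp add: right_diff_distrib[symmetric] abs_mult)
  then show ?thesis by (simp add: power_divide pos_le_divide_eq mult.commute)
qed

lemma cell_refine:
  fixes x :: "real^'n"
  assumes "y \<in> cell (Suc k) x" shows "y \<in> cell k x"
proof -
  have f: "\<lfloor>2^k * t\<rfloor> = \<lfloor>2^Suc k * t\<rfloor> div 2" for t :: real
    using floor_divide_real_eq_div[of 2 "2^Suc k * t"] by simp
  show ?thesis using assms unfolding cell_def by (auto simp: f simp del: power_Suc)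
qed

text \<open>An inverse inequality: \<open>D\<close> is constant on the cell around \<open>x\<close>,
  so the share of that one cell in the integral already controls the value, with the inverse volume
  as constant.\<close>

lemma cell_const_sup:
  fixes D :: "real^'n::finite \<Rightarrow> real"
  assumes [measurable]: "D \<in> borel_measurable borel" and c: "\<And>x y. y \<in> cell k x \<Longrightarrow> D y = D x"
    and N: "(\<integral>\<^sup>+x. ennreal ((D x)\<^sup>2) \<partial>lborel) \<le> ennreal N" "0 \<le> N"
  shows "(D x)\<^sup>2 \<le> 2^(k * CARD('n)) * N"
proof -
  have "ennreal ((D x)\<^sup>2) * emeasure lborel (cell k x) = (\<integral>\<^sup>+y. ennreal ((D x)\<^sup>2) * indicator (cell k x) y \<partial>lborel)"
    by (rule nn_integral_cmult_indicator[symmetric]) simp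
  also have "\<dots> \<le> (\<integral>\<^sup>+y. ennreal ((D y)\<^sup>2) \<partial>lborel)"
    by (intro nn_integral_mono) (auto simp: indicator_def c)
  also have "\<dots> \<le> ennreal N" by fact
  finally have "ennreal ((D x)\<^sup>2 * (1/2)^(k * CARD('n))) \<le> ennreal N"
    by (simp add: emeasure_cell ennreal_mult')
  then have "(D x)\<^sup>2 * (1/2)^(k * CARD('n)) \<le> N" using N by (simp add: ennreal_le_iff)
  then have "((D x)\<^sup>2 * (1/2)^(k * CARD('n))) * 2^(k * CARD('n)) \<le> N * 2^(k * CARD('n))"
    by (intro mult_right_mono) auto
  then show ?thesis unfolding mult.assoc half_two_pow by (simp add: mult.commute)
qed

text \<open>One factor \<open>(D x)\<^sup>2\<close> is estimated by its supremum and the other is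
  integrated.\<close>

lemma cell_const_L4:
  fixes D :: "real^'n::finite \<Rightarrow> real"
  assumes [measurable]: "D \<in> borel_measurable borel" and c: "\<And>x y. y \<in> cell k x \<Longrightarrow> D y = D x"
    and N: "(\<integral>\<^sup>+x. ennreal ((D x)\<^sup>2) \<partial>lborel) \<le> ennreal N" "0 \<le> N"
  shows "(\<integral>\<^sup>+x. ennreal ((D x)^4) \<partial>lborel) \<le> ennreal (2^(k * CARD('n)) * N\<^sup>2)"
proof -
  have "(\<integral>\<^sup>+x. ennreal ((D x)^4) \<partial>lborel) \<le> (\<integral>\<^sup>+x. ennreal (2^(k * CARD('n)) * N) * ennreal ((D x)\<^sup>2) \<partial>lborel)"
  proof (rule nn_integral_mono)
    fix x
    have "(D x)^4 = (D x)\<^sup>2 * (D x)\<^sup>2" by (simp flip: power_add)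
    also have "\<dots> \<le> (2^(k * CARD('n)) * N) * (D x)\<^sup>2"
      by (intro mult_right_mono cell_const_sup[OF assms]) auto
    finally show "ennreal ((D x)^4) \<le> ennreal (2^(k * CARD('n)) * N) * ennreal ((D x)\<^sup>2)"
      using N(2) by (subst ennreal_mult'[symmetric]) (auto intro: ennreal_leI)
  qed
  also have "\<dots> = ennreal (2^(k * CARD('n)) * N) * (\<integral>\<^sup>+x. ennreal ((D x)\<^sup>2) \<partial>lborel)"
    by (rule nn_integral_cmult) measurable
  also have "\<dots> \<le> ennreal (2^(k * CARD('n)) * N) * ennreal N"
    by (intro mult_left_mono N) auto
  also have "\<dots> = ennreal (2^(k * CARD('n)) * N\<^sup>2)"
    using N(2) by (simp add: ennreal_mult'[symmetric] power2_eq_square mult.assoc)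
  finally show ?thesis .
qed

lemma dyavg_cell_const:
  "y \<in> cell k x \<Longrightarrow> dyavg k f y = dyavg k f x"
  by (simp add: dyavg_def cell_eq)

lemma dyavg_tendsto:
  fixes f :: "real^'n::finite \<Rightarrow> real"
  assumes f: "continuous_on UNIV f" and b: "\<And>x. \<bar>f x\<bar> \<le> B"
  shows "(\<lambda>k. dyavg k f x) \<longlonglongrightarrow> f x"
proof (rule LIMSEQ_I)
  have [measurable]: "f \<in> borel_measurable borel" using f by (rule borel_measurable_continuous_onI)
  fix e :: real assume e: "e > 0"
  obtain d where d: "d > 0" "\<And>y. dist y x < d \<Longrightarrow> dist (f y) (f x) < e/2"
    using f e by (metis UNIV_I continuous_on_iff half_gt_zero)
  have "(\<lambda>k. real CARD('n) * (1/2)^k) \<longlonglongrightarrow> real CARD('n) * 0"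
    by (intro tendsto_mult tendsto_const LIMSEQ_realpow_zero) auto
  then have "\<forall>\<^sub>F k in sequentially. real CARD('n) * (1/2)^k < d"
    using d(1) by (intro order_tendstoD(2)) auto
  then obtain K where K: "\<And>k. k \<ge> K \<Longrightarrow> real CARD('n) * (1/2)^k < d"
    by (auto simp: eventually_sequentially)
  have "norm (dyavg k f x - f x) < e" if k: "k \<ge> K" for k
  proof -
    have near: "\<bar>f x - f y\<bar> \<le> e/2" if "y \<in> cell k x" for y
    proof -
      have "norm (y - x) \<le> (\<Sum>i\<in>UNIV. \<bar>(y - x) $ i\<bar>)" by (rule norm_le_l1_cart)
      also have "\<dots> \<le> (\<Sum>i\<in>(UNIV::'n set). (1/2)^k)"
        using cell_component[OF that] by (intro sum_mono) simp
      also have "\<dots> < d" using K[OF k] by simp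
      finally show ?thesis using d(2)[of y] by (simp add: dist_norm abs_minus_commute)
    qed
    have bb: "\<bar>f x - f y\<bar> \<le> 2 * B" for y using b[of x] b[of y] by linarith
    have "ennreal ((f x - dyavg k f x)\<^sup>2) = ennreal ((dyavg k (\<lambda>y. f x - f y) x)\<^sup>2)"
      using dyavg_diff_const[of f B k "f x" x] b by simp
    also have "\<dots> \<le> ennreal (2^(k * CARD('n))) * (\<integral>\<^sup>+y. ennreal (indicator (cell k x) y * (f x - f y)\<^sup>2) \<partial>lborel)"
      by (rule dyavg_jensen[OF _ bb]) measurable
    also have "\<dots> \<le> ennreal (2^(k * CARD('n))) * (\<integral>\<^sup>+y. ennreal ((e/2)\<^sup>2) * indicator (cell k x) y \<partial>lborel)"
    proof (intro mult_left_mono nn_integral_mono)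
      fix y
      have "y \<in> cell k x \<Longrightarrow> (f x - f y)\<^sup>2 \<le> (e/2)\<^sup>2"
        using near[of y] e by (metis abs_le_square_iff abs_of_pos half_gt_zero)
      then show "ennreal (indicator (cell k x) y * (f x - f y)\<^sup>2) \<le> ennreal ((e/2)\<^sup>2) * indicator (cell k x) y"
        by (auto simp: indicator_def intro: ennreal_leI)
    qed simp
    also have "\<dots> = ennreal (2^(k * CARD('n))) * (ennreal ((e/2)\<^sup>2) * ennreal ((1/2)^(k * CARD('n))))"
      by (subst nn_integral_cmult_indicator) (auto simp: emeasure_cell)
    also have "\<dots> = ennreal (2^(k * CARD('n)) * ((e/2)\<^sup>2 * (1/2)^(k * CARD('n))))"
      by (simp add: ennreal_mult')
    also have "2^(k * CARD('n)) * ((e/2)\<^sup>2 * (1/2)^(k * CARD('n))) = (e/2)\<^sup>2 * (2^(k * CARD('n)) * (1/2)^(k * CARD('n)))"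
      by algebra
    also have "\<dots> = (e/2)\<^sup>2" unfolding half_two_pow by simp
    finally have "(f x - dyavg k f x)\<^sup>2 \<le> (e/2)\<^sup>2" by (simp add: ennreal_le_iff)
    then have "\<bar>f x - dyavg k f x\<bar> \<le> \<bar>e/2\<bar>" by (simp only: abs_le_square_iff)
    then show ?thesis unfolding real_norm_def using e by linarith
  qed
  then show "\<exists>no. \<forall>k\<ge>no. norm (dyavg k f x - f x) < e" by blast
qed

section \<open>A Poincare inequality for dyadic averages\<close>

lemma norm_vec_sq: "(norm (x :: ('a::real_inner) ^ 'n))\<^sup>2 = (\<Sum>i\<in>UNIV. (norm (x $ i))\<^sup>2)"
  by (simp add: power2_norm_eq_inner inner_vec_def)

definition grad_sq :: "(real^'n::finite \<Rightarrow> real) \<Rightarrow> real" where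
  "grad_sq \<psi> = (LINT x|lborel. (\<Sum>i\<in>UNIV. (partial_deriv i \<psi> x)\<^sup>2))"

lemma test_integrable_sq:
  assumes "\<psi> \<in> test_functions U"
  shows "integrable lborel (\<lambda>x. (\<psi> x)\<^sup>2)"
  using test_functions_mult_continuous[OF assms test_functions_continuous[OF assms]] by (simp add: power2_eq_square)

lemma nn_grad_sq:
  assumes \<psi>: "\<psi> \<in> test_functions U"
  shows "(\<integral>\<^sup>+x. ennreal (\<Sum>i\<in>UNIV. (partial_deriv i \<psi> x)\<^sup>2) \<partial>lborel) = ennreal (grad_sq \<psi>)"
  unfolding grad_sq_def
  by (rule nn_integral_eq_integral)
    (auto intro!: sum_nonneg integrable_sum test_integrable_sq[OF partial_deriv_test[OF \<psi>]])

lemma grad_sq_nonneg: "0 \<le> grad_sq \<psi>"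
  unfolding grad_sq_def by (intro integral_nonneg_AE AE_I2 sum_nonneg) auto

lemma translate_grad_bound:
  fixes \<psi> :: "real^'n::finite \<Rightarrow> real"
  assumes \<psi>: "\<psi> \<in> test_functions U"
  shows "(\<integral>\<^sup>+x. ennreal ((\<psi> (x + v) - \<psi> x)\<^sup>2) \<partial>lborel) \<le> ennreal ((norm v)\<^sup>2 * grad_sq \<psi>)"
proof -
  note [measurable] = test_functions_borel[OF partial_deriv_test[OF \<psi>]]
  have "(\<integral>\<^sup>+x. ennreal ((\<psi> (x + v) - \<psi> x)\<^sup>2) \<partial>lborel) \<le> (\<integral>\<^sup>+x. ennreal ((frechet_derivative \<psi> (at x) v)\<^sup>2) \<partial>lborel)"
    by (rule test_functions_translate_bound[OF \<psi>])
  also have "\<dots> \<le> (\<integral>\<^sup>+x. ennreal ((norm v)\<^sup>2) * ennreal (\<Sum>i\<in>UNIV. (partial_deriv i \<psi> x)\<^sup>2) \<partial>lborel)"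
    by (intro nn_integral_mono) (auto simp: ennreal_mult'[symmetric] intro!: ennreal_leI frechet_derivative_test_sq[OF \<psi>])
  also have "\<dots> = ennreal ((norm v)\<^sup>2 * grad_sq \<psi>)"
    by (subst nn_integral_cmult) (auto simp: nn_grad_sq[OF \<psi>] ennreal_mult')
  finally show ?thesis .
qed

text \<open>The cell of \<open>x\<close> lies in \<open>x + Q\<close> for a cube \<open>Q\<close> of
  twice the side, which does not depend on \<open>x\<close>. After Jensen and Tonelli, only the
  translation estimate for \<open>z\<close> in \<open>Q\<close> is left, with squared length at most
  n 4^-k. The volume of \<open>Q\<close> exceeds that of a cell by the factor 2^n of the
  constant.\<close>

lemma dyadic_poincare:
  fixes \<psi> :: "real^'n::finite \<Rightarrow> real"
  assumes \<psi>: "\<psi> \<in> test_functions U"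
  shows "(\<integral>\<^sup>+x. ennreal ((\<psi> x - dyavg k \<psi> x)\<^sup>2) \<partial>lborel) \<le> ennreal (2^CARD('n) * real CARD('n) * (1/4)^k * grad_sq \<psi>)"
proof -
  note [measurable] = test_functions_borel[OF \<psi>]
  obtain B where B: "\<And>x. \<bar>\<psi> x\<bar> \<le> B" using test_functions_bounded[OF \<psi>] by blast
  let ?m = "ennreal (2^(k * CARD('n)))"
  define h where "h = (\<chi> i::'n. (1/2::real)^k)"
  define Q where "Q = cbox (- h) h"
  have Qm [measurable]: "Q \<in> sets borel" by (simp add: Q_def)
  have eQ: "emeasure lborel Q = ennreal ((2 * (1/2)^k)^CARD('n))"
    unfolding Q_def by (rule emeasure_const_box) (auto simp: h_def)
  have Qn: "(norm z)\<^sup>2 \<le> CARD('n) * (1/4)^k" if "z \<in> Q" for z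
  proof -
    have "\<bar>z $ i\<bar> \<le> (1/2)^k" for i using that by (auto simp: Q_def h_def mem_box_cart abs_le_iff minus_le_iff)
    then have "(z $ i)\<^sup>2 \<le> ((1/2)^k)\<^sup>2" for i by (metis abs_le_square_iff abs_of_nonneg zero_le_power zero_le_divide_1_iff zero_le_numeral)
    moreover have "((1/2::real)^k)\<^sup>2 = (1/4)^k"
      unfolding power2_eq_square power_mult_distrib[symmetric] by simp
    ultimately have "(z $ i)\<^sup>2 \<le> (1/4)^k" for i by metis
    then have "(\<Sum>i\<in>UNIV. (z $ i)\<^sup>2) \<le> (\<Sum>i\<in>(UNIV::'n set). (1/4)^k)" by (intro sum_mono) auto
    then show ?thesis by (simp add: norm_vec_sq)
  qed
  have "(\<integral>\<^sup>+x. ennreal ((\<psi> x - dyavg k \<psi> x)\<^sup>2) \<partial>lborel) \<le>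
      (\<integral>\<^sup>+x. ?m * (\<integral>\<^sup>+z. ennreal (indicator Q z * (\<psi> (x + z) - \<psi> x)\<^sup>2) \<partial>lborel) \<partial>lborel)"
  proof (rule nn_integral_mono)
    fix x
    have bb: "\<bar>\<psi> x - \<psi> y\<bar> \<le> 2 * B" for y using B[of x] B[of y] by linarith
    have "ennreal ((\<psi> x - dyavg k \<psi> x)\<^sup>2) = ennreal ((dyavg k (\<lambda>y. \<psi> x - \<psi> y) x)\<^sup>2)"
      using dyavg_diff_const[of \<psi> B k "\<psi> x" x] B by simp
    also have "\<dots> \<le> ?m * (\<integral>\<^sup>+y. ennreal (indicator (cell k x) y * (\<psi> x - \<psi> y)\<^sup>2) \<partial>lborel)"
      by (rule dyavg_jensen[OF _ bb]) measurable
    also have "\<dots> \<le> ?m * (\<integral>\<^sup>+y. ennreal (indicator Q (y - x) * (\<psi> y - \<psi> x)\<^sup>2) \<partial>lborel)"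
    proof (intro mult_left_mono nn_integral_mono ennreal_leI)
      fix y
      have "y \<in> cell k x \<Longrightarrow> y - x \<in> Q"
        using cell_component[of y k x] by (auto simp: Q_def h_def mem_box_cart abs_le_iff minus_le_iff algebra_simps)
      then show "indicator (cell k x) y * (\<psi> x - \<psi> y)\<^sup>2 \<le> indicator Q (y - x) * (\<psi> y - \<psi> x)\<^sup>2"
        by (auto simp: indicator_def power2_commute)
    qed simp
    also have "(\<integral>\<^sup>+y. ennreal (indicator Q (y - x) * (\<psi> y - \<psi> x)\<^sup>2) \<partial>lborel) =
        (\<integral>\<^sup>+z. ennreal (indicator Q z * (\<psi> (x + z) - \<psi> x)\<^sup>2) \<partial>lborel)"
      using nn_integral_lborel_translate[of "\<lambda>y. ennreal (indicator Q (y - x) * (\<psi> y - \<psi> x)\<^sup>2)" x]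
      by (simp add: add.commute)
    finally show "ennreal ((\<psi> x - dyavg k \<psi> x)\<^sup>2) \<le> ?m * (\<integral>\<^sup>+z. ennreal (indicator Q z * (\<psi> (x + z) - \<psi> x)\<^sup>2) \<partial>lborel)" .
  qed
  also have "\<dots> = ?m * (\<integral>\<^sup>+x. (\<integral>\<^sup>+z. ennreal (indicator Q z * (\<psi> (x + z) - \<psi> x)\<^sup>2) \<partial>lborel) \<partial>lborel)"
    by (rule nn_integral_cmult) measurable
  also have "\<dots> = ?m * (\<integral>\<^sup>+z. (\<integral>\<^sup>+x. ennreal (indicator Q z * (\<psi> (x + z) - \<psi> x)\<^sup>2) \<partial>lborel) \<partial>lborel)"
    by (subst lborel_pair.Fubini') auto
  also have "\<dots> \<le> ?m * (\<integral>\<^sup>+z. ennreal (CARD('n) * (1/4)^k * grad_sq \<psi>) * indicator Q z \<partial>lborel)"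
  proof (intro mult_left_mono nn_integral_mono)
    fix z :: "real^'n"
    show "(\<integral>\<^sup>+x. ennreal (indicator Q z * (\<psi> (x + z) - \<psi> x)\<^sup>2) \<partial>lborel) \<le> ennreal (CARD('n) * (1/4)^k * grad_sq \<psi>) * indicator Q z"
    proof (cases "z \<in> Q")
      case True
      have "(\<integral>\<^sup>+x. ennreal ((\<psi> (x + z) - \<psi> x)\<^sup>2) \<partial>lborel) \<le> ennreal ((norm z)\<^sup>2 * grad_sq \<psi>)"
        by (rule translate_grad_bound[OF \<psi>])
      also have "\<dots> \<le> ennreal (CARD('n) * (1/4)^k * grad_sq \<psi>)"
        by (intro ennreal_leI mult_right_mono Qn True grad_sq_nonneg)
      finally show ?thesis using True by simp
    qed simp
  qed simp
  also have "\<dots> = ?m * (ennreal (CARD('n) * (1/4)^k * grad_sq \<psi>) * ennreal ((2 * (1/2)^k)^CARD('n)))"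
    by (subst nn_integral_cmult_indicator) (auto simp: eQ)
  also have "\<dots> = ennreal (2^(k * CARD('n)) * (CARD('n) * (1/4)^k * grad_sq \<psi> * (2 * (1/2)^k)^CARD('n)))"
    using grad_sq_nonneg[of \<psi>] by (simp add: ennreal_mult')
  also have "2^(k * CARD('n)) * (CARD('n) * (1/4)^k * grad_sq \<psi> * (2 * (1/2)^k)^CARD('n)) =
    (2^(k * CARD('n)) * (1/2)^(k * CARD('n))) * (2^CARD('n) * real CARD('n) * (1/4)^k * grad_sq \<psi>)"
    by (simp only: power_mult_distrib power_mult of_nat_mult of_nat_power of_nat_numeral mult_ac)
  also have "\<dots> = 2^CARD('n) * real CARD('n) * (1/4)^k * grad_sq \<psi>"
    unfolding half_two_pow by simp
  finally show ?thesis .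
qed

section \<open>The interpolation inequality in \<open>L\<^sup>4\<close>\<close>

text \<open>Cauchy-Schwarz twice with weights s^j, s = 19/20. The sum of s^(2j) is at most 400/39,
  below 11, and 1331 = 11^3. The weight is close enough to 1 that s^6 exceeds 2/3, so the loss
  s^(-6j) is beaten by the decay 2^-j of the increments, with ratio at most 3/4.\<close>

lemma weighted_power4_sum:
  fixes d :: "nat \<Rightarrow> real"
  shows "(\<Sum>j<N. d j)^4 \<le> 1331 * (\<Sum>j<N. (d j)^4 / ((19/20)^6)^j)"
proof -
  let ?s = "19/20 :: real"
  have S: "(\<Sum>j<N. (?s^j)\<^sup>2) \<le> 11"
  proof -
    have "(\<Sum>j<N. (?s^j)\<^sup>2) = (\<Sum>j<N. (361/400)^j)"
      by (intro sum.cong refl) (simp add: power2_eq_square flip: power_mult_distrib)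
    also have "\<dots> \<le> (\<Sum>j. (361/400)^j)" by (intro sum_le_suminf summable_geometric) auto
    also have "\<dots> = 400/39" by (subst suminf_geometric) auto
    finally show ?thesis by simp
  qed
  have a: "(\<Sum>j<N. d j)\<^sup>2 \<le> 11 * (\<Sum>j<N. (d j / ?s^j)\<^sup>2)" (is "_ \<le> 11 * ?T")
  proof -
    have "(\<Sum>j<N. d j)\<^sup>2 = (\<Sum>j<N. ?s^j * (d j / ?s^j))\<^sup>2" by simp
    also have "\<dots> \<le> (\<Sum>j<N. (?s^j)\<^sup>2) * ?T" by (rule Cauchy_Schwarz_ineq_sum)
    also have "\<dots> \<le> 11 * ?T" by (intro mult_right_mono S sum_nonneg) auto
    finally show ?thesis .
  qed
  have b: "?T\<^sup>2 \<le> 11 * (\<Sum>j<N. (d j)^4 / (?s^6)^j)"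
  proof -
    have "?T\<^sup>2 = (\<Sum>j<N. ?s^j * ((d j)\<^sup>2 / (?s^j)^3))\<^sup>2"
      by (intro arg_cong[where f="\<lambda>x. x\<^sup>2"] sum.cong refl) (simp add: power_divide power2_eq_square power3_eq_cube)
    also have "\<dots> \<le> (\<Sum>j<N. (?s^j)\<^sup>2) * (\<Sum>j<N. ((d j)\<^sup>2 / (?s^j)^3)\<^sup>2)" by (rule Cauchy_Schwarz_ineq_sum)
    also have "\<dots> \<le> 11 * (\<Sum>j<N. ((d j)\<^sup>2 / (?s^j)^3)\<^sup>2)" by (intro mult_right_mono S sum_nonneg) auto
    also have "(\<Sum>j<N. ((d j)\<^sup>2 / (?s^j)^3)\<^sup>2) = (\<Sum>j<N. (d j)^4 / (?s^6)^j)"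
    proof (intro sum.cong refl)
      fix j
      have "((?s^j)^3)\<^sup>2 = (?s^6)^j" unfolding power_mult[symmetric] by (simp add: mult.commute)
      then show "((d j)\<^sup>2 / (?s^j)^3)\<^sup>2 = (d j)^4 / (?s^6)^j" by (simp only: power_divide) (simp flip: power_mult)
    qed
    finally show ?thesis .
  qed
  have "(\<Sum>j<N. d j)^4 = ((\<Sum>j<N. d j)\<^sup>2)\<^sup>2" by (simp flip: power_mult)
  also have "\<dots> \<le> (11 * ?T)\<^sup>2" by (intro power_mono a) auto
  also have "\<dots> = 121 * ?T\<^sup>2" by (simp add: power_mult_distrib)
  also have "\<dots> \<le> 121 * (11 * (\<Sum>j<N. (d j)^4 / (?s^6)^j))" using b by (intro mult_left_mono) auto
  finally show ?thesis by simp
qed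

lemma ennreal_numeral_linear:
  "0 \<le> a \<Longrightarrow> 0 \<le> b \<Longrightarrow> numeral w * ennreal a + numeral w * ennreal b = ennreal (numeral w * a + numeral w * b)"
  by (simp add: ennreal_plus ennreal_mult')

lemma sum_power4_le: "(a + b)^4 \<le> 8 * a^4 + 8 * b^4" for a b :: real
proof -
  have two: "(x + y)\<^sup>2 \<le> 2 * x\<^sup>2 + 2 * y\<^sup>2" for x y :: real
    using sum_squares_bound[of x y] by (simp add: power2_sum)
  have "(a + b)^4 = ((a + b)\<^sup>2)\<^sup>2" by (simp flip: power_mult)
  also have "\<dots> \<le> (2 * a\<^sup>2 + 2 * b\<^sup>2)\<^sup>2" by (intro power_mono two) auto
  also have "\<dots> \<le> 2 * (2 * a\<^sup>2)\<^sup>2 + 2 * (2 * b\<^sup>2)\<^sup>2" by (rule two)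
  also have "\<dots> = 8 * a^4 + 8 * b^4" by (simp add: power_mult_distrib flip: power_mult)
  finally show ?thesis .
qed

lemma dyavg_bounded:
  fixes f :: "real^'n::finite \<Rightarrow> real"
  assumes [measurable]: "f \<in> borel_measurable borel" and N: "(\<integral>\<^sup>+x. ennreal ((f x)\<^sup>2) \<partial>lborel) = ennreal N" "0 \<le> N"
    and b: "\<And>x. \<bar>f x\<bar> \<le> B"
  shows "(dyavg k f x)\<^sup>2 \<le> 2^(k * CARD('n)) * N"
  using dyavg_contraction[of f B k] N b by (intro cell_const_sup[where D="dyavg k f"]) (auto simp: dyavg_cell_const)

definition sq_int :: "(real^'n::finite \<Rightarrow> real) \<Rightarrow> real" where
  "sq_int \<psi> = (LINT x|lborel. (\<psi> x)\<^sup>2)"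

lemma sq_int_nonneg: "0 \<le> sq_int \<psi>"
  unfolding sq_int_def by (intro integral_nonneg_AE) auto

lemma nn_sq_int:
  assumes \<psi>: "\<psi> \<in> test_functions U"
  shows "(\<integral>\<^sup>+x. ennreal ((\<psi> x)\<^sup>2) \<partial>lborel) = ennreal (sq_int \<psi>)"
  unfolding sq_int_def by (rule nn_integral_eq_integral) (auto intro!: test_integrable_sq[OF \<psi>])

text \<open>Poincare at two levels makes the squared L^2 norm of order 4^-k. The increment is
  constant on cells of level \<open>Suc k\<close>, so passing to L^4 costs 2^((k+1)n), at most
  8^(k+1), times the square of that bound; 8^k 16^-k = 2^-k is the gain in dimension at most 3. Here
  24 = 8 * 3 bounds the Poincare constant and 128 = 8 * 16.\<close>

lemma dyadic_increment_L4:
  fixes \<psi> :: "real^'n::finite \<Rightarrow> real"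
  assumes \<psi>: "\<psi> \<in> test_functions U" and n: "CARD('n) \<le> 3"
  shows "(\<integral>\<^sup>+x. ennreal ((dyavg (Suc k) \<psi> x - dyavg k \<psi> x)^4) \<partial>lborel) \<le> ennreal (128 * 24\<^sup>2 * (1/2)^k * (grad_sq \<psi>)\<^sup>2)"
proof -
  note [measurable] = test_functions_borel[OF \<psi>]
  define C where "C = 2^CARD('n) * real CARD('n)"
  define G where "G = grad_sq \<psi>"
  have G: "0 \<le> G" by (simp add: G_def grad_sq_nonneg)
  have C0: "0 \<le> C" by (simp add: C_def)
  have p8: "(2::real)^CARD('n) \<le> 2^3" using n by (intro power_increasing) auto
  have C: "C \<le> 24"
    unfolding C_def using mult_mono[OF p8, of "real CARD('n)" 3] n by simp
  let ?D = "\<lambda>x. dyavg (Suc k) \<psi> x - dyavg k \<psi> x"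
  have "(\<integral>\<^sup>+x. ennreal ((?D x)\<^sup>2) \<partial>lborel) \<le>
     (\<integral>\<^sup>+x. 2 * ennreal ((\<psi> x - dyavg k \<psi> x)\<^sup>2) + 2 * ennreal ((\<psi> x - dyavg (Suc k) \<psi> x)\<^sup>2) \<partial>lborel)"
  proof (rule nn_integral_mono)
    fix x
    have "(a - b)\<^sup>2 \<le> 2 * a\<^sup>2 + 2 * b\<^sup>2" for a b :: real
      using zero_le_power2[of "a + b"] by (simp add: power2_sum power2_diff)
    from this[of "\<psi> x - dyavg k \<psi> x" "\<psi> x - dyavg (Suc k) \<psi> x"]
    have "(?D x)\<^sup>2 \<le> 2 * (\<psi> x - dyavg k \<psi> x)\<^sup>2 + 2 * (\<psi> x - dyavg (Suc k) \<psi> x)\<^sup>2" by simp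
    then have "ennreal ((?D x)\<^sup>2) \<le> ennreal (2 * (\<psi> x - dyavg k \<psi> x)\<^sup>2 + 2 * (\<psi> x - dyavg (Suc k) \<psi> x)\<^sup>2)"
      by (rule ennreal_leI)
    also have "\<dots> = 2 * ennreal ((\<psi> x - dyavg k \<psi> x)\<^sup>2) + 2 * ennreal ((\<psi> x - dyavg (Suc k) \<psi> x)\<^sup>2)"
      by (intro ennreal_numeral_linear[symmetric] ennreal_numeral_linear) auto
    finally show "ennreal ((?D x)\<^sup>2) \<le> 2 * ennreal ((\<psi> x - dyavg k \<psi> x)\<^sup>2) + 2 * ennreal ((\<psi> x - dyavg (Suc k) \<psi> x)\<^sup>2)" .
  qed
  also have "\<dots> = 2 * (\<integral>\<^sup>+x. ennreal ((\<psi> x - dyavg k \<psi> x)\<^sup>2) \<partial>lborel) + 2 * (\<integral>\<^sup>+x. ennreal ((\<psi> x - dyavg (Suc k) \<psi> x)\<^sup>2) \<partial>lborel)"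
    by (subst nn_integral_add) (auto simp: nn_integral_cmult)
  also have "\<dots> \<le> 2 * ennreal (C * (1/4)^k * G) + 2 * ennreal (C * (1/4)^Suc k * G)"
    unfolding C_def G_def by (intro add_mono mult_left_mono dyadic_poincare[OF \<psi>]) auto
  also have "\<dots> = ennreal (2 * (C * (1/4)^k * G) + 2 * (C * (1/4)^Suc k * G))"
    using C0 G by (intro ennreal_numeral_linear) auto
  also have "\<dots> \<le> ennreal (4 * (C * (1/4)^k * G))"
    using C0 G by (intro ennreal_leI) (auto intro!: mult_nonneg_nonneg)
  finally have D2: "(\<integral>\<^sup>+x. ennreal ((?D x)\<^sup>2) \<partial>lborel) \<le> ennreal (4 * (C * (1/4)^k * G))" .
  have Dm: "?D \<in> borel_measurable borel" by measurable
  have "(\<integral>\<^sup>+x. ennreal ((?D x)^4) \<partial>lborel) \<le> ennreal (2^(Suc k * CARD('n)) * (4 * (C * (1/4)^k * G))\<^sup>2)"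
    by (rule cell_const_L4[OF Dm _ D2])
      (use C0 G in \<open>auto simp: dyavg_cell_const cell_refine simp del: power_Suc intro!: mult_nonneg_nonneg\<close>)
  also have "\<dots> \<le> ennreal (128 * 24\<^sup>2 * (1/2)^k * G\<^sup>2)"
  proof (rule ennreal_leI)
    have "(2::real)^(Suc k * CARD('n)) \<le> 2^(Suc k * 3)" using n by (intro power_increasing mult_le_mono2) auto
    also have "\<dots> = 8^Suc k" by (simp only: power_mult mult.commute[of "Suc k"]) simp
    finally have "2^(Suc k * CARD('n)) * (4 * (C * (1/4)^k * G))\<^sup>2 \<le> 8^Suc k * (4 * (24 * (1/4)^k * G))\<^sup>2"
      using C C0 G by (intro mult_mono power_mono) (auto intro!: mult_mono mult_nonneg_nonneg)
    also have "\<dots> = 128 * 24\<^sup>2 * (8^k * ((1/4)^k * (1/4)^k)) * G\<^sup>2"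
      by (simp add: power2_eq_square)
    also have "8^k * ((1/4)^k * (1/4)^k) = (1/2::real)^k"
      by (simp only: power_mult_distrib[symmetric]) simp
    finally show "2^(Suc k * CARD('n)) * (4 * (C * (1/4)^k * G))\<^sup>2 \<le> 128 * 24\<^sup>2 * (1/2)^k * G\<^sup>2" .
  qed
  finally show ?thesis by (simp add: G_def)
qed

text \<open>The remainder is the sum of all increments from level \<open>m\<close> on. Finite sums
  are bounded uniformly by \<open>weighted_power4_sum\<close>, the factor 4 being the sum of
  (3/4)^j, and Fatou passes to the limit since the averages converge pointwise.\<close>

lemma dyadic_remainder_L4:
  fixes \<psi> :: "real^'n::finite \<Rightarrow> real"
  assumes \<psi>: "\<psi> \<in> test_functions U" and n: "CARD('n) \<le> 3"
  shows "(\<integral>\<^sup>+x. ennreal ((\<psi> x - dyavg m \<psi> x)^4) \<partial>lborel) \<le> ennreal (1331 * 4 * (128 * 24\<^sup>2) * (1/2)^m * (grad_sq \<psi>)\<^sup>2)"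
proof -
  note [measurable] = test_functions_borel[OF \<psi>]
  obtain B where B: "\<And>x. \<bar>\<psi> x\<bar> \<le> B" using test_functions_bounded[OF \<psi>] by blast
  define K where "K = 128 * 24\<^sup>2 * (1/2)^m * (grad_sq \<psi>)\<^sup>2"
  have K: "0 \<le> K" by (simp add: K_def)
  let ?d = "\<lambda>j x. dyavg (Suc (m + j)) \<psi> x - dyavg (m + j) \<psi> x"
  have part: "(\<integral>\<^sup>+x. ennreal ((dyavg (m + N) \<psi> x - dyavg m \<psi> x)^4) \<partial>lborel) \<le> ennreal (1331 * 4 * K)" for N
  proof -
    have "(\<integral>\<^sup>+x. ennreal ((dyavg (m + N) \<psi> x - dyavg m \<psi> x)^4) \<partial>lborel) \<le>
       (\<integral>\<^sup>+x. (\<Sum>j<N. ennreal (1331 / ((19/20)^6)^j) * ennreal ((?d j x)^4)) \<partial>lborel)"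
    proof (rule nn_integral_mono)
      fix x
      have "dyavg (m + N) \<psi> x - dyavg m \<psi> x = (\<Sum>j<N. ?d j x)"
        using sum_lessThan_telescope[of "\<lambda>j. dyavg (m + j) \<psi> x" N] by simp
      then have "(dyavg (m + N) \<psi> x - dyavg m \<psi> x)^4 \<le> 1331 * (\<Sum>j<N. (?d j x)^4 / ((19/20)^6)^j)"
        by (simp only: weighted_power4_sum)
      also have "\<dots> = (\<Sum>j<N. 1331 / ((19/20)^6)^j * (?d j x)^4)" by (simp add: sum_distrib_left)
      finally have "ennreal ((dyavg (m + N) \<psi> x - dyavg m \<psi> x)^4) \<le> ennreal (\<Sum>j<N. 1331 / ((19/20)^6)^j * (?d j x)^4)"
        by (rule ennreal_leI)
      also have "\<dots> = (\<Sum>j<N. ennreal (1331 / ((19/20)^6)^j) * ennreal ((?d j x)^4))"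
      proof -
        have "ennreal (\<Sum>j<N. 1331 / ((19/20)^6)^j * (?d j x)^4) = (\<Sum>j<N. ennreal (1331 / ((19/20)^6)^j * (?d j x)^4))"
          by (rule sum_ennreal[symmetric]) auto
        also have "\<dots> = (\<Sum>j<N. ennreal (1331 / ((19/20)^6)^j) * ennreal ((?d j x)^4))"
          by (intro sum.cong refl ennreal_mult) auto
        finally show ?thesis .
      qed
      finally show "ennreal ((dyavg (m + N) \<psi> x - dyavg m \<psi> x)^4) \<le> (\<Sum>j<N. ennreal (1331 / ((19/20)^6)^j) * ennreal ((?d j x)^4))" .
    qed
    also have "\<dots> = (\<Sum>j<N. ennreal (1331 / ((19/20)^6)^j) * (\<integral>\<^sup>+x. ennreal ((?d j x)^4) \<partial>lborel))"
      by (subst nn_integral_sum) (auto simp: nn_integral_cmult)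
    also have "\<dots> \<le> (\<Sum>j<N. ennreal (1331 * K * (3/4)^j))"
    proof (rule sum_mono)
      fix j
      have "ennreal (1331 / ((19/20)^6)^j) * (\<integral>\<^sup>+x. ennreal ((?d j x)^4) \<partial>lborel) \<le>
         ennreal (1331 / ((19/20)^6)^j) * ennreal (128 * 24\<^sup>2 * (1/2)^(m + j) * (grad_sq \<psi>)\<^sup>2)"
        using dyadic_increment_L4[OF \<psi> n, of "m + j"] by (intro mult_left_mono) auto
      also have "\<dots> = ennreal (1331 / ((19/20)^6)^j * (128 * 24\<^sup>2 * (1/2)^(m + j) * (grad_sq \<psi>)\<^sup>2))"
        by (rule ennreal_mult[symmetric]) auto
      also have "1331 / ((19/20)^6)^j * (128 * 24\<^sup>2 * (1/2)^(m + j) * (grad_sq \<psi>)\<^sup>2) = 1331 * K * ((1/2)^j / ((19/20)^6)^j)"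
        by (simp add: K_def power_add)
      also have "((1/2)^j / ((19/20)^6)^j) = ((1/2) / (19/20)^6 :: real)^j" by (simp only: power_divide)
      also have "ennreal (1331 * K * ((1/2) / (19/20)^6)^j) \<le> ennreal (1331 * K * (3/4)^j)"
        using K by (intro ennreal_leI mult_left_mono power_mono) (auto simp: eval_nat_numeral)
      finally show "ennreal (1331 / ((19/20)^6)^j) * (\<integral>\<^sup>+x. ennreal ((?d j x)^4) \<partial>lborel) \<le> ennreal (1331 * K * (3/4)^j)" .
    qed
    also have "\<dots> = ennreal (\<Sum>j<N. 1331 * K * (3/4)^j)" using K by (intro sum_ennreal) auto
    also have "\<dots> \<le> ennreal (1331 * 4 * K)"
    proof (rule ennreal_leI)
      have "(\<Sum>j<N. (3/4::real)^j) \<le> (\<Sum>j. (3/4)^j)" by (intro sum_le_suminf summable_geometric) auto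
      also have "\<dots> = 4" by (subst suminf_geometric) auto
      finally have "1331 * K * (\<Sum>j<N. (3/4::real)^j) \<le> 1331 * K * 4" using K by (intro mult_left_mono) auto
      then show "(\<Sum>j<N. 1331 * K * (3/4)^j) \<le> 1331 * 4 * K" by (simp add: sum_distrib_left)
    qed
    finally show ?thesis .
  qed
  have "(\<integral>\<^sup>+x. ennreal ((\<psi> x - dyavg m \<psi> x)^4) \<partial>lborel) =
     (\<integral>\<^sup>+x. liminf (\<lambda>N. ennreal ((dyavg (m + N) \<psi> x - dyavg m \<psi> x)^4)) \<partial>lborel)"
  proof (rule nn_integral_cong)
    fix x
    have "(\<lambda>N. dyavg N \<psi> x) \<longlonglongrightarrow> \<psi> x"
      by (rule dyavg_tendsto[OF test_functions_continuous[OF \<psi>] B])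
    then have "(\<lambda>N. dyavg (N + m) \<psi> x) \<longlonglongrightarrow> \<psi> x" by (rule LIMSEQ_ignore_initial_segment)
    then have "(\<lambda>N. ennreal ((dyavg (m + N) \<psi> x - dyavg m \<psi> x)^4)) \<longlonglongrightarrow> ennreal ((\<psi> x - dyavg m \<psi> x)^4)"
      by (intro tendsto_intros) (simp_all add: add.commute)
    then show "ennreal ((\<psi> x - dyavg m \<psi> x)^4) = liminf (\<lambda>N. ennreal ((dyavg (m + N) \<psi> x - dyavg m \<psi> x)^4))"
      by (metis lim_imp_Liminf trivial_limit_sequentially)
  qed
  also have "\<dots> \<le> liminf (\<lambda>N. \<integral>\<^sup>+x. ennreal ((dyavg (m + N) \<psi> x - dyavg m \<psi> x)^4) \<partial>lborel)"
    by (rule nn_integral_liminf) measurable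
  also have "\<dots> \<le> ennreal (1331 * 4 * K)"
    by (rule order_trans[OF Liminf_le_Limsup Limsup_bounded]) (use part in auto)
  finally show ?thesis by (simp add: K_def mult.assoc)
qed

text \<open>Splits into the remainder beyond level \<open>m\<close>, whose L^4 bound carries 2^-m on
  the gradient, and the average at level \<open>m\<close>, which costs only L^2 with a constant
  growing in \<open>m\<close>. Choosing \<open>m\<close> large makes the gradient weight as small as
  desired.\<close>

lemma test_L4_interpolation:
  assumes n: "CARD('n::finite) \<le> 3" and e: "e > 0"
  shows "\<exists>C\<ge>0. \<forall>U. \<forall>\<psi>\<in>test_functions (U :: (real^'n) set).
    (\<integral>\<^sup>+x. ennreal ((\<psi> x)^4) \<partial>lborel) \<le> ennreal (e * (grad_sq \<psi>)\<^sup>2 + C * (sq_int \<psi>)\<^sup>2)"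
proof -
  define c :: real where "c = 8 * (1331 * 4 * (128 * 24\<^sup>2))"
  have c: "c > 0" by (simp add: c_def)
  obtain m where m: "(1/2::real)^m < e / c"
    using real_arch_pow_inv[of "e/c" "1/2"] e c by auto
  have "(\<integral>\<^sup>+x. ennreal ((\<psi> x)^4) \<partial>lborel) \<le> ennreal (e * (grad_sq \<psi>)\<^sup>2 + 8 * 2^(m * CARD('n)) * (sq_int \<psi>)\<^sup>2)"
    if \<psi>: "\<psi> \<in> test_functions U" for U and \<psi> :: "real^'n \<Rightarrow> real"
  proof -
    note [measurable] = test_functions_borel[OF \<psi>]
    obtain B where B: "\<And>x. \<bar>\<psi> x\<bar> \<le> B" using test_functions_bounded[OF \<psi>] by blast
    have P: "(\<integral>\<^sup>+x. ennreal ((dyavg m \<psi> x)^4) \<partial>lborel) \<le> ennreal (2^(m * CARD('n)) * (sq_int \<psi>)\<^sup>2)"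
    proof (rule cell_const_L4)
      show "(\<integral>\<^sup>+x. ennreal ((dyavg m \<psi> x)\<^sup>2) \<partial>lborel) \<le> ennreal (sq_int \<psi>)"
        using dyavg_contraction[of \<psi> B m] B nn_sq_int[OF \<psi>] by simp
    qed (auto simp: dyavg_cell_const sq_int_nonneg)
    have "(\<integral>\<^sup>+x. ennreal ((\<psi> x)^4) \<partial>lborel) \<le>
      (\<integral>\<^sup>+x. 8 * ennreal ((\<psi> x - dyavg m \<psi> x)^4) + 8 * ennreal ((dyavg m \<psi> x)^4) \<partial>lborel)"
    proof (rule nn_integral_mono)
      fix x
      have "ennreal ((\<psi> x)^4) \<le> ennreal (8 * (\<psi> x - dyavg m \<psi> x)^4 + 8 * (dyavg m \<psi> x)^4)"
        using sum_power4_le[of "\<psi> x - dyavg m \<psi> x" "dyavg m \<psi> x"] by (intro ennreal_leI) simp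
      also have "\<dots> = 8 * ennreal ((\<psi> x - dyavg m \<psi> x)^4) + 8 * ennreal ((dyavg m \<psi> x)^4)"
        by (intro ennreal_numeral_linear[symmetric] ennreal_numeral_linear) auto
      finally show "ennreal ((\<psi> x)^4) \<le> 8 * ennreal ((\<psi> x - dyavg m \<psi> x)^4) + 8 * ennreal ((dyavg m \<psi> x)^4)" .
    qed
    also have "\<dots> = 8 * (\<integral>\<^sup>+x. ennreal ((\<psi> x - dyavg m \<psi> x)^4) \<partial>lborel) + 8 * (\<integral>\<^sup>+x. ennreal ((dyavg m \<psi> x)^4) \<partial>lborel)"
      by (subst nn_integral_add) (auto simp: nn_integral_cmult)
    also have "\<dots> \<le> 8 * ennreal (1331 * 4 * (128 * 24\<^sup>2) * (1/2)^m * (grad_sq \<psi>)\<^sup>2) + 8 * ennreal (2^(m * CARD('n)) * (sq_int \<psi>)\<^sup>2)"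
      by (intro add_mono mult_left_mono dyadic_remainder_L4[OF \<psi> n] P) auto
    also have "\<dots> = ennreal (8 * (1331 * 4 * (128 * 24\<^sup>2) * (1/2)^m * (grad_sq \<psi>)\<^sup>2) + 8 * (2^(m * CARD('n)) * (sq_int \<psi>)\<^sup>2))"
      by (intro ennreal_numeral_linear[symmetric] ennreal_numeral_linear) auto
    also have "\<dots> \<le> ennreal (e * (grad_sq \<psi>)\<^sup>2 + 8 * 2^(m * CARD('n)) * (sq_int \<psi>)\<^sup>2)"
    proof (rule ennreal_leI)
      have "c * (1/2)^m \<le> e" using m c by (simp add: pos_less_divide_eq mult.commute)
      then have "(c * (1/2)^m) * (grad_sq \<psi>)\<^sup>2 \<le> e * (grad_sq \<psi>)\<^sup>2" by (rule mult_right_mono) auto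
      then show "8 * (1331 * 4 * (128 * 24\<^sup>2) * (1/2)^m * (grad_sq \<psi>)\<^sup>2) + 8 * (2^(m * CARD('n)) * (sq_int \<psi>)\<^sup>2)
          \<le> e * (grad_sq \<psi>)\<^sup>2 + 8 * 2^(m * CARD('n)) * (sq_int \<psi>)\<^sup>2" by (simp add: c_def)
    qed
    finally show ?thesis .
  qed
  then show ?thesis by (intro exI[of _ "8 * 2^(m * CARD('n))"]) auto
qed

lemma norm_test_sq: "\<psi> \<in> test_functions U \<Longrightarrow> (norm (abs_l2 \<psi>))\<^sup>2 = sq_int \<psi>"
proof -
  assume \<psi>: "\<psi> \<in> test_functions U"
  note [measurable] = test_functions_borel[OF \<psi>]
  show ?thesis unfolding norm_abs_l2[OF test_functions_sq_integrable[OF \<psi>]] sq_int_def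
    by (rule integral_lebesgue_lborel) measurable
qed

context open_domain begin

lemma norm_grad_test_sq:
  assumes \<psi>: "\<psi> \<in> test_functions \<Omega>"
  shows "(norm (grad \<Omega> (abs_l2 \<psi>)))\<^sup>2 = grad_sq \<psi>"
proof -
  have "(norm (grad \<Omega> (abs_l2 \<psi>)))\<^sup>2 = (\<Sum>i\<in>UNIV. (norm (abs_l2 (partial_deriv i \<psi>)))\<^sup>2)"
    using H1_test[OF \<psi>] by (simp add: norm_vec_sq)
  also have "\<dots> = (\<Sum>i\<in>UNIV. sq_int (partial_deriv i \<psi>))"
    using norm_test_sq[OF partial_deriv_test[OF \<psi>]] by simp
  also have "\<dots> = grad_sq \<psi>"
    unfolding grad_sq_def sq_int_def
    by (rule Bochner_Integration.integral_sum[symmetric]) (rule test_integrable_sq[OF partial_deriv_test[OF \<psi>]])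
  finally show ?thesis .
qed

text \<open>Fatou along an almost everywhere convergent subsequence of approximating test functions;
  the right side is continuous in the graph norm.\<close>

lemma H10_L4_interpolation:
  assumes n: "CARD('n) \<le> 3" and e: "e > 0"
  shows "\<exists>C\<ge>0. \<forall>u\<in>H10 \<Omega>.
    (\<integral>\<^sup>+x. ennreal ((rep_l2 u x)^4) \<partial>lebesgue) \<le> ennreal (e * (norm (grad \<Omega> u))^4 + C * (norm u)^4)"
proof -
  obtain C where C: "C \<ge> 0" "\<And>\<psi>. \<psi> \<in> test_functions \<Omega> \<Longrightarrow>
    (\<integral>\<^sup>+x. ennreal ((\<psi> x)^4) \<partial>lborel) \<le> ennreal (e * (grad_sq \<psi>)\<^sup>2 + C * (sq_int \<psi>)\<^sup>2)"
    using test_L4_interpolation[OF n e] by blast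
  have "(\<integral>\<^sup>+x. ennreal ((rep_l2 u x)^4) \<partial>lebesgue) \<le> ennreal (e * (norm (grad \<Omega> u))^4 + C * (norm u)^4)"
    if u: "u \<in> H10 \<Omega>" for u
  proof -
    obtain \<psi> where \<psi>: "\<And>j. \<psi> j \<in> test_functions \<Omega>" "(\<lambda>j. abs_l2 (\<psi> j)) \<longlonglongrightarrow> u"
      "(\<lambda>j. grad \<Omega> (abs_l2 (\<psi> j))) \<longlonglongrightarrow> grad \<Omega> u"
      using H10_seq[OF u] by blast
    obtain r where r: "strict_mono r" "AE x in lebesgue. (\<lambda>j. rep_l2 (abs_l2 (\<psi> (r j))) x) \<longlonglongrightarrow> rep_l2 u x"
      using l2_subseq_AE_tendsto[OF \<psi>(2)] by blast
    have ae: "AE x in lebesgue. \<forall>j. rep_l2 (abs_l2 (\<psi> j)) x = \<psi> j x"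
      by (subst AE_all_countable) (simp add: rep_abs_l2 test_functions_sq_integrable[OF \<psi>(1)])
    have [measurable]: "\<psi> j \<in> borel_measurable lebesgue" for j
      by (rule borel_measurable_lebesgueI[OF test_functions_borel[OF \<psi>(1)]])
    have [measurable]: "\<psi> j \<in> borel_measurable borel" for j
      by (rule test_functions_borel[OF \<psi>(1)])
    let ?R = "\<lambda>w. e * (norm (grad \<Omega> w))^4 + C * (norm w)^4"
    have "(\<integral>\<^sup>+x. ennreal ((rep_l2 u x)^4) \<partial>lebesgue) = (\<integral>\<^sup>+x. liminf (\<lambda>j. ennreal ((\<psi> (r j) x)^4)) \<partial>lebesgue)"
    proof (rule nn_integral_cong_AE, use r(2) ae in eventually_elim)
      case (elim x)
      then have "(\<lambda>j. ennreal ((\<psi> (r j) x)^4)) \<longlonglongrightarrow> ennreal ((rep_l2 u x)^4)" by (intro tendsto_intros) auto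
      then show ?case by (metis lim_imp_Liminf trivial_limit_sequentially)
    qed
    also have "\<dots> \<le> liminf (\<lambda>j. \<integral>\<^sup>+x. ennreal ((\<psi> (r j) x)^4) \<partial>lebesgue)"
      by (rule nn_integral_liminf) measurable
    also have "\<dots> \<le> liminf (\<lambda>j. ennreal (?R (abs_l2 (\<psi> (r j)))))"
    proof (rule Liminf_mono, rule always_eventually, rule allI)
      fix j
      have "(\<integral>\<^sup>+x. ennreal ((\<psi> (r j) x)^4) \<partial>lebesgue) = (\<integral>\<^sup>+x. ennreal ((\<psi> (r j) x)^4) \<partial>lborel)"
        by (rule nn_integral_completion)
      also have "\<dots> \<le> ennreal (e * (grad_sq (\<psi> (r j)))\<^sup>2 + C * (sq_int (\<psi> (r j)))\<^sup>2)" by (rule C(2)[OF \<psi>(1)])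
      also have "e * (grad_sq (\<psi> (r j)))\<^sup>2 + C * (sq_int (\<psi> (r j)))\<^sup>2 = ?R (abs_l2 (\<psi> (r j)))"
        unfolding norm_grad_test_sq[OF \<psi>(1), symmetric] norm_test_sq[OF \<psi>(1), symmetric] by (simp flip: power_mult)
      finally show "(\<integral>\<^sup>+x. ennreal ((\<psi> (r j) x)^4) \<partial>lebesgue) \<le> ennreal (?R (abs_l2 (\<psi> (r j))))" .
    qed
    also have "\<dots> = ennreal (?R u)"
    proof (rule lim_imp_Liminf)
      have "(\<lambda>j. ennreal (?R (abs_l2 (\<psi> j)))) \<longlonglongrightarrow> ennreal (?R u)" by (intro tendsto_intros \<psi>)
      then show "(\<lambda>j. ennreal (?R (abs_l2 (\<psi> (r j))))) \<longlonglongrightarrow> ennreal (?R u)"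
        by (rule LIMSEQ_subseq_LIMSEQ[OF _ r(1), unfolded o_def])
    qed simp
    finally show ?thesis .
  qed
  with C(1) show ?thesis by blast
qed

lemma H10_square_sq_integrable:
  assumes n: "CARD('n) \<le> 3" and u: "u \<in> H10 \<Omega>"
  shows "sq_integrable (\<lambda>x. (rep_l2 u x)\<^sup>2)"
proof (rule sq_integrable_nn_integral)
  obtain C where "(\<integral>\<^sup>+x. ennreal ((rep_l2 u x)^4) \<partial>lebesgue) \<le> ennreal (1 * (norm (grad \<Omega> u))^4 + C * (norm u)^4)"
    using H10_L4_interpolation[OF n zero_less_one] u by blast
  then show "(\<integral>\<^sup>+x. ennreal (((rep_l2 u x)\<^sup>2)\<^sup>2) \<partial>lebesgue) < \<infinity>"
    by (simp add: le_less_trans flip: power_mult)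
qed measurable

text \<open>The bound in the form in which it is used: quadratic terms cost squared gradient norms.
  With weight 1 this makes the reaction integrable in time, with small weight diffusion absorbs
  it.\<close>

lemma H10_square_norm:
  assumes n: "CARD('n) \<le> 3" and e: "e > 0"
  shows "\<exists>C\<ge>0. \<forall>u\<in>H10 \<Omega>. norm (abs_l2 (\<lambda>x. (rep_l2 u x)\<^sup>2)) \<le> e * (norm (grad \<Omega> u))\<^sup>2 + C * (norm u)\<^sup>2"
proof -
  have "e\<^sup>2 > 0" using e by simp
  then obtain C where C: "C \<ge> 0" "\<And>u. u \<in> H10 \<Omega> \<Longrightarrow>
      (\<integral>\<^sup>+x. ennreal ((rep_l2 u x)^4) \<partial>lebesgue) \<le> ennreal (e\<^sup>2 * (norm (grad \<Omega> u))^4 + C * (norm u)^4)"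
    using H10_L4_interpolation[OF n] by blast
  have "norm (abs_l2 (\<lambda>x. (rep_l2 u x)\<^sup>2)) \<le> e * (norm (grad \<Omega> u))\<^sup>2 + sqrt C * (norm u)\<^sup>2" if u: "u \<in> H10 \<Omega>" for u
  proof (rule power2_le_imp_le)
    have sq: "sq_integrable (\<lambda>x. (rep_l2 u x)\<^sup>2)" by (rule H10_square_sq_integrable[OF n u])
    have "ennreal ((norm (abs_l2 (\<lambda>x. (rep_l2 u x)\<^sup>2)))\<^sup>2) = (\<integral>\<^sup>+x. ennreal (((rep_l2 u x)\<^sup>2)\<^sup>2) \<partial>lebesgue)"
      unfolding norm_abs_l2[OF sq] by (rule nn_integral_eq_integral[symmetric]) (use sq in \<open>auto simp: sq_integrable_def\<close>)
    also have "\<dots> \<le> ennreal (e\<^sup>2 * (norm (grad \<Omega> u))^4 + C * (norm u)^4)"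
      using C(2)[OF u] by (simp flip: power_mult)
    finally have "(norm (abs_l2 (\<lambda>x. (rep_l2 u x)\<^sup>2)))\<^sup>2 \<le> e\<^sup>2 * (norm (grad \<Omega> u))^4 + C * (norm u)^4"
      using C(1) by (subst (asm) ennreal_le_iff) auto
    also have "\<dots> = (e * (norm (grad \<Omega> u))\<^sup>2)\<^sup>2 + (sqrt C * (norm u)\<^sup>2)\<^sup>2"
      using C(1) by (simp add: power_mult_distrib flip: power_mult)
    also have "\<dots> \<le> (e * (norm (grad \<Omega> u))\<^sup>2 + sqrt C * (norm u)\<^sup>2)\<^sup>2"
      using e C(1) by (simp add: power2_sum)
    finally show "(norm (abs_l2 (\<lambda>x. (rep_l2 u x)\<^sup>2)))\<^sup>2 \<le> (e * (norm (grad \<Omega> u))\<^sup>2 + sqrt C * (norm u)\<^sup>2)\<^sup>2" .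
  qed (use e C(1) in auto)
  then show ?thesis using C(1) by (intro exI[of _ "sqrt C"]) auto
qed

end

section \<open>Compactness of the embedding of \<open>H\<^sub>0\<^sup>1\<close>\<close>

lemma dyavg_diff:
  fixes f g :: "real^'n::finite \<Rightarrow> real"
  assumes "f \<in> borel_measurable borel" "\<And>x. \<bar>f x\<bar> \<le> B" "g \<in> borel_measurable borel" "\<And>x. \<bar>g x\<bar> \<le> B'"
  shows "dyavg k (\<lambda>y. f y - g y) x = dyavg k f x - dyavg k g x"
proof -
  have "(LINT y|lborel. indicator (cell k x) y * (f y - g y)) =
     (LINT y|lborel. indicator (cell k x) y * f y) - (LINT y|lborel. indicator (cell k x) y * g y)"
    unfolding right_diff_distrib
    by (intro Bochner_Integration.integral_diff cell_integrable[where B=B] cell_integrable[where B=B'] assms)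
  then show ?thesis unfolding dyavg_eq by (simp add: right_diff_distrib)
qed

lemma finite_cells:
  fixes \<Omega> :: "(real^'n::finite) set"
  assumes "bounded \<Omega>"
  shows "\<exists>X. finite X \<and> (\<forall>x\<in>\<Omega>. \<exists>x'\<in>X. x \<in> cell k x')"
proof -
  define q where "q x = (\<lambda>i. \<lfloor>2^k * (x::real^'n) $ i\<rfloor>)" for x
  obtain M where M: "\<And>x. x \<in> \<Omega> \<Longrightarrow> norm x \<le> M" using assms by (auto simp: bounded_iff)
  define N where "N = \<lceil>2^k * M\<rceil> + 1"
  have "q ` \<Omega> \<subseteq> Pi\<^sub>E UNIV (\<lambda>_. {-N..N})"
  proof (rule image_subsetI)
    fix x assume "x \<in> \<Omega>"
    then have "\<bar>x $ i\<bar> \<le> M" for i using M component_le_norm_cart[of x i] by fastforce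
    then have b: "\<bar>2^k * x $ i\<bar> \<le> 2^k * M" for i by (simp add: abs_mult)
    have "- N \<le> q x i \<and> q x i \<le> N" for i
      unfolding q_def N_def using b[of i] by linarith
    then show "q x \<in> Pi\<^sub>E UNIV (\<lambda>_. {-N..N})" by (auto simp: PiE_def)
  qed
  then have "finite (q ` \<Omega>)" by (rule finite_subset) (rule finite_PiE, auto)
  moreover have "\<forall>c\<in>q ` \<Omega>. \<exists>x. x \<in> \<Omega> \<and> q x = c" by auto
  then obtain s where s: "\<And>c. c \<in> q ` \<Omega> \<Longrightarrow> s c \<in> \<Omega> \<and> q (s c) = c" by metis
  ultimately show ?thesis
    using s by (intro exI[of _ "s ` q ` \<Omega>"]) (force simp: cell_def q_def fun_eq_iff)
qed

locale bounded_open_domain = open_domain \<Omega> for \<Omega> :: "(real^'n::finite) set" +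
  assumes bounded_\<Omega>: "bounded \<Omega>"
begin

text \<open>Averages on the finitely many cells meeting the domain are rounded to multiples of
  \<open>d\<close>. Only finitely many rounded patterns occur, and two functions with the same
  pattern are close, because their averages are close and the Poincare inequality controls the rest.
  One representative per pattern forms the net.\<close>

lemma test_totally_bounded:
  assumes e: "e > 0" and R: "R > 0"
  shows "\<exists>F. finite F \<and> (\<forall>\<psi>\<in>test_functions \<Omega>. sq_int \<psi> \<le> R \<and> grad_sq \<psi> \<le> R \<longrightarrow> (\<exists>v\<in>F. (norm (abs_l2 \<psi> - v))\<^sup>2 \<le> e))"
proof -
  define C where "C = 2^CARD('n) * real CARD('n)"
  have C: "C > 0" unfolding C_def by (intro mult_pos_pos) auto
  \<comment> \<open>The difference of two admissible functions has squared gradient at most 4R, so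
    this makes the Poincare term at most e/4.\<close>
  obtain k where k: "(1/4::real)^k < e / (16 * C * R)"
    using real_arch_pow_inv[of "e / (16 * C * R)" "1/4"] e C R by auto
  obtain X where X: "finite X" "\<And>x. x \<in> \<Omega> \<Longrightarrow> \<exists>x'\<in>X. x \<in> cell k x'"
    using finite_cells[OF bounded_\<Omega>, of k] by blast
  \<comment> \<open>Cells have volume at most 1, so an error \<open>d\<close> on each of them
    contributes at most e/4; the added 1 covers an empty \<open>X\<close>.\<close>
  define d where "d = sqrt (e / (4 * (real (card X) + 1)))"
  have d: "d > 0" using e by (simp add: d_def)
  have d2: "d\<^sup>2 * real (card X) \<le> e / 4"
    using e by (simp add: d_def field_simps)
  define T where "T = {\<psi> \<in> test_functions \<Omega>. sq_int \<psi> \<le> R \<and> grad_sq \<psi> \<le> R}"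
  define q where "q \<psi> = (\<lambda>x\<in>X. \<lfloor>dyavg k \<psi> x / d\<rfloor>)" for \<psi> :: "real^'n \<Rightarrow> real"
  define N where "N = \<lceil>sqrt (2^(k * CARD('n)) * R) / d\<rceil> + 1"
  have "q ` T \<subseteq> Pi\<^sub>E X (\<lambda>_. {-N..N})"
  proof (rule image_subsetI)
    fix \<psi> assume "\<psi> \<in> T"
    then have \<psi>: "\<psi> \<in> test_functions \<Omega>" "sq_int \<psi> \<le> R" by (auto simp: T_def)
    obtain B where B: "\<And>x. \<bar>\<psi> x\<bar> \<le> B" using test_functions_bounded[OF \<psi>(1)] by blast
    have "- N \<le> \<lfloor>dyavg k \<psi> x / d\<rfloor> \<and> \<lfloor>dyavg k \<psi> x / d\<rfloor> \<le> N" for x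
    proof -
      have "(dyavg k \<psi> x)\<^sup>2 \<le> 2^(k * CARD('n)) * sq_int \<psi>"
        by (rule dyavg_bounded[OF test_functions_borel[OF \<psi>(1)] nn_sq_int[OF \<psi>(1)] sq_int_nonneg B])
      also have "\<dots> \<le> 2^(k * CARD('n)) * R" using \<psi>(2) by simp
      finally have "\<bar>dyavg k \<psi> x\<bar> \<le> sqrt (2^(k * CARD('n)) * R)" by (rule real_le_rsqrt[OF _, of "\<bar>_\<bar>", unfolded power2_abs])
      then have "\<bar>dyavg k \<psi> x / d\<bar> \<le> sqrt (2^(k * CARD('n)) * R) / d" using d by (simp add: divide_right_mono)
      then show ?thesis unfolding N_def by linarith
    qed
    then show "q \<psi> \<in> Pi\<^sub>E X (\<lambda>_. {-N..N})" by (auto simp: q_def)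
  qed
  then have fin: "finite (q ` T)" by (rule finite_subset) (rule finite_PiE[OF X(1)], auto)
  have "\<forall>c\<in>q ` T. \<exists>\<psi>. \<psi> \<in> T \<and> q \<psi> = c" by auto
  then obtain s where s: "\<And>c. c \<in> q ` T \<Longrightarrow> s c \<in> T \<and> q (s c) = c" by metis
  have close: "(norm (abs_l2 \<psi> - abs_l2 \<phi>))\<^sup>2 \<le> e" if \<psi>: "\<psi> \<in> T" and \<phi>: "\<phi> \<in> T" and eq: "q \<psi> = q \<phi>" for \<psi> \<phi>
  proof -
    have t: "\<psi> \<in> test_functions \<Omega>" "\<phi> \<in> test_functions \<Omega>" using \<psi> \<phi> by (auto simp: T_def)
    define w where "w x = \<psi> x - \<phi> x" for x
    have w: "w \<in> test_functions \<Omega>"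
      using test_functions_add[OF t(1) test_functions_scale[OF t(2), of "-1"]] by (simp add: w_def[abs_def])
    note [measurable] = test_functions_borel[OF w] test_functions_borel[OF t(1)] test_functions_borel[OF t(2)]
    obtain B where B: "\<And>x. \<bar>\<psi> x\<bar> \<le> B" using test_functions_bounded[OF t(1)] by blast
    obtain B' where B': "\<And>x. \<bar>\<phi> x\<bar> \<le> B'" using test_functions_bounded[OF t(2)] by blast
    have aw: "abs_l2 w = abs_l2 \<psi> - abs_l2 \<phi>"
      unfolding w_def by (rule abs_l2_minus[symmetric]) (rule test_functions_sq_integrable[OF t(1)] test_functions_sq_integrable[OF t(2)])+
    have gw: "grad_sq w \<le> 4 * R"
    proof -
      have "grad_sq w = (norm (grad \<Omega> (abs_l2 \<psi>) - grad \<Omega> (abs_l2 \<phi>)))\<^sup>2"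
        unfolding norm_grad_test_sq[OF w, symmetric] aw by (simp add: grad_diff H10_test t)
      also have "\<dots> \<le> (norm (grad \<Omega> (abs_l2 \<psi>)) + norm (grad \<Omega> (abs_l2 \<phi>)))\<^sup>2"
        by (intro power_mono norm_triangle_ineq4) auto
      also have "\<dots> \<le> 2 * (norm (grad \<Omega> (abs_l2 \<psi>)))\<^sup>2 + 2 * (norm (grad \<Omega> (abs_l2 \<phi>)))\<^sup>2"
        using sum_squares_bound[of "norm (grad \<Omega> (abs_l2 \<psi>))" "norm (grad \<Omega> (abs_l2 \<phi>))"] by (simp add: power2_sum)
      also have "\<dots> \<le> 4 * R" unfolding norm_grad_test_sq[OF t(1)] norm_grad_test_sq[OF t(2)] using \<psi> \<phi> by (auto simp: T_def)
      finally show ?thesis .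
    qed
    have near: "\<bar>dyavg k w x\<bar> \<le> d" if x: "x \<in> X" for x
    proof -
      have "\<lfloor>dyavg k \<psi> x / d\<rfloor> = \<lfloor>dyavg k \<phi> x / d\<rfloor>" using fun_cong[OF eq, of x] x by (simp add: q_def)
      then have "\<bar>dyavg k \<psi> x / d - dyavg k \<phi> x / d\<bar> \<le> 1" by linarith
      then have "\<bar>dyavg k \<psi> x - dyavg k \<phi> x\<bar> / d \<le> 1" using d by (simp add: diff_divide_distrib[symmetric])
      then show ?thesis unfolding w_def
        using dyavg_diff[OF _ B _ B', where k=k and x=x] d by (simp add: pos_divide_le_eq)
    qed
    have Pw: "(\<integral>\<^sup>+x. ennreal ((dyavg k w x)\<^sup>2) \<partial>lborel) \<le> ennreal (e / 4)"
    proof -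
      have "(\<integral>\<^sup>+x. ennreal ((dyavg k w x)\<^sup>2) \<partial>lborel) \<le> (\<integral>\<^sup>+x. (\<Sum>x'\<in>X. ennreal (d\<^sup>2) * indicator (cell k x') x) \<partial>lborel)"
      proof (rule nn_integral_mono)
        fix x
        show "ennreal ((dyavg k w x)\<^sup>2) \<le> (\<Sum>x'\<in>X. ennreal (d\<^sup>2) * indicator (cell k x') x)"
        proof (cases "\<exists>x'\<in>X. x \<in> cell k x'")
          case True
          then obtain x' where x': "x' \<in> X" "x \<in> cell k x'" by blast
          have "\<bar>dyavg k w x\<bar> \<le> d" using near[OF x'(1)] dyavg_cell_const[OF x'(2)] by metis
          then have "(dyavg k w x)\<^sup>2 \<le> d\<^sup>2" using d by (metis abs_le_square_iff abs_of_pos)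
          then have "ennreal ((dyavg k w x)\<^sup>2) \<le> ennreal (d\<^sup>2) * indicator (cell k x') x" using x'(2) by (simp add: ennreal_leI)
          also have "\<dots> \<le> (\<Sum>x'\<in>X. ennreal (d\<^sup>2) * indicator (cell k x') x)"
            using X(1) x'(1) by (intro member_le_sum) auto
          finally show ?thesis .
        next
          case False
          \<comment> \<open>A cell outside those listed in \<open>X\<close> misses the domain, so
            the average there is zero.\<close>
          have z: "indicator (cell k x) y * w y = 0" for y
          proof (cases "y \<in> cell k x \<and> y \<in> \<Omega>")
            case True
            then obtain x' where "x' \<in> X" "y \<in> cell k x'" using X(2) by blast
            with True False cell_eq[of y k x] cell_eq[of y k x'] cell_refl[of x k] show ?thesis by auto
          qed (auto simp: indicator_def test_functionsD(4)[OF w])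
          show ?thesis unfolding dyavg_eq z by simp
        qed
      qed
      also have "\<dots> = (\<Sum>x'\<in>X. ennreal (d\<^sup>2) * ennreal ((1/2)^(k * CARD('n))))"
        by (subst nn_integral_sum) (auto simp: nn_integral_cmult_indicator emeasure_cell)
      also have "\<dots> \<le> (\<Sum>x'\<in>X. ennreal (d\<^sup>2) * ennreal 1)"
        by (intro sum_mono mult_left_mono ennreal_leI) (auto simp: power_le_one)
      also have "\<dots> = ennreal (d\<^sup>2 * real (card X))"
        by (simp add: ennreal_mult' ennreal_of_nat_eq_real_of_nat mult.commute)
      also have "\<dots> \<le> ennreal (e/4)" by (rule ennreal_leI[OF d2])
      finally show ?thesis .
    qed
    have "ennreal (sq_int w) = (\<integral>\<^sup>+x. ennreal ((w x)\<^sup>2) \<partial>lborel)" by (rule nn_sq_int[OF w, symmetric])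
    also have "\<dots> \<le> (\<integral>\<^sup>+x. 2 * ennreal ((w x - dyavg k w x)\<^sup>2) + 2 * ennreal ((dyavg k w x)\<^sup>2) \<partial>lborel)"
    proof (rule nn_integral_mono)
      fix x
      have "(a + b)\<^sup>2 \<le> 2 * a\<^sup>2 + 2 * b\<^sup>2" for a b :: real
        using sum_squares_bound[of a b] by (simp add: power2_sum)
      from this[of "w x - dyavg k w x" "dyavg k w x"]
      have "ennreal ((w x)\<^sup>2) \<le> ennreal (2 * (w x - dyavg k w x)\<^sup>2 + 2 * (dyavg k w x)\<^sup>2)"
        by (intro ennreal_leI) simp
      also have "\<dots> = 2 * ennreal ((w x - dyavg k w x)\<^sup>2) + 2 * ennreal ((dyavg k w x)\<^sup>2)"
        by (intro ennreal_numeral_linear[symmetric] ennreal_numeral_linear) auto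
      finally show "ennreal ((w x)\<^sup>2) \<le> 2 * ennreal ((w x - dyavg k w x)\<^sup>2) + 2 * ennreal ((dyavg k w x)\<^sup>2)" .
    qed
    also have "\<dots> = 2 * (\<integral>\<^sup>+x. ennreal ((w x - dyavg k w x)\<^sup>2) \<partial>lborel) + 2 * (\<integral>\<^sup>+x. ennreal ((dyavg k w x)\<^sup>2) \<partial>lborel)"
      by (subst nn_integral_add) (auto simp: nn_integral_cmult)
    also have "\<dots> \<le> 2 * ennreal (C * (1/4)^k * grad_sq w) + 2 * ennreal (e/4)"
      unfolding C_def by (intro add_mono mult_left_mono dyadic_poincare[OF w] Pw) auto
    also have "\<dots> = ennreal (2 * (C * (1/4)^k * grad_sq w) + 2 * (e/4))"
      using C e grad_sq_nonneg[of w] by (intro ennreal_numeral_linear) auto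
    finally have "sq_int w \<le> 2 * (C * (1/4)^k * grad_sq w) + 2 * (e/4)"
      using C e grad_sq_nonneg[of w] by (subst (asm) ennreal_le_iff) auto
    also have "C * (1/4)^k * grad_sq w \<le> C * (e / (16 * C * R)) * (4 * R)"
      using C R k gw grad_sq_nonneg[of w] e by (intro mult_mono) auto
    also have "\<dots> = e / 4" using C R by (simp add: field_simps)
    finally show ?thesis unfolding aw[symmetric] norm_test_sq[OF w] by simp
  qed
  show ?thesis
  proof (intro exI[of _ "(\<lambda>c. abs_l2 (s c)) ` q ` T"] conjI ballI impI)
    show "finite ((\<lambda>c. abs_l2 (s c)) ` q ` T)" using fin by simp
    fix \<psi> assume "\<psi> \<in> test_functions \<Omega>" "sq_int \<psi> \<le> R \<and> grad_sq \<psi> \<le> R"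
    then have "\<psi> \<in> T" by (simp add: T_def)
    then show "\<exists>v\<in>(\<lambda>c. abs_l2 (s c)) ` q ` T. (norm (abs_l2 \<psi> - v))\<^sup>2 \<le> e"
      using close[of \<psi> "s (q \<psi>)"] s[of "q \<psi>"] by auto
  qed
qed

text \<open>Rellich: total boundedness of the test functions carries over by density. The enlarged
  radius leaves room for an approximation error below 1.\<close>

lemma H10_compact_embedding:
  "compact (closure {u \<in> H10 \<Omega>. norm u \<le> R \<and> norm (grad \<Omega> u) \<le> R})" (is "compact (closure ?K)")
  unfolding compact_eq_totally_bounded
proof (intro conjI allI impI)
  show "complete (closure ?K)" by (simp add: complete_eq_closed)
  fix e :: real assume e: "e > 0"
  define R' where "R' = (\<bar>R\<bar> + 1)\<^sup>2"
  have R': "R' > 0" by (simp add: R'_def)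
  obtain F where F: "finite F" "\<And>\<psi>. \<psi> \<in> test_functions \<Omega> \<Longrightarrow> sq_int \<psi> \<le> R' \<Longrightarrow> grad_sq \<psi> \<le> R' \<Longrightarrow>
      \<exists>v\<in>F. (norm (abs_l2 \<psi> - v))\<^sup>2 \<le> (e/4)\<^sup>2"
    using test_totally_bounded[of "(e/4)\<^sup>2" R'] e R' by auto
  have "closure ?K \<subseteq> (\<Union>x\<in>F. ball x e)"
  proof
    fix z assume "z \<in> closure ?K"
    moreover have "e/4 > 0" using e by simp
    ultimately have "\<exists>u\<in>?K. dist u z < e/4" unfolding closure_approachable by blast
    then obtain u where u: "u \<in> ?K" "dist u z < e/4" by blast
    obtain \<psi> where \<psi>: "\<psi> \<in> test_functions \<Omega>" "norm (u - abs_l2 \<psi>) < min 1 (e/4)"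
        "norm (grad \<Omega> u - grad \<Omega> (abs_l2 \<psi>)) < min 1 (e/4)"
      using H10_approx[of u "min 1 (e/4)"] u(1) e by auto
    have "norm (abs_l2 \<psi>) \<le> \<bar>R\<bar> + 1" "norm (grad \<Omega> (abs_l2 \<psi>)) \<le> \<bar>R\<bar> + 1"
      using \<psi>(2,3) u(1) norm_triangle_ineq3[of u "abs_l2 \<psi>"] norm_triangle_ineq3[of "grad \<Omega> u" "grad \<Omega> (abs_l2 \<psi>)"]
      by auto
    then have "sq_int \<psi> \<le> R'" "grad_sq \<psi> \<le> R'"
      unfolding norm_test_sq[OF \<psi>(1), symmetric] norm_grad_test_sq[OF \<psi>(1), symmetric] R'_def by (auto intro: power_mono)
    then obtain v where v: "v \<in> F" "(norm (abs_l2 \<psi> - v))\<^sup>2 \<le> (e/4)\<^sup>2" using F(2)[OF \<psi>(1)] by blast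
    have "norm (abs_l2 \<psi> - v) \<le> e/4" by (rule power2_le_imp_le[OF v(2)]) (use e in simp)
    moreover have "dist v z \<le> norm (abs_l2 \<psi> - v) + norm (u - abs_l2 \<psi>) + dist u z"
      using dist_triangle[of v z "abs_l2 \<psi>"] dist_triangle[of "abs_l2 \<psi>" z u] by (simp add: dist_norm norm_minus_commute)
    ultimately have "dist v z < e" using \<psi>(2) u(2) e by simp
    then show "z \<in> (\<Union>x\<in>F. ball x e)" using v(1) by (auto simp: mem_ball)
  qed
  then show "\<exists>k. finite k \<and> closure ?K \<subseteq> (\<Union>x\<in>k. ball x e)" using F(1) by blast
qed

end

section \<open>Eigenfunction expansions\<close>

text \<open>At a small \<open>t\<close> of sign opposite to \<open>b\<close> the linear term would
  dominate. This turns minimality into the Euler-Lagrange equation.\<close>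

lemma quadratic_nonneg_imp_zero:
  fixes b c :: real
  assumes "\<And>t. 0 \<le> 2 * t * b + t\<^sup>2 * c"
  shows "b = 0"
proof (rule ccontr)
  assume b: "b \<noteq> 0"
  define k where "k = \<bar>c\<bar> + 1"
  have k: "k > 0" "c \<le> k" by (auto simp: k_def)
  have "2 * (- b / k) * b + (- b / k)\<^sup>2 * c = b\<^sup>2 / k * (c / k - 2)"
    using k by (simp add: field_simps power2_eq_square)
  moreover have "c / k - 2 < 0" using k by (simp add: pos_divide_less_eq)
  moreover have "b\<^sup>2 / k > 0" using b k by simp
  ultimately have "2 * (- b / k) * b + (- b / k)\<^sup>2 * c < 0" by (simp only: mult_pos_neg)
  then show False using assms[of "- b / k"] by linarith
qed

lemma norm_add_scaled:
  fixes x y :: "'z::real_inner"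
  shows "(norm (x + t *\<^sub>R y))\<^sup>2 = (norm x)\<^sup>2 + 2 * t * (x \<bullet> y) + t\<^sup>2 * (norm y)\<^sup>2"
  by (simp add: power2_norm_eq_inner inner_add_left inner_add_right inner_commute[of y x] power2_eq_square[of t] algebra_simps)

text \<open>A closed operator with compact graph-norm balls and dense domain. This is enough to
  diagonalise the quadratic form of \<open>G\<close> by successive minimisation, with no inverse
  operator and no spectral theorem.\<close>

locale compact_gradient =
  fixes V :: "'a::{real_inner, complete_space} set" and G :: "'a \<Rightarrow> 'b::{real_inner, complete_space}"
    and H :: "'a set"
  assumes V_sub: "subspace V"
    and G_add: "u \<in> V \<Longrightarrow> v \<in> V \<Longrightarrow> G (u + v) = G u + G v"
    and G_scale: "u \<in> V \<Longrightarrow> G (c *\<^sub>R u) = c *\<^sub>R G u"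
    and G_closed: "(\<And>j::nat. x j \<in> V) \<Longrightarrow> x \<longlonglongrightarrow> l \<Longrightarrow> (\<lambda>j. G (x j)) \<longlonglongrightarrow> p \<Longrightarrow> l \<in> V \<and> G l = p"
    and V_compact: "compact (closure {u \<in> V. norm u \<le> R \<and> norm (G u) \<le> R})"
    and H_sub: "subspace H" and H_closed: "closed H" and V_H: "V \<subseteq> H"
    and V_dense: "h \<in> H \<Longrightarrow> (\<And>u. u \<in> V \<Longrightarrow> h \<bullet> u = 0) \<Longrightarrow> h = 0"
begin

lemma V_zero: "0 \<in> V" by (rule subspace_0[OF V_sub])
lemma G_zero: "G 0 = 0" using G_scale[OF V_zero, of 0] by simp
lemma G_diff: "u \<in> V \<Longrightarrow> v \<in> V \<Longrightarrow> G (u - v) = G u - G v"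
  using G_add[of u "- 1 *\<^sub>R v"] G_scale[of v "- 1"] subspace_scale[OF V_sub, of v "- 1"] by simp
lemma G_sum: "(\<And>i. i \<in> I \<Longrightarrow> f i \<in> V) \<Longrightarrow> G (\<Sum>i\<in>I. f i) = (\<Sum>i\<in>I. G (f i))"
  by (induction I rule: infinite_finite_induct) (auto simp: G_zero G_add subspace_sum[OF V_sub])

lemma bounded_subseq:
  assumes "\<And>j::nat. x j \<in> V" "\<And>j. norm (x j) \<le> R" "\<And>j. norm (G (x j)) \<le> R"
  shows "\<exists>l r. strict_mono r \<and> (\<lambda>j. x (r j)) \<longlonglongrightarrow> l"
proof -
  have "\<forall>j. x j \<in> closure {u \<in> V. norm u \<le> R \<and> norm (G u) \<le> R}"
    using assms closure_subset[of "{u \<in> V. norm u \<le> R \<and> norm (G u) \<le> R}"] by blast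
  then show ?thesis using V_compact[of R] unfolding compact_eq_seq_compact_metric seq_compact_def o_def by blast
qed

text \<open>The Rayleigh quotient on the constrained subspace. A minimising sequence is bounded in
  the graph norm, so it converges along a subsequence; the parallelogram law makes its gradients
  Cauchy as well, and closedness of \<open>G\<close> identifies the limit.\<close>

lemma minimizer:
  fixes f :: "nat \<Rightarrow> 'a" and m :: nat
  defines "W \<equiv> {u \<in> V. \<forall>j<m. u \<bullet> f j = 0}"
  assumes nz: "\<exists>u\<in>W. u \<noteq> 0"
  shows "\<exists>e\<in>W. norm e = 1 \<and> (\<forall>u\<in>W. (norm (G e))\<^sup>2 * (norm u)\<^sup>2 \<le> (norm (G u))\<^sup>2)"
proof -
  have W: "subspace W" unfolding W_def subspace_def
    using V_sub by (auto simp: subspace_0 subspace_add subspace_scale inner_add_left)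
  have WV: "u \<in> V" if "u \<in> W" for u using that by (simp add: W_def)
  define Q where "Q = (\<lambda>u. (norm (G u))\<^sup>2) ` {u \<in> W. norm u = 1}"
  define lam where "lam = Inf Q"
  have bdd: "bdd_below Q" by (rule bdd_belowI[of _ 0]) (auto simp: Q_def)
  obtain u0 where u0: "u0 \<in> W" "u0 \<noteq> 0" using nz by blast
  have ne: "Q \<noteq> {}"
    using subspace_scale[OF W u0(1), of "inverse (norm u0)"] u0(2) by (auto simp: Q_def intro!: exI[of _ "inverse (norm u0) *\<^sub>R u0"])
  have lam_le: "lam * (norm u)\<^sup>2 \<le> (norm (G u))\<^sup>2" if u: "u \<in> W" for u
  proof (cases "u = 0")
    case False
    define v where "v = inverse (norm u) *\<^sub>R u"
    have "(norm (G v))\<^sup>2 \<in> Q" using subspace_scale[OF W u, of "inverse (norm u)"] False by (auto simp: Q_def v_def)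
    then have "lam \<le> (norm (G v))\<^sup>2" unfolding lam_def by (rule cInf_lower[OF _ bdd])
    also have "(norm (G v))\<^sup>2 = (norm (G u))\<^sup>2 / (norm u)\<^sup>2"
      unfolding v_def G_scale[OF WV[OF u]] by (simp add: power_divide divide_inverse power_mult_distrib mult.commute power_inverse)
    finally show ?thesis using False by (simp add: pos_le_divide_eq)
  qed simp
  have "\<exists>u. u \<in> W \<and> norm u = 1 \<and> (norm (G u))\<^sup>2 < lam + 1 / Suc j" for j
  proof -
    have "Inf Q < lam + 1 / Suc j" by (simp add: lam_def)
    from cInf_lessD[OF ne this] show ?thesis unfolding Q_def by auto
  qed
  then obtain x where x: "\<And>j. x j \<in> W" "\<And>j. norm (x j) = 1" "\<And>j::nat. (norm (G (x j)))\<^sup>2 < lam + 1 / Suc j" by metis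
  define R where "R = \<bar>lam\<bar> + 2"
  have "norm (G (x j)) \<le> R" for j
  proof -
    have "1 / real (Suc j) \<le> 1" by simp
    then have "(norm (G (x j)))\<^sup>2 \<le> R" using x(3)[of j] unfolding R_def by linarith
    also have "R \<le> R\<^sup>2" unfolding R_def by (intro self_le_power) auto
    finally show ?thesis by (rule power2_le_imp_le) (simp add: R_def)
  qed
  then obtain l r where lr: "strict_mono r" "(\<lambda>j. x (r j)) \<longlonglongrightarrow> l"
    using bounded_subseq[of x R] x WV by (auto simp: R_def)
  define y where "y j = x (r j)" for j
  have y: "y j \<in> W" "norm (y j) = 1" "(norm (G (y j)))\<^sup>2 < lam + 1 / Suc j" for j
  proof -
    have "1 / real (Suc (r j)) \<le> 1 / real (Suc j)" using seq_suble[OF lr(1), of j] by (intro divide_left_mono) auto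
    then show "y j \<in> W" "norm (y j) = 1" "(norm (G (y j)))\<^sup>2 < lam + 1 / Suc j"
      using x(1)[of "r j"] x(2)[of "r j"] x(3)[of "r j"] by (auto simp: y_def)
  qed
  have yl: "y \<longlonglongrightarrow> l" using lr(2) by (simp add: y_def[abs_def])
  have lam0: "lam \<ge> 0" unfolding lam_def by (rule cInf_greatest[OF ne]) (auto simp: Q_def)
  have par: "(norm (a - b))\<^sup>2 = 2 * (norm a)\<^sup>2 + 2 * (norm b)\<^sup>2 - (norm (a + b))\<^sup>2" for a b :: "'z::real_inner"
    by (simp add: power2_norm_eq_inner inner_add_left inner_add_right inner_diff_left inner_diff_right inner_commute)
  \<comment> \<open>The sum \<open>y j + y k\<close> is admissible, so its gradient is bounded below
    by \<open>lam\<close>; the parallelogram law turns this into an upper bound for the gradient of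
    the difference.\<close>
  have gd: "(norm (G (y j) - G (y k)))\<^sup>2 \<le> 2 / Suc j + 2 / Suc k + lam * (norm (y j - y k))\<^sup>2" for j k
  proof -
    have "lam * (norm (y j + y k))\<^sup>2 \<le> (norm (G (y j) + G (y k)))\<^sup>2"
      using lam_le[OF subspace_add[OF W y(1) y(1)]] G_add[OF WV[OF y(1)] WV[OF y(1)]] by metis
    moreover have "(norm (y j + y k))\<^sup>2 = 4 - (norm (y j - y k))\<^sup>2" using par[of "y j" "y k"] y(2) by simp
    ultimately have "lam * (4 - (norm (y j - y k))\<^sup>2) \<le> (norm (G (y j) + G (y k)))\<^sup>2" by simp
    then show ?thesis using par[of "G (y j)" "G (y k)"] y(3)[of j] y(3)[of k] by (simp add: right_diff_distrib)
  qed
  have "Cauchy (\<lambda>j. G (y j))"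
  proof (rule metric_CauchyI)
    fix e :: real assume e: "e > 0"
    have "Cauchy y" using yl by (rule LIMSEQ_imp_Cauchy)
    then obtain M where M: "\<And>j k. j \<ge> M \<Longrightarrow> k \<ge> M \<Longrightarrow> dist (y j) (y k) < sqrt (e\<^sup>2 / (3 * (lam + 1)))"
      using e lam0 unfolding Cauchy_def by (metis divide_pos_pos real_sqrt_gt_zero zero_less_power add_nonneg_pos mult_pos_pos zero_less_numeral zero_less_one)
    obtain N where N: "2 / real (Suc N) < e\<^sup>2 / 3"
      using reals_Archimedean[of "e\<^sup>2 / 6"] e by (auto simp: inverse_eq_divide)
    have "dist (G (y j)) (G (y k)) < e" if j: "j \<ge> max M N" and k: "k \<ge> max M N" for j k
    proof -
      have "2 / real (Suc j) \<le> 2 / real (Suc N)" "2 / real (Suc k) \<le> 2 / real (Suc N)"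
        using j k by (auto intro!: divide_left_mono)
      moreover have "lam * (norm (y j - y k))\<^sup>2 \<le> e\<^sup>2 / 3"
      proof -
        have "(norm (y j - y k))\<^sup>2 \<le> (sqrt (e\<^sup>2 / (3 * (lam + 1))))\<^sup>2"
          using M[of j k] j k by (intro power_mono) (auto simp: dist_norm)
        also have "\<dots> = e\<^sup>2 / (3 * (lam + 1))" using lam0 by simp
        finally have "lam * (norm (y j - y k))\<^sup>2 \<le> (lam + 1) * (e\<^sup>2 / (3 * (lam + 1)))" using lam0 by (intro mult_mono) auto
        also have "\<dots> = e\<^sup>2 / 3" using lam0 by (simp add: field_simps)
        finally show ?thesis .
      qed
      ultimately have "(norm (G (y j) - G (y k)))\<^sup>2 < e\<^sup>2" using gd[of j k] N by linarith
      then show ?thesis using e by (simp add: dist_norm power_less_imp_less_base)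
    qed
    then show "\<exists>M. \<forall>m\<ge>M. \<forall>n\<ge>M. dist (G (y m)) (G (y n)) < e" by blast
  qed
  then obtain p where p: "(\<lambda>j. G (y j)) \<longlonglongrightarrow> p" using Cauchy_convergent convergent_def by blast
  have l: "l \<in> V" "G l = p" using G_closed[OF WV[OF y(1)] yl p] by auto
  have "l \<bullet> f j = 0" if "j < m" for j
  proof -
    have "(\<lambda>i. y i \<bullet> f j) \<longlonglongrightarrow> l \<bullet> f j" by (intro tendsto_intros yl)
    moreover have "y i \<bullet> f j = 0" for i using y(1)[of i] that by (simp add: W_def)
    ultimately show ?thesis by (simp add: LIMSEQ_const_iff)
  qed
  then have lW: "l \<in> W" using l by (simp add: W_def)
  have "(\<lambda>i. norm (y i)) \<longlonglongrightarrow> norm l" by (intro tendsto_intros yl)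
  then have nl: "norm l = 1" using y(2) by (simp add: LIMSEQ_const_iff)
  have "(norm (G l))\<^sup>2 \<le> lam"
  proof (rule LIMSEQ_le)
    show "(\<lambda>j. (norm (G (y j)))\<^sup>2) \<longlonglongrightarrow> (norm (G l))\<^sup>2" unfolding l(2) by (intro tendsto_intros p)
    have "(\<lambda>j. lam + inverse (real (Suc j))) \<longlonglongrightarrow> lam + 0" by (intro tendsto_intros LIMSEQ_inverse_real_of_nat)
    then show "(\<lambda>j. lam + 1 / real (Suc j)) \<longlonglongrightarrow> lam" by (simp add: inverse_eq_divide)
    show "\<exists>N. \<forall>n\<ge>N. (norm (G (y n)))\<^sup>2 \<le> lam + 1 / real (Suc n)" using y(3) less_imp_le by blast
  qed
  then have "\<forall>u\<in>W. (norm (G l))\<^sup>2 * (norm u)\<^sup>2 \<le> (norm (G u))\<^sup>2"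
    using lam_le mult_right_mono[of "(norm (G l))\<^sup>2" lam] by (meson order_trans zero_le_power2)
  with lW nl show ?thesis by blast
qed

text \<open>The condition involves \<open>f\<close> only below \<open>k\<close>, as the well-founded
  choice in \<open>eigen_sequence\<close> requires. The eigenvalue of a unit vector \<open>r\<close>
  is encoded as its squared gradient norm.\<close>

definition eigen_step :: "(nat \<Rightarrow> 'a) \<Rightarrow> nat \<Rightarrow> 'a \<Rightarrow> bool" where
  "eigen_step f k r \<longleftrightarrow> r \<in> V \<and> (r = 0 \<or> norm r = 1) \<and>
     (\<forall>\<phi>\<in>V. G r \<bullet> G \<phi> = (norm (G r))\<^sup>2 * (r \<bullet> \<phi>)) \<and> (\<forall>j<k. f j \<bullet> r = 0) \<and>
     (\<forall>u\<in>V. (\<forall>j<k. u \<bullet> f j = 0) \<longrightarrow> (norm (G r))\<^sup>2 * (norm u)\<^sup>2 \<le> (norm (G u))\<^sup>2) \<and>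
     (r = 0 \<longrightarrow> (\<forall>u\<in>V. (\<forall>j<k. u \<bullet> f j = 0) \<longrightarrow> u = 0))"

text \<open>The zero vector stands in for an eigenvector once the space is exhausted, so that no dimension count is needed.\<close>

lemma eigen_step_exists:
  assumes prev: "\<And>j. j < m \<Longrightarrow> eigen_step f j (f j)"
  shows "\<exists>r. eigen_step f m r"
proof (cases "\<exists>u\<in>{u \<in> V. \<forall>j<m. u \<bullet> f j = 0}. u \<noteq> 0")
  case False
  then have "eigen_step f m 0" unfolding eigen_step_def using V_zero G_zero by auto
  then show ?thesis by blast
next
  case True
  obtain e where e: "e \<in> V" "\<And>j. j < m \<Longrightarrow> e \<bullet> f j = 0" "norm e = 1"
    "\<And>u. u \<in> V \<Longrightarrow> (\<forall>j<m. u \<bullet> f j = 0) \<Longrightarrow> (norm (G e))\<^sup>2 * (norm u)\<^sup>2 \<le> (norm (G u))\<^sup>2"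
    using minimizer[OF True] by auto
  let ?L = "(norm (G e))\<^sup>2"
  have fV: "f j \<in> V" if "j < m" for j using prev[OF that] by (simp add: eigen_step_def)
  have ortho: "f i \<bullet> f j = 0" if "i < m" "j < m" "i \<noteq> j" for i j
  proof (cases "i < j")
    case True then show ?thesis using prev[OF that(2)] by (simp add: eigen_step_def)
  next
    case False then have "j < i" using that by simp
    then have "f j \<bullet> f i = 0" using prev[OF that(1)] by (simp add: eigen_step_def)
    then show ?thesis by (metis inner_commute)
  qed
  have nf: "c * (f j \<bullet> f j) = c \<or> f j = 0" if "j < m" for j c
    using prev[OF that] by (auto simp: eigen_step_def norm_eq_sqrt_inner)
  \<comment> \<open>First variation of the Rayleigh quotient in an admissible direction.\<close>
  have EL0: "G e \<bullet> G u = ?L * (e \<bullet> u)" if u: "u \<in> V" "\<And>j. j < m \<Longrightarrow> u \<bullet> f j = 0" for u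
  proof -
    have "G e \<bullet> G u - ?L * (e \<bullet> u) = 0"
    proof (rule quadratic_nonneg_imp_zero)
      fix t :: real
      have V: "e + t *\<^sub>R u \<in> V" "t *\<^sub>R u \<in> V" using V_sub e(1) u(1) by (auto intro: subspace_add subspace_scale)
      have "?L * (norm (e + t *\<^sub>R u))\<^sup>2 \<le> (norm (G (e + t *\<^sub>R u)))\<^sup>2"
        using e(2) u(2) by (intro e(4) V) (simp add: inner_add_left)
      also have "G (e + t *\<^sub>R u) = G e + t *\<^sub>R G u" using G_add[OF e(1) V(2)] G_scale[OF u(1)] by simp
      finally have "?L * ((norm e)\<^sup>2 + 2 * t * (e \<bullet> u) + t\<^sup>2 * (norm u)\<^sup>2) \<le> ?L + 2 * t * (G e \<bullet> G u) + t\<^sup>2 * (norm (G u))\<^sup>2"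
        unfolding norm_add_scaled .
      then show "0 \<le> 2 * t * (G e \<bullet> G u - ?L * (e \<bullet> u)) + t\<^sup>2 * ((norm (G u))\<^sup>2 - ?L * (norm u)\<^sup>2)"
        unfolding e(3) by (simp add: algebra_simps)
    qed
    then show ?thesis by simp
  qed
  have EL: "G e \<bullet> G \<phi> = ?L * (e \<bullet> \<phi>)" if \<phi>: "\<phi> \<in> V" for \<phi>
  proof -
    \<comment> \<open>A general \<open>\<phi>\<close> is split into its projection on the earlier
      eigenvectors and an admissible direction. Their own eigen equations make \<open>G e\<close>
      orthogonal to \<open>G s\<close>.\<close>
    define s where "s = (\<Sum>j<m. (\<phi> \<bullet> f j) *\<^sub>R f j)"
    have sV: "s \<in> V" unfolding s_def using fV by (intro subspace_sum[OF V_sub] subspace_scale[OF V_sub]) auto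
    have so: "(\<phi> - s) \<bullet> f i = 0" if i: "i < m" for i
    proof -
      have "s \<bullet> f i = (\<Sum>j<m. if j = i then (\<phi> \<bullet> f i) * (f i \<bullet> f i) else 0)"
        unfolding s_def inner_sum_left by (intro sum.cong) (auto simp: ortho i)
      also have "\<dots> = (\<phi> \<bullet> f i) * (f i \<bullet> f i)" using i by simp
      also have "\<dots> = \<phi> \<bullet> f i" using nf[OF i, of "\<phi> \<bullet> f i"] by auto
      finally show ?thesis by (simp add: inner_diff_left)
    qed
    have Gs: "G e \<bullet> G s = 0"
    proof -
      have "G s = (\<Sum>j<m. (\<phi> \<bullet> f j) *\<^sub>R G (f j))"
        unfolding s_def using fV by (subst G_sum) (auto simp: G_scale intro!: subspace_scale[OF V_sub])
      moreover have "G e \<bullet> G (f j) = 0" if "j < m" for j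
        using prev[OF that] e(1) e(2)[OF that] by (simp add: eigen_step_def inner_commute)
      ultimately show ?thesis by (simp add: inner_sum_right)
    qed
    have es: "e \<bullet> s = 0" unfolding s_def by (simp add: inner_sum_right e(2))
    have "G e \<bullet> G (\<phi> - s) = ?L * (e \<bullet> (\<phi> - s))"
      by (rule EL0) (use so \<phi> sV in \<open>auto intro: subspace_diff[OF V_sub]\<close>)
    then show ?thesis using Gs es G_diff[OF \<phi> sV] by (simp add: inner_diff_right)
  qed
  have "eigen_step f m e" unfolding eigen_step_def
    using e EL by (auto simp: inner_commute)
  then show ?thesis by blast
qed

lemma eigen_sequence: "\<exists>e. \<forall>k. eigen_step e k (e k)"
proof (rule dependent_wf_choice[of "less_than"])
  show "wf less_than" by (rule wf_less_than)
  show "eigen_step f x r = eigen_step g x r" if "\<And>z. (z, x) \<in> less_than \<Longrightarrow> f z = g z" for f g x r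
    using that by (simp add: eigen_step_def)
  show "\<exists>r. eigen_step f x r" if "\<And>y. (y, x) \<in> less_than \<Longrightarrow> eigen_step f y (f y)" for x f
    by (rule eigen_step_exists) (use that in simp)
qed

section \<open>Expansion in eigenvectors, Bessel inequalities and completeness\<close>

definition eig :: "nat \<Rightarrow> 'a" where "eig = (SOME e. \<forall>k. eigen_step e k (e k))"
definition eigval :: "nat \<Rightarrow> real" where "eigval k = (norm (G (eig k)))\<^sup>2"

lemma eig_step: "eigen_step eig k (eig k)"
  unfolding eig_def using someI_ex[OF eigen_sequence] by blast

lemma eig_V: "eig k \<in> V"
  and eig_weak: "\<phi> \<in> V \<Longrightarrow> G (eig k) \<bullet> G \<phi> = eigval k * (eig k \<bullet> \<phi>)"
  and eig_min: "u \<in> V \<Longrightarrow> (\<And>j. j < k \<Longrightarrow> u \<bullet> eig j = 0) \<Longrightarrow> eigval k * (norm u)\<^sup>2 \<le> (norm (G u))\<^sup>2"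
  and eig_norm: "eig k = 0 \<or> norm (eig k) = 1"
  and eig_exhausted: "eig k = 0 \<Longrightarrow> u \<in> V \<Longrightarrow> (\<And>j. j < k \<Longrightarrow> u \<bullet> eig j = 0) \<Longrightarrow> u = 0"
  using eig_step[of k] by (simp_all add: eigen_step_def eigval_def)

lemma eig_ortho: "i \<noteq> j \<Longrightarrow> eig i \<bullet> eig j = 0"
proof -
  have *: "eig i \<bullet> eig j = 0" if "i < j" for i j using eig_step[of j] that by (simp add: eigen_step_def)
  show "i \<noteq> j \<Longrightarrow> eig i \<bullet> eig j = 0" using *[of i j] *[of j i] by (metis inner_commute linorder_neqE_nat)
qed

lemma eigval_nonneg: "0 \<le> eigval k" by (simp add: eigval_def)

text \<open>Valid also for a zero vector in the sequence, so the formulas for partial sums need no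
  case distinction.\<close>

lemma coeff_eig: "(u \<bullet> eig k) * (eig k \<bullet> eig k) = u \<bullet> eig k"
  using eig_norm[of k] by (auto simp: norm_eq_sqrt_inner)

definition part :: "nat \<Rightarrow> 'a \<Rightarrow> 'a" where "part m u = (\<Sum>k<m. (u \<bullet> eig k) *\<^sub>R eig k)"

lemma part_V: "part m u \<in> V"
  unfolding part_def by (intro subspace_sum[OF V_sub] subspace_scale[OF V_sub] eig_V)

lemma part_inner: "part m u \<bullet> h = (\<Sum>k<m. (u \<bullet> eig k) * (h \<bullet> eig k))"
  unfolding part_def inner_sum_left by (intro sum.cong refl) (simp add: inner_commute)

lemma part_eig: "k < m \<Longrightarrow> part m u \<bullet> eig k = u \<bullet> eig k"
proof -
  assume k: "k < m"
  have "part m u \<bullet> eig k = (\<Sum>j<m. if j = k then (u \<bullet> eig k) * (eig k \<bullet> eig k) else 0)"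
    unfolding part_inner by (intro sum.cong) (auto simp: eig_ortho)
  with k show ?thesis by (simp add: coeff_eig)
qed

lemma part_norm: "(norm (part m u))\<^sup>2 = (\<Sum>k<m. (u \<bullet> eig k)\<^sup>2)"
proof -
  have "part m u \<bullet> part m u = (\<Sum>k<m. (u \<bullet> eig k) * (part m u \<bullet> eig k))" by (rule part_inner)
  also have "\<dots> = (\<Sum>k<m. (u \<bullet> eig k)\<^sup>2)" by (intro sum.cong) (auto simp: part_eig power2_eq_square)
  finally show ?thesis by (simp add: power2_norm_eq_inner)
qed

lemma remainder_norm: "(norm (u - part m u))\<^sup>2 = (norm u)\<^sup>2 - (\<Sum>k<m. (u \<bullet> eig k)\<^sup>2)"
proof -
  have "u \<bullet> part m u = (\<Sum>k<m. (u \<bullet> eig k)\<^sup>2)"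
    using part_inner[of m u u] by (simp add: inner_commute power2_eq_square)
  then have "(norm (u - part m u))\<^sup>2 = (norm u)\<^sup>2 - 2 * (\<Sum>k<m. (u \<bullet> eig k)\<^sup>2) + (norm (part m u))\<^sup>2"
    by (simp add: power2_norm_eq_inner inner_diff_left inner_diff_right inner_commute)
  then show ?thesis by (simp add: part_norm)
qed

lemma bessel: "(\<Sum>k<m. (u \<bullet> eig k)\<^sup>2) \<le> (norm u)\<^sup>2"
  using remainder_norm[of u m] zero_le_power2[of "norm (u - part m u)"] by linarith

lemma bessel_inner: "\<bar>\<Sum>k<m. (u \<bullet> eig k) * (h \<bullet> eig k)\<bar> \<le> norm u * norm h"
proof -
  have "norm (part m u) \<le> norm u"
    by (rule power2_le_imp_le) (use part_norm[of m u] bessel[of u m] in auto)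
  moreover have "\<bar>part m u \<bullet> h\<bar> \<le> norm (part m u) * norm h" by (rule Cauchy_Schwarz_ineq2)
  ultimately show ?thesis unfolding part_inner[symmetric]
    by (meson mult_right_mono norm_ge_zero order_trans)
qed

lemma G_part_inner: "\<phi> \<in> V \<Longrightarrow> G (part m u) \<bullet> G \<phi> = (\<Sum>k<m. eigval k * ((u \<bullet> eig k) * (\<phi> \<bullet> eig k)))"
proof -
  assume \<phi>: "\<phi> \<in> V"
  have "G (part m u) = (\<Sum>k<m. (u \<bullet> eig k) *\<^sub>R G (eig k))"
    unfolding part_def by (subst G_sum) (auto simp: G_scale eig_V intro!: subspace_scale[OF V_sub])
  then have "G (part m u) \<bullet> G \<phi> = (\<Sum>k<m. (u \<bullet> eig k) * (G (eig k) \<bullet> G \<phi>))"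
    by (simp add: inner_sum_left)
  also have "\<dots> = (\<Sum>k<m. eigval k * ((u \<bullet> eig k) * (\<phi> \<bullet> eig k)))"
    by (intro sum.cong refl) (simp only: eig_weak[OF \<phi>] inner_commute[of \<phi>] mult.left_commute)
  finally show ?thesis .
qed

lemma G_part_norm: "(norm (G (part m u)))\<^sup>2 = (\<Sum>k<m. eigval k * (u \<bullet> eig k)\<^sup>2)"
  unfolding power2_norm_eq_inner G_part_inner[OF part_V]
  by (intro sum.cong) (auto simp: part_eig power2_eq_square)

lemma G_remainder_norm:
  assumes u: "u \<in> V"
  shows "(norm (G (u - part m u)))\<^sup>2 = (norm (G u))\<^sup>2 - (\<Sum>k<m. eigval k * (u \<bullet> eig k)\<^sup>2)"
proof -
  have "G u \<bullet> G (part m u) = (\<Sum>k<m. eigval k * (u \<bullet> eig k)\<^sup>2)"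
    using G_part_inner[OF u, of m u] by (simp add: inner_commute power2_eq_square)
  then have "(norm (G (u - part m u)))\<^sup>2 = (norm (G u))\<^sup>2 - 2 * (\<Sum>k<m. eigval k * (u \<bullet> eig k)\<^sup>2) + (norm (G (part m u)))\<^sup>2"
    unfolding G_diff[OF u part_V] by (simp add: power2_norm_eq_inner inner_diff_left inner_diff_right inner_commute)
  then show ?thesis by (simp add: G_part_norm)
qed

lemma G_bessel: "u \<in> V \<Longrightarrow> (\<Sum>k<m. eigval k * (u \<bullet> eig k)\<^sup>2) \<le> (norm (G u))\<^sup>2"
  using G_remainder_norm[of u m] zero_le_power2[of "norm (G (u - part m u))"] by linarith

text \<open>Otherwise the orthonormal eigenvectors would be bounded in the graph norm and have a
  convergent subsequence, although their mutual distances are the square root of 2.\<close>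

lemma eigval_unbounded:
  assumes nz: "\<And>k. eig k \<noteq> 0"
  shows "\<exists>m. eigval m > L"
proof (rule ccontr)
  assume "\<nexists>m. eigval m > L"
  then have le: "(norm (G (eig k)))\<^sup>2 \<le> L" for k by (simp add: eigval_def not_less)
  define R where "R = max 1 L"
  have "norm (G (eig k)) \<le> R" for k
  proof (rule power2_le_imp_le)
    have "R \<le> R\<^sup>2" by (intro self_le_power) (auto simp: R_def)
    moreover have "L \<le> R" by (simp add: R_def)
    ultimately show "(norm (G (eig k)))\<^sup>2 \<le> R\<^sup>2" using le[of k] by linarith
  qed (simp add: R_def)
  moreover have n1: "norm (eig k) = 1" for k using eig_norm nz by blast
  ultimately obtain l r where lr: "strict_mono r" "(\<lambda>j. eig (r j)) \<longlonglongrightarrow> l"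
    using bounded_subseq[of eig R] eig_V by (auto simp: R_def)
  have "Cauchy (\<lambda>j. eig (r j))" using lr(2) by (rule LIMSEQ_imp_Cauchy)
  then obtain M where M: "\<And>j k. j \<ge> M \<Longrightarrow> k \<ge> M \<Longrightarrow> dist (eig (r j)) (eig (r k)) < 1"
    unfolding Cauchy_def by (meson zero_less_one)
  have "r M \<noteq> r (Suc M)" using lr(1) by (simp add: strict_mono_eq)
  then have "(norm (eig (r M) - eig (r (Suc M))))\<^sup>2 = 2"
    using n1[of "r M"] n1[of "r (Suc M)"] eig_ortho[of "r M" "r (Suc M)"]
    by (simp add: power2_norm_eq_inner inner_diff_left inner_diff_right inner_commute norm_eq_1)
  moreover have "(norm (eig (r M) - eig (r (Suc M))))\<^sup>2 < 1\<^sup>2"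
    using M[of M "Suc M"] by (intro power_strict_mono) (auto simp: dist_norm)
  ultimately show False by simp
qed

lemma eigval_mono: 
  assumes "eig (Suc k) \<noteq> 0" shows "eigval k \<le> eigval (Suc k)"
  using eig_min[OF eig_V[of "Suc k"], of k] eig_norm[of "Suc k"] assms eig_ortho by (simp add: eigval_def)

text \<open>The remainder is orthogonal to the first \<open>m\<close> eigenvectors, so its squared
  norm times \<open>eigval m\<close> is at most the squared gradient norm of \<open>u\<close>, and
  the eigenvalues tend to infinity. If the sequence is exhausted, the remainder is eventually
  zero.\<close>

lemma remainder_tendsto:
  assumes u: "u \<in> V"
  shows "(\<lambda>m. u - part m u) \<longlonglongrightarrow> 0"
proof -
  have rV: "u - part m u \<in> V" for m using u part_V by (intro subspace_diff[OF V_sub])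
  have ro: "(u - part m u) \<bullet> eig j = 0" if "j < m" for j m using part_eig[OF that, of u] by (simp add: inner_diff_left)
  show ?thesis
  proof (cases "\<exists>k. eig k = 0")
    case True
    then obtain k where k: "eig k = 0" by blast
    have "u - part m u = 0" if "m \<ge> k" for m by (rule eig_exhausted[OF k rV]) (use ro that in auto)
    then show ?thesis by (intro tendsto_eventually eventually_sequentiallyI)
  next
    case False
    then have nz: "\<And>k. eig k \<noteq> 0" by blast
    have inc: "incseq eigval" using eigval_mono nz by (simp add: incseq_SucI)
    show ?thesis
    proof (rule LIMSEQ_I)
      fix e :: real assume e: "e > 0"
      define L where "L = (norm (G u))\<^sup>2 / e\<^sup>2"
      obtain k where k: "eigval k > L" using eigval_unbounded[OF nz] by blast
      have "norm (u - part m u - 0) < e" if m: "m \<ge> k" for m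
      proof -
        have lm: "eigval m > L" using incseqD[OF inc m] k by linarith
        have "eigval m * (norm (u - part m u))\<^sup>2 \<le> (norm (G (u - part m u)))\<^sup>2"
          by (rule eig_min[OF rV ro])
        also have "\<dots> \<le> (norm (G u))\<^sup>2"
          unfolding G_remainder_norm[OF u] by (simp add: sum_nonneg eigval_nonneg)
        also have "\<dots> = L * e\<^sup>2" using e by (simp add: L_def)
        also have "\<dots> < eigval m * e\<^sup>2" using lm e by (intro mult_strict_right_mono) auto
        finally have "(norm (u - part m u))\<^sup>2 < e\<^sup>2" using eigval_nonneg[of m] by (simp add: mult_less_cancel_left)
        then show ?thesis using e by (simp add: power_less_imp_less_base)
      qed
      then show "\<exists>no. \<forall>n\<ge>no. norm (u - part n u - 0) < e" by blast
    qed
  qed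
qed

lemma part_tendsto: "u \<in> V \<Longrightarrow> (\<lambda>m. part m u) \<longlonglongrightarrow> u"
  using tendsto_diff[OF tendsto_const remainder_tendsto, of u u] by simp

lemma inner_expansion:
  assumes "u \<in> V"
  shows "(\<lambda>m. \<Sum>k<m. (u \<bullet> eig k) * (h \<bullet> eig k)) \<longlonglongrightarrow> u \<bullet> h"
  unfolding part_inner[symmetric] by (intro tendsto_intros part_tendsto assms)

lemma Cauchy_of_squares:
  fixes x :: "nat \<Rightarrow> 'z::real_inner" and S :: "nat \<Rightarrow> real"
  assumes d: "\<And>m n. m \<le> n \<Longrightarrow> (norm (x n - x m))\<^sup>2 \<le> S n - S m" and S: "convergent S"
  shows "Cauchy x"
proof (rule metric_CauchyI)
  fix e :: real assume e: "e > 0"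
  have "Cauchy S" using S by (rule convergent_Cauchy)
  then obtain M where M: "\<And>m n. m \<ge> M \<Longrightarrow> n \<ge> M \<Longrightarrow> dist (S m) (S n) < e\<^sup>2"
    using e unfolding Cauchy_def by (meson zero_less_power)
  have le: "dist (x n) (x m) < e" if "m \<ge> M" "m \<le> n" for m n
  proof -
    have "(norm (x n - x m))\<^sup>2 < e\<^sup>2" using d[OF that(2)] M[of n m] that by (auto simp: dist_real_def)
    then show ?thesis using e by (simp add: dist_norm power_less_imp_less_base)
  qed
  show "\<exists>M. \<forall>m\<ge>M. \<forall>n\<ge>M. dist (x m) (x n) < e"
    using le by (intro exI[of _ M]) (metis dist_commute nle_le)
qed

text \<open>Parseval on all of \<open>H\<close>. The partial sums converge to some \<open>q\<close>
  with the same coefficients; expanding elements of \<open>V\<close> shows that \<open>h - q\<close>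
  is orthogonal to \<open>V\<close>, hence zero.\<close>

lemma norm_expansion:
  assumes h: "h \<in> H"
  shows "(\<lambda>m. \<Sum>k<m. (h \<bullet> eig k)\<^sup>2) \<longlonglongrightarrow> (norm h)\<^sup>2"
proof -
  have "Cauchy (\<lambda>m. part m h)"
  proof (rule Cauchy_of_squares[where S="\<lambda>m. \<Sum>k<m. (h \<bullet> eig k)\<^sup>2"])
    fix m n :: nat assume mn: "m \<le> n"
    have pp: "part n h \<bullet> part m h = (\<Sum>k<m. (h \<bullet> eig k)\<^sup>2)"
    proof -
      have "part m h \<bullet> part n h = (\<Sum>k<m. (h \<bullet> eig k) * (part n h \<bullet> eig k))" by (rule part_inner)
      also have "\<dots> = (\<Sum>k<m. (h \<bullet> eig k)\<^sup>2)" using mn by (intro sum.cong) (auto simp: part_eig power2_eq_square)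
      finally show ?thesis by (simp add: inner_commute)
    qed
    have "(norm (part n h - part m h))\<^sup>2 = (norm (part n h))\<^sup>2 - 2 * (part n h \<bullet> part m h) + (norm (part m h))\<^sup>2"
      by (simp add: power2_norm_eq_inner inner_diff_left inner_diff_right inner_commute)
    then show "(norm (part n h - part m h))\<^sup>2 \<le> (\<Sum>k<n. (h \<bullet> eig k)\<^sup>2) - (\<Sum>k<m. (h \<bullet> eig k)\<^sup>2)"
      by (simp add: pp part_norm)
  next
    show "convergent (\<lambda>m. \<Sum>k<m. (h \<bullet> eig k)\<^sup>2)"
      by (rule Bseq_mono_convergent)
        (auto intro!: BseqI'[of _ "(norm h)\<^sup>2"] sum_mono2 simp: sum_nonneg bessel)
  qed
  then obtain q where q: "(\<lambda>m. part m h) \<longlonglongrightarrow> q" using Cauchy_convergent convergent_def by blast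
  have qe: "q \<bullet> eig k = h \<bullet> eig k" for k
  proof (rule LIMSEQ_unique)
    show "(\<lambda>m. part m h \<bullet> eig k) \<longlonglongrightarrow> q \<bullet> eig k" by (intro tendsto_intros q)
    show "(\<lambda>m. part m h \<bullet> eig k) \<longlonglongrightarrow> h \<bullet> eig k"
      by (rule tendsto_eventually) (auto intro!: eventually_sequentiallyI[of "Suc k"] part_eig)
  qed
  have qH: "q \<in> H" using closed_sequentially[OF H_closed _ q] part_V V_H by blast
  have "h - q = 0"
  proof (rule V_dense)
    show "h - q \<in> H" by (rule subspace_diff[OF H_sub h qH])
    fix u assume u: "u \<in> V"
    have "(\<lambda>m. \<Sum>k<m. (u \<bullet> eig k) * ((h - q) \<bullet> eig k)) \<longlonglongrightarrow> u \<bullet> (h - q)" by (rule inner_expansion[OF u])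
    then show "(h - q) \<bullet> u = 0" by (simp add: inner_diff_left qe LIMSEQ_const_iff inner_commute)
  qed
  then have "q = h" by simp
  then have "(\<lambda>m. (norm (part m h))\<^sup>2) \<longlonglongrightarrow> (norm h)\<^sup>2" using q by (intro tendsto_intros) auto
  then show ?thesis by (simp add: part_norm)
qed

text \<open>The images of the partial sums are Cauchy by the Bessel inequality for \<open>G\<close>,
  and closedness identifies their limit as \<open>G u\<close>.\<close>

lemma G_expansion:
  assumes u: "u \<in> V"
  shows "(\<lambda>m. \<Sum>k<m. eigval k * (u \<bullet> eig k)\<^sup>2) \<longlonglongrightarrow> (norm (G u))\<^sup>2"
proof -
  let ?S = "\<lambda>m. \<Sum>k<m. eigval k * (u \<bullet> eig k)\<^sup>2"
  have "Cauchy (\<lambda>m. G (part m u))"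
  proof (rule Cauchy_of_squares[where S="?S"])
    fix m n :: nat assume mn: "m \<le> n"
    have pp: "G (part m u) \<bullet> G (part n u) = ?S m"
      unfolding G_part_inner[OF part_V] using mn by (intro sum.cong) (auto simp: part_eig power2_eq_square)
    have "(norm (G (part n u) - G (part m u)))\<^sup>2 = (norm (G (part n u)))\<^sup>2 - 2 * (G (part m u) \<bullet> G (part n u)) + (norm (G (part m u)))\<^sup>2"
      by (simp add: power2_norm_eq_inner inner_diff_left inner_diff_right inner_commute)
    then show "(norm (G (part n u) - G (part m u)))\<^sup>2 \<le> ?S n - ?S m" by (simp add: pp G_part_norm)
  next
    show "convergent ?S"
      by (rule Bseq_mono_convergent)
        (auto intro!: BseqI'[of _ "(norm (G u))\<^sup>2"] sum_mono2 simp: sum_nonneg eigval_nonneg G_bessel[OF u])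
  qed
  then obtain q where q: "(\<lambda>m. G (part m u)) \<longlonglongrightarrow> q" using Cauchy_convergent convergent_def by blast
  have "G u = q" using G_closed[OF part_V part_tendsto[OF u] q] by simp
  then have "(\<lambda>m. (norm (G (part m u)))\<^sup>2) \<longlonglongrightarrow> (norm (G u))\<^sup>2" using q by (intro tendsto_intros) auto
  then show ?thesis by (simp add: G_part_norm)
qed

end

lemma (in bounded_open_domain) compact_gradient: "compact_gradient (H10 \<Omega>) (grad \<Omega>) (L2_space \<Omega>)"
proof (rule compact_gradient.intro)
  show "subspace (H10 \<Omega>)" by (rule H10_sub)
  show "grad \<Omega> (u + v) = grad \<Omega> u + grad \<Omega> v" if "u \<in> H10 \<Omega>" "v \<in> H10 \<Omega>" for u v
    by (rule grad_add[OF that])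
  show "grad \<Omega> (c *\<^sub>R u) = c *\<^sub>R grad \<Omega> u" if "u \<in> H10 \<Omega>" for u c
    by (rule grad_scale[OF that])
  show "l \<in> H10 \<Omega> \<and> grad \<Omega> l = p"
    if "\<And>j. x j \<in> H10 \<Omega>" "x \<longlonglongrightarrow> l" "(\<lambda>j. grad \<Omega> (x j)) \<longlonglongrightarrow> p" for x :: "nat \<Rightarrow> _" and l p
    by (rule H10_limit[OF that])
  show "compact (closure {u \<in> H10 \<Omega>. norm u \<le> R \<and> norm (grad \<Omega> u) \<le> R})" for R
    by (rule H10_compact_embedding)
  show "subspace (L2_space \<Omega>)" by (rule L2_sub)
  show "closed (L2_space \<Omega>)" by (rule L2_closed)
  show "H10 \<Omega> \<subseteq> L2_space \<Omega>" using H10_L2 by blast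
  show "h = 0" if "h \<in> L2_space \<Omega>" "\<And>u. u \<in> H10 \<Omega> \<Longrightarrow> h \<bullet> u = 0" for h
    by (rule orthogonal_test_zero[OF that(1)], rule that(2)[OF H10_test])
qed

section \<open>Distributional derivatives on an interval\<close>

text \<open>\<open>R\<close> is the normalised primitive of a bump on the interval from -d to d.
  Shifted copies of \<open>R\<close> form smooth cutoffs, and their derivatives act as approximate
  point evaluations.\<close>

lemma smooth_step:
  assumes d: "d > (0::real)"
  shows "\<exists>R \<kappa>. (\<forall>x. (R has_real_derivative \<kappa> x) (at x)) \<and> (\<forall>k. C_k k R) \<and> continuous_on UNIV \<kappa> \<and> (\<forall>x. 0 \<le> \<kappa> x) \<and>
     (\<forall>x. d \<le> \<bar>x\<bar> \<longrightarrow> \<kappa> x = 0) \<and> (\<forall>x\<le>- d. R x = 0) \<and> (\<forall>x\<ge>d. R x = 1) \<and> (\<forall>x. 0 \<le> R x \<and> R x \<le> 1)"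
proof -
  define g where "g x = bump (x + d) * bump (d + (-1) * x)" for x
  have gC: "C_k k g" for k
  proof -
    have "C_k k (\<lambda>x. (-1) * x :: real)" by (rule C_k_linear[OF bounded_linear_mult_right])
    then have "C_k k (\<lambda>x. bump (d + (-1) * x))" by (rule C_k_compose[OF C_k_bump C_k_add[OF C_k_const]])
    then show ?thesis unfolding g_def[abs_def] by (rule C_k_mult[OF C_k_shift[OF C_k_bump]])
  qed
  have gc: "continuous_on S g" for S using C_k_continuous[OF gC] continuous_on_subset by blast
  have g0: "0 \<le> g x" for x by (simp add: g_def bump_nonneg)
  have gz: "g x = 0" if "d \<le> \<bar>x\<bar>" for x using that by (auto simp: g_def bump_zero abs_if split: if_splits)
  define I where "I = integral {- d - 1..d} g"
  have I: "I > 0"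
  proof -
    have "I \<ge> 0" unfolding I_def by (intro integral_nonneg integrable_continuous_real gc g0)
    moreover have "I \<noteq> 0"
    proof
      assume "I = 0"
      then have "\<forall>x\<in>{- d - 1..d}. g x = 0"
        using integral_eq_0_iff[of "- d - 1" d g] gc g0 d by (simp add: I_def)
      then have "g 0 = 0" using d by auto
      then show False using bump_pos[OF d] by (simp add: g_def)
    qed
    ultimately show ?thesis by simp
  qed
  \<comment> \<open>The integral starts one unit left of the support, so that -d is an interior
    point when the primitive is differentiated.\<close>
  define R where "R x = integral {- d - 1..x} g / I" for x
  have Rl: "R x = 0" if "x \<le> - d" for x
  proof -
    have "integral {- d - 1..x} g = integral {- d - 1..x} (\<lambda>_. 0)"
      by (intro integral_cong gz) (use that d in auto)
    then show ?thesis by (simp add: R_def)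
  qed
  have Rr: "R x = 1" if "x \<ge> d" for x
  proof -
    have "integral {- d - 1..d} g + integral {d..x} g = integral {- d - 1..x} g"
      by (rule Henstock_Kurzweil_Integration.integral_combine) (use that d in \<open>auto intro: integrable_continuous_real gc\<close>)
    moreover have "integral {d..x} g = integral {d..x} (\<lambda>_. 0)" by (intro integral_cong gz) (use d in auto)
    ultimately show ?thesis using I by (simp add: R_def I_def)
  qed
  have Rd: "(R has_real_derivative g x / I) (at x)" for x
  proof (cases "x < - d")
    case True
    have "((\<lambda>_. 0) has_real_derivative g x / I) (at x)" using gz[of x] True d by simp
    then show ?thesis by (rule has_field_derivative_transform_within_open[of _ _ _ "{..<- d}"]) (use True Rl in auto)
  next
    case False
    have "((\<lambda>u. integral {- d - 1..u} g) has_real_derivative g x) (at x within {- d - 1..x + 1})"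
      by (rule integral_has_real_derivative[OF gc]) (use False in auto)
    moreover have "at x within {- d - 1..x + 1} = at x" by (rule at_within_Icc_at) (use False in auto)
    ultimately show ?thesis unfolding R_def[abs_def] by (intro DERIV_cdivide) simp
  qed
  have RC: "C_k k R" for k
  proof -
    have "C_k k (\<lambda>x. inverse I * g x)" by (intro C_k_mult C_k_const gC)
    then have "C_k k (\<lambda>x. g x / I)" by (simp add: divide_inverse mult.commute)
    then show ?thesis using C_k_Suc_D[OF C_k_real_deriv[OF Rd]] by blast
  qed
  have mono: "R x \<le> R y" if "x \<le> y" for x y
    by (rule DERIV_nonneg_imp_nondecreasing[OF that]) (use Rd g0 I in \<open>force intro: divide_nonneg_pos\<close>)
  have "0 \<le> R x \<and> R x \<le> 1" for x
    using mono[of "min x (-d)" x] mono[of x "max x d"] Rl[of "min x (-d)"] Rr[of "max x d"] by auto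
  moreover have "continuous_on UNIV (\<lambda>x. g x / I)" using I by (intro continuous_intros gc) auto
  ultimately show ?thesis using Rd RC g0 gz Rl Rr I
    by (intro exI[of _ R] exI[of _ "\<lambda>x. g x / I"]) (auto simp: less_imp_le)
qed

lemma integrable_lebesgue_on_subinterval:
  fixes f :: "real \<Rightarrow> real"
  assumes "integrable (lebesgue_on S) f" "S \<in> sets lebesgue" "A \<in> sets lebesgue" "A \<subseteq> S"
  shows "integrable (lebesgue_on A) f"
  using assms set_integrable_subset[of lebesgue S f A]
  by (simp add: integrable_restrict_space set_integrable_def)

lemma lebesgue_on_indicator_integral:
  fixes f :: "real \<Rightarrow> real"
  assumes f: "integrable (lebesgue_on S) f" and S: "S \<in> sets lebesgue" "{s..t} \<subseteq> S"
  shows "integrable (lebesgue_on S) (\<lambda>x. indicator {s..t} x * f x)"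
    "(LINT x|lebesgue_on S. indicator {s..t} x * f x) = integral {s..t} f"
proof -
  have "integrable lebesgue (\<lambda>x. indicator S x *\<^sub>R f x)" using f S by (simp add: integrable_restrict_space)
  then have "integrable lebesgue (\<lambda>x. indicator {s..t} x *\<^sub>R (indicator S x *\<^sub>R f x))"
    by (rule integrable_mult_indicator[rotated]) simp
  then show i: "integrable (lebesgue_on S) (\<lambda>x. indicator {s..t} x * f x)"
    using S by (simp add: integrable_restrict_space mult.left_commute)
  have "(LINT x|lebesgue_on S. indicator {s..t} x * f x) = integral S (\<lambda>x. indicator {s..t} x * f x)"
    by (rule lebesgue_integral_eq_integral[OF i S(1)])
  also have "\<dots> = integral S (\<lambda>x. if x \<in> {s..t} then f x else 0)"
    by (rule integral_cong) (simp add: indicator_def)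
  also have "\<dots> = integral {s..t} f" unfolding Henstock_Kurzweil_Integration.integral_restrict_Int Int_absorb2[OF S(2)] ..
  finally show "(LINT x|lebesgue_on S. indicator {s..t} x * f x) = integral {s..t} f" .
qed

text \<open>The shifted \<open>\<kappa>\<close> has integral 1 over the interval and lives within
  distance \<open>d\<close> of \<open>a\<close>, so the integral is a weighted mean of values of
  \<open>y\<close> near \<open>a\<close>.\<close>

lemma mollifier_bound:
  fixes y \<kappa> :: "real \<Rightarrow> real"
  assumes y: "continuous_on {0..T} y" and \<kappa>: "\<And>x. (R has_real_derivative \<kappa> x) (at x)" "continuous_on UNIV \<kappa>"
    "\<And>x. 0 \<le> \<kappa> x" "\<And>x. d \<le> \<bar>x\<bar> \<Longrightarrow> \<kappa> x = 0" "\<And>x. x \<le> - d \<Longrightarrow> R x = 0" "\<And>x. d \<le> x \<Longrightarrow> R x = 1"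
    and a: "d \<le> a" "a + d \<le> T" "0 < d" and e: "\<And>x. x \<in> {0..T} \<Longrightarrow> \<bar>x - a\<bar> \<le> d \<Longrightarrow> \<bar>y x - y a\<bar> \<le> e"
  shows "\<bar>integral {0..T} (\<lambda>x. y x * \<kappa> (x - a)) - y a\<bar> \<le> e"
proof -
  have kc: "continuous_on S (\<lambda>x. \<kappa> (x - a))" for S
    by (rule continuous_on_compose2[OF \<kappa>(2)]) (auto intro!: continuous_intros)
  have kI: "((\<lambda>x. \<kappa> (x - a)) has_integral (R (T - a) - R (0 - a))) {0..T}"
  proof (rule fundamental_theorem_of_calculus)
    fix x
    have "((\<lambda>x. R (x - a)) has_real_derivative \<kappa> (x - a)) (at x)"
      using DERIV_shift[of R "\<kappa> (x - a)" x "- a"] \<kappa>(1)[of "x - a"] by simp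
    then show "((\<lambda>x. R (x - a)) has_vector_derivative \<kappa> (x - a)) (at x within {0..T})"
      by (simp add: has_real_derivative_iff_has_vector_derivative has_vector_derivative_at_within)
  qed (use a in simp)
  have R1: "R (T - a) - R (0 - a) = 1" using \<kappa>(5)[of "- a"] \<kappa>(6)[of "T - a"] a by simp
  have k1: "integral {0..T} (\<lambda>x. \<kappa> (x - a)) = 1" using integral_unique[OF kI] R1 by simp
  have i1: "(\<lambda>x. y x * \<kappa> (x - a)) integrable_on {0..T}"
    by (intro integrable_continuous_real continuous_intros y kc)
  have i2: "(\<lambda>x. y a * \<kappa> (x - a)) integrable_on {0..T}"
    by (intro integrable_continuous_real continuous_intros kc)
  have "integral {0..T} (\<lambda>x. y x * \<kappa> (x - a)) - y a = integral {0..T} (\<lambda>x. y x * \<kappa> (x - a) - y a * \<kappa> (x - a))"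
    by (subst Henstock_Kurzweil_Integration.integral_diff[OF i1 i2]) (simp add: k1)
  also have "\<bar>\<dots>\<bar> \<le> integral {0..T} (\<lambda>x. e * \<kappa> (x - a))"
    unfolding real_norm_def[symmetric]
  proof (rule integral_norm_bound_integral)
    show "(\<lambda>x. y x * \<kappa> (x - a) - y a * \<kappa> (x - a)) integrable_on {0..T}"
      by (intro Henstock_Kurzweil_Integration.integrable_diff i1 i2)
    show "(\<lambda>x. e * \<kappa> (x - a)) integrable_on {0..T}" by (intro integrable_continuous_real continuous_intros kc)
    fix x assume x: "x \<in> {0..T}"
    show "norm (y x * \<kappa> (x - a) - y a * \<kappa> (x - a)) \<le> e * \<kappa> (x - a)"
    proof (cases "\<bar>x - a\<bar> \<le> d")
      case True
      have "norm (y x * \<kappa> (x - a) - y a * \<kappa> (x - a)) = \<bar>y x - y a\<bar> * \<kappa> (x - a)"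
        using \<kappa>(3)[of "x - a"] by (simp add: left_diff_distrib[symmetric] abs_mult)
      then show ?thesis using e[OF x True] \<kappa>(3)[of "x - a"] by (simp add: mult_right_mono)
    next
      case False then show ?thesis using \<kappa>(4)[of "x - a"] by simp
    qed
  qed
  also have "\<dots> = e" by (simp add: k1)
  finally show ?thesis .
qed

text \<open>The test function is a smoothed indicator of the interval from \<open>s\<close> to
  \<open>t\<close>. Its derivative is the difference of two approximate point masses, so one side
  tends to the increment of \<open>y\<close>, and dominated convergence handles the other.\<close>

lemma distr_deriv_interior:
  assumes D: "distr_deriv T y z" and y: "continuous_on {0..T} y" and z: "integrable (lebesgue_on {0..T}) z"
    and st: "0 < s" "s < t" "t < T"
  shows "y t - y s = integral {s..t} z"
proof -
  \<comment> \<open>Keeps both ramps inside the open interval and apart from each other.\<close>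
  define d0 where "d0 = min s (min (T - t) ((t - s) / 2))"
  define d where "d m = d0 / real (Suc (Suc m))" for m
  have d0: "d0 > 0" using st by (simp add: d0_def)
  have dp: "d m > 0" for m using d0 by (simp add: d_def)
  have dle: "d m < d0" for m using d0 by (simp add: d_def pos_divide_less_eq)
  have ds: "d m \<le> s" "t + d m \<le> T" "s + d m \<le> t - d m" "d m \<le> t" "s + d m \<le> T" for m
  proof -
    have "d m \<le> s" "d m \<le> T - t" "d m \<le> (t - s) / 2" using dle[of m] by (auto simp: d0_def)
    then show "d m \<le> s" "t + d m \<le> T" "s + d m \<le> t - d m" "d m \<le> t" "s + d m \<le> T" using st by auto
  qed
  have dlim: "d \<longlonglongrightarrow> 0"
  proof -
    have "(\<lambda>m. d0 * inverse (real (Suc (Suc m)))) \<longlonglongrightarrow> d0 * 0"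
      by (intro tendsto_intros LIMSEQ_Suc[OF LIMSEQ_inverse_real_of_nat])
    then show ?thesis by (simp add: d_def[abs_def] divide_inverse)
  qed
  obtain R \<kappa> where S: "\<And>m x. (R m has_real_derivative \<kappa> m x) (at x)" "\<And>m k. C_k k (R m)" "\<And>m. continuous_on UNIV (\<kappa> m)"
    "\<And>m x. 0 \<le> \<kappa> m x" "\<And>m x. d m \<le> \<bar>x\<bar> \<Longrightarrow> \<kappa> m x = 0" "\<And>m x. x \<le> - d m \<Longrightarrow> R m x = 0" "\<And>m x. d m \<le> x \<Longrightarrow> R m x = 1"
    "\<And>m x. 0 \<le> R m x \<and> R m x \<le> 1"
    using smooth_step[OF dp] by metis
  define \<eta> where "\<eta> m x = R m (x + (- s)) + (-1) * R m (x + (- t))" for m x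
  have \<eta>t: "\<eta> m \<in> test_functions {0<..<T}" for m
  proof (rule test_functionsI[of _ "{s - d m..t + d m}"])
    show "C_k k (\<eta> m)" for k
      unfolding \<eta>_def[abs_def] by (rule C_k_add[OF C_k_shift[OF S(2)] C_k_mult[OF C_k_const C_k_shift[OF S(2)]]])
    show "{s - d m..t + d m} \<subseteq> {0<..<T}" using dle[of m] by (auto simp: d0_def)
    fix x assume nz: "\<eta> m x \<noteq> 0"
    show "x \<in> {s - d m..t + d m}"
    proof (rule ccontr)
      assume "x \<notin> {s - d m..t + d m}"
      then consider "x < s - d m" | "t + d m < x" by force
      then show False using nz S(6)[of "x + - s" m] S(6)[of "x + - t" m] S(7)[of m "x + - s"] S(7)[of m "x + - t"] st
        by cases (auto simp: \<eta>_def)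
    qed
  qed simp
  have \<eta>d: "deriv (\<eta> m) x = \<kappa> m (x - s) - \<kappa> m (x - t)" for m x
  proof (rule DERIV_imp_deriv)
    have "((\<lambda>x. R m (x + - a)) has_real_derivative \<kappa> m (x + - a)) (at x)" for a
      using DERIV_shift[of "R m" "\<kappa> m (x + - a)" x "- a"] S(1)[of m "x + - a"] by blast
    from DERIV_add[OF this[of s] DERIV_cmult[OF this[of t], of "-1"]]
    show "(\<eta> m has_real_derivative \<kappa> m (x - s) - \<kappa> m (x - t)) (at x)"
      by (simp add: \<eta>_def[abs_def])
  qed
  have kc: "continuous_on A (\<lambda>x. \<kappa> m (x - a))" for m a A
    by (rule continuous_on_compose2[OF S(3)]) (auto intro!: continuous_intros)
  have yk: "integrable (lebesgue_on {0<..<T}) (\<lambda>x. y x * \<kappa> m (x - a))"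
    "(LINT x|lebesgue_on {0<..<T}. y x * \<kappa> m (x - a)) = integral {0..T} (\<lambda>x. y x * \<kappa> m (x - a))" for m a
  proof -
    have "integrable (lebesgue_on {0..T}) (\<lambda>x. y x * \<kappa> m (x - a))"
      by (intro continuous_imp_integrable_real continuous_intros y kc)
    then show i: "integrable (lebesgue_on {0<..<T}) (\<lambda>x. y x * \<kappa> m (x - a))"
      by (rule integrable_lebesgue_on_subinterval) auto
    show "(LINT x|lebesgue_on {0<..<T}. y x * \<kappa> m (x - a)) = integral {0..T} (\<lambda>x. y x * \<kappa> m (x - a))"
      using lebesgue_integral_eq_integral[OF i] integral_open_interval_real[of 0 T "\<lambda>x. y x * \<kappa> m (x - a)"] by simp
  qed
  have eq: "integral {0..T} (\<lambda>x. y x * \<kappa> m (x - t)) - integral {0..T} (\<lambda>x. y x * \<kappa> m (x - s)) =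
     (LINT x|lebesgue_on {0<..<T}. z x * \<eta> m x)" for m
  proof -
    have "- (LINT x|lebesgue_on {0<..<T}. y x * deriv (\<eta> m) x) = (LINT x|lebesgue_on {0<..<T}. z x * \<eta> m x)"
      using D \<eta>t unfolding distr_deriv_def by blast
    moreover have "(LINT x|lebesgue_on {0<..<T}. y x * deriv (\<eta> m) x) =
       (LINT x|lebesgue_on {0<..<T}. y x * \<kappa> m (x - s)) - (LINT x|lebesgue_on {0<..<T}. y x * \<kappa> m (x - t))"
      unfolding \<eta>d right_diff_distrib by (rule Bochner_Integration.integral_diff[OF yk(1) yk(1)])
    ultimately show ?thesis by (simp add: yk(2))
  qed
  have lim: "(\<lambda>m. integral {0..T} (\<lambda>x. y x * \<kappa> m (x - a))) \<longlonglongrightarrow> y a" if a: "\<And>m. d m \<le> a" "\<And>m. a + d m \<le> T" for a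
  proof (rule LIMSEQ_I)
    fix e :: real assume e: "e > 0"
    have "a \<in> {0..T}" using a(1)[of 0] a(2)[of 0] dp[of 0] by auto
    then obtain r where r: "r > 0" "\<And>x. x \<in> {0..T} \<Longrightarrow> dist x a < r \<Longrightarrow> dist (y x) (y a) < e/2"
      using y e unfolding continuous_on_iff by (metis half_gt_zero)
    have "\<forall>\<^sub>F m in sequentially. d m < r" using order_tendstoD(2)[OF dlim r(1)] .
    then obtain M where M: "\<And>m. m \<ge> M \<Longrightarrow> d m < r" by (auto simp: eventually_sequentially)
    have "\<bar>integral {0..T} (\<lambda>x. y x * \<kappa> m (x - a)) - y a\<bar> \<le> e/2" if "m \<ge> M" for m
      by (rule mollifier_bound[OF y S(1) S(3) S(4) S(5) S(6) S(7) a(1) a(2) dp])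
        (use r(2) M[OF that] in \<open>force simp: dist_real_def\<close>)+
    then show "\<exists>no. \<forall>m\<ge>no. norm (integral {0..T} (\<lambda>x. y x * \<kappa> m (x - a)) - y a) < e"
      using e by (intro exI[of _ M]) (auto intro: le_less_trans[of _ "e/2"])
  qed
  have "(\<lambda>m. integral {0..T} (\<lambda>x. y x * \<kappa> m (x - t)) - integral {0..T} (\<lambda>x. y x * \<kappa> m (x - s))) \<longlonglongrightarrow> y t - y s"
    by (intro tendsto_diff lim ds)
  moreover have "(\<lambda>m. LINT x|lebesgue_on {0<..<T}. z x * \<eta> m x) \<longlonglongrightarrow> (LINT x|lebesgue_on {0<..<T}. indicator {s..t} x * z x)"
  proof (rule integral_dominated_convergence[where w="\<lambda>x. \<bar>z x\<bar>"])
    have zi: "integrable (lebesgue_on {0<..<T}) z" by (rule integrable_lebesgue_on_subinterval[OF z]) auto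
    then show "integrable (lebesgue_on {0<..<T}) (\<lambda>x. \<bar>z x\<bar>)" by simp
    have [measurable]: "z \<in> borel_measurable (lebesgue_on {0<..<T})" using zi by simp
    have [measurable]: "\<eta> m \<in> borel_measurable (lebesgue_on {0<..<T})" for m
      by (rule measurable_restrict_space1[OF borel_measurable_lebesgueI[OF test_functions_borel[OF \<eta>t]]])
    have [measurable]: "indicat_real {s..t} \<in> borel_measurable (lebesgue_on {0<..<T})"
      by (intro measurable_restrict_space1 borel_measurable_indicator) simp
    show "(\<lambda>x. indicator {s..t} x * z x) \<in> borel_measurable (lebesgue_on {0<..<T})" by measurable
    show "(\<lambda>x. z x * \<eta> m x) \<in> borel_measurable (lebesgue_on {0<..<T})" for m by measurable
    have "\<bar>\<eta> m x\<bar> \<le> 1" for m x using S(8)[of m "x + - s"] S(8)[of m "x + - t"] by (auto simp: \<eta>_def)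
    then show "AE x in lebesgue_on {0<..<T}. norm (z x * \<eta> m x) \<le> \<bar>z x\<bar>" for m
      by (intro AE_I2) (simp add: abs_mult mult_left_le)
    have ptw: "(\<lambda>m. z x * \<eta> m x) \<longlonglongrightarrow> indicator {s..t} x * z x" if x: "x \<noteq> s" "x \<noteq> t" for x
    proof -
      have "\<forall>\<^sub>F m in sequentially. d m < \<bar>x - s\<bar> \<and> d m < \<bar>x - t\<bar>"
        using order_tendstoD(2)[OF dlim, of "\<bar>x - s\<bar>"] order_tendstoD(2)[OF dlim, of "\<bar>x - t\<bar>"] x by (auto intro: eventually_conj)
      then have "\<forall>\<^sub>F m in sequentially. z x * \<eta> m x = indicator {s..t} x * z x"
      proof eventually_elim
        case (elim m)
        consider "x \<le> s - d m" | "s + d m \<le> x \<and> x \<le> t - d m" | "t + d m \<le> x" using elim by (auto simp: abs_if split: if_splits)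
        then show ?case
          using S(6)[of "x + - s" m] S(6)[of "x + - t" m] S(7)[of m "x + - s"] S(7)[of m "x + - t"] dp[of m] ds[of m] st
          by cases (auto simp: \<eta>_def indicator_def)
      qed
      then show ?thesis by (rule tendsto_eventually)
    qed
    have "AE x in lebesgue. x \<notin> {s, t}" by (intro AE_not_in) (auto intro!: null_sets_completionI)
    then have "AE x in lebesgue_on {0<..<T}. x \<notin> {s, t}" by (subst AE_restrict_space_iff) (auto elim: AE_mp)
    then show "AE x in lebesgue_on {0<..<T}. (\<lambda>m. z x * \<eta> m x) \<longlonglongrightarrow> indicator {s..t} x * z x"
      by eventually_elim (auto intro: ptw)
  qed
  moreover have "(LINT x|lebesgue_on {0<..<T}. indicator {s..t} x * z x) = integral {s..t} z"
    by (rule lebesgue_on_indicator_integral(2)) (use st in \<open>auto intro: integrable_lebesgue_on_subinterval[OF z]\<close>)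
  ultimately show ?thesis unfolding eq using LIMSEQ_unique by metis
qed

text \<open>Subtracting the primitive of \<open>z\<close> leaves a function constant on the open
  interval; continuity of both extends this to the endpoints.\<close>

lemma distr_deriv_integral:
  assumes D: "distr_deriv T y z" and T: "T > 0" and y: "continuous_on {0..T} y" and z: "integrable (lebesgue_on {0..T}) z"
    and st: "0 \<le> s" "s \<le> t" "t \<le> T"
  shows "y t - y s = integral {s..t} z"
proof -
  have zi: "z integrable_on {0..T}" by (rule integrable_on_lebesgue_on[OF z]) simp
  define w where "w x = y x - integral {0..x} z" for x
  have comb: "integral {0..a} z + integral {a..b} z = integral {0..b} z" if "0 \<le> a" "a \<le> b" "b \<le> T" for a b
    by (rule Henstock_Kurzweil_Integration.integral_combine)
      (use that in \<open>auto intro: integrable_on_subinterval[OF zi]\<close>)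
  have const: "w b = w a" if "0 < a" "a < b" "b < T" for a b
    using distr_deriv_interior[OF D y z that] comb[of a b] that by (simp add: w_def)
  have wc: "continuous_on {0..T} w"
    unfolding w_def[abs_def] by (intro continuous_intros y indefinite_integral_continuous_1 zi)
  have "w x = w (T/2)" if "x \<in> {0<..<T}" for x
  proof (rule linorder_cases[of x "T/2"])
    show "x < T/2 \<Longrightarrow> ?thesis" using const[of x "T/2"] that by simp
    show "T/2 < x \<Longrightarrow> ?thesis" using const[of "T/2" x] that by simp
    show "x = T/2 \<Longrightarrow> ?thesis" by (rule arg_cong)
  qed
  note inner = this
  have cl: "closure {0<..<T} = {0..T}" using T by simp
  have all: "w x = w (T/2)" if x: "x \<in> {0..T}" for x
  proof (rule continuous_constant_on_closure[of "{0<..<T}" w])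
    show "continuous_on (closure {0<..<T}) w" unfolding cl by (rule wc)
    show "x \<in> closure {0<..<T}" unfolding cl by (rule x)
  qed (rule inner)
  have "s \<in> {0..T}" "t \<in> {0..T}" using st by auto
  then have "w s = w t" using all[of s] all[of t] by (simp only:)
  then show ?thesis using st comb[of s t] unfolding w_def by linarith
qed

text \<open>The chain rule for a square when \<open>z\<close> is merely integrable. On an interval
  shorter than the modulus of uniform continuity, the error is at most the oscillation of
  \<open>y\<close> times the integral of the absolute value of \<open>z\<close>; these local errors
  add up to an arbitrarily small total.\<close>

lemma integral_square:
  fixes y z :: "real \<Rightarrow> real"
  assumes y: "continuous_on {0..T} y" and z: "integrable (lebesgue_on {0..T}) z"
    and yz: "\<And>s t. 0 \<le> s \<Longrightarrow> s \<le> t \<Longrightarrow> t \<le> T \<Longrightarrow> y t - y s = integral {s..t} z"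
    and st: "0 \<le> s" "s \<le> t" "t \<le> T"
  shows "integrable (lebesgue_on {0..T}) (\<lambda>x. y x * z x)" "(y t)\<^sup>2 - (y s)\<^sup>2 = 2 * integral {s..t} (\<lambda>x. y x * z x)"
proof -
  have "bounded (y ` {0..T})" by (intro compact_imp_bounded compact_continuous_image y) auto
  then obtain B where "\<forall>x\<in>{0..T}. \<bar>y x\<bar> \<le> B" by (auto simp: bounded_iff)
  then have B: "\<And>x. x \<in> {0..T} \<Longrightarrow> \<bar>y x\<bar> \<le> B" by blast
  have ym: "y \<in> borel_measurable (lebesgue_on {0..T})"
    by (rule continuous_imp_measurable_on_sets_lebesgue[OF y]) simp
  have yzI: "integrable (lebesgue_on {0..T}) (\<lambda>x. y x * z x)"
  proof (rule Bochner_Integration.integrable_bound)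
    show "integrable (lebesgue_on {0..T}) (\<lambda>x. B * z x)" using z by simp
    show "(\<lambda>x. y x * z x) \<in> borel_measurable (lebesgue_on {0..T})" using ym z by simp
    show "AE x in lebesgue_on {0..T}. norm (y x * z x) \<le> norm (B * z x)"
      using B by (intro AE_I2) (force simp: abs_mult intro!: mult_right_mono)
  qed
  then show "integrable (lebesgue_on {0..T}) (\<lambda>x. y x * z x)" .
  have zi: "z integrable_on {0..T}" and ai: "(\<lambda>x. \<bar>z x\<bar>) integrable_on {0..T}" and pi: "(\<lambda>x. y x * z x) integrable_on {0..T}"
    using z yzI by (auto intro: integrable_on_lebesgue_on)
  note sub = integrable_on_subinterval
  define h where "h = integral {0..T} (\<lambda>x. \<bar>z x\<bar>)"
  have h0: "0 \<le> h" unfolding h_def by (intro integral_nonneg ai) simp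
  let ?E = "\<lambda>s t. (y t)\<^sup>2 - (y s)\<^sup>2 - 2 * integral {s..t} (\<lambda>x. y x * z x)"
  have small: "\<bar>?E s t\<bar> \<le> e" if e: "e > 0" for e
  proof -
    have "uniformly_continuous_on {0..T} y" by (rule compact_uniformly_continuous[OF y]) simp
    then obtain d where d: "d > 0" "\<And>a b. a \<in> {0..T} \<Longrightarrow> b \<in> {0..T} \<Longrightarrow> dist a b < d \<Longrightarrow> dist (y a) (y b) < e / (2 * (h + 1))"
      using e h0 unfolding uniformly_continuous_on_def by (metis divide_pos_pos mult_pos_pos add_nonneg_pos zero_less_one zero_less_numeral)
    let ?w = "e / (h + 1)"
    have halves: "e / (2 * k) + e / (2 * k) = e / k" for k :: real by (cases "k = 0") (auto simp: field_simps)
    have local: "\<bar>?E a b\<bar> \<le> ?w * integral {a..b} (\<lambda>x. \<bar>z x\<bar>)" if ab: "0 \<le> a" "a \<le> b" "b \<le> T" "b - a < d" for a b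
    proof -
      have iz: "z integrable_on {a..b}" "(\<lambda>x. \<bar>z x\<bar>) integrable_on {a..b}" "(\<lambda>x. y x * z x) integrable_on {a..b}"
        using ab by (auto intro: sub[OF zi] sub[OF ai] sub[OF pi])
      have "?E a b = (y b + y a) * integral {a..b} z - 2 * integral {a..b} (\<lambda>x. y x * z x)"
        using yz[OF ab(1-3)] by (simp add: power2_eq_square algebra_simps)
      also have "\<dots> = integral {a..b} (\<lambda>x. (y b + y a) * z x - 2 * (y x * z x))"
        using iz by (subst Henstock_Kurzweil_Integration.integral_diff) (auto intro: integrable_on_mult_right)
      also have "\<bar>\<dots>\<bar> \<le> integral {a..b} (\<lambda>x. ?w * \<bar>z x\<bar>)"
        unfolding real_norm_def[symmetric]
      proof (rule integral_norm_bound_integral)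
        show "(\<lambda>x. (y b + y a) * z x - 2 * (y x * z x)) integrable_on {a..b}"
          using iz by (intro Henstock_Kurzweil_Integration.integrable_diff integrable_on_mult_right)
        show "(\<lambda>x. ?w * norm (z x)) integrable_on {a..b}" using iz by (intro integrable_on_mult_right) simp
        fix x assume x: "x \<in> {a..b}"
        have "dist (y b) (y x) < e / (2 * (h + 1))" "dist (y a) (y x) < e / (2 * (h + 1))"
          using x ab d(2)[of b x] d(2)[of a x] by (auto simp: dist_real_def)
        then have "\<bar>y b + y a - 2 * y x\<bar> \<le> e / (2 * (h + 1)) + e / (2 * (h + 1))" by (simp add: dist_real_def)
        also have "\<dots> = ?w" by (rule halves)
        finally have "\<bar>y b + y a - 2 * y x\<bar> * \<bar>z x\<bar> \<le> ?w * \<bar>z x\<bar>" by (rule mult_right_mono) simp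
        moreover have "(y b + y a) * z x - 2 * (y x * z x) = (y b + y a - 2 * y x) * z x" by (simp add: algebra_simps)
        ultimately show "norm ((y b + y a) * z x - 2 * (y x * z x)) \<le> ?w * norm (z x)" by (simp only: real_norm_def abs_mult)
      qed
      finally show ?thesis by simp
    qed
    have chain: "\<bar>?E a b\<bar> \<le> ?w * integral {a..b} (\<lambda>x. \<bar>z x\<bar>)" if ab: "0 \<le> a" "a \<le> b" "b \<le> T" "b - a \<le> real n * (d/2)" for a b n
      using ab
    proof (induction n arbitrary: b)
      case 0
      then have "a = b" by simp
      then show ?case by simp
    next
      case (Suc n)
      \<comment> \<open>Pieces of length at most d/2 stay strictly below the modulus
        \<open>d\<close>; the maximum handles the incomplete piece.\<close>
      define c where "c = max a (b - d/2)"
      have c: "a \<le> c" "c \<le> b" "b - c < d" "c - a \<le> real n * (d/2)" using Suc.prems d(1) by (auto simp: c_def algebra_simps max_def)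
      have IH: "\<bar>?E a c\<bar> \<le> ?w * integral {a..c} (\<lambda>x. \<bar>z x\<bar>)" using Suc c by (intro Suc.IH) auto
      have lo: "\<bar>?E c b\<bar> \<le> ?w * integral {c..b} (\<lambda>x. \<bar>z x\<bar>)" using Suc.prems c by (intro local) auto
      have "integral {a..c} (\<lambda>x. y x * z x) + integral {c..b} (\<lambda>x. y x * z x) = integral {a..b} (\<lambda>x. y x * z x)"
        using Suc.prems c by (intro Henstock_Kurzweil_Integration.integral_combine sub[OF pi]) auto
      moreover have "integral {a..c} (\<lambda>x. \<bar>z x\<bar>) + integral {c..b} (\<lambda>x. \<bar>z x\<bar>) = integral {a..b} (\<lambda>x. \<bar>z x\<bar>)"
        using Suc.prems c by (intro Henstock_Kurzweil_Integration.integral_combine sub[OF ai]) auto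
      ultimately show ?case using IH lo by (smt (verit) distrib_left)
    qed
    obtain n where "t - s \<le> real n * (d/2)" using d(1) reals_Archimedean3[of "d/2"] by (meson half_gt_zero less_imp_le)
    then have "\<bar>?E s t\<bar> \<le> ?w * integral {s..t} (\<lambda>x. \<bar>z x\<bar>)" by (rule chain[OF st])
    also have "integral {s..t} (\<lambda>x. \<bar>z x\<bar>) \<le> h"
      unfolding h_def by (rule integral_subset_le) (use st in \<open>auto intro: sub[OF ai] ai\<close>)
    then have "?w * integral {s..t} (\<lambda>x. \<bar>z x\<bar>) \<le> ?w * h" using e h0 by (intro mult_left_mono) auto
    also have "\<dots> \<le> e" using e h0 by (simp add: pos_divide_le_eq algebra_simps)
    finally show ?thesis .
  qed
  have "\<bar>?E s t\<bar> \<le> 0" by (rule field_le_epsilon) (use small in simp)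
  then show "(y t)\<^sup>2 - (y s)\<^sup>2 = 2 * integral {s..t} (\<lambda>x. y x * z x)" by simp
qed

text \<open>A distributional derivative is integrable only over compact parts of the open interval.
  Exhausting the interval gives measurability of \<open>z\<close>, and the integrable majorant gives
  integrability up to the ends.\<close>

lemma integrable_from_compacts:
  fixes z :: "real \<Rightarrow> real"
  assumes T: "T > 0" and loc: "\<And>a b. 0 < a \<Longrightarrow> b < T \<Longrightarrow> integrable (lebesgue_on {a..b}) z"
    and m: "integrable (lebesgue_on {0..T}) m" and b: "AE x in lebesgue_on {0..T}. \<bar>z x\<bar> \<le> m x"
  shows "integrable (lebesgue_on {0..T}) z"
proof (rule Bochner_Integration.integrable_bound[OF m])
  have meas: "(\<lambda>x. indicator {0<..<T} x * z x) \<in> borel_measurable lebesgue"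
  proof (rule borel_measurable_LIMSEQ_real)
    fix n :: nat
    have "integrable lebesgue (\<lambda>x. indicator {1 / Suc n..T - 1 / Suc n} x *\<^sub>R z x)"
      using loc[of "1 / Suc n" "T - 1 / Suc n"] by (simp add: integrable_restrict_space)
    then show "(\<lambda>x. indicator {1 / Suc n..T - 1 / Suc n} x * z x) \<in> borel_measurable lebesgue" by simp
  next
    fix x :: real
    show "(\<lambda>n. indicator {1 / Suc n..T - 1 / Suc n} x * z x) \<longlonglongrightarrow> indicator {0<..<T} x * z x"
    proof (cases "x \<in> {0<..<T}")
      case True
      then have "min x (T - x) > 0" by simp
      then have "\<forall>\<^sub>F n in sequentially. inverse (real (Suc n)) < min x (T - x)"
        by (rule order_tendstoD(2)[OF LIMSEQ_inverse_real_of_nat])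
      then have "\<forall>\<^sub>F n in sequentially. indicator {1 / Suc n..T - 1 / Suc n} x * z x = indicator {0<..<T} x * z x"
        by eventually_elim (use True in \<open>auto simp: indicator_def inverse_eq_divide\<close>)
      then show ?thesis by (rule tendsto_eventually)
    next
      case False
      have p: "1 / real (Suc n) > 0" for n by simp
      have "x \<notin> {1 / Suc n..T - 1 / Suc n}" for n
      proof
        assume "x \<in> {1 / Suc n..T - 1 / Suc n}"
        then have "1 / real (Suc n) \<le> x" "x \<le> T - 1 / real (Suc n)" unfolding atLeastAtMost_iff by blast+
        with p[of n] have "0 < x" "x < T" by linarith+
        with False show False by simp
      qed
      then have z0: "indicator {1 / Suc n..T - 1 / Suc n} x * z x = 0" for n
        unfolding indicator_def by simp
      show ?thesis unfolding z0 using False by simp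
    qed
  qed
  \<comment> \<open>The two endpoint values are restored so that the function equals
    \<open>z\<close> everywhere on the closed interval.\<close>
  have "(\<lambda>x. indicator {0<..<T} x * z x + indicator {0} x * z 0 + indicator {T} x * z T) \<in> borel_measurable lebesgue"
  proof -
    have c: "(\<lambda>x. indicator {a} x * c) \<in> borel_measurable lebesgue" for a c :: real
      by (rule borel_measurable_times[OF borel_measurable_indicator borel_measurable_const]) simp
    show ?thesis by (rule borel_measurable_add[OF borel_measurable_add[OF meas c] c])
  qed
  then have "(\<lambda>x. indicator {0<..<T} x * z x + indicator {0} x * z 0 + indicator {T} x * z T) \<in> borel_measurable (lebesgue_on {0..T})"
    by (rule measurable_restrict_space1)
  then show "z \<in> borel_measurable (lebesgue_on {0..T})"
    by (rule measurable_cong[THEN iffD1, rotated]) (use T in \<open>auto simp: indicator_def\<close>)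
  show "AE x in lebesgue_on {0..T}. norm (z x) \<le> norm (m x)" using b by eventually_elim simp
qed

section \<open>The energy identity\<close>

context compact_gradient begin

lemma eig_le_1: "norm (eig k) \<le> 1" using eig_norm[of k] by auto

lemma coeff_continuous_measurable:
  fixes u :: "real \<Rightarrow> 'a"
  shows "continuous_on {0..T} (\<lambda>t. u t \<bullet> eig k) \<Longrightarrow> (\<lambda>t. u t \<bullet> eig k) \<in> borel_measurable (lebesgue_on {0..T})"
  by (rule continuous_imp_measurable_on_sets_lebesgue) simp_all

text \<open>Measurability in time comes from the eigenfunction expansion: for almost every time the
  squared gradient norm is the limit of finite sums of continuous functions, and \<open>lim\<close>
  of these is a measurable version.\<close>

lemma grad_norm_integrable:
  fixes u :: "real \<Rightarrow> 'a"
  assumes uc: "\<And>k. continuous_on {0..T} (\<lambda>t. u t \<bullet> eig k)"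
    and uV: "AE t in lebesgue_on {0..T}. u t \<in> V"
    and ui: "(\<integral>\<^sup>+t. ennreal ((norm (G (u t)))\<^sup>2) \<partial>lebesgue_on {0..T}) < \<infinity>"
  shows "\<exists>N. integrable (lebesgue_on {0..T}) N \<and> (AE t in lebesgue_on {0..T}. N t = (norm (G (u t)))\<^sup>2)"
proof -
  let ?M = "lebesgue_on {0..T}"
  define N where "N t = lim (\<lambda>n. \<Sum>k<n. eigval k * (u t \<bullet> eig k)\<^sup>2)" for t
  note [measurable] = coeff_continuous_measurable[OF uc]
  have Nm [measurable]: "N \<in> borel_measurable ?M" unfolding N_def by measurable
  have NA: "AE t in ?M. N t = (norm (G (u t)))\<^sup>2"
    using uV
  proof eventually_elim
    case (elim t) then show ?case unfolding N_def by (intro limI G_expansion)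
  qed
  have "integrable ?M N"
  proof (rule integrableI_bounded[OF Nm])
    have "(\<integral>\<^sup>+t. ennreal (norm (N t)) \<partial>?M) = (\<integral>\<^sup>+t. ennreal ((norm (G (u t)))\<^sup>2) \<partial>?M)"
      by (rule nn_integral_cong_AE, use NA in eventually_elim) simp
    then show "(\<integral>\<^sup>+t. ennreal (norm (N t)) \<partial>?M) < \<infinity>" using ui by simp
  qed
  with NA show ?thesis by blast
qed

text \<open>Tested with an eigenvector, the gradient term becomes \<open>eigval k\<close> times a
  bounded coefficient. The right side thus has an integrable majorant and the equation can be
  integrated up to the endpoints.\<close>

lemma mode_equation:
  fixes u F :: "real \<Rightarrow> 'a"
  assumes T: "T > 0"
    and uc: "\<And>k. continuous_on {0..T} (\<lambda>t. u t \<bullet> eig k)"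
    and uV: "AE t in lebesgue_on {0..T}. u t \<in> V"
    and ub: "\<And>t. t \<in> {0..T} \<Longrightarrow> norm (u t) \<le> R"
    and Fb: "AE t in lebesgue_on {0..T}. norm (F t) \<le> m t" and m: "integrable (lebesgue_on {0..T}) m"
    and eq: "\<And>k. distr_deriv T (\<lambda>t. u t \<bullet> eig k) (\<lambda>t. - d * (G (u t) \<bullet> G (eig k)) + F t \<bullet> eig k)"
  shows "\<exists>z. (\<forall>k. integrable (lebesgue_on {0..T}) (z k)) \<and>
    (AE t in lebesgue_on {0..T}. \<forall>k. z k t = - d * (eigval k * (u t \<bullet> eig k)) + F t \<bullet> eig k) \<and>
    (\<forall>k s t. 0 \<le> s \<longrightarrow> s \<le> t \<longrightarrow> t \<le> T \<longrightarrow> u t \<bullet> eig k - u s \<bullet> eig k = integral {s..t} (z k))"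
proof -
  let ?M = "lebesgue_on {0..T}"
  define y where "y k t = u t \<bullet> eig k" for k t
  define z where "z k t = - d * (G (u t) \<bullet> G (eig k)) + F t \<bullet> eig k" for k t
  have R0: "0 \<le> R" using ub[of 0] T norm_ge_zero[of "u 0"] by (meson atLeastAtMost_iff less_imp_le order_refl order_trans)
  have yb: "\<bar>y k t\<bar> \<le> R" if "t \<in> {0..T}" for k t
  proof -
    have "\<bar>y k t\<bar> \<le> norm (u t) * norm (eig k)" unfolding y_def by (rule Cauchy_Schwarz_ineq2)
    also have "\<dots> \<le> R * 1" using ub[OF that] eig_le_1 R0 by (intro mult_mono) auto
    finally show ?thesis by simp
  qed
  have zV: "AE t in ?M. \<forall>k. z k t = - d * (eigval k * y k t) + F t \<bullet> eig k"
    using uV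
  proof eventually_elim
    case (elim t)
    then show ?case using eig_weak[OF elim] by (simp add: z_def y_def inner_commute)
  qed
  have zi: "integrable ?M (z k)" for k
  proof (rule integrable_from_compacts[OF T])
    show "integrable (lebesgue_on {a..b}) (z k)" if "0 < a" "b < T" for a b
      using eq[of k] that unfolding distr_deriv_def z_def[abs_def] by blast
    show "integrable ?M (\<lambda>t. \<bar>d\<bar> * (eigval k * R) + m t)"
      by (intro Bochner_Integration.integrable_add m) (auto simp: finite_measure_lebesgue_on intro!: finite_measure.integrable_const)
    have "AE t in ?M. t \<in> {0..T}" by (rule AE_I2) simp
    with zV Fb show "AE t in ?M. \<bar>z k t\<bar> \<le> \<bar>d\<bar> * (eigval k * R) + m t"
    proof eventually_elim
      case (elim t)
      have "\<bar>F t \<bullet> eig k\<bar> \<le> norm (F t) * norm (eig k)" by (rule Cauchy_Schwarz_ineq2)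
      also have "\<dots> \<le> norm (F t) * 1" by (intro mult_left_mono eig_le_1) auto
      finally have "\<bar>F t \<bullet> eig k\<bar> \<le> m t" using elim by simp
      moreover have "\<bar>- d * (eigval k * y k t)\<bar> \<le> \<bar>d\<bar> * (eigval k * R)"
        unfolding abs_mult abs_minus_cancel using eigval_nonneg[of k] yb[OF elim(3)] by (intro mult_left_mono) (auto intro: mult_left_mono)
      ultimately show ?case using elim(1) by (auto simp: abs_le_iff)
    qed
  qed
  have yint: "y k t - y k s = integral {s..t} (z k)" if "0 \<le> s" "s \<le> t" "t \<le> T" for k s t
    by (rule distr_deriv_integral[OF _ T uc[of k, folded y_def] zi that]) (use eq in \<open>simp add: y_def[abs_def] z_def[abs_def]\<close>)
  show ?thesis
    by (rule exI[of _ z], intro conjI allI impI zi zV[unfolded y_def] yint[unfolded y_def])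
qed

text \<open>Each mode obeys \<open>integral_square\<close>; summation gives the identity for partial
  sums. Parseval yields the limit of the left side and dominated convergence that of the right.
  \<open>Z\<close> is a measurable version of the limiting integrand.\<close>

theorem energy_identity:
  fixes u F :: "real \<Rightarrow> 'a" and z :: "nat \<Rightarrow> real \<Rightarrow> real"
  assumes T: "T > 0"
    and uH: "\<And>t. t \<in> {0..T} \<Longrightarrow> u t \<in> H"
    and uc: "\<And>k. continuous_on {0..T} (\<lambda>t. u t \<bullet> eig k)"
    and uV: "AE t in lebesgue_on {0..T}. u t \<in> V"
    and Ni: "integrable (lebesgue_on {0..T}) N"
    and NA: "AE t in lebesgue_on {0..T}. N t = (norm (G (u t)))\<^sup>2"
    and ub: "\<And>t. t \<in> {0..T} \<Longrightarrow> norm (u t) \<le> R"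
    and Fb: "AE t in lebesgue_on {0..T}. norm (F t) \<le> m t" and m: "integrable (lebesgue_on {0..T}) m"
    and zi: "\<And>k. integrable (lebesgue_on {0..T}) (z k)"
    and zV: "AE t in lebesgue_on {0..T}. \<forall>k. z k t = - d * (eigval k * (u t \<bullet> eig k)) + F t \<bullet> eig k"
    and zint: "\<And>k s t. 0 \<le> s \<Longrightarrow> s \<le> t \<Longrightarrow> t \<le> T \<Longrightarrow> u t \<bullet> eig k - u s \<bullet> eig k = integral {s..t} (z k)"
  shows "\<exists>Z. integrable (lebesgue_on {0..T}) Z \<and>
    (AE t in lebesgue_on {0..T}. Z t = - d * (norm (G (u t)))\<^sup>2 + F t \<bullet> u t) \<and>
    (\<forall>s t. 0 \<le> s \<longrightarrow> s \<le> t \<longrightarrow> t \<le> T \<longrightarrow> (norm (u t))\<^sup>2 - (norm (u s))\<^sup>2 = 2 * integral {s..t} Z)"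
proof -
  let ?M = "lebesgue_on {0..T}"
  define y where "y k t = u t \<bullet> eig k" for k t
  have R0: "0 \<le> R" using ub[of 0] T norm_ge_zero[of "u 0"] by (meson atLeastAtMost_iff less_imp_le order_refl order_trans)
  have yc: "continuous_on {0..T} (y k)" for k using uc by (simp add: y_def[abs_def])
  have ym [measurable]: "y k \<in> borel_measurable ?M" for k
    by (rule continuous_imp_measurable_on_sets_lebesgue[OF yc]) simp
  have yint: "y k t - y k s = integral {s..t} (z k)" if "0 \<le> s" "s \<le> t" "t \<le> T" for k s t
    using zint[OF that] by (simp add: y_def)
  have sq: "integrable ?M (\<lambda>x. y k x * z k x)" "(y k t)\<^sup>2 - (y k s)\<^sup>2 = 2 * integral {s..t} (\<lambda>x. y k x * z k x)"
    if "0 \<le> s" "s \<le> t" "t \<le> T" for k s t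
    using integral_square[OF yc zi yint that] by auto
  have yzi: "integrable ?M (\<lambda>x. y k x * z k x)" for k using sq(1)[of 0 0 k] T by simp
  define Zn where "Zn n t = (\<Sum>k<n. y k t * z k t)" for n t
  define Z where "Z t = lim (\<lambda>n. Zn n t)" for t
  have zm [measurable]: "z k \<in> borel_measurable ?M" for k using zi by simp
  have Znm [measurable]: "Zn n \<in> borel_measurable ?M" for n unfolding Zn_def by measurable
  have Zm [measurable]: "Z \<in> borel_measurable ?M" unfolding Z_def by measurable
  have ZnA: "AE t in ?M. \<forall>n. Zn n t = - d * (\<Sum>k<n. eigval k * (y k t)\<^sup>2) + (\<Sum>k<n. (u t \<bullet> eig k) * (F t \<bullet> eig k))"
    using zV
  proof eventually_elim
    case (elim t)
    have "y k t * z k t = - d * (eigval k * (y k t)\<^sup>2) + (u t \<bullet> eig k) * (F t \<bullet> eig k)" for k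
      unfolding spec[OF elim, of k, folded y_def] by (simp add: y_def power2_eq_square algebra_simps)
    then show ?case by (simp add: Zn_def sum.distrib sum_distrib_left sum_subtractf sum_negf)
  qed
  have Zlim: "AE t in ?M. (\<lambda>n. Zn n t) \<longlonglongrightarrow> - d * (norm (G (u t)))\<^sup>2 + F t \<bullet> u t"
    using ZnA uV
  proof eventually_elim
    case (elim t)
    have "(\<lambda>n. - d * (\<Sum>k<n. eigval k * (y k t)\<^sup>2) + (\<Sum>k<n. (u t \<bullet> eig k) * (F t \<bullet> eig k))) \<longlonglongrightarrow>
        - d * (norm (G (u t)))\<^sup>2 + u t \<bullet> F t"
      unfolding y_def by (intro tendsto_intros G_expansion[OF elim(2)] inner_expansion[OF elim(2)])
    then show ?case using elim(1) by (simp add: inner_commute)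
  qed
  have ZA: "AE t in ?M. Z t = - d * (norm (G (u t)))\<^sup>2 + F t \<bullet> u t"
    using Zlim by eventually_elim (simp add: Z_def limI)
  \<comment> \<open>A majorant for all partial sums: Bessel bounds the gradient part by
    \<open>N\<close> and the reaction part by the product of the norms.\<close>
  define W where "W t = \<bar>d\<bar> * N t + R * m t" for t
  have Wi: "integrable ?M W" unfolding W_def[abs_def] using Ni m by simp
  have Zb: "AE t in ?M. \<forall>n. \<bar>Zn n t\<bar> \<le> W t"
  proof -
    have "AE t in ?M. t \<in> {0..T}" by (rule AE_I2) simp
    with ZnA NA uV Fb show ?thesis
    proof eventually_elim
      case (elim t)
      show ?case
      proof
        fix n
        have "\<bar>- d * (\<Sum>k<n. eigval k * (y k t)\<^sup>2)\<bar> = \<bar>d\<bar> * (\<Sum>k<n. eigval k * (y k t)\<^sup>2)"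
          by (simp add: abs_mult sum_nonneg eigval_nonneg)
        also have "\<dots> \<le> \<bar>d\<bar> * N t" unfolding elim(2) y_def by (intro mult_left_mono G_bessel elim) auto
        finally have A: "\<bar>- d * (\<Sum>k<n. eigval k * (y k t)\<^sup>2)\<bar> \<le> \<bar>d\<bar> * N t" .
        have "\<bar>\<Sum>k<n. (u t \<bullet> eig k) * (F t \<bullet> eig k)\<bar> \<le> norm (u t) * norm (F t)" by (rule bessel_inner)
        also have "\<dots> \<le> R * m t" using ub[OF elim(5)] elim(4) R0 by (intro mult_mono) auto
        finally show "\<bar>Zn n t\<bar> \<le> W t" using A elim(1) unfolding W_def by (auto simp: abs_le_iff)
      qed
    qed
  qed
  have Zi: "integrable ?M Z"
  proof (rule Bochner_Integration.integrable_bound[OF Wi Zm])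
    show "AE t in ?M. norm (Z t) \<le> norm (W t)"
      using ZA Zlim Zb
    proof eventually_elim
      case (elim t)
      have "(\<lambda>n. \<bar>Zn n t\<bar>) \<longlonglongrightarrow> \<bar>Z t\<bar>" using elim by (intro tendsto_rabs) simp
      then have "\<bar>Z t\<bar> \<le> W t" by (rule LIMSEQ_le_const2) (use elim in auto)
      then show ?case by simp
    qed
  qed
  have id: "(norm (u t))\<^sup>2 - (norm (u s))\<^sup>2 = 2 * integral {s..t} Z" if st: "0 \<le> s" "s \<le> t" "t \<le> T" for s t
  proof -
    have sub: "{s..t} \<subseteq> {0..T}" using st by auto
    have Zni: "integrable ?M (Zn n)" for n unfolding Zn_def[abs_def] by (intro Bochner_Integration.integrable_sum yzi)
    have "(\<lambda>n. LINT x|?M. indicator {s..t} x * Zn n x) \<longlonglongrightarrow> (LINT x|?M. indicator {s..t} x * Z x)"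
    proof (rule integral_dominated_convergence[OF _ _ Wi])
      have [measurable]: "indicat_real {s..t} \<in> borel_measurable ?M"
        by (intro measurable_restrict_space1 borel_measurable_indicator) simp
      show "(\<lambda>x. indicator {s..t} x * Z x) \<in> borel_measurable ?M" by measurable
      show "(\<lambda>x. indicator {s..t} x * Zn n x) \<in> borel_measurable ?M" for n by measurable
      show "AE x in ?M. (\<lambda>n. indicator {s..t} x * Zn n x) \<longlonglongrightarrow> indicator {s..t} x * Z x"
        using Zlim ZA by eventually_elim (auto intro!: tendsto_mult)
      show "AE x in ?M. norm (indicator {s..t} x * Zn n x) \<le> W x" for n
        using Zb
      proof eventually_elim
        case (elim x)
        then have "\<bar>Zn n x\<bar> \<le> W x" by simp
        then show ?case by (auto simp: indicator_def intro: order_trans[OF abs_ge_zero])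
      qed
    qed
    then have "(\<lambda>n. 2 * integral {s..t} (Zn n)) \<longlonglongrightarrow> 2 * integral {s..t} Z"
      using lebesgue_on_indicator_integral(2)[OF Zni _ sub] lebesgue_on_indicator_integral(2)[OF Zi _ sub]
      by (intro tendsto_mult_left) simp
    moreover have "2 * integral {s..t} (Zn n) = (\<Sum>k<n. (y k t)\<^sup>2) - (\<Sum>k<n. (y k s)\<^sup>2)" for n
    proof -
      have "(\<lambda>x. y k x * z k x) integrable_on {s..t}" for k
        by (rule integrable_on_lebesgue_on[OF integrable_lebesgue_on_subinterval[OF yzi _ _ sub]]) auto
      then have "integral {s..t} (Zn n) = (\<Sum>k<n. integral {s..t} (\<lambda>x. y k x * z k x))"
        unfolding Zn_def[abs_def] by (intro Henstock_Kurzweil_Integration.integral_sum) auto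
      then show ?thesis by (simp only: sum_subtractf[symmetric] sq(2)[OF st] sum_distrib_left)
    qed
    moreover have "(\<lambda>n. (\<Sum>k<n. (y k t)\<^sup>2) - (\<Sum>k<n. (y k s)\<^sup>2)) \<longlonglongrightarrow> (norm (u t))\<^sup>2 - (norm (u s))\<^sup>2"
      unfolding y_def using st by (intro tendsto_diff norm_expansion uH) auto
    ultimately show ?thesis using LIMSEQ_unique by simp
  qed
  show ?thesis using Zi ZA id by blast
qed

end

section \<open>Products of \<open>H\<^sub>0\<^sup>1\<close> functions\<close>

lemma norm_abs_l2_mono:
  assumes f: "sq_integrable f" and g: "g \<in> borel_measurable lebesgue" and le: "AE x in lebesgue. \<bar>g x\<bar> \<le> \<bar>f x\<bar>"
  shows "sq_integrable g" "norm (abs_l2 g) \<le> norm (abs_l2 f)"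
proof -
  show g': "sq_integrable g" by (rule sq_integrable_bound[OF assms])
  have "(norm (abs_l2 g))\<^sup>2 \<le> (norm (abs_l2 f))\<^sup>2"
    unfolding norm_abs_l2[OF f] norm_abs_l2[OF g']
  proof (rule integral_mono_AE)
    show "AE x in lebesgue. (g x)\<^sup>2 \<le> (f x)\<^sup>2" using le by eventually_elim (simp add: abs_le_square_iff)
  qed (use f g' in \<open>auto simp: sq_integrable_def\<close>)
  then show "norm (abs_l2 g) \<le> norm (abs_l2 f)" by (rule power2_le_imp_le) simp
qed

definition prodl2 :: "'a::euclidean_space l2 \<Rightarrow> 'a l2 \<Rightarrow> 'a l2" where
  "prodl2 u v = abs_l2 (\<lambda>x. rep_l2 u x * rep_l2 v x)"

definition sql2 :: "'a::euclidean_space l2 \<Rightarrow> 'a l2" where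
  "sql2 u = abs_l2 (\<lambda>x. (rep_l2 u x)\<^sup>2)"

lemma sql2_eq: "sql2 u = prodl2 u u" by (simp add: sql2_def prodl2_def power2_eq_square)
lemma prodl2_commute: "prodl2 u v = prodl2 v u" by (simp add: prodl2_def mult.commute)

locale low_dim_domain = bounded_open_domain \<Omega> for \<Omega> :: "(real^'n::finite) set" +
  assumes low_dim: "CARD('n) \<le> 3"
begin

sublocale compact_gradient "H10 \<Omega>" "grad \<Omega>" "L2_space \<Omega>" by (rule compact_gradient)

lemma sq_sq: "u \<in> H10 \<Omega> \<Longrightarrow> sq_integrable (\<lambda>x. (rep_l2 u x)\<^sup>2)"
  by (rule H10_square_sq_integrable[OF low_dim])

lemma prod_bound:
  assumes u: "u \<in> H10 \<Omega>" and v: "v \<in> H10 \<Omega>"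
  shows "sq_integrable (\<lambda>x. rep_l2 u x * rep_l2 v x)" "norm (prodl2 u v) \<le> norm (sql2 u) + norm (sql2 v)"
proof -
  let ?f = "\<lambda>x. (rep_l2 u x)\<^sup>2 + (rep_l2 v x)\<^sup>2"
  have f: "sq_integrable ?f" by (intro sq_integrable_add sq_sq u v)
  have b: "\<bar>a * b\<bar> \<le> \<bar>a\<^sup>2 + b\<^sup>2\<bar>" for a b :: real
  proof -
    have "2 * (\<bar>a\<bar> * \<bar>b\<bar>) \<le> a\<^sup>2 + b\<^sup>2" using sum_squares_bound[of "\<bar>a\<bar>" "\<bar>b\<bar>"] by simp
    moreover have "0 \<le> \<bar>a\<bar> * \<bar>b\<bar>" by simp
    ultimately show ?thesis unfolding abs_mult by linarith
  qed
  have m: "(\<lambda>x. rep_l2 u x * rep_l2 v x) \<in> borel_measurable lebesgue" by measurable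
  show "sq_integrable (\<lambda>x. rep_l2 u x * rep_l2 v x)" by (rule norm_abs_l2_mono[OF f m]) (rule AE_I2[OF b])
  have "norm (prodl2 u v) \<le> norm (abs_l2 ?f)" unfolding prodl2_def by (rule norm_abs_l2_mono[OF f m]) (rule AE_I2[OF b])
  also have "abs_l2 ?f = sql2 u + sql2 v" unfolding sql2_def by (rule abs_l2_plus[symmetric]) (rule sq_sq u v)+
  finally show "norm (prodl2 u v) \<le> norm (sql2 u) + norm (sql2 v)" using norm_triangle_ineq[of "sql2 u" "sql2 v"] by linarith
qed

lemma rep_prod:
  "u \<in> H10 \<Omega> \<Longrightarrow> v \<in> H10 \<Omega> \<Longrightarrow> AE x in lebesgue. rep_l2 (prodl2 u v) x = rep_l2 u x * rep_l2 v x"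
  unfolding prodl2_def by (rule rep_abs_l2) (rule prod_bound)

text \<open>Isolates the factor that is bounded in L^2, so that the product of the other two is what
  the interpolation inequality has to control.\<close>

lemma prod_inner_swap:
  assumes "u \<in> H10 \<Omega>" "v \<in> H10 \<Omega>" "w \<in> H10 \<Omega>"
  shows "prodl2 u v \<bullet> w = u \<bullet> prodl2 v w"
  unfolding inner_rep_l2
proof (rule integral_cong_AE)
  show "AE x in lebesgue. rep_l2 (prodl2 u v) x * rep_l2 w x = rep_l2 u x * rep_l2 (prodl2 v w) x"
    using rep_prod[OF assms(1,2)] rep_prod[OF assms(2,3)] by eventually_elim simp
qed measurable

lemma prod_add_left:
  assumes "u \<in> H10 \<Omega>" "u' \<in> H10 \<Omega>" "v \<in> H10 \<Omega>"
  shows "prodl2 (u + u') v = prodl2 u v + prodl2 u' v"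
proof (rule l2_eqI)
  show "AE x in lebesgue. rep_l2 (prodl2 (u + u') v) x = rep_l2 (prodl2 u v + prodl2 u' v) x"
    using rep_prod[OF H10_add[OF assms(1,2)] assms(3)] rep_prod[OF assms(1,3)] rep_prod[OF assms(2,3)]
      rep_plus[of u u'] rep_plus[of "prodl2 u v" "prodl2 u' v"]
    by eventually_elim (simp add: distrib_right)
qed

lemma prod_diff_left:
  assumes "u \<in> H10 \<Omega>" "u' \<in> H10 \<Omega>" "v \<in> H10 \<Omega>"
  shows "prodl2 (u - u') v = prodl2 u v - prodl2 u' v"
  using prod_add_left[OF subspace_diff[OF H10_sub assms(1,2)] assms(2,3)] by simp

lemma inner_prod_le:
  assumes "norm u \<le> R" "v \<in> H10 \<Omega>" "w \<in> H10 \<Omega>"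
  shows "\<bar>u \<bullet> prodl2 v w\<bar> \<le> R * (norm (sql2 v) + norm (sql2 w))"
proof -
  have "\<bar>u \<bullet> prodl2 v w\<bar> \<le> norm u * norm (prodl2 v w)" by (rule Cauchy_Schwarz_ineq2)
  also have "\<dots> \<le> R * (norm (sql2 v) + norm (sql2 w))"
    using assms prod_bound[OF assms(2,3)] norm_ge_zero[of u] by (intro mult_mono) (linarith | simp)+
  finally show ?thesis .
qed

end

section \<open>The reaction terms\<close>

lemma norm_state_sq: "(norm (g :: ('b::real_inner)^3))\<^sup>2 = (norm (g $ 1))\<^sup>2 + (norm (g $ 2))\<^sup>2 + (norm (g $ 3))\<^sup>2"
  unfolding norm_vec_sq sum_3 ..

text \<open>\<open>be\<close> is the maximum of \<open>(b1 - G1 * u) * u\<close>; \<open>K\<close>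
  collects the growth of \<open>u\<^sup>2\<close> plus 1 left over as damping; \<open>p\<close>
  weights the third equation so that its damping pays for the coupling into the second. The terms
  with \<open>F\<close> and \<open>G2\<close> have the right sign because the components are
  nonnegative.\<close>

lemma reaction_pointwise:
  fixes u v w :: real
  assumes pos: "F > 0" "G1 > 0" "b2 > 0" "c2 > 0" "c3 > 0" "a1 > 0" "a3 > 0" "G2 > 0" "b1 > 0"
    and nn: "u \<ge> 0" "v \<ge> 0" "w \<ge> 0" and p: "p = 1 + c2\<^sup>2 / (b2 * c3)"
    and K: "K = a1 + p * a3\<^sup>2 / (2 * c3) + 1" and be: "be = b1\<^sup>2 / (4 * G1)"
    and dl: "0 < dl" "dl \<le> 1" "dl \<le> b2 / 4" "dl * p \<le> c3 / 2"
  shows "(a1 * u + b1 * v - F * u\<^sup>2 - G1 * (u * v)) * u + (- b2 * v + c2 * w - G2 * (u * v)) * v + p * ((a3 * u - c3 * w) * w)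
     \<le> (K^3 / F\<^sup>2 + be\<^sup>2 / b2) - dl * (u\<^sup>2 + v\<^sup>2 + p * w\<^sup>2)"
proof -
  have p1: "p \<ge> 1" using pos by (simp add: p)
  have K0: "K > 0" using pos p1 by (simp add: K add_pos_nonneg)
  \<comment> \<open>Young's inequality with a free weight, the source of every absorption
    below.\<close>
  have sqq: "x * y \<le> e * x\<^sup>2 + y\<^sup>2 / (4 * e)" if "e > 0" for x y e :: real
  proof -
    have "0 \<le> (2 * e * x - y)\<^sup>2 / (4 * e)" using that by simp
    also have "\<dots> = e * x\<^sup>2 - x * y + y\<^sup>2 / (4 * e)" using that by (simp add: power2_eq_square field_simps)
    finally show ?thesis by simp
  qed
  have A: "(b1 - G1 * u) * u \<le> be"
    using sqq[OF pos(2), of u b1] by (simp add: be algebra_simps power2_eq_square)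
  have A': "(b1 - G1 * u) * u * v \<le> b2 / 4 * v\<^sup>2 + be\<^sup>2 / b2"
  proof -
    have "(b1 - G1 * u) * u * v \<le> be * v" by (rule mult_right_mono[OF A nn(2)])
    also have "\<dots> \<le> b2 / 4 * v\<^sup>2 + be\<^sup>2 / b2" using sqq[of "b2 / 4" v be] pos by (simp add: mult.commute)
    finally show ?thesis .
  qed
  have B: "c2 * w * v \<le> b2 / 2 * v\<^sup>2 + c2\<^sup>2 / (2 * b2) * w\<^sup>2"
    using sqq[of "b2 / 2" v "c2 * w"] pos by (simp add: power_mult_distrib algebra_simps)
  have C: "a3 * u * w \<le> c3 / 2 * w\<^sup>2 + a3\<^sup>2 / (2 * c3) * u\<^sup>2"
    using sqq[of "c3 / 2" w "a3 * u"] pos by (simp add: power_mult_distrib algebra_simps)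
  have C': "p * (a3 * u * w) \<le> p * (c3 / 2) * w\<^sup>2 + (K - a1 - 1) * u\<^sup>2"
    using mult_left_mono[OF C, of p] p1 by (simp add: K algebra_simps)
  \<comment> \<open>This identity determines \<open>p\<close>: after paying for the coupling term,
    half of the damping \<open>c3\<close> remains.\<close>
  have pc: "p * (c3 / 2) - c2\<^sup>2 / (2 * b2) = c3 / 2"
    using pos by (simp add: p field_simps power2_eq_square)
  \<comment> \<open>The cubic term wins once \<open>u\<close> reaches K/F; below that the quadratic
    term is at most its value there.\<close>
  have D: "K * u\<^sup>2 - F * u\<^sup>2 * u \<le> K^3 / F\<^sup>2"
  proof (cases "K \<le> F * u")
    case True
    then have "K * u\<^sup>2 \<le> F * u * u\<^sup>2" by (rule mult_right_mono) simp
    moreover have "0 \<le> K^3 / F\<^sup>2" using K0 by simp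
    ultimately show ?thesis by (simp add: algebra_simps)
  next
    case False
    then have "u \<le> K / F" using pos by (simp add: pos_le_divide_eq mult.commute)
    then have "u\<^sup>2 \<le> (K / F)\<^sup>2" using nn by (intro power_mono) auto
    then have "K * u\<^sup>2 \<le> K * (K / F)\<^sup>2" using K0 by (intro mult_left_mono) auto
    also have "\<dots> = K^3 / F\<^sup>2" by (simp add: power_divide power3_eq_cube power2_eq_square)
    finally show ?thesis using mult_nonneg_nonneg[OF mult_nonneg_nonneg[OF less_imp_le[OF pos(1)] zero_le_power2[of u]] nn(1)] by linarith
  qed
  have G: "0 \<le> G2 * (u * v) * v" using pos nn by simp
  have "(a1 * u + b1 * v - F * u\<^sup>2 - G1 * (u * v)) * u + (- b2 * v + c2 * w - G2 * (u * v)) * v + p * ((a3 * u - c3 * w) * w)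
     = a1 * u\<^sup>2 - F * u\<^sup>2 * u + (b1 - G1 * u) * u * v - b2 * v\<^sup>2 + c2 * w * v - G2 * (u * v) * v + p * (a3 * u * w) - p * c3 * w\<^sup>2"
    by (simp add: algebra_simps power2_eq_square)
  also have "\<dots> \<le> a1 * u\<^sup>2 - F * u\<^sup>2 * u + (b2 / 4 * v\<^sup>2 + be\<^sup>2 / b2) - b2 * v\<^sup>2 + (b2 / 2 * v\<^sup>2 + c2\<^sup>2 / (2 * b2) * w\<^sup>2)
      + (p * (c3 / 2) * w\<^sup>2 + (K - a1 - 1) * u\<^sup>2) - p * c3 * w\<^sup>2"
    using A' B C' G by linarith
  also have "\<dots> = (K * u\<^sup>2 - F * u\<^sup>2 * u) + be\<^sup>2 / b2 - u\<^sup>2 - b2 / 4 * v\<^sup>2 - (p * (c3 / 2) - c2\<^sup>2 / (2 * b2)) * w\<^sup>2"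
    by (simp add: algebra_simps)
  also have "\<dots> \<le> K^3 / F\<^sup>2 + be\<^sup>2 / b2 - u\<^sup>2 - b2 / 4 * v\<^sup>2 - c3 / 2 * w\<^sup>2"
    unfolding pc using D by linarith
  also have "\<dots> \<le> (K^3 / F\<^sup>2 + be\<^sup>2 / b2) - dl * (u\<^sup>2 + v\<^sup>2 + p * w\<^sup>2)"
  proof -
    have "dl * u\<^sup>2 \<le> 1 * u\<^sup>2" "dl * v\<^sup>2 \<le> b2 / 4 * v\<^sup>2" "dl * p * w\<^sup>2 \<le> c3 / 2 * w\<^sup>2"
      using dl by (intro mult_right_mono; simp)+
    then show ?thesis by (simp add: algebra_simps)
  qed
  finally show ?thesis .
qed

section \<open>The reaction map on E\<close>

locale oregonator = low_dim_domain \<Omega> for \<Omega> :: "(real^'n::finite) set" +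
  fixes d1 d2 d3 a1 a3 b1 b2 c2 c3 F G1 G2 :: real
  assumes pos: "d1 > 0" "d2 > 0" "d3 > 0" "a1 > 0" "a3 > 0" "b1 > 0" "b2 > 0" "c2 > 0" "c3 > 0" "F > 0" "G1 > 0" "G2 > 0"
begin

abbreviation Aop :: "'n state \<Rightarrow> 'n state \<Rightarrow> real" where "Aop \<equiv> oregonator_A \<Omega> d1 d2 d3"
abbreviation fop :: "'n state \<Rightarrow> 'n state" where "fop \<equiv> oregonator_f a1 b1 F G1 b2 c2 G2 a3 c3"

lemma E_comp: "g \<in> E_space \<Omega> \<Longrightarrow> g $ i \<in> H10 \<Omega>" by (simp add: E_space_def)

lemma f_components:
  assumes g: "g \<in> E_space \<Omega>"
  shows "fop g $ 1 = a1 *\<^sub>R (g $ 1) + b1 *\<^sub>R (g $ 2) - F *\<^sub>R sql2 (g $ 1) - G1 *\<^sub>R prodl2 (g $ 1) (g $ 2)"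
    "fop g $ 2 = (- b2) *\<^sub>R (g $ 2) + c2 *\<^sub>R (g $ 3) - G2 *\<^sub>R prodl2 (g $ 1) (g $ 2)"
    "fop g $ 3 = a3 *\<^sub>R (g $ 1) - c3 *\<^sub>R (g $ 3)"
proof -
  let ?u = "rep_l2 (g $ 1)" and ?v = "rep_l2 (g $ 2)" and ?w = "rep_l2 (g $ 3)"
  have s: "sq_integrable (\<lambda>x. c * rep_l2 (g $ i) x)" for c i by (intro sq_integrable_scale) simp
  have sq: "sq_integrable (\<lambda>x. c * (?u x)\<^sup>2)" for c by (intro sq_integrable_scale sq_sq E_comp g)
  have pr: "sq_integrable (\<lambda>x. c * (?u x * ?v x))" for c by (intro sq_integrable_scale prod_bound E_comp g)
  have r: "c *\<^sub>R (g $ i) = abs_l2 (\<lambda>x. c * rep_l2 (g $ i) x)" for c i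
    using abs_l2_scaleR[of "rep_l2 (g $ i)" c] by simp
  have rs: "c *\<^sub>R sql2 (g $ 1) = abs_l2 (\<lambda>x. c * (?u x)\<^sup>2)" for c
    unfolding sql2_def by (rule abs_l2_scaleR[OF sq_sq[OF E_comp[OF g]]])
  have rp: "c *\<^sub>R prodl2 (g $ 1) (g $ 2) = abs_l2 (\<lambda>x. c * (?u x * ?v x))" for c
    unfolding prodl2_def by (rule abs_l2_scaleR[OF prod_bound(1)[OF E_comp[OF g] E_comp[OF g]]])
  have 1: "fop g $ 1 = abs_l2 (\<lambda>x. a1 * ?u x + b1 * ?v x - F * (?u x)\<^sup>2 - G1 * (?u x * ?v x))"
    by (simp add: oregonator_f_def Let_def mult.assoc)
  have 2: "fop g $ 2 = abs_l2 (\<lambda>x. (- b2) * ?v x + c2 * ?w x - G2 * (?u x * ?v x))"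
    by (simp add: oregonator_f_def Let_def mult.assoc)
  have 3: "fop g $ 3 = abs_l2 (\<lambda>x. a3 * ?u x - c3 * ?w x)" by (simp add: oregonator_f_def Let_def)
  show "fop g $ 1 = a1 *\<^sub>R (g $ 1) + b1 *\<^sub>R (g $ 2) - F *\<^sub>R sql2 (g $ 1) - G1 *\<^sub>R prodl2 (g $ 1) (g $ 2)"
    unfolding 1 r rs rp abs_l2_plus[OF s s] abs_l2_minus[OF sq_integrable_add[OF s s] sq]
      abs_l2_minus[OF sq_integrable_diff[OF sq_integrable_add[OF s s] sq] pr] ..
  show "fop g $ 2 = (- b2) *\<^sub>R (g $ 2) + c2 *\<^sub>R (g $ 3) - G2 *\<^sub>R prodl2 (g $ 1) (g $ 2)"
    unfolding 2 r rp abs_l2_plus[OF s s] abs_l2_minus[OF sq_integrable_add[OF s s] pr] ..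
  show "fop g $ 3 = a3 *\<^sub>R (g $ 1) - c3 *\<^sub>R (g $ 3)"
    unfolding 3 r abs_l2_minus[OF s s] ..
qed

definition csum :: real where "csum = a1 + b1 + F + G1 + b2 + c2 + G2 + a3 + c3"

lemma csum_pos: "csum > 0" using pos by (simp add: csum_def)

lemma csum_ge: "a1 \<le> csum" "b1 \<le> csum" "F \<le> csum" "G1 \<le> csum" "b2 \<le> csum" "c2 \<le> csum" "G2 \<le> csum" "a3 \<le> csum" "c3 \<le> csum"
  unfolding csum_def using pos by linarith+

lemma csum_mult: "c \<in> {a1, b1, F, G1, b2, c2, G2, a3, c3} \<Longrightarrow> 0 \<le> y \<Longrightarrow> c * y \<le> csum * y"
  using csum_ge by (intro mult_right_mono) blast+

lemma f_norm_bound: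
  assumes g: "g \<in> E_space \<Omega>"
  shows "norm (fop g $ i) \<le> csum * (2 * norm g + 2 * norm (sql2 (g $ 1)) + norm (sql2 (g $ 2)))"
proof -
  have n: "norm (g $ j) \<le> norm g" for j by (rule Finite_Cartesian_Product.norm_nth_le)
  have pr: "norm (prodl2 (g $ 1) (g $ 2)) \<le> norm (sql2 (g $ 1)) + norm (sql2 (g $ 2))"
    by (intro prod_bound E_comp g)
  let ?x = "norm g" and ?s = "norm (sql2 (g $ 1))" and ?r = "norm (sql2 (g $ 2))"
  have nn: "0 \<le> ?x" "0 \<le> ?s" "0 \<le> ?r" by auto
  have 1: "norm (fop g $ 1) \<le> a1 * ?x + b1 * ?x + F * ?s + G1 * (?s + ?r)"
  proof -
    have "norm (fop g $ 1) \<le> norm (a1 *\<^sub>R (g $ 1)) + norm (b1 *\<^sub>R (g $ 2)) + norm (F *\<^sub>R sql2 (g $ 1)) + norm (G1 *\<^sub>R prodl2 (g $ 1) (g $ 2))"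
      unfolding f_components[OF g]
      by (intro norm_triangle_ineq4[THEN order_trans] add_mono norm_triangle_ineq order_refl)
    also have "\<dots> \<le> a1 * ?x + b1 * ?x + F * ?s + G1 * (?s + ?r)"
      using n pr pos by (simp, intro add_mono mult_left_mono) auto
    finally show ?thesis .
  qed
  have 2: "norm (fop g $ 2) \<le> b2 * ?x + c2 * ?x + G2 * (?s + ?r)"
  proof -
    have "norm (fop g $ 2) \<le> norm ((- b2) *\<^sub>R (g $ 2)) + norm (c2 *\<^sub>R (g $ 3)) + norm (G2 *\<^sub>R prodl2 (g $ 1) (g $ 2))"
      unfolding f_components[OF g]
      by (intro norm_triangle_ineq4[THEN order_trans] add_mono norm_triangle_ineq order_refl)
    also have "\<dots> \<le> b2 * ?x + c2 * ?x + G2 * (?s + ?r)"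
      using n pr pos by (simp, intro add_mono mult_left_mono) auto
    finally show ?thesis .
  qed
  have 3: "norm (fop g $ 3) \<le> a3 * ?x + c3 * ?x"
  proof -
    have "norm (fop g $ 3) \<le> norm (a3 *\<^sub>R (g $ 1)) + norm (c3 *\<^sub>R (g $ 3))"
      unfolding f_components[OF g] by (rule norm_triangle_ineq4)
    also have "\<dots> \<le> a3 * ?x + c3 * ?x" using n pos by (simp, intro add_mono mult_left_mono) auto
    finally show ?thesis .
  qed
  have sr: "0 \<le> ?s + ?r" using nn by simp
  have e: "csum * (2 * ?x + 2 * ?s + ?r) = csum * ?x + csum * ?x + csum * ?s + csum * (?s + ?r)" by (simp add: algebra_simps)
  have nnc: "0 \<le> csum * ?s" "0 \<le> csum * (?s + ?r)" using csum_pos sr by auto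
  have mx: "a1 * ?x \<le> csum * ?x" "b1 * ?x \<le> csum * ?x" "b2 * ?x \<le> csum * ?x" "c2 * ?x \<le> csum * ?x"
      "a3 * ?x \<le> csum * ?x" "c3 * ?x \<le> csum * ?x" "F * ?s \<le> csum * ?s"
      "G1 * (?s + ?r) \<le> csum * (?s + ?r)" "G2 * (?s + ?r) \<le> csum * (?s + ?r)"
    by (rule csum_mult; simp add: sr)+
  consider "i = 1" | "i = 2" | "i = 3" using exhaust_3 by blast
  then show ?thesis
  proof cases
    case a: 1 show ?thesis unfolding a e using 1 mx by linarith
  next
    case a: 2 show ?thesis unfolding a e using 2 mx nnc by linarith
  next
    case a: 3 show ?thesis unfolding a e using 3 mx nnc by linarith
  qed
qed

text \<open>Tested with \<open>z = g - h\<close>, the differences of the quadratic terms become products of one solution,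
  bounded by \<open>R\<close> in \<open>L\<^sup>2\<close>, with some \<open>z\<^sub>i z\<^sub>j\<close>, whose \<open>L\<^sup>2\<close> norm the interpolation inequality controls.\<close>

lemma f_difference_bound:
  assumes g: "g \<in> E_space \<Omega>" and h: "h \<in> E_space \<Omega>" and R: "norm g \<le> R" "norm h \<le> R"
  shows "(fop g $ 1 - fop h $ 1) \<bullet> (g $ 1 - h $ 1) + (fop g $ 2 - fop h $ 2) \<bullet> (g $ 2 - h $ 2) + (fop g $ 3 - fop h $ 3) \<bullet> (g $ 3 - h $ 3)
    \<le> csum * (4 * (norm (g - h))\<^sup>2 + 8 * R * (norm (sql2 (g $ 1 - h $ 1)) + norm (sql2 (g $ 2 - h $ 2))))"
proof -
  have R0: "0 \<le> R" using R norm_ge_zero[of g] by linarith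
  define z1 where "z1 = g $ 1 - h $ 1"
  define z2 where "z2 = g $ 2 - h $ 2"
  define z3 where "z3 = g $ 3 - h $ 3"
  have Hg: "g $ i \<in> H10 \<Omega>" "h $ i \<in> H10 \<Omega>" for i using g h by (auto intro: E_comp)
  have Hz: "z1 \<in> H10 \<Omega>" "z2 \<in> H10 \<Omega>" "z3 \<in> H10 \<Omega>"
    unfolding z1_def z2_def z3_def by (intro subspace_diff[OF H10_sub] Hg)+
  have nR: "norm (g $ i) \<le> R" "norm (h $ i) \<le> R" for i
    using R Finite_Cartesian_Product.norm_nth_le[of g i] Finite_Cartesian_Product.norm_nth_le[of h i] by linarith+
  let ?s1 = "norm (sql2 z1)" and ?s2 = "norm (sql2 z2)"
  have sq: "sql2 (g $ 1) - sql2 (h $ 1) = prodl2 (g $ 1 + h $ 1) z1"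
  proof -
    have "prodl2 z1 (g $ 1 + h $ 1) = prodl2 (g $ 1) (g $ 1 + h $ 1) - prodl2 (h $ 1) (g $ 1 + h $ 1)"
      unfolding z1_def by (intro prod_diff_left Hg H10_add)
    also have "\<dots> = prodl2 (g $ 1 + h $ 1) (g $ 1) - prodl2 (g $ 1 + h $ 1) (h $ 1)" by (simp add: prodl2_commute)
    also have "\<dots> = prodl2 (g $ 1) (g $ 1) + prodl2 (h $ 1) (g $ 1) - (prodl2 (g $ 1) (h $ 1) + prodl2 (h $ 1) (h $ 1))"
      using prod_add_left[OF Hg(1)[of 1] Hg(2)[of 1] Hg(1)[of 1]] prod_add_left[OF Hg(1)[of 1] Hg(2)[of 1] Hg(2)[of 1]] by simp
    also have "\<dots> = sql2 (g $ 1) - sql2 (h $ 1)" using prodl2_commute[of "g $ 1" "h $ 1"] by (simp add: sql2_eq)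
    finally show ?thesis using prodl2_commute[of z1] by simp
  qed
  have pr: "prodl2 (g $ 1) (g $ 2) - prodl2 (h $ 1) (h $ 2) = prodl2 (g $ 2) z1 + prodl2 (h $ 1) z2"
  proof -
    have "prodl2 z1 (g $ 2) = prodl2 (g $ 1) (g $ 2) - prodl2 (h $ 1) (g $ 2)" unfolding z1_def by (intro prod_diff_left Hg)
    moreover have "prodl2 z2 (h $ 1) = prodl2 (g $ 2) (h $ 1) - prodl2 (h $ 2) (h $ 1)" unfolding z2_def by (intro prod_diff_left Hg)
    ultimately show ?thesis
      using prodl2_commute[of z1 "g $ 2"] prodl2_commute[of z2 "h $ 1"] prodl2_commute[of "g $ 2" "h $ 1"] prodl2_commute[of "h $ 2" "h $ 1"] by simp
  qed
  have t1: "\<bar>(sql2 (g $ 1) - sql2 (h $ 1)) \<bullet> z1\<bar> \<le> 4 * R * ?s1"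
  proof -
    have "norm (g $ 1 + h $ 1) \<le> 2 * R" using nR[of 1] norm_triangle_ineq[of "g $ 1" "h $ 1"] by linarith
    from inner_prod_le[OF this Hz(1) Hz(1)] show ?thesis
      unfolding sq using prod_inner_swap[OF H10_add[OF Hg(1) Hg(2)] Hz(1) Hz(1)] by simp
  qed
  have t2: "\<bar>(prodl2 (g $ 1) (g $ 2) - prodl2 (h $ 1) (h $ 2)) \<bullet> z\<bar> \<le> R * (?s1 + norm (sql2 z)) + R * (?s2 + norm (sql2 z))"
    if z: "z \<in> H10 \<Omega>" for z
  proof -
    have "(prodl2 (g $ 1) (g $ 2) - prodl2 (h $ 1) (h $ 2)) \<bullet> z = g $ 2 \<bullet> prodl2 z1 z + h $ 1 \<bullet> prodl2 z2 z"
      unfolding pr by (simp add: inner_add_left prod_inner_swap Hg Hz z)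
    then show ?thesis
      using inner_prod_le[OF nR(1)[of 2] Hz(1) z] inner_prod_le[OF nR(2)[of 1] Hz(2) z] by linarith
  qed
  have ip: "\<bar>x \<bullet> y\<bar> \<le> (norm x)\<^sup>2 + (norm y)\<^sup>2" for x y :: "(real^'n) l2"
  proof -
    have "\<bar>x \<bullet> y\<bar> \<le> norm x * norm y" by (rule Cauchy_Schwarz_ineq2)
    also have "\<dots> \<le> (norm x)\<^sup>2 + (norm y)\<^sup>2"
      using sum_squares_bound[of "norm x" "norm y"] mult_nonneg_nonneg[OF norm_ge_zero[of x] norm_ge_zero[of y]] by linarith
    finally show ?thesis .
  qed
  define n1 n2 n3 where "n1 = (norm z1)\<^sup>2" "n2 = (norm z2)\<^sup>2" "n3 = (norm z3)\<^sup>2"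
  have nn: "0 \<le> n1" "0 \<le> n2" "0 \<le> n3" "0 \<le> R * ?s1" "0 \<le> R * ?s2" using R0 by (auto simp: n1_n2_n3_def)
  have N: "(norm (g - h))\<^sup>2 = n1 + n2 + n3" by (simp add: norm_state_sq n1_n2_n3_def z1_def z2_def z3_def)
  have f1: "(fop g $ 1 - fop h $ 1) \<bullet> z1 = a1 * (z1 \<bullet> z1) + b1 * (z2 \<bullet> z1) - F * ((sql2 (g $ 1) - sql2 (h $ 1)) \<bullet> z1)
      - G1 * ((prodl2 (g $ 1) (g $ 2) - prodl2 (h $ 1) (h $ 2)) \<bullet> z1)"
    unfolding f_components[OF g] f_components[OF h] z2_def
    by (simp add: inner_diff_left inner_add_left algebra_simps) (simp add: z1_def inner_diff_left algebra_simps)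
  have f2: "(fop g $ 2 - fop h $ 2) \<bullet> z2 = - b2 * (z2 \<bullet> z2) + c2 * (z3 \<bullet> z2)
      - G2 * ((prodl2 (g $ 1) (g $ 2) - prodl2 (h $ 1) (h $ 2)) \<bullet> z2)"
    unfolding f_components[OF g] f_components[OF h] z3_def
    by (simp add: inner_diff_left inner_add_left algebra_simps) (simp add: z2_def inner_diff_left algebra_simps)
  have f3: "(fop g $ 3 - fop h $ 3) \<bullet> z3 = a3 * (z1 \<bullet> z3) - c3 * (z3 \<bullet> z3)"
    unfolding f_components[OF g] f_components[OF h] z1_def
    by (simp add: inner_diff_left inner_add_left algebra_simps) (simp add: z3_def inner_diff_left algebra_simps)
  have mm: "c * x \<le> c * y" if "\<bar>x\<bar> \<le> y" "0 < c" for c x y :: real using that by (intro mult_left_mono) auto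
  have mm': "- c * x \<le> c * y" if "\<bar>x\<bar> \<le> y" "0 < c" for c x y :: real
    using mm[of "- x" y c] that by simp
  have zz: "z1 \<bullet> z1 = n1" "z2 \<bullet> z2 = n2" "z3 \<bullet> z3 = n3" by (simp_all add: n1_n2_n3_def power2_norm_eq_inner)
  have e1: "(fop g $ 1 - fop h $ 1) \<bullet> z1 \<le> a1 * n1 + b1 * (n2 + n1) + F * (4 * (R * ?s1)) + G1 * (3 * (R * ?s1) + R * ?s2)"
  proof -
    have "b1 * (z2 \<bullet> z1) \<le> b1 * (n2 + n1)" by (rule mm) (use ip[of z2 z1] pos in \<open>auto simp: n1_n2_n3_def\<close>)
    moreover have "- F * ((sql2 (g $ 1) - sql2 (h $ 1)) \<bullet> z1) \<le> F * (4 * (R * ?s1))" by (rule mm') (use t1 pos in auto)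
    moreover have "- G1 * ((prodl2 (g $ 1) (g $ 2) - prodl2 (h $ 1) (h $ 2)) \<bullet> z1) \<le> G1 * (3 * (R * ?s1) + R * ?s2)"
      by (rule mm') (use t2[OF Hz(1)] pos in \<open>auto simp: algebra_simps\<close>)
    ultimately show ?thesis unfolding f1 zz by linarith
  qed
  have e2: "(fop g $ 2 - fop h $ 2) \<bullet> z2 \<le> c2 * (n3 + n2) + G2 * (R * ?s1 + 3 * (R * ?s2))"
  proof -
    have "c2 * (z3 \<bullet> z2) \<le> c2 * (n3 + n2)" by (rule mm) (use ip[of z3 z2] pos in \<open>auto simp: n1_n2_n3_def\<close>)
    moreover have "- G2 * ((prodl2 (g $ 1) (g $ 2) - prodl2 (h $ 1) (h $ 2)) \<bullet> z2) \<le> G2 * (R * ?s1 + 3 * (R * ?s2))"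
      by (rule mm') (use t2[OF Hz(2)] pos in \<open>auto simp: algebra_simps\<close>)
    moreover have "0 \<le> b2 * n2" using pos nn by simp
    ultimately show ?thesis unfolding f2 zz by linarith
  qed
  have e3: "(fop g $ 3 - fop h $ 3) \<bullet> z3 \<le> a3 * (n1 + n3)"
  proof -
    have "a3 * (z1 \<bullet> z3) \<le> a3 * (n1 + n3)" by (rule mm) (use ip[of z1 z3] pos in \<open>auto simp: n1_n2_n3_def\<close>)
    moreover have "0 \<le> c3 * n3" using pos nn by simp
    ultimately show ?thesis unfolding f3 zz by linarith
  qed
  have "(fop g $ 1 - fop h $ 1) \<bullet> z1 + (fop g $ 2 - fop h $ 2) \<bullet> z2 + (fop g $ 3 - fop h $ 3) \<bullet> z3
    \<le> csum * n1 + csum * (n2 + n1) + csum * (4 * (R * ?s1)) + csum * (3 * (R * ?s1) + R * ?s2) + csum * (n3 + n2)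
      + csum * (R * ?s1 + 3 * (R * ?s2)) + csum * (n1 + n3)"
  proof -
    have "a1 * n1 \<le> csum * n1" "b1 * (n2 + n1) \<le> csum * (n2 + n1)" "F * (4 * (R * ?s1)) \<le> csum * (4 * (R * ?s1))"
      "G1 * (3 * (R * ?s1) + R * ?s2) \<le> csum * (3 * (R * ?s1) + R * ?s2)" "c2 * (n3 + n2) \<le> csum * (n3 + n2)"
      "G2 * (R * ?s1 + 3 * (R * ?s2)) \<le> csum * (R * ?s1 + 3 * (R * ?s2))" "a3 * (n1 + n3) \<le> csum * (n1 + n3)"
      by (rule csum_mult; use nn in simp)+
    with e1 e2 e3 show ?thesis by linarith
  qed
  also have "\<dots> = csum * (3 * n1 + 2 * n2 + 2 * n3 + 8 * (R * ?s1) + 4 * (R * ?s2))" by (simp add: algebra_simps)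
  also have "\<dots> \<le> csum * (4 * (n1 + n2 + n3) + 8 * R * (?s1 + ?s2))"
    using csum_pos nn by (intro mult_left_mono) (auto simp: algebra_simps)
  finally show ?thesis unfolding N z1_def z2_def z3_def .
qed

text \<open>The weight \<open>pw\<close> of the third component lets its damping absorb the coupling \<open>c\<^sub>2 w\<close>.\<close>

definition pw :: real where "pw = 1 + c2\<^sup>2 / (b2 * c3)"
text \<open>The largest rate satisfying the upper bounds on damping in
  \<open>reaction_pointwise\<close>.\<close>

definition dl :: real where "dl = min 1 (min (b2 / 4) (c3 / (2 * pw)))"
text \<open>The additive constant of \<open>reaction_pointwise\<close> at weight \<open>pw\<close>;
  integrated over the domain it produces the size of the absorbing set.\<close>

definition Kc :: real where
  "Kc = (a1 + pw * a3\<^sup>2 / (2 * c3) + 1)^3 / F\<^sup>2 + (b1\<^sup>2 / (4 * G1))\<^sup>2 / b2"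

section \<open>Dissipation on the positive cone\<close>

lemma pw_ge_1: "pw \<ge> 1" using pos by (simp add: pw_def)
lemma dl_pos: "dl > 0" using pos pw_ge_1 by (simp add: dl_def)
lemma Kc_nonneg: "Kc \<ge> 0" unfolding Kc_def using pos pw_ge_1 by (auto intro!: add_nonneg_nonneg divide_nonneg_nonneg)

lemma H_plus_AE:
  assumes "g \<in> H_plus \<Omega>"
  shows "AE x in lebesgue. (x \<notin> \<Omega> \<longrightarrow> rep_l2 (g $ i) x = 0) \<and> 0 \<le> rep_l2 (g $ i) x"
proof -
  have "AE x in lebesgue. x \<in> \<Omega> \<longrightarrow> 0 \<le> rep_l2 (g $ i) x"
    using assms unfolding H_plus_def by (simp add: AE_restrict_space_iff)
  moreover have "AE x in lebesgue. x \<notin> \<Omega> \<longrightarrow> rep_l2 (g $ i) x = 0"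
    using assms unfolding H_plus_def H_space_def L2_space_def by simp
  ultimately show ?thesis by eventually_elim auto
qed

text \<open>Integrates the pointwise inequality. All components vanish outside the domain, so the
  constant is charged only there and contributes the finite measure of the bounded set.\<close>

lemma f_dissipation:
  assumes g: "g \<in> E_space \<Omega>" and gp: "g \<in> H_plus \<Omega>"
  shows "fop g $ 1 \<bullet> g $ 1 + fop g $ 2 \<bullet> g $ 2 + pw * (fop g $ 3 \<bullet> g $ 3)
    \<le> Kc * measure lebesgue \<Omega> - dl * ((norm (g $ 1))\<^sup>2 + (norm (g $ 2))\<^sup>2 + pw * (norm (g $ 3))\<^sup>2)"
proof -
  let ?u = "rep_l2 (g $ 1)" and ?v = "rep_l2 (g $ 2)" and ?w = "rep_l2 (g $ 3)"
  have Om: "\<Omega> \<in> lmeasurable" using bounded_\<Omega> open_\<Omega> by (simp add: lmeasurable_open)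
  have iO: "integrable lebesgue (indicat_real \<Omega>)" using Om by (simp add: lmeasurable_iff_integrable)
  have sq: "sq_integrable (\<lambda>x. (?u x)\<^sup>2)" by (intro sq_sq E_comp g)
  have pr: "sq_integrable (\<lambda>x. ?u x * ?v x)" by (intro prod_bound E_comp g)
  have f1: "AE x in lebesgue. rep_l2 (fop g $ 1) x = a1 * ?u x + b1 * ?v x - F * (?u x)\<^sup>2 - G1 * (?u x * ?v x)"
  proof -
    have "fop g $ 1 = abs_l2 (\<lambda>x. a1 * ?u x + b1 * ?v x - F * (?u x)\<^sup>2 - G1 * (?u x * ?v x))"
      by (simp add: oregonator_f_def Let_def mult.assoc)
    then show ?thesis
      by (simp only:) (intro rep_abs_l2 sq_integrable_diff sq_integrable_add sq_integrable_scale sq pr sq_integrable_rep)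
  qed
  have f2: "AE x in lebesgue. rep_l2 (fop g $ 2) x = - b2 * ?v x + c2 * ?w x - G2 * (?u x * ?v x)"
  proof -
    have "fop g $ 2 = abs_l2 (\<lambda>x. - b2 * ?v x + c2 * ?w x - G2 * (?u x * ?v x))"
      by (simp add: oregonator_f_def Let_def mult.assoc)
    then show ?thesis
      by (simp only:) (intro rep_abs_l2 sq_integrable_diff sq_integrable_add sq_integrable_scale pr sq_integrable_rep)
  qed
  have f3: "AE x in lebesgue. rep_l2 (fop g $ 3) x = a3 * ?u x - c3 * ?w x"
  proof -
    have "fop g $ 3 = abs_l2 (\<lambda>x. a3 * ?u x - c3 * ?w x)" by (simp add: oregonator_f_def Let_def)
    then show ?thesis by (simp only:) (intro rep_abs_l2 sq_integrable_diff sq_integrable_scale sq_integrable_rep)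
  qed
  note irm = integrable_rep_mult
  have "fop g $ 1 \<bullet> g $ 1 + fop g $ 2 \<bullet> g $ 2 + pw * (fop g $ 3 \<bullet> g $ 3) =
    (LINT x|lebesgue. rep_l2 (fop g $ 1) x * ?u x + rep_l2 (fop g $ 2) x * ?v x + pw * (rep_l2 (fop g $ 3) x * ?w x))"
    unfolding inner_rep_l2 by (simp add: Bochner_Integration.integral_add irm)
  also have "\<dots> \<le> (LINT x|lebesgue. Kc * indicator \<Omega> x - dl * ((?u x)\<^sup>2 + (?v x)\<^sup>2 + pw * (?w x)\<^sup>2))"
  proof (rule integral_mono_AE)
    show "integrable lebesgue (\<lambda>x. rep_l2 (fop g $ 1) x * ?u x + rep_l2 (fop g $ 2) x * ?v x + pw * (rep_l2 (fop g $ 3) x * ?w x))"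
      by (intro Bochner_Integration.integrable_add integrable_mult_right irm)
    show "integrable lebesgue (\<lambda>x. Kc * indicator \<Omega> x - dl * ((?u x)\<^sup>2 + (?v x)\<^sup>2 + pw * (?w x)\<^sup>2))"
      by (intro Bochner_Integration.integrable_diff Bochner_Integration.integrable_add integrable_mult_right integrable_rep_sq iO)
    show "AE x in lebesgue. rep_l2 (fop g $ 1) x * ?u x + rep_l2 (fop g $ 2) x * ?v x + pw * (rep_l2 (fop g $ 3) x * ?w x)
        \<le> Kc * indicator \<Omega> x - dl * ((?u x)\<^sup>2 + (?v x)\<^sup>2 + pw * (?w x)\<^sup>2)"
      using f1 f2 f3 H_plus_AE[OF gp, of 1] H_plus_AE[OF gp, of 2] H_plus_AE[OF gp, of 3]
    proof eventually_elim
      case (elim x)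
      show ?case
      proof (cases "x \<in> \<Omega>")
        case True
        have "(a1 * ?u x + b1 * ?v x - F * (?u x)\<^sup>2 - G1 * (?u x * ?v x)) * ?u x + (- b2 * ?v x + c2 * ?w x - G2 * (?u x * ?v x)) * ?v x
            + pw * ((a3 * ?u x - c3 * ?w x) * ?w x)
          \<le> ((a1 + pw * a3\<^sup>2 / (2 * c3) + 1)^3 / F\<^sup>2 + (b1\<^sup>2 / (4 * G1))\<^sup>2 / b2) - dl * ((?u x)\<^sup>2 + (?v x)\<^sup>2 + pw * (?w x)\<^sup>2)"
        proof (rule reaction_pointwise[OF _ _ _ _ _ _ _ _ _ _ _ _ pw_def refl refl dl_pos])
          have "dl \<le> c3 / (2 * pw)" by (simp add: dl_def)
          then show "dl * pw \<le> c3 / 2" using pw_ge_1 by (simp add: pos_le_divide_eq field_simps)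
        qed (use pos elim in \<open>auto simp: dl_def\<close>)
        then show ?thesis using True unfolding elim(1-3) Kc_def by simp
      next
        case False
        then have "?u x = 0" "?v x = 0" "?w x = 0" using elim by auto
        with False show ?thesis by simp
      qed
    qed
  qed
  also have "\<dots> = Kc * measure lebesgue \<Omega> - dl * ((norm (g $ 1))\<^sup>2 + (norm (g $ 2))\<^sup>2 + pw * (norm (g $ 3))\<^sup>2)"
    unfolding norm_rep_l2 by (simp add: Bochner_Integration.integral_diff Bochner_Integration.integral_add integrable_rep_sq iO)
  finally show ?thesis .
qed

end

section \<open>Differential inequalities\<close>

lemma integral_mono_AE_on:
  fixes f g :: "real \<Rightarrow> real"
  assumes f: "integrable (lebesgue_on {0..T}) f" and g: "integrable (lebesgue_on {0..T}) g"
    and le: "AE t in lebesgue_on {0..T}. f t \<le> g t" and st: "0 \<le> s" "t \<le> T"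
  shows "integral {s..t} f \<le> integral {s..t} g"
proof -
  have sub: "{s..t} \<subseteq> {0..T}" using st by auto
  have S: "{0..T} \<in> sets lebesgue" by simp
  have "(LINT x|lebesgue_on {0..T}. indicator {s..t} x * f x) \<le> (LINT x|lebesgue_on {0..T}. indicator {s..t} x * g x)"
  proof (rule integral_mono_AE[OF lebesgue_on_indicator_integral(1)[OF f S sub] lebesgue_on_indicator_integral(1)[OF g S sub]])
    show "AE x in lebesgue_on {0..T}. indicator {s..t} x * f x \<le> indicator {s..t} x * g x"
      using le by eventually_elim (simp add: indicator_def)
  qed
  then show ?thesis
    unfolding lebesgue_on_indicator_integral(2)[OF f S sub] lebesgue_on_indicator_integral(2)[OF g S sub] .
qed

lemma integrable_on_sub:
  fixes f :: "real \<Rightarrow> real"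
  assumes "integrable (lebesgue_on {0..T}) f" "0 \<le> s" "t \<le> T"
  shows "f integrable_on {s..t}"
  by (rule integrable_on_subinterval[OF integrable_on_lebesgue_on[OF assms(1)]]) (use assms in auto)

text \<open>The hypothesis covers every subinterval because \<open>c\<close> may be negative, where
  the estimate from time 0 alone would not give decay. In both cases an exponential times a shifted
  integral of \<open>h\<close> is nonincreasing.\<close>

lemma gronwall:
  fixes h :: "real \<Rightarrow> real"
  assumes T: "0 \<le> T" and hc: "continuous_on {0..T} h" and c: "c \<noteq> 0"
    and ineq: "\<And>s t. 0 \<le> s \<Longrightarrow> s \<le> t \<Longrightarrow> t \<le> T \<Longrightarrow> h t - h s \<le> c * integral {s..t} h"
  shows "h T \<le> exp (c * T) * h 0"
proof -
  define I where "I t = integral {0..t} h" for t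
  have hi: "h integrable_on {0..T}" by (rule integrable_continuous_real[OF hc])
  have Ic: "continuous_on {0..T} I" unfolding I_def[abs_def] by (rule indefinite_integral_continuous_1[OF hi])
  have Id: "(I has_real_derivative h t) (at t)" if "0 < t" "t < T" for t
  proof -
    have "(I has_real_derivative h t) (at t within {0..T})"
      unfolding I_def[abs_def] by (rule integral_has_real_derivative[OF hc]) (use that in auto)
    then show ?thesis using that by (simp add: at_within_Icc_at)
  qed
  have I0: "I 0 = 0" by (simp add: I_def)
  have ee: "exp (c * T) * exp (- c * T) = 1" by (simp add: exp_minus)
  have up: "h t - h 0 \<le> c * I t" if "0 \<le> t" "t \<le> T" for t using ineq[of 0 t] that by (simp add: I_def)
  show ?thesis
  proof (cases "c > 0")
    case True
    have "exp (- c * 0) * (I 0 + h 0 / c) \<ge> exp (- c * T) * (I T + h 0 / c)"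
    proof (rule DERIV_nonpos_imp_decreasing_open[OF T])
      fix t assume t: "0 < t" "t < T"
      have "((\<lambda>t. exp (- c * t) * (I t + h 0 / c)) has_real_derivative exp (- c * t) * (h t - c * I t - h 0)) (at t)"
        using c by (auto intro!: derivative_eq_intros Id t simp: field_simps)
      moreover have "exp (- c * t) * (h t - c * I t - h 0) \<le> 0" using up[of t] t by (intro mult_nonneg_nonpos) auto
      ultimately show "\<exists>y. ((\<lambda>t. exp (- c * t) * (I t + h 0 / c)) has_real_derivative y) (at t) \<and> y \<le> 0" by blast
    qed (intro continuous_intros Ic)
    then have "c * (exp (c * T) * (exp (- c * T) * (I T + h 0 / c))) \<le> c * (exp (c * T) * (h 0 / c))"
      using True by (intro mult_left_mono) (auto simp: I0)
    also have "c * (exp (c * T) * (exp (- c * T) * (I T + h 0 / c))) = (exp (c * T) * exp (- c * T)) * (c * (I T + h 0 / c))"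
      by (simp only: mult_ac)
    also have "c * (I T + h 0 / c) = c * I T + h 0" using c by (simp add: distrib_left)
    also have "c * (exp (c * T) * (h 0 / c)) = exp (c * T) * h 0" using c by simp
    finally have "c * I T + h 0 \<le> exp (c * T) * h 0" unfolding ee by simp
    then show ?thesis using up[of T] T by simp
  next
    case False
    then have c0: "c < 0" using c by simp
    \<comment> \<open>For negative rate the argument looks back from \<open>T\<close>: it uses the
      inequality on the tails from \<open>t\<close> to \<open>T\<close>, and the inequality from 0
      to \<open>T\<close> at the end.\<close>
    have "exp (- c * 0) * (I T - I 0 - h T / c) \<ge> exp (- c * T) * (I T - I T - h T / c)"
    proof (rule DERIV_nonpos_imp_decreasing_open[OF T])
      fix t assume t: "0 < t" "t < T"
      have "((\<lambda>t. exp (- c * t) * (I T - I t - h T / c)) has_real_derivative exp (- c * t) * (h T - h t - c * (I T - I t))) (at t)"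
        using c by (auto intro!: derivative_eq_intros Id t simp: field_simps)
      moreover have "exp (- c * t) * (h T - h t - c * (I T - I t)) \<le> 0"
      proof -
        have "I t + integral {t..T} h = I T" unfolding I_def
          by (rule Henstock_Kurzweil_Integration.integral_combine) (use t hi in auto)
        then have J: "integral {t..T} h = I T - I t" by linarith
        have "h T - h t \<le> c * integral {t..T} h" by (rule ineq) (use t in auto)
        then have "h T - h t \<le> c * (I T - I t)" unfolding J .
        then show ?thesis by (intro mult_nonneg_nonpos) auto
      qed
      ultimately show "\<exists>y. ((\<lambda>t. exp (- c * t) * (I T - I t - h T / c)) has_real_derivative y) (at t) \<and> y \<le> 0" by blast
    qed (intro continuous_intros Ic)
    then have A: "(- c) * (exp (- c * T) * (- h T / c)) \<le> (- c) * (I T - h T / c)"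
      using c0 by (intro mult_left_mono) (auto simp: I0)
    have e1: "(- c) * (exp (- c * T) * (- h T / c)) = exp (- c * T) * h T" using c by simp
    have e2: "(- c) * (I T - h T / c) = - c * I T + h T" using c by (simp add: right_diff_distrib)
    have "exp (- c * T) * h T \<le> - c * I T + h T" using A unfolding e1 e2 .
    also have "\<dots> \<le> h 0" using up[of T] T by simp
    finally have "exp (c * T) * (exp (- c * T) * h T) \<le> exp (c * T) * h 0" by (intro mult_left_mono) auto
    then show ?thesis unfolding mult.assoc[symmetric] ee by simp
  qed
qed

section \<open>A priori estimates\<close>

context oregonator begin

definition dif :: "3 \<Rightarrow> real" where "dif i = (if i = 1 then d1 else if i = 2 then d2 else d3)"
definition dm :: real where "dm = min d1 (min d2 d3)"

lemma dm_pos: "dm > 0" and dm_le: "dm \<le> dif i"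
  using pos by (auto simp: dm_def dif_def)

lemma H_space_D: "g \<in> H_space \<Omega> \<Longrightarrow> g $ i \<in> L2_space \<Omega>" by (simp add: H_space_def)

lemma H_space_sub: "subspace (H_space \<Omega>)"
  using L2_sub unfolding H_space_def subspace_def by simp

lemma H_space_closed: "closed (H_space \<Omega>)"
proof -
  have "H_space \<Omega> = (\<Inter>i. (\<lambda>g. g $ i) -` L2_space \<Omega>)" by (auto simp: H_space_def)
  then show ?thesis by (auto intro!: closed_INT closed_vimage L2_closed continuous_intros)
qed

lemma A_axis: "Aop g (axis i v) = - dif i * (grad \<Omega> (g $ i) \<bullet> grad \<Omega> v)"
  using exhaust_3[of i] by (auto simp: oregonator_A_def dirichlet_laplacian_def axis_def grad_zero dif_def)

lemma axis_E: "v \<in> H10 \<Omega> \<Longrightarrow> axis i v \<in> E_space \<Omega>"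
  by (simp add: E_space_def axis_def H10_zero)

lemma axis_H: "v \<in> L2_space \<Omega> \<Longrightarrow> axis i v \<in> H_space \<Omega>"
  using subspace_0[OF L2_sub] by (simp add: H_space_def axis_def)

lemma E_norm_comp: "(norm (grad \<Omega> (\<phi> $ i)))\<^sup>2 \<le> (E_norm \<Omega> \<phi>)\<^sup>2"
proof -
  have "(E_norm \<Omega> \<phi>)\<^sup>2 = (\<Sum>i\<in>UNIV. (norm (grad \<Omega> (\<phi> $ i)))\<^sup>2)" by (simp add: E_norm_def norm_vec_sq)
  then show ?thesis by (metis (no_types, lifting) finite_UNIV member_le_sum UNIV_I zero_le_power2 finite)
qed

text \<open>The data of a weak solution in terms of its modes; \<open>N\<close> is a measurable version of the squared gradient norms.\<close>

definition regular ::
  "real \<Rightarrow> (real \<Rightarrow> 'n state) \<Rightarrow> real \<Rightarrow> (3 \<Rightarrow> real \<Rightarrow> real) \<Rightarrow> (3 \<Rightarrow> nat \<Rightarrow> real \<Rightarrow> real) \<Rightarrow> bool" where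
  "regular T g R N z \<longleftrightarrow>
    (\<forall>t\<in>{0..T}. g t \<in> H_space \<Omega> \<and> norm (g t) \<le> R) \<and>
    (\<forall>h\<in>H_space \<Omega>. continuous_on {0..T} (\<lambda>t. g t \<bullet> h)) \<and>
    (AE t in lebesgue_on {0..T}. g t \<in> E_space \<Omega>) \<and>
    (\<forall>i. integrable (lebesgue_on {0..T}) (N i)) \<and>
    (\<forall>i. AE t in lebesgue_on {0..T}. N i t = (norm (grad \<Omega> (g t $ i)))\<^sup>2) \<and>
    (\<exists>m. integrable (lebesgue_on {0..T}) m \<and> (\<forall>i. AE t in lebesgue_on {0..T}. norm (fop (g t) $ i) \<le> m t)) \<and>
    (\<forall>i k. integrable (lebesgue_on {0..T}) (z i k)) \<and>
    (\<forall>i. AE t in lebesgue_on {0..T}. \<forall>k. z i k t = - dif i * (eigval k * (g t $ i \<bullet> eig k)) + fop (g t) $ i \<bullet> eig k) \<and>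
    (\<forall>i k s t. 0 \<le> s \<longrightarrow> s \<le> t \<longrightarrow> t \<le> T \<longrightarrow> g t $ i \<bullet> eig k - g s $ i \<bullet> eig k = integral {s..t} (z i k))"

lemma regularD:
  assumes "regular T g R N z"
  shows "\<And>t. t \<in> {0..T} \<Longrightarrow> g t \<in> H_space \<Omega>" "\<And>t. t \<in> {0..T} \<Longrightarrow> norm (g t) \<le> R"
    "\<And>h. h \<in> H_space \<Omega> \<Longrightarrow> continuous_on {0..T} (\<lambda>t. g t \<bullet> h)"
    "AE t in lebesgue_on {0..T}. g t \<in> E_space \<Omega>"
    "\<And>i. integrable (lebesgue_on {0..T}) (N i)"
    "\<And>i. AE t in lebesgue_on {0..T}. N i t = (norm (grad \<Omega> (g t $ i)))\<^sup>2"
    "\<exists>m. integrable (lebesgue_on {0..T}) m \<and> (\<forall>i. AE t in lebesgue_on {0..T}. norm (fop (g t) $ i) \<le> m t)"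
    "\<And>i k. integrable (lebesgue_on {0..T}) (z i k)"
    "\<And>i. AE t in lebesgue_on {0..T}. \<forall>k. z i k t = - dif i * (eigval k * (g t $ i \<bullet> eig k)) + fop (g t) $ i \<bullet> eig k"
    "\<And>i k s t. 0 \<le> s \<Longrightarrow> s \<le> t \<Longrightarrow> t \<le> T \<Longrightarrow> g t $ i \<bullet> eig k - g s $ i \<bullet> eig k = integral {s..t} (z i k)"
  using assms unfolding regular_def by (blast | metis)+

lemma comp_inner: "g $ i \<bullet> v = g \<bullet> axis i v" by (simp add: inner_axis)

text \<open>Weak continuity bounds each scalar pairing on the compact interval, and uniform
  boundedness then provides \<open>R\<close>. The rest collects, component by component, what the
  mode analysis needs.\<close>

lemma weak_solution_regular:
  assumes T: "T > 0" and w: "weak_solution \<Omega> Aop fop T g0 g"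
  shows "\<exists>R N z. regular T g R N z"
proof -
  let ?M = "lebesgue_on {0..T}"
  have gE: "AE t in ?M. g t \<in> E_space \<Omega>" and gi: "(\<integral>\<^sup>+t. ennreal ((E_norm \<Omega> (g t))\<^sup>2) \<partial>?M) < \<infinity>"
    using w unfolding weak_solution_def in_L2_E_def by auto
  have gH: "g t \<in> H_space \<Omega>" if "t \<in> {0..T}" for t using w that unfolding weak_solution_def in_Cw_H_def by auto
  have gc: "continuous_on {0..T} (\<lambda>t. g t \<bullet> h)" if "h \<in> H_space \<Omega>" for h using w that unfolding weak_solution_def in_Cw_H_def by auto
  have gD: "distr_deriv T (\<lambda>t. g t \<bullet> \<phi>) (\<lambda>t. Aop (g t) \<phi> + fop (g t) \<bullet> \<phi>)" if "\<phi> \<in> E_space \<Omega>" for \<phi>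
    using w that unfolding weak_solution_def by auto
  have "\<exists>R. \<forall>t\<in>{0..T}. norm (g t) \<le> R"
  proof (rule weakly_bounded_imp_bounded[OF H_space_sub H_space_closed])
    show "\<exists>C. \<forall>t\<in>{0..T}. \<bar>g t \<bullet> h\<bar> \<le> C" if "h \<in> H_space \<Omega>" for h
    proof -
      have "bounded ((\<lambda>t. g t \<bullet> h) ` {0..T})" by (intro compact_imp_bounded compact_continuous_image gc that) auto
      then show ?thesis by (auto simp: bounded_iff)
    qed
  qed (rule gH)
  then obtain R where R: "\<And>t. t \<in> {0..T} \<Longrightarrow> norm (g t) \<le> R" by blast
  have uc: "continuous_on {0..T} (\<lambda>t. g t $ i \<bullet> eig k)" for i k
    unfolding comp_inner by (intro gc axis_H H10_L2 eig_V)
  have uV: "AE t in ?M. g t $ i \<in> H10 \<Omega>" for i using gE by eventually_elim (rule E_comp)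
  have ub: "norm (g t $ i) \<le> R" if "t \<in> {0..T}" for t i
    using R[OF that] Finite_Cartesian_Product.norm_nth_le[of "g t" i] by linarith
  have ui: "(\<integral>\<^sup>+t. ennreal ((norm (grad \<Omega> (g t $ i)))\<^sup>2) \<partial>?M) < \<infinity>" for i
    by (rule le_less_trans[OF nn_integral_mono gi]) (intro ennreal_leI E_norm_comp)
  have "\<forall>i. \<exists>N. integrable ?M N \<and> (AE t in ?M. N t = (norm (grad \<Omega> (g t $ i)))\<^sup>2)"
    using grad_norm_integrable[OF uc uV ui] by blast
  from choice[OF this] obtain N where
    N': "\<forall>i. integrable ?M (N i) \<and> (AE t in ?M. N i t = (norm (grad \<Omega> (g t $ i)))\<^sup>2)" by (rule exE)
  then have N: "\<And>i. integrable ?M (N i)" "\<And>i. AE t in ?M. N i t = (norm (grad \<Omega> (g t $ i)))\<^sup>2" by auto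
  obtain C where C: "C \<ge> 0" "\<And>u. u \<in> H10 \<Omega> \<Longrightarrow> norm (sql2 u) \<le> 1 * (norm (grad \<Omega> u))\<^sup>2 + C * (norm u)\<^sup>2"
    using H10_square_norm[OF low_dim zero_less_one] unfolding sql2_def by blast
  \<comment> \<open>\<open>f_norm_bound\<close> combined with the interpolation inequality at weight
    1; integrable because the squared gradients are.\<close>
  define m where "m t = csum * (2 * R + 2 * (N 1 t + C * R\<^sup>2) + (N 2 t + C * R\<^sup>2))" for t
  have ci: "integrable ?M (\<lambda>t. c)" for c :: real
    by (auto simp: finite_measure_lebesgue_on intro!: finite_measure.integrable_const)
  have mi: "integrable ?M m" unfolding m_def[abs_def]
    by (intro integrable_mult_right Bochner_Integration.integrable_add N ci)
  have AT: "AE t in ?M. t \<in> {0..T}" by (rule AE_I2) simp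
  have fb: "AE t in ?M. norm (fop (g t) $ i) \<le> m t" for i
    using gE N(2)[of 1] N(2)[of 2] AT
  proof eventually_elim
    case (elim t)
    have s: "norm (sql2 (g t $ j)) \<le> (norm (grad \<Omega> (g t $ j)))\<^sup>2 + C * R\<^sup>2" for j
    proof -
      have "(norm (g t $ j))\<^sup>2 \<le> R\<^sup>2" by (rule power_mono[OF ub[OF elim(4)]]) simp
      then have "C * (norm (g t $ j))\<^sup>2 \<le> C * R\<^sup>2" by (rule mult_left_mono[OF _ C(1)])
      then show ?thesis using C(2)[OF E_comp[OF elim(1), of j]] by linarith
    qed
    have "norm (fop (g t) $ i) \<le> csum * (2 * norm (g t) + 2 * norm (sql2 (g t $ 1)) + norm (sql2 (g t $ 2)))"
      by (rule f_norm_bound[OF elim(1)])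
    also have "\<dots> \<le> m t" unfolding m_def elim(2,3)
      using s[of 1] s[of 2] R[OF elim(4)] csum_pos by (intro mult_left_mono add_mono) auto
    finally show ?case .
  qed
  have eq: "distr_deriv T (\<lambda>t. g t $ i \<bullet> eig k) (\<lambda>t. - dif i * (grad \<Omega> (g t $ i) \<bullet> grad \<Omega> (eig k)) + fop (g t) $ i \<bullet> eig k)" for i k
    using gD[OF axis_E[OF eig_V[of k]], of i] by (simp only: A_axis inner_axis)
  have "\<forall>i. \<exists>z. (\<forall>k. integrable ?M (z k)) \<and>
    (AE t in ?M. \<forall>k. z k t = - dif i * (eigval k * (g t $ i \<bullet> eig k)) + fop (g t) $ i \<bullet> eig k) \<and>
    (\<forall>k s t. 0 \<le> s \<longrightarrow> s \<le> t \<longrightarrow> t \<le> T \<longrightarrow> g t $ i \<bullet> eig k - g s $ i \<bullet> eig k = integral {s..t} (z k))"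
    using mode_equation[OF T uc uV ub fb mi eq] by blast
  from choice[OF this] obtain z where z: "\<forall>i. (\<forall>k. integrable ?M (z i k)) \<and>
    (AE t in ?M. \<forall>k. z i k t = - dif i * (eigval k * (g t $ i \<bullet> eig k)) + fop (g t) $ i \<bullet> eig k) \<and>
    (\<forall>k s t. 0 \<le> s \<longrightarrow> s \<le> t \<longrightarrow> t \<le> T \<longrightarrow> g t $ i \<bullet> eig k - g s $ i \<bullet> eig k = integral {s..t} (z i k))"
    by (rule exE)
  have "regular T g R N z" unfolding regular_def
    using gH R gc gE N mi fb z by blast
  then show ?thesis by blast
qed

lemma energy_single:
  assumes T: "T > 0" and g: "regular T g R N z"
  shows "\<exists>Z. \<forall>i. integrable (lebesgue_on {0..T}) (Z i) \<and>
    (AE t in lebesgue_on {0..T}. Z i t = - dif i * N i t + fop (g t) $ i \<bullet> g t $ i) \<and>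
    (\<forall>s t. 0 \<le> s \<longrightarrow> s \<le> t \<longrightarrow> t \<le> T \<longrightarrow> (norm (g t $ i))\<^sup>2 - (norm (g s $ i))\<^sup>2 = 2 * integral {s..t} (Z i))"
proof (rule choice, rule allI)
  fix i
  note r = regularD[OF g]
  obtain m where m: "integrable (lebesgue_on {0..T}) m" "AE t in lebesgue_on {0..T}. norm (fop (g t) $ i) \<le> m t" using r(7) by blast
  have uc: "continuous_on {0..T} (\<lambda>t. g t $ i \<bullet> eig k)" for k unfolding comp_inner by (intro r(3) axis_H H10_L2 eig_V)
  have uV: "AE t in lebesgue_on {0..T}. g t $ i \<in> H10 \<Omega>" using r(4) by eventually_elim (rule E_comp)
  have ub: "norm (g t $ i) \<le> R" if "t \<in> {0..T}" for t
    using r(2)[OF that] Finite_Cartesian_Product.norm_nth_le[of "g t" i] by linarith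
  obtain Z where Z: "integrable (lebesgue_on {0..T}) Z"
    "AE t in lebesgue_on {0..T}. Z t = - dif i * (norm (grad \<Omega> (g t $ i)))\<^sup>2 + fop (g t) $ i \<bullet> g t $ i"
    "\<forall>s t. 0 \<le> s \<longrightarrow> s \<le> t \<longrightarrow> t \<le> T \<longrightarrow> (norm (g t $ i))\<^sup>2 - (norm (g s $ i))\<^sup>2 = 2 * integral {s..t} Z"
    using energy_identity[where u="\<lambda>t. g t $ i" and F="\<lambda>t. fop (g t) $ i", OF T H_space_D[OF r(1)] uc uV r(5,6) ub m(2,1) r(8) r(9) r(10)] by blast
  have "AE t in lebesgue_on {0..T}. Z t = - dif i * N i t + fop (g t) $ i \<bullet> g t $ i"
    using Z(2) r(6)[of i] by eventually_elim simp
  with Z show "\<exists>Z. integrable (lebesgue_on {0..T}) Z \<and>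
    (AE t in lebesgue_on {0..T}. Z t = - dif i * N i t + fop (g t) $ i \<bullet> g t $ i) \<and>
    (\<forall>s t. 0 \<le> s \<longrightarrow> s \<le> t \<longrightarrow> t \<le> T \<longrightarrow> (norm (g t $ i))\<^sup>2 - (norm (g s $ i))\<^sup>2 = 2 * integral {s..t} Z)" by blast
qed

text \<open>The energy identity is quadratic and cannot be subtracted, so it is applied afresh to
  the difference, whose mode equations are the subtracted ones.\<close>

lemma energy_difference:
  assumes T: "T > 0" and g: "regular T g R N z" and h: "regular T h R N' z'"
  shows "\<exists>Z. \<forall>i. integrable (lebesgue_on {0..T}) (Z i) \<and>
    (AE t in lebesgue_on {0..T}. Z i t = - dif i * (norm (grad \<Omega> (g t $ i - h t $ i)))\<^sup>2 + (fop (g t) $ i - fop (h t) $ i) \<bullet> (g t $ i - h t $ i)) \<and>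
    (\<forall>s t. 0 \<le> s \<longrightarrow> s \<le> t \<longrightarrow> t \<le> T \<longrightarrow> (norm (g t $ i - h t $ i))\<^sup>2 - (norm (g s $ i - h s $ i))\<^sup>2 = 2 * integral {s..t} (Z i))"
proof (rule choice, rule allI)
  fix i
  let ?M = "lebesgue_on {0..T}"
  note r = regularD[OF g] and q = regularD[OF h]
  obtain m where m: "integrable ?M m" "AE t in ?M. norm (fop (g t) $ i) \<le> m t" using r(7) by blast
  obtain m' where m': "integrable ?M m'" "AE t in ?M. norm (fop (h t) $ i) \<le> m' t" using q(7) by blast
  let ?u = "\<lambda>t. g t $ i - h t $ i"
  have uH: "?u t \<in> L2_space \<Omega>" if "t \<in> {0..T}" for t
    using r(1)[OF that] q(1)[OF that] by (intro subspace_diff[OF L2_sub] H_space_D)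
  have uc: "continuous_on {0..T} (\<lambda>t. ?u t \<bullet> eig k)" for k
    unfolding inner_diff_left comp_inner by (intro continuous_intros r(3) q(3) axis_H H10_L2 eig_V)
  have gV: "AE t in ?M. g t $ i \<in> H10 \<Omega>" using r(4) by eventually_elim (rule E_comp)
  have hV: "AE t in ?M. h t $ i \<in> H10 \<Omega>" using q(4) by eventually_elim (rule E_comp)
  have uV: "AE t in ?M. ?u t \<in> H10 \<Omega>" using gV hV by eventually_elim (rule subspace_diff[OF H10_sub])
  have ub: "norm (?u t) \<le> 2 * R" if "t \<in> {0..T}" for t
    using r(2)[OF that] q(2)[OF that] Finite_Cartesian_Product.norm_nth_le[of "g t" i]
      Finite_Cartesian_Product.norm_nth_le[of "h t" i] norm_triangle_ineq4[of "g t $ i" "h t $ i"] by linarith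
  have ui: "(\<integral>\<^sup>+t. ennreal ((norm (grad \<Omega> (?u t)))\<^sup>2) \<partial>?M) < \<infinity>"
  proof -
    have "(\<integral>\<^sup>+t. ennreal ((norm (grad \<Omega> (?u t)))\<^sup>2) \<partial>?M) \<le> (\<integral>\<^sup>+t. ennreal \<bar>2 * N i t + 2 * N' i t\<bar> \<partial>?M)"
    proof (rule nn_integral_mono_AE, use gV hV r(6)[of i] q(6)[of i] in eventually_elim)
      case (elim t)
      have "(norm (grad \<Omega> (?u t)))\<^sup>2 \<le> (norm (grad \<Omega> (g t $ i)) + norm (grad \<Omega> (h t $ i)))\<^sup>2"
        unfolding grad_diff[OF elim(1,2)] by (intro power_mono norm_triangle_ineq4) auto
      also have "\<dots> \<le> 2 * N i t + 2 * N' i t"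
        unfolding elim using sum_squares_bound[of "norm (grad \<Omega> (g t $ i))" "norm (grad \<Omega> (h t $ i))"] by (simp add: power2_sum)
      finally show ?case by (intro ennreal_leI) linarith
    qed
    also have "\<dots> < \<infinity>"
    proof -
      have "integrable ?M (\<lambda>t. 2 * N i t + 2 * N' i t)" using r(5)[of i] q(5)[of i] by simp
      then show ?thesis unfolding integrable_iff_bounded by simp
    qed
    finally show ?thesis .
  qed
  obtain Nd where Nd: "integrable ?M Nd" "AE t in ?M. Nd t = (norm (grad \<Omega> (?u t)))\<^sup>2"
    using grad_norm_integrable[OF uc uV ui] by blast
  have Fb: "AE t in ?M. norm (fop (g t) $ i - fop (h t) $ i) \<le> m t + m' t"
    using m(2) m'(2) by eventually_elim (rule norm_triangle_le_diff, linarith)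
  have zV: "AE t in ?M. \<forall>k. z i k t - z' i k t = - dif i * (eigval k * (?u t \<bullet> eig k)) + (fop (g t) $ i - fop (h t) $ i) \<bullet> eig k"
    using r(9)[of i] q(9)[of i]
  proof eventually_elim
    case (elim t)
    show ?case
      unfolding spec[OF elim(1)] spec[OF elim(2)] by (simp add: inner_diff_left algebra_simps)
  qed
  have zint: "?u t \<bullet> eig k - ?u s \<bullet> eig k = integral {s..t} (\<lambda>x. z i k x - z' i k x)" if "0 \<le> s" "s \<le> t" "t \<le> T" for k s t
  proof -
    have "integral {s..t} (\<lambda>x. z i k x - z' i k x) = integral {s..t} (z i k) - integral {s..t} (z' i k)"
      by (intro Henstock_Kurzweil_Integration.integral_diff integrable_on_sub[OF r(8)] integrable_on_sub[OF q(8)] that)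
    then show ?thesis using r(10)[OF that, of i k] q(10)[OF that, of i k] by (simp add: inner_diff_left)
  qed
  have mi: "integrable ?M (\<lambda>t. m t + m' t)" using m(1) m'(1) by simp
  have zi: "integrable ?M (\<lambda>x. z i k x - z' i k x)" for k using r(8) q(8) by simp
  show "\<exists>Z. integrable ?M Z \<and>
    (AE t in ?M. Z t = - dif i * (norm (grad \<Omega> (?u t)))\<^sup>2 + (fop (g t) $ i - fop (h t) $ i) \<bullet> ?u t) \<and>
    (\<forall>s t. 0 \<le> s \<longrightarrow> s \<le> t \<longrightarrow> t \<le> T \<longrightarrow> (norm (?u t))\<^sup>2 - (norm (?u s))\<^sup>2 = 2 * integral {s..t} Z)"
    by (rule energy_identity[where u="?u" and F="\<lambda>t. fop (g t) $ i - fop (h t) $ i" and z="\<lambda>k x. z i k x - z' i k x",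
          OF T uH uc uV Nd ub Fb mi zi zV zint])
qed

section \<open>The weighted energy and continuity of trajectories\<close>

definition Phi :: "'n state \<Rightarrow> real" where
  "Phi g = (norm (g $ 1))\<^sup>2 + (norm (g $ 2))\<^sup>2 + pw * (norm (g $ 3))\<^sup>2"

lemma Phi_bounds: "(norm g)\<^sup>2 \<le> Phi g" "Phi g \<le> pw * (norm g)\<^sup>2"
proof -
  have "1 * (norm (g $ i))\<^sup>2 \<le> pw * (norm (g $ i))\<^sup>2" for i by (rule mult_right_mono[OF pw_ge_1]) simp
  from this[of 1] this[of 2] this[of 3] show "(norm g)\<^sup>2 \<le> Phi g" "Phi g \<le> pw * (norm g)\<^sup>2"
    unfolding Phi_def norm_state_sq by (simp_all add: distrib_left)
qed

lemma component_norm_continuous: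
  assumes T: "T > 0" and g: "regular T g R N z"
  shows "continuous_on {0..T} (\<lambda>t. (norm (g t $ i))\<^sup>2)"
proof -
  obtain Z where Z: "\<And>i. integrable (lebesgue_on {0..T}) (Z i)"
    "\<And>i s t. 0 \<le> s \<Longrightarrow> s \<le> t \<Longrightarrow> t \<le> T \<Longrightarrow> (norm (g t $ i))\<^sup>2 - (norm (g s $ i))\<^sup>2 = 2 * integral {s..t} (Z i)"
    using energy_single[OF T g] by blast
  have "Z i integrable_on {0..T}" by (rule integrable_on_lebesgue_on[OF Z(1)]) simp
  then have "continuous_on {0..T} (\<lambda>t. (norm (g 0 $ i))\<^sup>2 + 2 * integral {0..t} (Z i))"
    by (intro continuous_intros indefinite_integral_continuous_1)
  then show ?thesis
    by (rule continuous_on_eq) (use Z(2)[of 0 _ i] in force)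
qed

text \<open>In a Hilbert space weak continuity together with continuity of the norm, here a
  consequence of the energy identity, gives strong continuity.\<close>

lemma trajectory_continuous:
  assumes T: "T > 0" and g: "regular T g R N z"
  shows "continuous_on {0..T} g"
  unfolding continuous_on_def
proof
  fix s assume s: "s \<in> {0..T}"
  have n: "continuous_on {0..T} (\<lambda>t. (norm (g t))\<^sup>2)"
    unfolding norm_state_sq by (intro continuous_intros component_norm_continuous[OF T g])
  have "((\<lambda>t. (norm (g t))\<^sup>2 - 2 * (g t \<bullet> g s) + (norm (g s))\<^sup>2) \<longlongrightarrow> (norm (g s))\<^sup>2 - 2 * (g s \<bullet> g s) + (norm (g s))\<^sup>2) (at s within {0..T})"
  proof -
    have A: "((\<lambda>t. (norm (g t))\<^sup>2) \<longlongrightarrow> (norm (g s))\<^sup>2) (at s within {0..T})"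
      using n s unfolding continuous_on_def by blast
    have B: "((\<lambda>t. g t \<bullet> g s) \<longlongrightarrow> g s \<bullet> g s) (at s within {0..T})"
      using regularD(3)[OF g regularD(1)[OF g s]] s unfolding continuous_on_def by blast
    show ?thesis by (rule tendsto_add[OF tendsto_diff[OF A tendsto_mult[OF tendsto_const B]] tendsto_const])
  qed
  moreover have "(norm (g t))\<^sup>2 - 2 * (g t \<bullet> g s) + (norm (g s))\<^sup>2 = (norm (g t - g s))\<^sup>2" for t
    by (simp add: power2_norm_eq_inner inner_diff_left inner_diff_right inner_commute)
  ultimately have "((\<lambda>t. (norm (g t - g s))\<^sup>2) \<longlongrightarrow> 0) (at s within {0..T})" by simp
  then have "((\<lambda>t. sqrt ((norm (g t - g s))\<^sup>2)) \<longlongrightarrow> sqrt 0) (at s within {0..T})" by (rule tendsto_real_sqrt)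
  then show "(g \<longlongrightarrow> g s) (at s within {0..T})" by (simp add: tendsto_norm_zero_iff LIM_zero_iff)
qed

text \<open>Both bounds come from one inequality for the weighted energy. Discarding the gradients
  and applying Gronwall at a negative rate gives the decay; discarding the damping gives the bound
  on the integrated gradients.\<close>

lemma dissipation:
  assumes T: "T > 0" and g: "regular T g R N z" and gp: "\<And>t. t \<in> {0..T} \<Longrightarrow> g t \<in> H_plus \<Omega>"
  shows "Phi (g T) \<le> exp (- 2 * dl * T) * Phi (g 0) + Kc * measure lebesgue \<Omega> / dl"
    "2 * dm * integral {0..T} (\<lambda>t. N 1 t + N 2 t + N 3 t) \<le> Phi (g 0) + 2 * (Kc * measure lebesgue \<Omega>) * T"
proof -
  let ?M = "lebesgue_on {0..T}"
  define K where "K = Kc * measure lebesgue \<Omega>"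
  have K0: "0 \<le> K" unfolding K_def by (intro mult_nonneg_nonneg Kc_nonneg) simp
  note r = regularD[OF g]
  obtain Z where Z: "\<And>i. integrable ?M (Z i)" "\<And>i. AE t in ?M. Z i t = - dif i * N i t + fop (g t) $ i \<bullet> g t $ i"
    "\<And>i s t. 0 \<le> s \<Longrightarrow> s \<le> t \<Longrightarrow> t \<le> T \<Longrightarrow> (norm (g t $ i))\<^sup>2 - (norm (g s $ i))\<^sup>2 = 2 * integral {s..t} (Z i)"
    using energy_single[OF T g] by blast
  define P where "P t = Phi (g t)" for t
  have Pc: "continuous_on {0..T} P" unfolding P_def[abs_def] Phi_def
    by (intro continuous_intros component_norm_continuous[OF T g])
  have P0: "0 \<le> P t" for t unfolding P_def using Phi_bounds(1)[of "g t"] zero_le_power2[of "norm (g t)"] by linarith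
  have Pi: "integrable ?M P" by (rule continuous_imp_integrable_real[OF Pc])
  have ci: "integrable ?M (\<lambda>t. c)" for c :: real
    by (auto simp: finite_measure_lebesgue_on intro!: finite_measure.integrable_const)
  have Ni: "integrable ?M (\<lambda>t. N 1 t + N 2 t + N 3 t)" using r(5) by simp
  have Zi: "integrable ?M (\<lambda>t. Z 1 t + Z 2 t + pw * Z 3 t)" using Z(1) by simp
  have AT: "AE t in ?M. t \<in> {0..T}" by (rule AE_I2) simp
  have AZ: "AE t in ?M. Z 1 t + Z 2 t + pw * Z 3 t \<le> (K - dl * P t) - dm * (N 1 t + N 2 t + N 3 t)"
    using Z(2)[of 1] Z(2)[of 2] Z(2)[of 3] r(6)[of 1] r(6)[of 2] r(6)[of 3] r(4) AT
  proof eventually_elim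
    case (elim t)
    have n: "0 \<le> N 1 t" "0 \<le> N 2 t" "0 \<le> N 3 t" unfolding elim by auto
    have a: "dm * N i t \<le> dif i * N i t" if "0 \<le> N i t" for i by (rule mult_right_mono[OF dm_le that])
    have dif0: "0 \<le> dif 3" using dm_le[of 3] dm_pos by linarith
    \<comment> \<open>Since the weight is at least 1, the weighted diffusion of the third component
      dominates the unweighted one.\<close>
    have b: "dif 3 * N 3 t \<le> pw * (dif 3 * N 3 t)"
      using mult_right_mono[OF pw_ge_1, of "dif 3 * N 3 t"] mult_nonneg_nonneg[OF dif0 n(3)] by linarith
    have "fop (g t) $ 1 \<bullet> g t $ 1 + fop (g t) $ 2 \<bullet> g t $ 2 + pw * (fop (g t) $ 3 \<bullet> g t $ 3) \<le> K - dl * P t"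
      unfolding K_def P_def Phi_def by (rule f_dissipation[OF elim(7) gp[OF elim(8)]])
    moreover have "Z 1 t + Z 2 t + pw * Z 3 t = (fop (g t) $ 1 \<bullet> g t $ 1 + fop (g t) $ 2 \<bullet> g t $ 2 + pw * (fop (g t) $ 3 \<bullet> g t $ 3))
        - dif 1 * N 1 t - dif 2 * N 2 t - pw * (dif 3 * N 3 t)"
      unfolding elim(1-3) by (simp add: algebra_simps)
    moreover have "dm * (N 1 t + N 2 t + N 3 t) = dm * N 1 t + dm * N 2 t + dm * N 3 t" by (simp add: distrib_left)
    ultimately show ?case using a[OF n(1)] a[OF n(2)] a[OF n(3)] b by linarith
  qed
  have Pd: "P t - P s \<le> 2 * integral {s..t} (\<lambda>r. K - dl * P r) - 2 * dm * integral {s..t} (\<lambda>t. N 1 t + N 2 t + N 3 t)"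
    if st: "0 \<le> s" "s \<le> t" "t \<le> T" for s t
  proof -
    have zi: "Z i integrable_on {s..t}" for i by (rule integrable_on_sub[OF Z(1)]) (use st in auto)
    have ni: "(\<lambda>t. N 1 t + N 2 t + N 3 t) integrable_on {s..t}" by (rule integrable_on_sub[OF Ni]) (use st in auto)
    have ki: "(\<lambda>r. K - dl * P r) integrable_on {s..t}"
      by (rule integrable_on_sub[where T=T]) (use st in \<open>auto intro!: Bochner_Integration.integrable_diff ci Pi\<close>)
    have "integral {s..t} (\<lambda>r. Z 1 r + Z 2 r + pw * Z 3 r) = integral {s..t} (Z 1) + integral {s..t} (Z 2) + pw * integral {s..t} (Z 3)"
      using zi by (simp add: Henstock_Kurzweil_Integration.integral_add integrable_add integrable_on_mult_right)
    then have "P t - P s = 2 * integral {s..t} (\<lambda>r. Z 1 r + Z 2 r + pw * Z 3 r)"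
      unfolding P_def Phi_def using Z(3)[OF st, of 1] Z(3)[OF st, of 2] Z(3)[OF st, of 3] by (simp add: algebra_simps)
    also have "\<dots> \<le> 2 * integral {s..t} (\<lambda>r. (K - dl * P r) - dm * (N 1 r + N 2 r + N 3 r))"
    proof (intro mult_left_mono integral_mono_AE_on[OF Zi _ AZ])
      show "integrable ?M (\<lambda>r. (K - dl * P r) - dm * (N 1 r + N 2 r + N 3 r))"
        by (intro Bochner_Integration.integrable_diff integrable_mult_right ci Pi Ni)
    qed (use st in auto)
    also have "integral {s..t} (\<lambda>r. (K - dl * P r) - dm * (N 1 r + N 2 r + N 3 r)) =
      integral {s..t} (\<lambda>r. K - dl * P r) - integral {s..t} (\<lambda>r. dm * (N 1 r + N 2 r + N 3 r))"
      by (rule Henstock_Kurzweil_Integration.integral_diff[OF ki integrable_on_mult_right[OF ni]])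
    also have "integral {s..t} (\<lambda>r. dm * (N 1 r + N 2 r + N 3 r)) = dm * integral {s..t} (\<lambda>r. N 1 r + N 2 r + N 3 r)"
      by (rule integral_mult_right)
    finally show ?thesis by (simp add: algebra_simps)
  qed
  have nonneg_N: "0 \<le> integral {s..t} (\<lambda>t. N 1 t + N 2 t + N 3 t)" if st: "0 \<le> s" "s \<le> t" "t \<le> T" for s t
  proof -
    have "AE t in ?M. 0 \<le> N 1 t + N 2 t + N 3 t" using r(6)[of 1] r(6)[of 2] r(6)[of 3] by eventually_elim simp
    from integral_mono_AE_on[OF ci[of 0] Ni this] st show ?thesis by simp
  qed
  \<comment> \<open>Shifting by the equilibrium value K/dl makes the inequality homogeneous, as
    \<open>gronwall\<close> requires.\<close>
  define h where "h t = P t - K / dl" for t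
  have hc: "continuous_on {0..T} h" unfolding h_def[abs_def] by (intro continuous_intros Pc)
  have "h T \<le> exp ((- 2 * dl) * T) * h 0"
  proof (rule gronwall)
    fix s t assume st: "0 \<le> s" "s \<le> t" "t \<le> T"
    have "P t - P s \<le> 2 * integral {s..t} (\<lambda>r. K - dl * P r)"
      using Pd[OF st] mult_nonneg_nonneg[OF less_imp_le[OF dm_pos] nonneg_N[OF st]] by linarith
    also have "integral {s..t} (\<lambda>r. K - dl * P r) = integral {s..t} (\<lambda>r. (- dl) * h r)"
      using dl_pos by (intro integral_cong) (simp add: h_def algebra_simps)
    also have "\<dots> = (- dl) * integral {s..t} h" by (rule integral_mult_right)
    finally show "h t - h s \<le> (- 2 * dl) * integral {s..t} h" by (simp add: h_def)
  qed (use T dl_pos hc in auto)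
  also have "\<dots> \<le> exp (- 2 * dl * T) * P 0" using K0 dl_pos by (simp add: h_def)
  finally show "Phi (g T) \<le> exp (- 2 * dl * T) * Phi (g 0) + Kc * measure lebesgue \<Omega> / dl"
    by (simp add: h_def P_def K_def)
  have "integral {0..T} (\<lambda>r. K - dl * P r) \<le> integral {0..T} (\<lambda>r. K)"
    using T P0 dl_pos by (intro integral_le integrable_continuous_real continuous_intros Pc) auto
  also have "\<dots> = K * T" using T by simp
  finally have "2 * dm * integral {0..T} (\<lambda>t. N 1 t + N 2 t + N 3 t) \<le> P 0 + 2 * K * T"
    using Pd[of 0 T] P0[of T] T by linarith
  then show "2 * dm * integral {0..T} (\<lambda>t. N 1 t + N 2 t + N 3 t) \<le> Phi (g 0) + 2 * (Kc * measure lebesgue \<Omega>) * T"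
    by (simp add: P_def K_def)
qed

text \<open>The quadratic differences cost \<open>R\<close> times squared gradient norms;
  interpolation with small weight lets diffusion absorb that part, and Gronwall handles the rest.
  The constant depends on the solutions only through \<open>R\<close>, hence is uniform over bounded
  sets.\<close>

lemma lipschitz_dependence:
  assumes R: "R \<ge> 0"
  shows "\<exists>c>0. \<forall>T g h N z N' z'. 0 < T \<longrightarrow> regular T g R N z \<longrightarrow> regular T h R N' z' \<longrightarrow>
     (norm (g T - h T))\<^sup>2 \<le> exp (c * T) * (norm (g 0 - h 0))\<^sup>2"
proof -
  \<comment> \<open>Chosen so that \<open>csum * (8 * R * e)\<close> is at most the smallest
    diffusion rate; R + 1 avoids division by zero.\<close>
  define e where "e = dm / (8 * csum * (R + 1))"
  have e: "e > 0" unfolding e_def using dm_pos csum_pos R by (intro divide_pos_pos mult_pos_pos) auto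
  obtain C where C: "C \<ge> 0" "\<And>u. u \<in> H10 \<Omega> \<Longrightarrow> norm (sql2 u) \<le> e * (norm (grad \<Omega> u))\<^sup>2 + C * (norm u)\<^sup>2"
    using H10_square_norm[OF low_dim e] unfolding sql2_def by blast
  define c where "c = 2 * csum * (4 + 8 * R * C)"
  have c: "c > 0" unfolding c_def using csum_pos R C(1) by (intro mult_pos_pos add_pos_nonneg) auto
  have eR: "csum * (8 * R * e) \<le> dm"
  proof -
    have "csum * (8 * R * (dm / (8 * csum * r))) = dm * (R / r)" if "r \<noteq> 0" for r
      using csum_pos that by (simp add: field_simps)
    from this[of "R + 1"] have "csum * (8 * R * e) = dm * (R / (R + 1))" unfolding e_def using R by simp
    also have "\<dots> \<le> dm * 1" using dm_pos R by (intro mult_left_mono) auto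
    finally show ?thesis by simp
  qed
  have "(norm (g T - h T))\<^sup>2 \<le> exp (c * T) * (norm (g 0 - h 0))\<^sup>2"
    if T: "0 < T" and g: "regular T g R N z" and h: "regular T h R N' z'" for T g h N z N' z'
  proof -
    let ?M = "lebesgue_on {0..T}"
    note r = regularD[OF g] and q = regularD[OF h]
    obtain Z where Z: "\<And>i. integrable ?M (Z i)"
      "\<And>i. AE t in ?M. Z i t = - dif i * (norm (grad \<Omega> (g t $ i - h t $ i)))\<^sup>2 + (fop (g t) $ i - fop (h t) $ i) \<bullet> (g t $ i - h t $ i)"
      "\<And>i s t. 0 \<le> s \<Longrightarrow> s \<le> t \<Longrightarrow> t \<le> T \<Longrightarrow> (norm (g t $ i - h t $ i))\<^sup>2 - (norm (g s $ i - h s $ i))\<^sup>2 = 2 * integral {s..t} (Z i)"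
      using energy_difference[OF T g h] by blast
    define X where "X t = (norm (g t - h t))\<^sup>2" for t
    have Xc: "continuous_on {0..T} X" unfolding X_def[abs_def]
      by (intro continuous_intros trajectory_continuous[OF T g] trajectory_continuous[OF T h])
    have Xi: "integrable ?M X" by (rule continuous_imp_integrable_real[OF Xc])
    have AT: "AE t in ?M. t \<in> {0..T}" by (rule AE_I2) simp
    have AZ: "AE t in ?M. Z 1 t + Z 2 t + Z 3 t \<le> c / 2 * X t"
      using Z(2)[of 1] Z(2)[of 2] Z(2)[of 3] r(4) q(4) AT
    proof eventually_elim
      case (elim t)
      define n where "n i = (norm (grad \<Omega> (g t $ i - h t $ i)))\<^sup>2" for i
      have n0: "0 \<le> n i" for i by (simp add: n_def)
      have a: "dm * n i \<le> dif i * n i" for i by (rule mult_right_mono[OF dm_le n0])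
      have X3: "(norm (g t $ 1 - h t $ 1))\<^sup>2 + (norm (g t $ 2 - h t $ 2))\<^sup>2 + (norm (g t $ 3 - h t $ 3))\<^sup>2 = X t"
        unfolding X_def norm_state_sq by simp
      have zV: "g t $ i - h t $ i \<in> H10 \<Omega>" for i using elim by (intro subspace_diff[OF H10_sub] E_comp)
      have "norm (sql2 (g t $ 1 - h t $ 1)) + norm (sql2 (g t $ 2 - h t $ 2)) \<le>
          e * (n 1 + n 2) + C * ((norm (g t $ 1 - h t $ 1))\<^sup>2 + (norm (g t $ 2 - h t $ 2))\<^sup>2)"
        using C(2)[OF zV, of 1] C(2)[OF zV, of 2] by (simp add: n_def distrib_left)
      also have "\<dots> \<le> e * (n 1 + n 2) + C * X t"
        using C(1) unfolding X3[symmetric] by (intro add_left_mono mult_left_mono) auto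
      finally have s: "8 * R * (norm (sql2 (g t $ 1 - h t $ 1)) + norm (sql2 (g t $ 2 - h t $ 2))) \<le> 8 * R * (e * (n 1 + n 2) + C * X t)"
        using R by (intro mult_left_mono) auto
      have "(fop (g t) $ 1 - fop (h t) $ 1) \<bullet> (g t $ 1 - h t $ 1) + (fop (g t) $ 2 - fop (h t) $ 2) \<bullet> (g t $ 2 - h t $ 2) + (fop (g t) $ 3 - fop (h t) $ 3) \<bullet> (g t $ 3 - h t $ 3)
        \<le> csum * (4 * X t + 8 * R * (norm (sql2 (g t $ 1 - h t $ 1)) + norm (sql2 (g t $ 2 - h t $ 2))))"
        unfolding X_def by (rule f_difference_bound[OF elim(4,5) r(2)[OF elim(6)] q(2)[OF elim(6)]])
      also have "\<dots> \<le> csum * (4 * X t + 8 * R * (e * (n 1 + n 2) + C * X t))"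
        using s csum_pos by (intro mult_left_mono) auto
      also have "\<dots> = c / 2 * X t + (csum * (8 * R * e)) * (n 1 + n 2)" by (simp add: c_def algebra_simps)
      also have "\<dots> \<le> c / 2 * X t + dm * (n 1 + n 2)"
        using mult_right_mono[OF eR, of "n 1 + n 2"] n0 by simp
      finally have "(fop (g t) $ 1 - fop (h t) $ 1) \<bullet> (g t $ 1 - h t $ 1) + (fop (g t) $ 2 - fop (h t) $ 2) \<bullet> (g t $ 2 - h t $ 2) + (fop (g t) $ 3 - fop (h t) $ 3) \<bullet> (g t $ 3 - h t $ 3)
        \<le> c / 2 * X t + dm * (n 1 + n 2)" .
      moreover have "0 \<le> dif 3 * n 3" using a[of 3] mult_nonneg_nonneg[OF less_imp_le[OF dm_pos] n0[of 3]] by linarith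
      moreover have "dm * (n 1 + n 2) = dm * n 1 + dm * n 2" by (rule distrib_left)
      ultimately show ?case using a[of 1] a[of 2] unfolding elim(1-3) n_def[symmetric] by linarith
    qed
    have "X T \<le> exp (c * T) * X 0"
    proof (rule gronwall)
      fix s t assume st: "0 \<le> s" "s \<le> t" "t \<le> T"
      have zi: "Z i integrable_on {s..t}" for i by (rule integrable_on_sub[OF Z(1)]) (use st in auto)
      have "integral {s..t} (\<lambda>r. Z 1 r + Z 2 r + Z 3 r) = integral {s..t} (Z 1) + integral {s..t} (Z 2) + integral {s..t} (Z 3)"
        using zi by (simp add: Henstock_Kurzweil_Integration.integral_add integrable_add)
      then have "X t - X s = 2 * integral {s..t} (\<lambda>r. Z 1 r + Z 2 r + Z 3 r)"
        unfolding X_def norm_state_sq using Z(3)[OF st, of 1] Z(3)[OF st, of 2] Z(3)[OF st, of 3] by simp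
      also have "\<dots> \<le> 2 * integral {s..t} (\<lambda>r. c / 2 * X r)"
        using st by (intro mult_left_mono integral_mono_AE_on[OF _ _ AZ]) (use Z(1) Xi in auto)
      also have "integral {s..t} (\<lambda>r. c / 2 * X r) = c / 2 * integral {s..t} X" by (rule integral_mult_right)
      finally show "X t - X s \<le> c * integral {s..t} X" by simp
    qed (use T c Xc in auto)
    then show ?thesis by (simp add: X_def)
  qed
  with c show ?thesis by blast
qed

end

section \<open>Global attractors of semigroups with a compact absorbing set\<close>

lemma nested_limit:
  fixes C :: "nat \<Rightarrow> 'a::metric_space set"
  assumes K: "compact K" and cl: "\<And>n. closed (C n)" and sub: "\<And>n. C n \<subseteq> K" and dec: "decseq C" and x: "\<And>n. x n \<in> C n"
  obtains l r where "strict_mono (r :: nat \<Rightarrow> nat)" "(\<lambda>m. x (r m)) \<longlonglongrightarrow> l" "\<And>n. l \<in> C n"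
proof -
  have "\<forall>n. x n \<in> K" using x sub by blast
  then obtain l r where r: "strict_mono (r :: nat \<Rightarrow> nat)" and l: "(x \<circ> r) \<longlonglongrightarrow> l"
    using K unfolding compact_def by blast
  have lim: "(\<lambda>m. x (r m)) \<longlonglongrightarrow> l" using l by (simp add: o_def)
  have "l \<in> C n" for n
  proof (rule Lim_in_closed_set[OF cl _ _ lim])
    have "x (r m) \<in> C n" if "n \<le> m" for m
    proof -
      have "n \<le> r m" using that seq_suble[OF r, of m] by linarith
      then show ?thesis using x[of "r m"] decseqD[OF dec] by blast
    qed
    then show "\<forall>\<^sub>F m in sequentially. x (r m) \<in> C n" unfolding eventually_sequentially by blast
  qed simp
  then show thesis using r lim that by blast
qed

text \<open>Every bounded set ends up in \<open>K\<close>, so it suffices to follow \<open>K\<close>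
  itself: the attractor is the intersection of the closed tails \<open>C n\<close> of its orbit. The
  tails lie in \<open>K\<close>, because by time \<open>T0\<close> the set \<open>K\<close> has
  absorbed itself.\<close>

theorem compact_absorbing_attractor:
  fixes S :: "real \<Rightarrow> 'a::metric_space \<Rightarrow> 'a"
  assumes ne: "X \<noteq> {}"
    and S_in: "\<And>t x. 0 \<le> t \<Longrightarrow> x \<in> X \<Longrightarrow> S t x \<in> X"
    and S_add: "\<And>s t x. 0 \<le> s \<Longrightarrow> 0 \<le> t \<Longrightarrow> x \<in> X \<Longrightarrow> S (t + s) x = S t (S s x)"
    and S_cont: "\<And>t. 0 \<le> t \<Longrightarrow> continuous_on X (S t)"
    and K: "compact K" "K \<subseteq> X"
    and absorb: "\<And>B. B \<subseteq> X \<Longrightarrow> bounded B \<Longrightarrow> \<exists>T\<ge>0. \<forall>t\<ge>T. S t ` B \<subseteq> K"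
  shows "\<exists>A. global_attractor X S A"
proof -
  obtain T0 where T0: "T0 \<ge> 0" "\<And>t. t \<ge> T0 \<Longrightarrow> S t ` K \<subseteq> K"
    using absorb[OF K(2) compact_imp_bounded[OF K(1)]] by blast
  define U where "U n = (\<Union>t\<in>{T0 + real n..}. S t ` K)" for n :: nat
  define C where "C n = closure (U n)" for n
  define A where "A = (\<Inter>n. C n)"
  have UI: "S t y \<in> U n" if "y \<in> K" "T0 + real n \<le> t" for y t n using that by (auto simp: U_def)
  have UD: "\<exists>t y. T0 + real n \<le> t \<and> y \<in> K \<and> x = S t y" if "x \<in> U n" for x n using that by (auto simp: U_def)
  have UK: "U n \<subseteq> K" for n
  proof
    fix x assume "x \<in> U n"
    then obtain t y where t: "T0 + real n \<le> t" "y \<in> K" "x = S t y" using UD by blast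
    have "T0 \<le> t" using t(1) by linarith
    then show "x \<in> K" using T0(2) t by blast
  qed
  have CK: "C n \<subseteq> K" for n unfolding C_def by (rule closure_minimal[OF UK compact_imp_closed[OF K(1)]])
  have Ccl: "closed (C n)" for n by (simp add: C_def)
  have UC: "U n \<subseteq> C n" for n unfolding C_def by (rule closure_subset)
  have dec: "decseq C" unfolding decseq_def C_def
  proof (intro allI impI closure_mono)
    fix m n :: nat assume "m \<le> n"
    then have "{T0 + real n..} \<subseteq> {T0 + real m..}" by auto
    then show "U n \<subseteq> U m" unfolding U_def by (rule UN_mono[OF _ order_refl])
  qed
  have enter: "\<exists>T. \<forall>t\<ge>T. S t ` B \<subseteq> C n" if B: "B \<subseteq> X" "bounded B" for B n
  proof -
    obtain TB where TB: "TB \<ge> 0" "\<And>t. t \<ge> TB \<Longrightarrow> S t ` B \<subseteq> K" using absorb[OF B] by blast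
    have "S t x \<in> C n" if "t \<ge> TB + T0 + real n" "x \<in> B" for t x
    proof -
      have t': "T0 + real n \<le> t - TB" using that(1) by linarith
      have t'': "0 \<le> t - TB" using t' T0(1) by linarith
      have "S t x = S (t - TB) (S TB x)" using S_add[OF TB(1) t''] B(1) that(2) by auto
      moreover have "S TB x \<in> K" using TB(2) that(2) by blast
      ultimately show ?thesis using UI t' UC by fastforce
    qed
    then show ?thesis by blast
  qed
  have Cne: "\<exists>x. x \<in> C n" for n
  proof -
    obtain y where "y \<in> X" using ne by blast
    then obtain T where "\<forall>t\<ge>T. S t ` {y} \<subseteq> C n" using enter[of "{y}" n] by auto
    then show ?thesis by blast
  qed
  have "A \<noteq> {}"
  proof -
    obtain x where x: "\<And>n. x n \<in> C n" using Cne by metis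
    show ?thesis by (rule nested_limit[OF K(1) Ccl CK dec x]) (auto simp: A_def)
  qed
  have AK: "A \<subseteq> K" using CK unfolding A_def by blast
  have "compact (K \<inter> A)" unfolding A_def by (intro compact_Int_closed K(1) closed_INT ballI Ccl)
  moreover have "K \<inter> A = A" using AK by blast
  ultimately have Ac: "compact A" by simp
  \<comment> \<open>Points of the tails that stayed away from \<open>A\<close> would accumulate at a
    point common to all tails, that is, at a point of \<open>A\<close>.\<close>
  have near: "\<exists>n. \<forall>y\<in>C n. infdist y A < e" if e: "e > 0" for e
  proof (rule ccontr)
    assume "\<not> ?thesis"
    then have "\<forall>n. \<exists>y. y \<in> C n \<and> e \<le> infdist y A" by (auto simp: not_less)
    then obtain x where x: "\<And>n. x n \<in> C n" "\<And>n. e \<le> infdist (x n) A" by metis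
    obtain l r where r: "strict_mono (r :: nat \<Rightarrow> nat)" "(\<lambda>m. x (r m)) \<longlonglongrightarrow> l" "\<And>n. l \<in> C n"
      by (rule nested_limit[OF K(1) Ccl CK dec x(1)]) blast
    have "(\<lambda>m. infdist (x (r m)) A) \<longlonglongrightarrow> infdist l A" by (rule tendsto_infdist[OF r(2)])
    then have "e \<le> infdist l A" by (rule LIMSEQ_le_const) (use x(2) in blast)
    moreover have "l \<in> A" using r(3) by (simp add: A_def)
    ultimately show False using e by simp
  qed
  have attract: "((\<lambda>t. SUP x\<in>B. ennreal (infdist (S t x) A)) \<longlongrightarrow> 0) at_top" if B: "B \<subseteq> X" "bounded B" for B
  proof (rule order_tendstoI)
    fix a :: ennreal assume "0 < a"
    then obtain b where b: "0 < b" "b < a" using dense by blast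
    obtain e where e: "b = ennreal e" "0 \<le> e" using b(2) by (cases b) auto
    have "0 < e" using b(1) e by (simp add: ennreal_less_zero_iff)
    then obtain n where n: "\<forall>y\<in>C n. infdist y A < e" using near by blast
    obtain T where T: "\<forall>t\<ge>T. S t ` B \<subseteq> C n" using enter[OF B] by blast
    have "(SUP x\<in>B. ennreal (infdist (S t x) A)) < a" if "T \<le> t" for t
    proof -
      have "(SUP x\<in>B. ennreal (infdist (S t x) A)) \<le> b"
      proof (rule SUP_least)
        fix x assume "x \<in> B"
        then have "infdist (S t x) A < e" using T n that by blast
        then show "ennreal (infdist (S t x) A) \<le> b" unfolding e(1) by (intro ennreal_leI) simp
      qed
      then show ?thesis using b(2) by simp
    qed
    then show "\<forall>\<^sub>F t in at_top. (SUP x\<in>B. ennreal (infdist (S t x) A)) < a"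
      unfolding eventually_at_top_linorder by blast
  qed simp
  have invar: "S r ` A = A" if r: "r \<ge> 0" for r
  proof
    have cont: "continuous_on (C n) (S r)" for n
      by (rule continuous_on_subset[OF S_cont[OF r]]) (use CK K(2) in blast)
    have "S r ` U n \<subseteq> C n" for n
    proof (intro image_subsetI)
      fix x assume "x \<in> U n"
      then obtain t y where t: "T0 + real n \<le> t" "y \<in> K" "x = S t y" using UD by blast
      have "S (r + t) y = S r (S t y)" by (rule S_add) (use t r T0(1) K(2) in auto)
      moreover have "S (r + t) y \<in> U n" by (rule UI) (use t r in auto)
      ultimately show "S r x \<in> C n" using UC t(3) by auto
    qed
    then have "S r ` C n \<subseteq> C n" for n
      using image_closure_subset[of "U n" "S r" "C n"] cont[of n] Ccl[of n] unfolding C_def by simp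
    then show "S r ` A \<subseteq> A" unfolding A_def by blast
    show "A \<subseteq> S r ` A"
    proof
      fix x assume x: "x \<in> A"
      define N where "N = nat \<lceil>r\<rceil>"
      have N: "r \<le> real N" unfolding N_def by linarith
      have "x \<in> S r ` C n" for n
      proof -
        \<comment> \<open>A travel time of at least T0 + n + N exceeds T0 + n by at least
          \<open>r\<close>, so the last stretch of length \<open>r\<close> can be split off. The
          image of \<open>C n\<close> is compact, so the inclusion passes to the closure.\<close>
        have "U (n + N) \<subseteq> S r ` C n"
        proof
          fix x assume "x \<in> U (n + N)"
          then obtain t y where t: "T0 + real (n + N) \<le> t" "y \<in> K" "x = S t y" using UD by blast
          have t': "T0 + real n \<le> t - r" using t(1) N by simp
          have "0 \<le> t - r" using t' T0(1) by linarith
          then have "S (r + (t - r)) y = S r (S (t - r) y)" by (intro S_add) (use r t K(2) in auto)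
          then have "x = S r (S (t - r) y)" using t(3) by simp
          moreover have "S (t - r) y \<in> C n" using UI[OF t(2) t'] UC by blast
          ultimately show "x \<in> S r ` C n" by blast
        qed
        moreover have "compact (C n)"
        proof -
          have "compact (K \<inter> C n)" by (rule compact_Int_closed[OF K(1) Ccl])
          moreover have "K \<inter> C n = C n" using CK by blast
          ultimately show ?thesis by simp
        qed
        then have "closed (S r ` C n)" by (intro compact_imp_closed compact_continuous_image cont)
        ultimately have "C (n + N) \<subseteq> S r ` C n" unfolding C_def[of "n + N"] by (rule closure_minimal)
        then show ?thesis using x unfolding A_def by blast
      qed
      then have "\<forall>n. \<exists>y. y \<in> C n \<and> S r y = x" by (metis imageE)
      \<comment> \<open>The preimages vary with \<open>n\<close>; their accumulation point lies in
        every tail and is still mapped to \<open>x\<close> by continuity.\<close>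
      then obtain y where y: "\<And>n. y n \<in> C n" "\<And>n. S r (y n) = x" by metis
      obtain l \<rho> where l: "strict_mono (\<rho> :: nat \<Rightarrow> nat)" "(\<lambda>m. y (\<rho> m)) \<longlonglongrightarrow> l" "\<And>n. l \<in> C n"
        by (rule nested_limit[OF K(1) Ccl CK dec y(1)]) blast
      have inX: "z \<in> C n \<Longrightarrow> z \<in> X" for z n using CK K(2) by blast
      have "(\<lambda>m. S r (y (\<rho> m))) \<longlonglongrightarrow> S r l"
        by (rule continuous_on_tendsto_compose[OF S_cont[OF r] l(2) inX[OF l(3)]]) (simp add: inX[OF y(1)])
      then have "(\<lambda>m::nat. x) \<longlonglongrightarrow> S r l" unfolding y(2) .
      then have "S r l = x" using LIMSEQ_unique[OF _ tendsto_const] by blast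
      moreover have "l \<in> A" using l(3) by (simp add: A_def)
      ultimately show "x \<in> S r ` A" by blast
    qed
  qed
  have "global_attractor X S A"
    unfolding global_attractor_def using \<open>A \<noteq> {}\<close> Ac AK K(2) invar attract by blast
  then show ?thesis ..
qed

section \<open>Time translation of weak solutions\<close>

lemma lebesgue_real_shift:
  fixes s :: real
  shows "(\<lambda>t. t + s) \<in> lebesgue \<rightarrow>\<^sub>M lebesgue" "distr lebesgue lebesgue (\<lambda>t. t + s) = lebesgue"
  using lebesgue_affine_measurable[of "\<lambda>_::real. 1" s] lebesgue_affine_euclidean[of "\<lambda>_::real. 1" s]
  by (simp_all add: add.commute density_1)

lemma integrable_shift:
  fixes f :: "real \<Rightarrow> real"
  shows "integrable lebesgue f \<Longrightarrow> integrable lebesgue (\<lambda>t. f (t + s))"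
  using integrable_distr[OF lebesgue_real_shift(1), of s f] unfolding lebesgue_real_shift(2) by simp

lemma integral_shift:
  fixes f :: "real \<Rightarrow> real"
  shows "(LINT t|lebesgue. f (t + s)) = (LINT t|lebesgue. f t)"
proof (cases "integrable lebesgue f")
  case True
  then have "f \<in> borel_measurable lebesgue" by auto
  then show ?thesis using integral_distr[OF lebesgue_real_shift(1), of f s] unfolding lebesgue_real_shift(2) by simp
next
  case False
  \<comment> \<open>Neither function is integrable, so both integrals take the default value
    0.\<close>
  then have "\<not> integrable lebesgue (\<lambda>t. f (t + s))" using integrable_shift[of "\<lambda>t. f (t + s)" "- s"] by auto
  then show ?thesis using False by (simp add: not_integrable_integral_eq)
qed

text \<open>Stated for arbitrary \<open>f\<close>, since it is applied to the E-norm along a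
  trajectory without a proof of measurability. The integral is a supremum over simple functions
  below the integrand, and those can be shifted individually.\<close>

lemma nn_integral_shift_le:
  fixes f :: "real \<Rightarrow> ennreal"
  shows "(\<integral>\<^sup>+t. f (t + s) \<partial>lebesgue) \<le> (\<integral>\<^sup>+t. f t \<partial>lebesgue)"
  unfolding nn_integral_def[of _ "\<lambda>t. f (t + s)"]
proof (rule SUP_least)
  fix h assume "h \<in> {h. simple_function lebesgue h \<and> h \<le> (\<lambda>t. f (t + s))}"
  then have h: "simple_function lebesgue h" "\<And>t. h t \<le> f (t + s)" by (auto simp: le_fun_def)
  have hm: "h \<in> borel_measurable lebesgue" by (rule borel_measurable_simple_function[OF h(1)])
  have "integral\<^sup>S lebesgue h = (\<integral>\<^sup>+t. h t \<partial>lebesgue)" using nn_integral_eq_simple_integral[OF h(1)] by simp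
  also have "\<dots> = (\<integral>\<^sup>+t. h t \<partial>distr lebesgue lebesgue (\<lambda>t. t + - s))" unfolding lebesgue_real_shift(2) ..
  also have "\<dots> = (\<integral>\<^sup>+t. h (t + - s) \<partial>lebesgue)" by (rule nn_integral_distr[OF lebesgue_real_shift(1)]) (simp add: hm)
  also have "\<dots> \<le> (\<integral>\<^sup>+t. f t \<partial>lebesgue)"
    using h(2)[of "_ + - s"] by (intro nn_integral_mono) auto
  finally show "integral\<^sup>S lebesgue h \<le> (\<integral>\<^sup>+t. f t \<partial>lebesgue)" .
qed

lemma AE_interval_shift:
  fixes s :: real
  assumes "0 \<le> s" "AE t in lebesgue_on {0..T + s}. P t"
  shows "AE t in lebesgue_on {0..T}. P (t + s)"
proof -
  have "AE t in distr lebesgue lebesgue (\<lambda>t. t + s). t \<in> {0..T + s} \<longrightarrow> P t"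
    using assms(2) unfolding lebesgue_real_shift(2) by (simp add: AE_restrict_space_iff)
  then have "AE t in lebesgue. t + s \<in> {0..T + s} \<longrightarrow> P (t + s)"
    by (rule AE_distrD[OF lebesgue_real_shift(1)])
  then have "AE t in lebesgue. t \<in> {0..T} \<longrightarrow> P (t + s)"
    by eventually_elim (use assms(1) in auto)
  then show ?thesis by (simp add: AE_restrict_space_iff)
qed

lemma integral_supported:
  fixes f :: "real \<Rightarrow> real"
  assumes "U \<in> sets lebesgue" "\<And>t. t \<notin> U \<Longrightarrow> f t = 0"
  shows "(LINT t|lebesgue_on U. f t) = (LINT t|lebesgue. f t)"
proof -
  have "(LINT t|lebesgue_on U. f t) = (LINT t|lebesgue. indicator U t *\<^sub>R f t)"
    using assms(1) by (simp add: integral_restrict_space)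
  also have "(\<lambda>t. indicator U t *\<^sub>R f t) = f" using assms(2) by (auto simp: indicator_def fun_eq_iff)
  finally show ?thesis .
qed

lemma test_functions_deriv_zero:
  fixes \<eta> :: "real \<Rightarrow> real"
  assumes "\<eta> \<in> test_functions U" "t \<notin> U"
  shows "deriv \<eta> t = 0"
proof (rule DERIV_imp_deriv)
  have t: "t \<in> - closure {x. \<eta> x \<noteq> 0}" using test_functionsD(3)[OF assms(1)] assms(2) by blast
  have z: "x \<in> - closure {x. \<eta> x \<noteq> 0} \<Longrightarrow> 0 = \<eta> x" for x using closure_subset[of "{x. \<eta> x \<noteq> 0}"] by auto
  have o: "open (- closure {x. \<eta> x \<noteq> 0})" by (simp add: open_Compl)
  show "(\<eta> has_field_derivative 0) (at t)"
    by (rule has_field_derivative_transform_within_open[OF DERIV_const o t z])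
qed

lemma test_functions_shift:
  fixes \<eta> :: "real \<Rightarrow> real"
  assumes \<eta>: "\<eta> \<in> test_functions {0<..<T}" and s: "0 \<le> s"
  shows "(\<lambda>t. \<eta> (t + - s)) \<in> test_functions {0<..<T + s}" "deriv (\<lambda>t. \<eta> (t + - s)) t = deriv \<eta> (t + - s)"
proof -
  let ?L = "closure {x. \<eta> x \<noteq> 0}"
  show "(\<lambda>t. \<eta> (t + - s)) \<in> test_functions {0<..<T + s}"
  proof (rule test_functionsI[of _ "(\<lambda>x. s + x) ` ?L"])
    show "C_k k (\<lambda>t. \<eta> (t + - s))" for k by (rule C_k_shift[OF test_functionsD(1)[OF \<eta>]])
    show "compact ((\<lambda>x. s + x) ` ?L)" by (rule compact_translation[OF test_functionsD(2)[OF \<eta>]])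
    show "(\<lambda>x. s + x) ` ?L \<subseteq> {0<..<T + s}" using test_functionsD(3)[OF \<eta>] s by fastforce
    fix x assume "\<eta> (x + - s) \<noteq> 0"
    then have "x + - s \<in> ?L" using closure_subset[of "{x. \<eta> x \<noteq> 0}"] by blast
    then have "s + (x + - s) \<in> (\<lambda>x. s + x) ` ?L" by (rule imageI)
    then show "x \<in> (\<lambda>x. s + x) ` ?L" by simp
  qed
  have "\<eta> differentiable (at (t + - s))" using test_functionsD(1)[OF \<eta>, of "Suc 0"] by simp
  then obtain D where D: "(\<eta> has_field_derivative D) (at (t + - s))" by (auto simp: real_differentiable_def)
  have "((\<lambda>t. \<eta> (t + - s)) has_field_derivative D) (at t)" using D unfolding DERIV_shift .
  then show "deriv (\<lambda>t. \<eta> (t + - s)) t = deriv \<eta> (t + - s)"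
    using D by (simp add: DERIV_imp_deriv)
qed

text \<open>Instead of \<open>y\<close> and \<open>z\<close> the test function is shifted, in the
  opposite direction; its support stays inside the longer interval.\<close>

lemma distr_deriv_shift:
  assumes d: "distr_deriv (T + s) y z" and s: "0 \<le> s"
  shows "distr_deriv T (\<lambda>t. y (t + s)) (\<lambda>t. z (t + s))"
  unfolding distr_deriv_def
proof (intro conjI allI impI ballI)
  fix a b :: real assume ab: "0 < a \<and> b < T"
  then have "integrable (lebesgue_on {a + s..b + s}) z" using d s unfolding distr_deriv_def by simp
  then have "integrable lebesgue (\<lambda>t. indicator {a + s..b + s} t *\<^sub>R z t)" by (simp add: integrable_restrict_space)
  then have "integrable lebesgue (\<lambda>t. indicator {a + s..b + s} (t + s) *\<^sub>R z (t + s))" by (rule integrable_shift)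
  moreover have "(\<lambda>t. indicator {a + s..b + s} (t + s) *\<^sub>R z (t + s)) = (\<lambda>t. indicator {a..b} t *\<^sub>R z (t + s))"
    by (auto simp: indicator_def fun_eq_iff)
  ultimately show "integrable (lebesgue_on {a..b}) (\<lambda>t. z (t + s))" by (simp add: integrable_restrict_space)
next
  fix \<eta> assume \<eta>: "\<eta> \<in> test_functions {0<..<T}"
  note sh = test_functions_shift[OF \<eta> s]
  have move: "(LINT t|lebesgue_on {0<..<T}. w (t + s) * \<theta> t) = (LINT t|lebesgue_on {0<..<T + s}. w t * \<theta> (t + - s))"
    if \<theta>: "\<And>t. t \<notin> {0<..<T} \<Longrightarrow> \<theta> t = 0" for w \<theta> :: "real \<Rightarrow> real"
  proof -
    have "(LINT t|lebesgue_on {0<..<T}. w (t + s) * \<theta> t) = (LINT t|lebesgue. w (t + s) * \<theta> t)"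
      by (rule integral_supported) (use \<theta> in auto)
    also have "\<dots> = (LINT t|lebesgue. w t * \<theta> (t + - s))"
      using integral_shift[of "\<lambda>t. w t * \<theta> (t + - s)" s] by simp
    also have "\<dots> = (LINT t|lebesgue_on {0<..<T + s}. w t * \<theta> (t + - s))"
      by (rule integral_supported[symmetric]) (use \<theta> s in auto)
    finally show ?thesis .
  qed
  have "- (LINT t|lebesgue_on {0<..<T + s}. y t * deriv (\<lambda>t. \<eta> (t + - s)) t) = (LINT t|lebesgue_on {0<..<T + s}. z t * \<eta> (t + - s))"
    using d sh(1) unfolding distr_deriv_def by blast
  then show "- (LINT t|lebesgue_on {0<..<T}. y (t + s) * deriv \<eta> t) = (LINT t|lebesgue_on {0<..<T}. z (t + s) * \<eta> t)"
    unfolding sh(2) move[of "deriv \<eta>" y, OF test_functions_deriv_zero[OF \<eta>], simplified]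
      move[of \<eta> z, OF test_functionsD(4)[OF \<eta>], simplified] by simp
qed

lemma weak_solution_shift:
  assumes w: "weak_solution \<Omega> A f (T + s) g0 g" and s: "0 \<le> s"
  shows "weak_solution \<Omega> A f T (g s) (\<lambda>t. g (t + s))"
  unfolding weak_solution_def
proof (intro conjI ballI)
  have L: "in_L2_E \<Omega> (T + s) g" and Cw: "in_Cw_H \<Omega> (T + s) g"
    and D: "\<And>\<phi>. \<phi> \<in> E_space \<Omega> \<Longrightarrow> distr_deriv (T + s) (\<lambda>t. g t \<bullet> \<phi>) (\<lambda>t. A (g t) \<phi> + f (g t) \<bullet> \<phi>)"
    using w unfolding weak_solution_def by auto
  obtain h where h: "\<And>k. simple_function (lebesgue_on {0..T + s}) (h k)" "\<And>k t. t \<in> {0..T + s} \<Longrightarrow> h k t \<in> E_space \<Omega>"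
      "AE t in lebesgue_on {0..T + s}. (\<lambda>k. E_norm \<Omega> (h k t - g t)) \<longlonglongrightarrow> 0"
    using L unfolding in_L2_E_def by blast
  have meas: "(\<lambda>t. t + s) \<in> lebesgue_on {0..T} \<rightarrow>\<^sub>M lebesgue_on {0..T + s}"
    by (rule measurable_restrict_space3[OF lebesgue_real_shift(1)]) (use s in auto)
  have "(\<integral>\<^sup>+t. ennreal ((E_norm \<Omega> (g (t + s)))\<^sup>2) \<partial>lebesgue_on {0..T})
      = (\<integral>\<^sup>+t. ennreal ((E_norm \<Omega> (g (t + s)))\<^sup>2) * indicator {0..T} t \<partial>lebesgue)"
    by (simp add: nn_integral_restrict_space)
  also have "\<dots> \<le> (\<integral>\<^sup>+t. ennreal ((E_norm \<Omega> (g (t + s)))\<^sup>2) * indicator {0..T + s} (t + s) \<partial>lebesgue)"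
    by (rule nn_integral_mono) (use s in \<open>auto simp: indicator_def\<close>)
  also have "\<dots> \<le> (\<integral>\<^sup>+t. ennreal ((E_norm \<Omega> (g t))\<^sup>2) * indicator {0..T + s} t \<partial>lebesgue)"
    by (rule nn_integral_shift_le)
  also have "\<dots> = (\<integral>\<^sup>+t. ennreal ((E_norm \<Omega> (g t))\<^sup>2) \<partial>lebesgue_on {0..T + s})"
    by (simp add: nn_integral_restrict_space)
  also have "\<dots> < \<infinity>" using L unfolding in_L2_E_def by blast
  finally have fin: "(\<integral>\<^sup>+t. ennreal ((E_norm \<Omega> (g (t + s)))\<^sup>2) \<partial>lebesgue_on {0..T}) < \<infinity>" .
  show "in_L2_E \<Omega> T (\<lambda>t. g (t + s))" unfolding in_L2_E_def
  proof (intro conjI fin exI[of _ "\<lambda>k t. h k (t + s)"] allI ballI)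
    show "AE t in lebesgue_on {0..T}. g (t + s) \<in> E_space \<Omega>"
      by (rule AE_interval_shift[OF s]) (use L in \<open>simp add: in_L2_E_def\<close>)
    show "simple_function (lebesgue_on {0..T}) (\<lambda>t. h k (t + s))" for k
      by (rule simple_function_comp[OF meas h(1)])
    show "h k (t + s) \<in> E_space \<Omega>" if "t \<in> {0..T}" for k t by (rule h(2)) (use that s in auto)
    show "AE t in lebesgue_on {0..T}. (\<lambda>k. E_norm \<Omega> (h k (t + s) - g (t + s))) \<longlonglongrightarrow> 0"
      by (rule AE_interval_shift[OF s h(3)])
  qed
  show "in_Cw_H \<Omega> T (\<lambda>t. g (t + s))" unfolding in_Cw_H_def
  proof (intro conjI ballI)
    show "g (t + s) \<in> H_space \<Omega>" if "t \<in> {0..T}" for t using Cw that s unfolding in_Cw_H_def by simp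
    fix \<phi> assume "\<phi> \<in> H_space \<Omega>"
    then have c: "continuous_on {0..T + s} (\<lambda>t. g t \<bullet> \<phi>)" using Cw unfolding in_Cw_H_def by blast
    show "continuous_on {0..T} (\<lambda>t. g (t + s) \<bullet> \<phi>)"
      by (rule continuous_on_compose2[OF c]) (use s in \<open>auto intro!: continuous_intros\<close>)
  qed
  show "g (0 + s) = g s" by simp
  show "distr_deriv T (\<lambda>t. g (t + s) \<bullet> \<phi>) (\<lambda>t. A (g (t + s)) \<phi> + f (g (t + s)) \<bullet> \<phi>)" if "\<phi> \<in> E_space \<Omega>" for \<phi>
    by (rule distr_deriv_shift[OF D[OF that] s])
qed

text \<open>The trajectory restarted at time \<open>s\<close> is a global weak solution with initial
  state \<open>S s x\<close>, so uniqueness identifies it.\<close>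

lemma solution_semiflow_add:
  assumes S: "solution_semiflow \<Omega> A f S" and x: "x \<in> H_plus \<Omega>" and st: "0 \<le> s" "0 \<le> t"
  shows "S (t + s) x = S t (S s x)"
proof -
  have w: "global_weak_solution \<Omega> A f x (\<lambda>t. S t x)" and Sx: "S s x \<in> H_plus \<Omega>"
    using S x st unfolding solution_semiflow_def by auto
  have "global_weak_solution \<Omega> A f (S s x) (\<lambda>t. S (t + s) x)" unfolding global_weak_solution_def
  proof (intro allI impI)
    fix \<tau> :: real assume "\<tau> > 0"
    then have "weak_solution \<Omega> A f (\<tau> + s) x (\<lambda>t. S t x)" using w st unfolding global_weak_solution_def by simp
    then show "weak_solution \<Omega> A f \<tau> (S s x) (\<lambda>t. S (t + s) x)" by (rule weak_solution_shift[OF _ st(1)])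
  qed
  then show ?thesis using S Sx st unfolding solution_semiflow_def by blast
qed

section \<open>The Oregonator semiflow\<close>

context oregonator begin

lemma regular_bound: "regular T g R N z \<Longrightarrow> (\<And>t. t \<in> {0..T} \<Longrightarrow> norm (g t) \<le> R') \<Longrightarrow> regular T g R' N z"
  unfolding regular_def by blast

lemma H_plus_closed: "closed (H_plus \<Omega>)"
  unfolding closed_sequential_limits
proof (intro allI impI)
  fix x l assume "(\<forall>n. x n \<in> H_plus \<Omega>) \<and> x \<longlonglongrightarrow> l"
  then have x: "\<And>n. x n \<in> H_plus \<Omega>" and lim: "x \<longlonglongrightarrow> l" by auto
  have "l \<in> H_space \<Omega>"
    by (rule closed_sequentially[OF H_space_closed _ lim]) (use x in \<open>auto simp: H_plus_def\<close>)
  moreover have "AE y in lebesgue_on \<Omega>. 0 \<le> rep_l2 (l $ i) y" for i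
  proof -
    have "(\<lambda>n. x n $ i) \<longlonglongrightarrow> l $ i" by (rule tendsto_vec_nth[OF lim])
    from l2_subseq_AE_tendsto[OF this] obtain r where
      r: "AE y in lebesgue. (\<lambda>n. rep_l2 (x (r n) $ i) y) \<longlonglongrightarrow> rep_l2 (l $ i) y" by blast
    have "AE y in lebesgue. 0 \<le> rep_l2 (x (r n) $ i) y" for n
      using H_plus_AE[OF x, of "r n" i] by eventually_elim auto
    then have "AE y in lebesgue. \<forall>n. 0 \<le> rep_l2 (x (r n) $ i) y" unfolding AE_all_countable by blast
    then have "AE y in lebesgue. 0 \<le> rep_l2 (l $ i) y"
      using r by eventually_elim (rule LIMSEQ_le_const, auto)
    then show ?thesis by (auto simp: AE_restrict_space_iff elim: eventually_mono)
  qed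
  ultimately show "l \<in> H_plus \<Omega>" unfolding H_plus_def by blast
qed

lemma zero_H_plus: "0 \<in> H_plus \<Omega>"
proof -
  have "AE x in lebesgue. 0 \<le> rep_l2 (0::(real^'n) l2) x" using rep_zero by eventually_elim simp
  then have "AE x in lebesgue_on \<Omega>. 0 \<le> rep_l2 (0::(real^'n) l2) x" by (auto simp: AE_restrict_space_iff elim: eventually_mono)
  then show ?thesis using subspace_0[OF H_space_sub] by (simp add: H_plus_def)
qed

text \<open>The set of triples is a continuous image of a threefold product of compact sets,
  intersected with the closed positive cone.\<close>

lemma compact_H10_states:
  "compact (H_plus \<Omega> \<inter> {y. \<forall>i. y $ i \<in> closure {u \<in> H10 \<Omega>. norm u \<le> R \<and> norm (grad \<Omega> u) \<le> R}})"
proof -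
  define C where "C = closure {u \<in> H10 \<Omega>. norm u \<le> R \<and> norm (grad \<Omega> u) \<le> R}"
  define j where "j p = (\<chi> i::3. if i = 1 then fst p else if i = 2 then fst (snd p) else snd (snd p))"
    for p :: "(real^'n) l2 \<times> (real^'n) l2 \<times> (real^'n) l2"
  have "continuous_on S (\<lambda>p. if i = 1 then fst p else if i = 2 then fst (snd p) else snd (snd p))"
    for i :: 3 and S :: "((real^'n) l2 \<times> (real^'n) l2 \<times> (real^'n) l2) set"
    by (cases "i = 1"; cases "i = 2") (auto intro!: continuous_intros)
  then have jc: "continuous_on (C \<times> C \<times> C) j"
    unfolding j_def by (rule continuous_on_vec_lambda)
  have "{y. \<forall>i. y $ i \<in> C} = j ` (C \<times> C \<times> C)"
  proof (intro equalityI subsetI)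
    fix y :: "'n state" assume y: "y \<in> {y. \<forall>i. y $ i \<in> C}"
    have "y $ i = j (y $ 1, y $ 2, y $ 3) $ i" for i using exhaust_3[of i] by (auto simp: j_def)
    then have "y = j (y $ 1, y $ 2, y $ 3)" unfolding vec_eq_iff by (rule allI)
    then show "y \<in> j ` (C \<times> C \<times> C)" by (rule image_eqI) (use y in simp)
  next
    fix y assume "y \<in> j ` (C \<times> C \<times> C)"
    then show "y \<in> {y. \<forall>i. y $ i \<in> C}" by (auto simp: j_def)
  qed
  moreover have "compact (j ` (C \<times> C \<times> C))"
    by (intro compact_continuous_image jc compact_Times) (simp_all add: C_def H10_compact_embedding)
  ultimately have "compact {y :: 'n state. \<forall>i. y $ i \<in> C}" by (simp only:)
  then show ?thesis unfolding C_def by (rule closed_Int_compact[OF H_plus_closed])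
qed

end

locale oregonator_semiflow = oregonator \<Omega> d1 d2 d3 a1 a3 b1 b2 c2 c3 F G1 G2
  for \<Omega> :: "(real^'n::finite) set" and d1 d2 d3 a1 a3 b1 b2 c2 c3 F G1 G2 :: real +
  fixes S :: "real \<Rightarrow> 'n state \<Rightarrow> 'n state"
  assumes semiflow: "solution_semiflow \<Omega> Aop fop S"
begin

lemma S_in: "0 \<le> t \<Longrightarrow> x \<in> H_plus \<Omega> \<Longrightarrow> S t x \<in> H_plus \<Omega>"
  using semiflow unfolding solution_semiflow_def by blast

lemma S_add: "0 \<le> s \<Longrightarrow> 0 \<le> t \<Longrightarrow> x \<in> H_plus \<Omega> \<Longrightarrow> S (t + s) x = S t (S s x)"
  by (rule solution_semiflow_add[OF semiflow])

lemma S_weak_solution: "x \<in> H_plus \<Omega> \<Longrightarrow> T > 0 \<Longrightarrow> weak_solution \<Omega> Aop fop T x (\<lambda>t. S t x)"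
  using semiflow unfolding solution_semiflow_def global_weak_solution_def by blast

lemma S_0: "x \<in> H_plus \<Omega> \<Longrightarrow> S 0 x = x"
  using S_weak_solution[of x 1] unfolding weak_solution_def by simp

definition \<kappa> :: real where "\<kappa> = Kc * measure lebesgue \<Omega>"

lemma \<kappa>_nonneg: "0 \<le> \<kappa>" unfolding \<kappa>_def by (intro mult_nonneg_nonneg Kc_nonneg) simp

lemma \<kappa>_dl_nonneg: "0 \<le> \<kappa> / dl" using \<kappa>_nonneg dl_pos by simp

lemma S_decay:
  assumes x: "x \<in> H_plus \<Omega>" and T: "0 \<le> T"
  shows "(norm (S T x))\<^sup>2 \<le> exp (- 2 * dl * T) * (pw * (norm x)\<^sup>2) + \<kappa> / dl"
proof (cases "T = 0")
  case True
  have "1 * (norm x)\<^sup>2 \<le> pw * (norm x)\<^sup>2" by (rule mult_right_mono[OF pw_ge_1]) simp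
  then show ?thesis using \<kappa>_dl_nonneg by (simp add: True S_0[OF x])
next
  case False
  then have T0: "T > 0" using T by simp
  obtain R N z where r: "regular T (\<lambda>t. S t x) R N z" using weak_solution_regular[OF T0 S_weak_solution[OF x T0]] by blast
  have "Phi (S T x) \<le> exp (- 2 * dl * T) * Phi (S 0 x) + \<kappa> / dl"
    unfolding \<kappa>_def by (rule dissipation(1)[OF T0 r]) (use S_in x in auto)
  moreover have "exp (- 2 * dl * T) * Phi (S 0 x) \<le> exp (- 2 * dl * T) * (pw * (norm x)\<^sup>2)"
    unfolding S_0[OF x] by (rule mult_left_mono[OF Phi_bounds(2)]) simp
  ultimately show ?thesis using Phi_bounds(1)[of "S T x"] by linarith
qed

lemma S_bounded:
  assumes x: "x \<in> H_plus \<Omega>" and T: "0 \<le> T" and R: "norm x \<le> R"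
  shows "norm (S T x) \<le> sqrt (pw * R\<^sup>2 + \<kappa> / dl)"
proof (rule real_le_rsqrt)
  have pw0: "0 \<le> pw" using pw_ge_1 by linarith
  have "exp (- 2 * dl * T) * (pw * (norm x)\<^sup>2) \<le> 1 * (pw * (norm x)\<^sup>2)"
    by (rule mult_right_mono) (use dl_pos T pw0 in auto)
  moreover have "pw * (norm x)\<^sup>2 \<le> pw * R\<^sup>2" by (intro mult_left_mono power_mono R pw0) simp
  ultimately show "(norm (S T x))\<^sup>2 \<le> pw * R\<^sup>2 + \<kappa> / dl" using S_decay[OF x T] by linarith
qed

text \<open>Trajectories from the ball of radius \<open>R\<close> stay in one larger ball for all
  times, so a single constant serves every pair of states and every \<open>T\<close>.\<close>

lemma S_lipschitz:
  "\<exists>c>0. \<forall>x\<in>H_plus \<Omega>. \<forall>y\<in>H_plus \<Omega>. \<forall>T\<ge>0. norm x \<le> R \<longrightarrow> norm y \<le> R \<longrightarrow>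
     (norm (S T x - S T y))\<^sup>2 \<le> exp (c * T) * (norm (x - y))\<^sup>2"
proof -
  define R' where "R' = sqrt (pw * R\<^sup>2 + \<kappa> / dl)"
  have "0 \<le> pw * R\<^sup>2" using pw_ge_1 by simp
  then have "0 \<le> R'" unfolding R'_def using \<kappa>_dl_nonneg by simp
  from lipschitz_dependence[OF this] obtain c where c: "c > 0"
    "\<And>T g h N z N' z'. 0 < T \<Longrightarrow> regular T g R' N z \<Longrightarrow> regular T h R' N' z' \<Longrightarrow>
       (norm (g T - h T))\<^sup>2 \<le> exp (c * T) * (norm (g 0 - h 0))\<^sup>2" by blast
  have reg: "\<exists>N z. regular T (\<lambda>t. S t x) R' N z" if x: "x \<in> H_plus \<Omega>" "norm x \<le> R" and T: "T > 0" for x T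
  proof -
    obtain R0 N z where "regular T (\<lambda>t. S t x) R0 N z" using weak_solution_regular[OF T S_weak_solution[OF x(1) T]] by blast
    then have "regular T (\<lambda>t. S t x) R' N z"
      by (rule regular_bound) (use S_bounded[OF x(1) _ x(2)] in \<open>simp add: R'_def\<close>)
    then show ?thesis by blast
  qed
  have "(norm (S T x - S T y))\<^sup>2 \<le> exp (c * T) * (norm (x - y))\<^sup>2"
    if x: "x \<in> H_plus \<Omega>" "norm x \<le> R" and y: "y \<in> H_plus \<Omega>" "norm y \<le> R" and T: "0 \<le> T" for x y T
  proof (cases "T = 0")
    case True
    then show ?thesis by (simp add: S_0[OF x(1)] S_0[OF y(1)])
  next
    case False
    then have T0: "T > 0" using T by simp
    obtain N z where g: "regular T (\<lambda>t. S t x) R' N z" using reg[OF x T0] by blast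
    obtain N' z' where h: "regular T (\<lambda>t. S t y) R' N' z'" using reg[OF y T0] by blast
    show ?thesis using c(2)[OF T0 g h] by (simp add: S_0[OF x(1)] S_0[OF y(1)])
  qed
  then show ?thesis using c(1) by blast
qed

text \<open>Joint continuity: the Lipschitz bound in the initial state is uniform for times up to
  \<open>T\<close>, and the trajectory of the limit state is continuous in time.\<close>

lemma S_tendsto:
  assumes x: "\<And>n. x n \<in> H_plus \<Omega>" "l \<in> H_plus \<Omega>" "x \<longlonglongrightarrow> l"
    and t: "\<And>n. t n \<in> {0..T}" "t0 \<in> {0..T}" "t \<longlonglongrightarrow> t0" and T: "T > 0"
  shows "(\<lambda>n. S (t n) (x n)) \<longlonglongrightarrow> S t0 l"
proof -
  obtain R where R: "\<And>n. norm (x n) \<le> R" using BseqE[OF convergent_imp_Bseq[OF convergentI[OF x(3)]]] by metis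
  have Rl: "norm l \<le> R" by (rule LIMSEQ_le_const2[OF tendsto_norm[OF x(3)]]) (use R in blast)
  obtain c where c: "c > 0" "\<And>x y T. x \<in> H_plus \<Omega> \<Longrightarrow> y \<in> H_plus \<Omega> \<Longrightarrow> T \<ge> 0 \<Longrightarrow> norm x \<le> R \<Longrightarrow> norm y \<le> R \<Longrightarrow>
     (norm (S T x - S T y))\<^sup>2 \<le> exp (c * T) * (norm (x - y))\<^sup>2" using S_lipschitz[of R] by blast
  have b: "norm (S (t n) (x n) - S (t n) l) \<le> sqrt (exp (c * T)) * norm (x n - l)" for n
  proof -
    have "(norm (S (t n) (x n) - S (t n) l))\<^sup>2 \<le> exp (c * t n) * (norm (x n - l))\<^sup>2"
      by (rule c(2)[OF x(1,2) _ R Rl]) (use t(1)[of n] in simp)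
    also have "\<dots> \<le> exp (c * T) * (norm (x n - l))\<^sup>2"
      by (rule mult_right_mono) (use t(1)[of n] c(1) in auto)
    finally have "norm (S (t n) (x n) - S (t n) l) \<le> sqrt (exp (c * T) * (norm (x n - l))\<^sup>2)" by (rule real_le_rsqrt)
    then show ?thesis by (simp add: real_sqrt_mult)
  qed
  have lim: "(\<lambda>n. sqrt (exp (c * T)) * norm (x n - l)) \<longlonglongrightarrow> 0"
    using tendsto_mult_right_zero[OF tendsto_norm_zero[OF LIM_zero[OF x(3)]]] .
  have "(\<lambda>n. S (t n) (x n) - S (t n) l) \<longlonglongrightarrow> 0"
    by (rule Lim_null_comparison[OF always_eventually[OF allI[OF b]] lim])
  moreover have "(\<lambda>n. S (t n) l) \<longlonglongrightarrow> S t0 l"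
  proof -
    obtain R N z where "regular T (\<lambda>t. S t l) R N z" using weak_solution_regular[OF T S_weak_solution[OF x(2) T]] by blast
    from trajectory_continuous[OF T this] show ?thesis
      by (rule continuous_on_tendsto_compose[OF _ t(3,2)]) (simp add: t(1) del: atLeastAtMost_iff)
  qed
  ultimately have "(\<lambda>n. (S (t n) (x n) - S (t n) l) + S (t n) l) \<longlonglongrightarrow> 0 + S t0 l" by (rule tendsto_add)
  then show ?thesis by simp
qed

lemma S_continuous: "0 \<le> T \<Longrightarrow> continuous_on (H_plus \<Omega>) (S T)"
proof (rule continuous_on_sequentiallyI)
  fix u a assume "0 \<le> T" and u: "\<forall>n. u n \<in> H_plus \<Omega>" "a \<in> H_plus \<Omega>" "u \<longlonglongrightarrow> a"
  then have t: "T \<in> {0..T + 1}" "T + 1 > 0" by auto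
  show "(\<lambda>n. S T (u n)) \<longlonglongrightarrow> S T a"
    by (rule S_tendsto[where t = "\<lambda>_. T" and T = "T + 1", OF spec[OF u(1)] u(2,3) t(1) t(1) tendsto_const t(2)])
qed

lemma S_absorbing:
  assumes B: "B \<subseteq> H_plus \<Omega>" "bounded B"
  shows "\<exists>T\<ge>0. \<forall>t\<ge>T. S t ` B \<subseteq> {x \<in> H_plus \<Omega>. (norm x)\<^sup>2 \<le> \<kappa> / dl + 1}"
proof -
  obtain R where R: "\<And>x. x \<in> B \<Longrightarrow> norm x \<le> R" using B(2) unfolding bounded_iff by blast
  have pw0: "0 \<le> pw" using pw_ge_1 by linarith
  \<comment> \<open>From this time on \<open>2 * dl * t\<close> dominates the initial weighted
    energy, and y <= exp y makes the decaying term at most 1.\<close>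
  define T where "T = pw * R\<^sup>2 / (2 * dl)"
  have T: "0 \<le> T" unfolding T_def using pw0 dl_pos by simp
  have "(norm (S t x))\<^sup>2 \<le> \<kappa> / dl + 1" if "T \<le> t" "x \<in> B" for t x
  proof -
    define y where "y = 2 * dl * t"
    have "2 * dl * T = pw * R\<^sup>2" unfolding T_def using dl_pos by simp
    moreover have "2 * dl * T \<le> y" unfolding y_def by (rule mult_left_mono) (use that(1) dl_pos in auto)
    moreover have "norm x \<le> R" by (rule R[OF that(2)])
    then have "pw * (norm x)\<^sup>2 \<le> pw * R\<^sup>2" by (intro mult_left_mono power_mono pw0) auto
    ultimately have "pw * (norm x)\<^sup>2 \<le> y" by linarith
    also have "y \<le> exp y" using exp_ge_add_one_self[of y] by linarith
    finally have "exp (- y) * (pw * (norm x)\<^sup>2) \<le> exp (- y) * exp y" by (rule mult_left_mono) simp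
    also have "\<dots> = 1" by (simp add: exp_minus)
    finally have "exp (- 2 * dl * t) * (pw * (norm x)\<^sup>2) \<le> 1" by (simp add: y_def)
    moreover have "(norm (S t x))\<^sup>2 \<le> exp (- 2 * dl * t) * (pw * (norm x)\<^sup>2) + \<kappa> / dl"
      by (rule S_decay) (use that T B in auto)
    ultimately show ?thesis by linarith
  qed
  then have "\<forall>t\<ge>T. S t ` B \<subseteq> {x \<in> H_plus \<Omega>. (norm x)\<^sup>2 \<le> \<kappa> / dl + 1}"
    using S_in T B(1) by fastforce
  then show ?thesis using T by blast
qed

text \<open>The time average of the gradient norm over \<open>[0,1]\<close> is bounded, so every trajectory from the
  absorbing ball meets a fixed bounded subset of \<open>E\<close> before time \<open>1\<close>.\<close>

lemma S_visits_E:
  assumes x: "x \<in> H_plus \<Omega>" "(norm x)\<^sup>2 \<le> \<kappa> / dl + 1"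
  shows "\<exists>t\<in>{0..1}. S t x \<in> E_space \<Omega> \<and>
    (\<forall>i. (norm (grad \<Omega> (S t x $ i)))\<^sup>2 \<le> (pw * (\<kappa> / dl + 1) + 2 * \<kappa>) / (2 * dm) + 1)"
proof (rule ccontr)
  define M where "M = (pw * (\<kappa> / dl + 1) + 2 * \<kappa>) / (2 * dm) + 1"
  assume "\<not> ?thesis"
  then have no: "\<not> (\<forall>i. (norm (grad \<Omega> (S t x $ i)))\<^sup>2 \<le> M)" if "t \<in> {0..1}" "S t x \<in> E_space \<Omega>" for t
    using that unfolding M_def by blast
  let ?M = "lebesgue_on {0..1::real}"
  obtain R N z where r: "regular 1 (\<lambda>t. S t x) R N z" using weak_solution_regular[OF zero_less_one S_weak_solution[OF x(1) zero_less_one]] by blast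
  have "AE t in ?M. t \<in> {0..1}" by (rule AE_I2) simp
  then have le: "AE t in ?M. M \<le> N 1 t + N 2 t + N 3 t"
    using regularD(4)[OF r] regularD(6)[OF r, of 1] regularD(6)[OF r, of 2] regularD(6)[OF r, of 3]
  proof eventually_elim
    fix t assume t: "t \<in> {0..1}" "S t x \<in> E_space \<Omega>" "N 1 t = (norm (grad \<Omega> (S t x $ 1)))\<^sup>2"
      "N 2 t = (norm (grad \<Omega> (S t x $ 2)))\<^sup>2" "N 3 t = (norm (grad \<Omega> (S t x $ 3)))\<^sup>2"
    have "0 \<le> N 1 t" "0 \<le> N 2 t" "0 \<le> N 3 t" unfolding t(3-5) by auto
    moreover have "\<not> (N 1 t \<le> M \<and> N 2 t \<le> M \<and> N 3 t \<le> M)"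
      using no[OF t(1,2)] unfolding forall_3 t(3-5) .
    ultimately show "M \<le> N 1 t + N 2 t + N 3 t" by linarith
  qed
  have "integral {0..1} (\<lambda>t::real. M) \<le> integral {0..1} (\<lambda>t. N 1 t + N 2 t + N 3 t)"
    by (rule integral_mono_AE_on[OF _ _ le]) (auto intro!: Bochner_Integration.integrable_add regularD(5)[OF r])
  then have "2 * dm * M \<le> 2 * dm * integral {0..1} (\<lambda>t. N 1 t + N 2 t + N 3 t)" using dm_pos by simp
  also have "\<dots> \<le> Phi (S 0 x) + 2 * \<kappa> * 1"
    using dissipation(2)[OF zero_less_one r] S_in x(1) unfolding \<kappa>_def by simp
  also have "\<dots> \<le> pw * (\<kappa> / dl + 1) + 2 * \<kappa>"
  proof -
    have "pw * (norm x)\<^sup>2 \<le> pw * (\<kappa> / dl + 1)" by (rule mult_left_mono[OF x(2)]) (use pw_ge_1 in linarith)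
    then show ?thesis using Phi_bounds(2)[of x] S_0[OF x(1)] by simp
  qed
  also have "\<dots> = 2 * dm * (M - 1)" unfolding M_def using dm_pos by simp
  finally show False using dm_pos by (simp add: right_diff_distrib)
qed

theorem oregonator_attractor: "\<exists>\<A>. global_attractor (H_plus \<Omega>) S \<A>"
proof -
  define B0 where "B0 = {x \<in> H_plus \<Omega>. (norm x)\<^sup>2 \<le> \<kappa> / dl + 1}"
  define M where "M = (pw * (\<kappa> / dl + 1) + 2 * \<kappa>) / (2 * dm) + 1"
  \<comment> \<open>Adding the norm bound and the gradient bound gives one radius valid for
    both.\<close>
  define R where "R = sqrt (pw * (sqrt (\<kappa> / dl + 1))\<^sup>2 + \<kappa> / dl) + sqrt M"
  define C where "C = H_plus \<Omega> \<inter> {y. \<forall>i. y $ i \<in> closure {u \<in> H10 \<Omega>. norm u \<le> R \<and> norm (grad \<Omega> u) \<le> R}}"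
  define K where "K = (\<lambda>p. S (fst p) (snd p)) ` ({0..1} \<times> C)"
  have pw0: "0 \<le> pw" using pw_ge_1 by linarith
  have k1: "0 \<le> \<kappa> / dl + 1" using \<kappa>_dl_nonneg by linarith
  have M0: "0 \<le> M" unfolding M_def
    using mult_nonneg_nonneg[OF pw0 k1] \<kappa>_nonneg dm_pos by simp
  have "compact C" unfolding C_def by (rule compact_H10_states)
  have CH: "C \<subseteq> H_plus \<Omega>" unfolding C_def by blast
  have "continuous_on ({0..1} \<times> C) (\<lambda>p. S (fst p) (snd p))"
  proof (rule continuous_on_sequentiallyI)
    fix u :: "nat \<Rightarrow> real \<times> 'n state" and a assume u: "\<forall>n. u n \<in> {0..1} \<times> C" "a \<in> {0..1} \<times> C" "u \<longlonglongrightarrow> a"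
    have m: "p \<in> {0..1} \<times> C \<Longrightarrow> fst p \<in> {0..1} \<and> snd p \<in> H_plus \<Omega>" for p using CH by auto
    show "(\<lambda>n. S (fst (u n)) (snd (u n))) \<longlonglongrightarrow> S (fst a) (snd a)"
      by (rule S_tendsto[OF _ _ tendsto_snd[OF u(3)] _ _ tendsto_fst[OF u(3)] zero_less_one])
        (use m u in blast)+
  qed
  then have "compact K" unfolding K_def
    by (rule compact_continuous_image[OF _ compact_Times[OF compact_Icc \<open>compact C\<close>]])
  have KH: "K \<subseteq> H_plus \<Omega>" unfolding K_def using S_in CH by auto
  have step: "S 1 x \<in> K" if x: "x \<in> B0" for x
  proof -
    have xH: "x \<in> H_plus \<Omega>" "(norm x)\<^sup>2 \<le> \<kappa> / dl + 1" using x by (auto simp: B0_def)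
    obtain t where t: "t \<in> {0..1}" "S t x \<in> E_space \<Omega>" "\<And>i. (norm (grad \<Omega> (S t x $ i)))\<^sup>2 \<le> M"
      using S_visits_E[OF xH] unfolding M_def by blast
    have t0: "0 \<le> t" "0 \<le> 1 - t" using t(1) by auto
    \<comment> \<open>The trajectory may visit E at any time \<open>t\<close> in the unit interval,
      so the size of the state is bounded uniformly over \<open>t\<close>.\<close>
    have "norm x \<le> sqrt (\<kappa> / dl + 1)" by (rule real_le_rsqrt[OF xH(2)])
    then have n: "norm (S t x) \<le> sqrt (pw * (sqrt (\<kappa> / dl + 1))\<^sup>2 + \<kappa> / dl)" by (rule S_bounded[OF xH(1) t0(1)])
    have "S t x $ i \<in> {u \<in> H10 \<Omega>. norm u \<le> R \<and> norm (grad \<Omega> u) \<le> R}" for i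
    proof -
      have "norm (S t x $ i) \<le> R" using Finite_Cartesian_Product.norm_nth_le[of "S t x" i] n real_sqrt_ge_zero[OF M0] unfolding R_def by linarith
      moreover have "norm (grad \<Omega> (S t x $ i)) \<le> sqrt M" by (rule real_le_rsqrt[OF t(3)])
      then have "norm (grad \<Omega> (S t x $ i)) \<le> R" using n norm_ge_zero[of "S t x"] unfolding R_def by linarith
      ultimately show ?thesis using E_comp[OF t(2), of i] by blast
    qed
    then have "S t x \<in> C" unfolding C_def using S_in[OF t0(1) xH(1)] closure_subset by blast
    \<comment> \<open>The remaining time 1 - t also lies in the unit interval, which is why flowing
      \<open>C\<close> for such times captures the state at time exactly 1.\<close>
    then have "(1 - t, S t x) \<in> {0..1} \<times> C" using t(1) by simp
    then have "S (1 - t) (S t x) \<in> K" unfolding K_def by (rule rev_image_eqI) simp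
    then show ?thesis using S_add[OF t0 xH(1)] by simp
  qed
  have absorb: "\<exists>T\<ge>0. \<forall>t\<ge>T. S t ` B \<subseteq> K" if B: "B \<subseteq> H_plus \<Omega>" "bounded B" for B
  proof -
    obtain T where T: "T \<ge> 0" "\<And>t. t \<ge> T \<Longrightarrow> S t ` B \<subseteq> B0" using S_absorbing[OF B] unfolding B0_def by blast
    have "S t x \<in> K" if "T + 1 \<le> t" "x \<in> B" for t x
    proof -
      have t: "T \<le> t - 1" "0 \<le> t - 1" using that(1) T(1) by auto
      have "S (t - 1) x \<in> B0" using T(2)[OF t(1)] that(2) by blast
      moreover have "S (1 + (t - 1)) x = S 1 (S (t - 1) x)" by (rule S_add) (use t B(1) that(2) in auto)
      ultimately show ?thesis using step by simp
    qed
    then show ?thesis using T(1) by (intro exI[of _ "T + 1"]) auto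
  qed
  show ?thesis
    by (rule compact_absorbing_attractor[OF _ S_in S_add S_continuous \<open>compact K\<close> KH absorb])
      (use zero_H_plus in auto)
qed

end

theorem theorem1:
  fixes \<Omega> :: "(real^'n::finite) set"
    and d1 d2 d3 a1 a3 b1 b2 c2 c3 F G1 G2 :: real
    and S :: "real \<Rightarrow> 'n state \<Rightarrow> 'n state"
  assumes "bounded_lipschitz_domain \<Omega>" and "CARD('n) \<le> 3"
    and "d1 > 0" "d2 > 0" "d3 > 0" "a1 > 0" "a3 > 0" "b1 > 0" "b2 > 0" "c2 > 0" "c3 > 0"
    and "F > 0" "G1 > 0" "G2 > 0"
    and "solution_semiflow \<Omega> (oregonator_A \<Omega> d1 d2 d3)
           (oregonator_f a1 b1 F G1 b2 c2 G2 a3 c3) S"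
  shows "\<exists>\<A>. global_attractor (H_plus \<Omega>) S \<A>"
proof -
  interpret oregonator_semiflow \<Omega> d1 d2 d3 a1 a3 b1 b2 c2 c3 F G1 G2 S
    by unfold_locales (use assms in \<open>auto simp: bounded_lipschitz_domain_def\<close>)
  show ?thesis by (rule oregonator_attractor)
qed

end
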